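(* Let $P(x,D)=\sum_{|\alpha|\le m}c_\alpha(x)D^\alpha$ be a differential operator with coefficients $c_\alpha\in\mathcal{G}_\infty(\mathbb{R}^n)$. Assume that there exist $a,a'\in\mathbb{R}$ with $a\le a'$, $0\le m'\le m$, $R>0$ and a representative $(P_\varepsilon)_\varepsilon$ of $P$ such that: (i) $|P_\varepsilon|^{(m)}_{\alpha,\beta}=O(\varepsilon^a)$ for all $\alpha,\beta\in\mathbb{N}^n$; (ii) there exists $c>0$ such that $|P_\varepsilon(x,\xi)|\ge c\,\varepsilon^{a'}\langle\xi\rangle^{m'}$ for all $x\in\mathbb{R}^n$, $|\xi|\ge R$ and $\varepsilon\in(0,1]$; (iii) for all $\alpha,\beta\in\mathbb{N}^n$ there exists a net $(c_{\alpha,\beta,\varepsilon})_\varepsilon$ with $c_{\alpha,\beta,\varepsilon}=O(1)$ such that $|\partial^\alpha_\xi\partial^\beta_xP_\varepsilon(x,\xi)|\le c_{\alpha,\beta,\varepsilon}|P_\varepsilon(x,\xi)|\langle\xi\rangle^{-|\alpha|}$ for all $x\in\mathbb{R}^n$, $|\xi|\ge R$ and $\varepsilon\in(0,1]$. Then there exist $(q_\varepsilon)_\varepsilon\in\mathcal{M}_{S^{-m'}(\mathbb{R}^{2n}),-a'}$ and $(r_\varepsilon)_\varepsilon\in\mathcal{M}_{S^{-\infty}(\mathbb{R}^{2n}),a-a'}$ such that $$P_\varepsilon(x,D)q_\varepsilon(x,D)=I+r_\varepsilon(x,D)\qquad\text{for all }\varepsilon\in(0,1].$$ Moreover, there exists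 $(s_\varepsilon)_\varepsilon\in\mathcal{M}_{S^{-\infty}(\mathbb{R}^{2n}),2a-2a'}$ such that $$q_\varepsilon(x,D)P_\varepsilon(x,D)=I+s_\varepsilon(x,D)\qquad\text{for all }\varepsilon\in(0,1].$$
   Context: All nets are indexed by $\varepsilon\in(0,1]$ and $O(\cdot)$ refers to $\varepsilon\to0$. $\mathcal{G}_\infty(\mathbb{R}^n)=\mathcal{M}_E/\mathcal{N}_E$ with $E=\bigcap_sW^{s,\infty}(\mathbb{R}^n)$, where $\mathcal{M}_E$ is the set of nets $(u_\varepsilon)_\varepsilon\in E^{(0,1]}$ such that for every continuous seminorm $p$ of $E$ there is $N\in\mathbb{N}$ with $p(u_\varepsilon)=O(\varepsilon^{-N})$, and $\mathcal{N}_E$ is the set of nets with $p(u_\varepsilon)=O(\varepsilon^q)$ for all $p$ and all $q\in\mathbb{N}$. A representative of $P$ is a net $P_\varepsilon(x,\xi)=\sum_{|\alpha|\le m}c_{\alpha,\varepsilon}(x)\xi^\alpha$ with $(c_{\alpha,\varepsilon})_\varepsilon$ a representative of $c_\alpha$; $D=-i\partial$. $S^m(\mathbb{R}^{2n})$ is the space of $a\in\mathcal{C}^\infty(\mathbb{R}^{2n})$ with all seminorms $|a|^{(m)}_{\alpha,\beta}=\sup_{(x,\xi)\in\mathbb{R}^{2n}}\langle\xi\rangle^{-m+|\alpha|}|\partial_\xi^\alpha\partial_x^\beta a(x,\xi)|$ finite, $\langle\xi\rangle=(1+|\xi|^2)^{1/2}$. For $b\in\mathbb{R}$, $\mathcal{M}_{S^m(\mathbb{R}^{2n}),b}$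 is the set of nets $(a_\varepsilon)_\varepsilon$ in $S^m(\mathbb{R}^{2n})$ with $|a_\varepsilon|^{(m)}_{\alpha,\beta}=O(\varepsilon^b)$ for all $\alpha,\beta\in\mathbb{N}^n$; $\mathcal{M}_{S^{-\infty}(\mathbb{R}^{2n}),b}$ is the set of nets in $S^{-\infty}(\mathbb{R}^{2n})=\bigcap_mS^m(\mathbb{R}^{2n})$ with $|a_\varepsilon|^{(m)}_{\alpha,\beta}=O(\varepsilon^b)$ for all $m\in\mathbb{R}$ and all $\alpha,\beta$. $a(x,D)u=(2\pi)^{-n}\int e^{ix\xi}a(x,\xi)\widehat u(\xi)\,d\xi$, acting on $\mathscr{S}(\mathbb{R}^n)$ (and by extension on $\mathscr{S}'(\mathbb{R}^n)$). *)

theory Defs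
  imports "HOL-Analysis.Analysis" "HOL-Library.Landau_Symbols"
begin

section \<open>Multi-indices and iterated partial derivatives\<close>

type_synonym 'n mindex = "'n \<Rightarrow> nat"

definition mlen :: "'n::finite mindex \<Rightarrow> nat" where
  "mlen \<alpha> = (\<Sum>i\<in>UNIV. \<alpha> i)"

lemma finite_mlen_le: "finite {\<alpha> :: 'n::finite mindex. mlen \<alpha> \<le> k}"
proof (rule finite_subset)
  show "{\<alpha> :: 'n mindex. mlen \<alpha> \<le> k} \<subseteq> (UNIV \<rightarrow>\<^sub>E {..k})"
  proof
    fix \<alpha> :: "'n mindex" assume "\<alpha> \<in> {\<alpha>. mlen \<alpha> \<le> k}"
    moreover have "\<alpha> i \<le> mlen \<alpha>" for i
      unfolding mlen_def by (rule member_le_sum) auto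
    ultimately show "\<alpha> \<in> UNIV \<rightarrow>\<^sub>E {..k}"
      by (auto intro: order_trans)
  qed
qed (auto intro: finite_PiE)

definition mpow :: "real ^ 'n \<Rightarrow> 'n::finite mindex \<Rightarrow> complex" where
  "mpow \<xi> \<alpha> = (\<Prod>i\<in>UNIV. complex_of_real (\<xi> $ i) ^ \<alpha> i)"

definition dir_deriv ::
  "'a::real_normed_vector \<Rightarrow> ('a \<Rightarrow> 'b::real_normed_vector) \<Rightarrow> 'a \<Rightarrow> 'b" where
  "dir_deriv v f x = vector_derivative (\<lambda>t. f (x + t *\<^sub>R v)) (at 0)"

text \<open>All iterated partial derivatives exist and are again (totally) differentiable, hence
  continuous; this is the class of infinitely differentiable functions.\<close>

definition smooth :: "('a::euclidean_space \<Rightarrow> 'b::real_normed_vector) \<Rightarrow> bool" where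
  "smooth f \<longleftrightarrow>
     (\<forall>vs. set vs \<subseteq> Basis \<longrightarrow> (\<forall>x. foldr dir_deriv vs f differentiable (at x)))"

text \<open>An arbitrary enumeration of the coordinates fixes the order in which the partial
  derivatives making up a multi-index derivative are taken. For smooth functions the order is
  immaterial.\<close>

definition index_enum :: "'n::finite list" where
  "index_enum = (SOME is. distinct is \<and> set is = UNIV)"

definition mderiv :: "('n::finite \<Rightarrow> 'a::real_normed_vector) \<Rightarrow> 'n mindex \<Rightarrow>
    ('a \<Rightarrow> 'b::real_normed_vector) \<Rightarrow> 'a \<Rightarrow> 'b" where
  "mderiv e \<alpha> f =
     foldr dir_deriv (concat (map (\<lambda>i. replicate (\<alpha> i) (e i)) index_enum)) f"

definition pd :: "'n::finite mindex \<Rightarrow> (real ^ 'n \<Rightarrow> complex) \<Rightarrow> real ^ 'n \<Rightarrow> complex" where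
  "pd \<alpha> = mderiv (\<lambda>i. axis i 1) \<alpha>"

definition pd_x :: "'n::finite mindex \<Rightarrow> ((real ^ 'n) \<times> (real ^ 'n) \<Rightarrow> complex) \<Rightarrow>
    (real ^ 'n) \<times> (real ^ 'n) \<Rightarrow> complex" where
  "pd_x \<beta> = mderiv (\<lambda>i. (axis i 1, 0)) \<beta>"

definition pd_xi :: "'n::finite mindex \<Rightarrow> ((real ^ 'n) \<times> (real ^ 'n) \<Rightarrow> complex) \<Rightarrow>
    (real ^ 'n) \<times> (real ^ 'n) \<Rightarrow> complex" where
  "pd_xi \<alpha> = mderiv (\<lambda>i. (0, axis i 1)) \<alpha>"


section \<open>The algebra of generalized functions based on the Sobolev spaces with exponent infinity\<close>

definition Linf :: "(real ^ 'n::finite \<Rightarrow> complex) set" where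
  "Linf = {v \<in> borel_measurable lborel. \<exists>C. AE x in lborel. norm (v x) \<le> C}"

definition Linf_norm :: "(real ^ 'n::finite \<Rightarrow> complex) \<Rightarrow> real" where
  "Linf_norm v = Inf {C. 0 \<le> C \<and> (AE x in lborel. norm (v x) \<le> C)}"

definition test_fun :: "(real ^ 'n::finite \<Rightarrow> complex) set" where
  "test_fun = {\<phi>. smooth \<phi> \<and> (\<exists>K. compact K \<and> (\<forall>x. x \<notin> K \<longrightarrow> \<phi> x = 0))}"

definition weak_deriv ::
  "'n::finite mindex \<Rightarrow> (real ^ 'n \<Rightarrow> complex) \<Rightarrow> (real ^ 'n \<Rightarrow> complex) \<Rightarrow> bool" where
  "weak_deriv \<alpha> u v \<longleftrightarrow> (\<forall>\<phi>\<in>test_fun.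
     (LINT x|lborel. u x * pd \<alpha> \<phi> x) = (-1) ^ mlen \<alpha> * (LINT x|lborel. v x * \<phi> x))"

definition Winf :: "nat \<Rightarrow> (real ^ 'n::finite \<Rightarrow> complex) set" where
  "Winf k = {u \<in> Linf. \<forall>\<alpha>. mlen \<alpha> \<le> k \<longrightarrow> (\<exists>v\<in>Linf. weak_deriv \<alpha> u v)}"

text \<open>The weak derivative is determined up to null sets only, so the choice does not affect
  its norm.\<close>

definition Winf_norm :: "nat \<Rightarrow> (real ^ 'n::finite \<Rightarrow> complex) \<Rightarrow> real" where
  "Winf_norm k u = (MAX \<alpha>\<in>{\<alpha>. mlen \<alpha> \<le> k}. Linf_norm (SOME v. v \<in> Linf \<and> weak_deriv \<alpha> u v))"

text \<open>Elements of the intersection of all \<^const>\<open>Winf\<close> spaces are classes modulo null sets.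
  By the Sobolev embedding each of these classes contains exactly one smooth function, which
  is taken to stand for the class, so that point values and classical derivatives make sense.\<close>

definition E_space :: "(real ^ 'n::finite \<Rightarrow> complex) set" where
  "E_space = {u. smooth u \<and> (\<forall>k. u \<in> Winf k)}"

text \<open>The topology is generated by the increasing sequence of norms \<^const>\<open>Winf_norm\<close>, so a
  seminorm is continuous iff it is dominated by a multiple of one of them.\<close>

definition cont_seminorm :: "((real ^ 'n::finite \<Rightarrow> complex) \<Rightarrow> real) \<Rightarrow> bool" where
  "cont_seminorm p \<longleftrightarrow>
     (\<forall>u\<in>E_space. 0 \<le> p u) \<and>
     (\<forall>u\<in>E_space. \<forall>v\<in>E_space. p (\<lambda>x. u x + v x) \<le> p u + p v) \<and>
     (\<forall>c. \<forall>u\<in>E_space. p (\<lambda>x. c * u x) = norm c * p u) \<and>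
     (\<exists>k C. \<forall>u\<in>E_space. p u \<le> C * Winf_norm k u)"

text \<open>A net indexed by the half-open unit interval is a function on the reals of which only
  the values on \<open>{0<..1}\<close> matter.\<close>

type_synonym 'a net = "real \<Rightarrow> 'a"

definition M_E :: "(real ^ 'n::finite \<Rightarrow> complex) net set" where
  "M_E = {u \<in> {0<..1} \<rightarrow> E_space. \<forall>p. cont_seminorm p \<longrightarrow>
     (\<exists>N::nat. (\<lambda>\<epsilon>. p (u \<epsilon>)) \<in> O[at_right 0](\<lambda>\<epsilon>. \<epsilon> powr (- real N)))}"

definition N_E :: "(real ^ 'n::finite \<Rightarrow> complex) net set" where
  "N_E = {u \<in> {0<..1} \<rightarrow> E_space. \<forall>p. cont_seminorm p \<longrightarrow>
     (\<forall>q::nat. (\<lambda>\<epsilon>. p (u \<epsilon>)) \<in> O[at_right 0](\<lambda>\<epsilon>. \<epsilon> powr real q))}"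

definition G_inf :: "(real ^ 'n::finite \<Rightarrow> complex) net set set" where
  "G_inf = M_E // {(u, v). u \<in> M_E \<and> v \<in> M_E \<and> (\<lambda>\<epsilon> x. u \<epsilon> x - v \<epsilon> x) \<in> N_E}"


section \<open>Symbols\<close>

definition jbracket :: "real ^ 'n::finite \<Rightarrow> real" where
  "jbracket \<xi> = sqrt (1 + (norm \<xi>)\<^sup>2)"

definition symb_weight :: "real \<Rightarrow> 'n::finite mindex \<Rightarrow> 'n mindex \<Rightarrow>
    ((real ^ 'n) \<times> (real ^ 'n) \<Rightarrow> complex) \<Rightarrow> (real ^ 'n) \<times> (real ^ 'n) \<Rightarrow> real" where
  "symb_weight m \<alpha> \<beta> a z =
     jbracket (snd z) powr (- m + real (mlen \<alpha>)) * norm (pd_xi \<alpha> (pd_x \<beta> a) z)"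

definition S_symb :: "real \<Rightarrow> ((real ^ 'n::finite) \<times> (real ^ 'n) \<Rightarrow> complex) set" where
  "S_symb m = {a. smooth a \<and> (\<forall>\<alpha> \<beta>. bdd_above (range (symb_weight m \<alpha> \<beta> a)))}"

text \<open>A real supremum, meaningful for elements of \<^term>\<open>S_symb m\<close>.\<close>

definition symb_seminorm :: "real \<Rightarrow> 'n::finite mindex \<Rightarrow> 'n mindex \<Rightarrow>
    ((real ^ 'n) \<times> (real ^ 'n) \<Rightarrow> complex) \<Rightarrow> real" where
  "symb_seminorm m \<alpha> \<beta> a = (SUP z. symb_weight m \<alpha> \<beta> a z)"

definition M_symb ::
  "real \<Rightarrow> real \<Rightarrow> ((real ^ 'n::finite) \<times> (real ^ 'n) \<Rightarrow> complex) net set" where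
  "M_symb m b = {a \<in> {0<..1} \<rightarrow> S_symb m.
     \<forall>\<alpha> \<beta>. (\<lambda>\<epsilon>. symb_seminorm m \<alpha> \<beta> (a \<epsilon>)) \<in> O[at_right 0](\<lambda>\<epsilon>. \<epsilon> powr b)}"

definition M_symb_minf ::
  "real \<Rightarrow> ((real ^ 'n::finite) \<times> (real ^ 'n) \<Rightarrow> complex) net set" where
  "M_symb_minf b = {a \<in> {0<..1} \<rightarrow> (\<Inter>m. S_symb m).
     \<forall>m \<alpha> \<beta>. (\<lambda>\<epsilon>. symb_seminorm m \<alpha> \<beta> (a \<epsilon>)) \<in> O[at_right 0](\<lambda>\<epsilon>. \<epsilon> powr b)}"


section \<open>Pseudodifferential operators on the Schwartz space\<close>

definition schwartz :: "(real ^ 'n::finite \<Rightarrow> complex) set" where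
  "schwartz = {u. smooth u \<and> (\<forall>\<alpha> \<beta>. bounded (range (\<lambda>x. mpow x \<alpha> * pd \<beta> u x)))}"

definition fourier :: "(real ^ 'n::finite \<Rightarrow> complex) \<Rightarrow> real ^ 'n \<Rightarrow> complex" where
  "fourier u \<xi> = (LINT x|lborel. exp (- \<i> * complex_of_real (x \<bullet> \<xi>)) * u x)"

definition psdo :: "((real ^ 'n::finite) \<times> (real ^ 'n) \<Rightarrow> complex) \<Rightarrow>
    (real ^ 'n \<Rightarrow> complex) \<Rightarrow> real ^ 'n \<Rightarrow> complex" where
  "psdo a u x = complex_of_real ((2 * pi) powr (- real CARD('n))) *
     (LINT \<xi>|lborel. exp (\<i> * complex_of_real (x \<bullet> \<xi>)) * a (x, \<xi>) * fourier u \<xi>)"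


section \<open>Differential operators with generalized coefficients\<close>

text \<open>A differential operator of order at most \<open>m\<close> is given by its coefficients
  \<open>c \<alpha>\<close>, \<open>mlen \<alpha> \<le> m\<close>, each of which is a class of nets; only these multi-indices matter.\<close>

definition gen_diff_op :: "nat \<Rightarrow> ('n::finite mindex \<Rightarrow> (real ^ 'n \<Rightarrow> complex) net set) \<Rightarrow> bool" where
  "gen_diff_op m c \<longleftrightarrow> (\<forall>\<alpha>. mlen \<alpha> \<le> m \<longrightarrow> c \<alpha> \<in> G_inf)"

definition representative :: "nat \<Rightarrow> ('n::finite mindex \<Rightarrow> (real ^ 'n \<Rightarrow> complex) net set) \<Rightarrow>
    ((real ^ 'n) \<times> (real ^ 'n) \<Rightarrow> complex) net \<Rightarrow> bool" where
  "representative m c P \<longleftrightarrow> (\<exists>d. (\<forall>\<alpha>. mlen \<alpha> \<le> m \<longrightarrow> d \<alpha> \<in> c \<alpha>) \<and>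
     (\<forall>\<epsilon>\<in>{0<..1}. \<forall>x \<xi>. P \<epsilon> (x, \<xi>) = (\<Sum>\<alpha> | mlen \<alpha> \<le> m. d \<alpha> \<epsilon> x * mpow \<xi> \<alpha>)))"

end

theory Submission
  imports Defs "HOL-Probability.Sinc_Integral" "HOL-Probability.Distributions"
begin

text \<open>Composing the differential operator \<open>P\<close> on the left of an operator with symbol \<open>f\<close> gives the
  finite expansion \<open>\<Sum>k\<le>m. Phi k P f\<close>, whose \<open>k\<close>-th term involves \<open>k\<close> covariable derivatives of \<open>P\<close>. By (iii),
  \<open>q0 = \<theta> / P\<close> with a cutoff \<open>\<theta>\<close> satisfies bounds in which multiplying \<open>q0\<close> by these derivatives
  gains decay in \<open>\<xi>\<close> but loses no power of \<open>\<epsilon>\<close>. Hence the recursion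
  \<open>q (Suc j) = - q0 * (\<Sum>k=1..m. Phi k P (q j))\<close> produces terms of order \<open>- m' - j\<close>, all of size
  \<open>\<epsilon> powr (- a')\<close>, and Borel summation with \<open>\<epsilon>\<close>-dependent dilations of the cutoff yields \<open>q\<close>.

  For the left inverse no second parametrix is constructed: the operator product \<open>q P\<close> has a symbol \<open>1 + s\<close> of
  some finite order, and associativity, \<open>P (q P) = (P q) P\<close>, shows that composing \<open>P\<close> with \<open>s\<close> gives the
  symbol of \<open>r P\<close>, which is of order \<open>- \<infinity>\<close>. Multiplying the expansion of this composition by \<open>q0\<close>
  lowers the order of \<open>s\<close> by one, again without loss in \<open>\<epsilon>\<close>; iterating makes it \<open>- \<infinity>\<close>.\<close>

section \<open>Directional derivatives and derivative bounds\<close>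

text \<open>Two kinds of estimates coexist. Symbol estimates proper, in which a covariable
  derivative gains a power of \<open>jbracket \<xi>\<close>, are kept for \<open>P\<close>,
  \<open>q0\<close>, \<open>q\<close> and \<open>r\<close>, where the composition formula is a
  finite algebraic expression. Other compositions are estimated without that gain; their symbols,
  given by \<open>kcomp\<close>, then require no oscillatory integrals. This is enough: for order -
  \<infinity> the two kinds agree, and the bootstrap for \<open>s\<close> draws its decay from the
  derivatives of \<open>P\<close> alone.

  The obstacle is uniformity in \<epsilon>. Bounding derivatives of \<open>P\<close> by (i) and
  \<open>1 / P\<close> by (ii) would cost a factor \<open>\<epsilon> powr (a - a')\<close> at every
  step of the recursion. Hence weights may depend on \<epsilon>, and \<open>P\<close> is measured by
  \<open>norm (P \<epsilon> z)\<close> itself, which cancels against the weight of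
  \<open>1 / P\<close>. Constants enter compositions as products, so powers of \<epsilon> simply add
  up. The exponent 2a - 2a' is - a' from \<open>q0\<close>, a - a' from \<open>r\<close> and a from
  \<open>P\<close>, in the bound for \<open>q0\<close> times the symbol of
  \<open>r P\<close>.\<close>

lemma dir_deriv_eq:
  assumes "(f has_derivative f') (at x)"
  shows "dir_deriv v f x = f' v"
proof -
  have 1: "((\<lambda>t. x + t *\<^sub>R v) has_derivative (\<lambda>t. t *\<^sub>R v)) (at (0::real))"
    by (auto intro!: derivative_eq_intros)
  have 2: "(f has_derivative f') (at (x + 0 *\<^sub>R v))" using assms by simp
  have "((\<lambda>t. f (x + t *\<^sub>R v)) has_derivative (\<lambda>t. f' (t *\<^sub>R v))) (at 0)"
    using has_derivative_compose[OF 1 2] by simp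
  moreover have "(\<lambda>t. f' (t *\<^sub>R v)) = (\<lambda>t. t *\<^sub>R f' v)"
    using assms has_derivative_linear linear_cmul by blast
  ultimately show ?thesis
    by (simp add: dir_deriv_def has_vector_derivative_def vector_derivative_at)
qed

lemma dir_deriv_frechet:
  "f differentiable (at x) \<Longrightarrow> dir_deriv v f x = frechet_derivative f (at x) v"
  by (metis dir_deriv_eq frechet_derivative_works)

lemma dir_deriv_cong:
  assumes "open U" "x \<in> U" "\<And>y. y \<in> U \<Longrightarrow> f y = g y"
  shows "dir_deriv v f x = dir_deriv v g x"
proof -
  have "((\<lambda>t. x + t *\<^sub>R v) \<longlongrightarrow> x + 0 *\<^sub>R v) (nhds (0::real))"
    by (intro tendsto_intros filterlim_ident)
  then have "eventually (\<lambda>t. x + t *\<^sub>R v \<in> U) (nhds (0::real))"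
    by (rule topological_tendstoD) (use assms in auto)
  then have "eventually (\<lambda>t. t \<in> UNIV \<longrightarrow> f (x + t *\<^sub>R v) = g (x + t *\<^sub>R v)) (nhds (0::real))"
    by (rule eventually_mono) (use assms in auto)
  then show ?thesis
    unfolding dir_deriv_def by (rule vector_derivative_cong_eq) auto
qed

lemma dir_deriv_affine:
  assumes "linear L"
  shows "dir_deriv v (\<lambda>x. f (L x + c)) x = dir_deriv (L v) f (L x + c)"
  using assms by (simp add: dir_deriv_def linear_add linear_cmul algebra_simps)

lemma dir_deriv_zero [simp]: "dir_deriv 0 f = (\<lambda>x. 0)"
  by (auto simp: dir_deriv_def intro!: ext vector_derivative_at)

lemma dir_deriv_const [simp]: "dir_deriv v (\<lambda>x. c) = (\<lambda>x. 0)"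
  by (auto simp: dir_deriv_def intro!: ext vector_derivative_at)

lemma dir_deriv_add:
  assumes "f differentiable (at x)" "g differentiable (at x)"
  shows "dir_deriv v (\<lambda>x. f x + g x) x = dir_deriv v f x + dir_deriv v g x"
proof -
  from assms obtain f' g' where *: "(f has_derivative f') (at x)" "(g has_derivative g') (at x)"
    unfolding differentiable_def by auto
  show ?thesis
    using dir_deriv_eq[OF has_derivative_add[OF *]] dir_deriv_eq[OF *(1)] dir_deriv_eq[OF *(2)]
    by simp
qed

lemma dir_deriv_mult:
  fixes f g :: "'a::real_normed_vector \<Rightarrow> complex"
  assumes "f differentiable (at x)" "g differentiable (at x)"
  shows "dir_deriv v (\<lambda>x. f x * g x) x = dir_deriv v f x * g x + f x * dir_deriv v g x"
proof -
  from assms obtain f' g' where *: "(f has_derivative f') (at x)" "(g has_derivative g') (at x)"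
    unfolding differentiable_def by auto
  show ?thesis
    using dir_deriv_eq[OF has_derivative_mult[OF *]] dir_deriv_eq[OF *(1)] dir_deriv_eq[OF *(2)]
    by simp
qed

lemma dir_deriv_cmult:
  fixes f :: "'a::real_normed_vector \<Rightarrow> complex"
  assumes "f differentiable (at x)"
  shows "dir_deriv v (\<lambda>x. c * f x) x = c * dir_deriv v f x"
  using dir_deriv_mult[of "\<lambda>x. c" x f v] assms by simp

lemma dir_deriv_expand:
  fixes f :: "'a::euclidean_space \<Rightarrow> complex"
  assumes "f differentiable (at x)"
  shows "dir_deriv v f x = (\<Sum>b\<in>Basis. complex_of_real (v \<bullet> b) * dir_deriv b f x)"
proof -
  let ?D = "frechet_derivative f (at x)"
  have lin: "linear ?D" using assms by (rule linear_frechet_derivative)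
  have "?D v = ?D (\<Sum>b\<in>Basis. (v \<bullet> b) *\<^sub>R b)" by (simp add: euclidean_representation)
  also have "\<dots> = (\<Sum>b\<in>Basis. (v \<bullet> b) *\<^sub>R ?D b)"
    by (simp add: linear_sum[OF lin] linear_cmul[OF lin])
  finally show ?thesis using assms by (simp add: dir_deriv_frechet scaleR_conv_of_real)
qed

lemma differentiable_cong_open:
  assumes "open U" "x \<in> U" "\<And>y. y \<in> U \<Longrightarrow> f y = g y" "f differentiable (at x)"
  shows "g differentiable (at x)"
  using assms unfolding differentiable_def
  by (metis has_derivative_transform_within_open)

section \<open>Weighted bounds on iterated derivatives\<close>

text \<open>One constant \<open>C\<close> serves all derivatives of order at most \<open>k\<close>
  in basis directions, taken in any order. \<open>w\<close> is the weight of the function itself and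
  \<open>l b z\<close> the factor by which a derivative in direction \<open>b\<close> improves it:
  \<open>lam\<close> gives symbol estimates, the constant 1 gives bounds without gain.
  Differentiability is part of the recursion because \<open>dir_deriv\<close> is total and a bound
  on it would otherwise mean little.\<close>

primrec dbound :: "('a \<Rightarrow> 'a \<Rightarrow> real) \<Rightarrow> 'a set \<Rightarrow> nat \<Rightarrow> real \<Rightarrow> ('a \<Rightarrow> real) \<Rightarrow>
    ('a::euclidean_space \<Rightarrow> complex) \<Rightarrow> bool" where
  "dbound l U 0 = (\<lambda>C w f. \<forall>z\<in>U. norm (f z) \<le> C * w z)"
| "dbound l U (Suc k) = (\<lambda>C w f. (\<forall>z\<in>U. norm (f z) \<le> C * w z) \<and>
     (\<forall>z\<in>U. f differentiable (at z)) \<and>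
     (\<forall>b\<in>Basis. dbound l U k C (\<lambda>z. w z * l b z) (dir_deriv b f)))"

lemma dbound_0: "dbound l U k C w f \<Longrightarrow> z \<in> U \<Longrightarrow> norm (f z) \<le> C * w z"
  by (cases k) auto

lemma dbound_SucD:
  assumes "dbound l U (Suc k) C w f"
  shows "\<And>z. z \<in> U \<Longrightarrow> f differentiable (at z)"
    "\<And>b. b \<in> Basis \<Longrightarrow> dbound l U k C (\<lambda>z. w z * l b z) (dir_deriv b f)"
  using assms by auto

lemma dbound_cong:
  assumes "open U" "dbound l U k C w f" "\<And>z. z \<in> U \<Longrightarrow> f z = g z" "\<And>z. z \<in> U \<Longrightarrow> w z = w' z"
  shows "dbound l U k C w' g"
  using assms(2-)
proof (induction k arbitrary: C w w' f g)
  case (Suc k)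
  have "dbound l U k C (\<lambda>z. w' z * l b z) (dir_deriv b g)" if b: "b \<in> Basis" for b
    by (rule Suc.IH[OF dbound_SucD(2)[OF Suc.prems(1) b]])
      (use Suc.prems in \<open>auto intro!: dir_deriv_cong[OF assms(1)]\<close>)
  moreover have "g differentiable (at z)" if "z \<in> U" for z
    by (rule differentiable_cong_open[OF assms(1) that Suc.prems(2)])
      (use Suc.prems that in auto)
  ultimately show ?case using Suc.prems by auto
qed auto

lemma dbound_mono:
  assumes "dbound l U k C w f" "\<And>z. z \<in> U \<Longrightarrow> C * w z \<le> C' * w' z" "\<And>b z. 0 \<le> l b z"
  shows "dbound l U k C' w' f"
  using assms(1,2)
proof (induction k arbitrary: w w' f)
  case (Suc k)
  have "dbound l U k C' (\<lambda>z. w' z * l b z) (dir_deriv b f)" if b: "b \<in> Basis" for b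
    by (rule Suc.IH[OF dbound_SucD(2)[OF Suc.prems(1) b]])
      (metis Suc.prems(2) assms(3) mult.assoc mult_right_mono)
  then show ?case using Suc.prems by (force intro: order_trans)
qed (force intro: order_trans)

lemma dbound_mono_dir:
  assumes "dbound l U k C w f" "\<And>b z. 0 \<le> l b z" "\<And>b z. l b z \<le> l' b z" "\<And>z. 0 \<le> C * w z"
  shows "dbound l' U k C w f"
  using assms(1,4)
proof (induction k arbitrary: w f)
  case (Suc k)
  have l': "0 \<le> l' b z" for b z using assms(2,3) order_trans by blast
  have "dbound l' U k C (\<lambda>z. w z * l' b z) (dir_deriv b f)" if b: "b \<in> Basis" for b
  proof -
    have "dbound l' U k C (\<lambda>z. w z * l b z) (dir_deriv b f)"
      by (rule Suc.IH[OF dbound_SucD(2)[OF Suc.prems(1) b]])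
        (metis Suc.prems(2) assms(2) mult.assoc mult_nonneg_nonneg)
    then show ?thesis
      by (rule dbound_mono)
        (use l' Suc.prems(2) assms(3) in \<open>auto simp: mult.assoc[symmetric] intro!: mult_left_mono\<close>)
  qed
  then show ?case using Suc.prems by auto
qed auto

lemma dbound_subset: "dbound l U k C w f \<Longrightarrow> V \<subseteq> U \<Longrightarrow> dbound l V k C w f"
  by (induction k arbitrary: w f) auto

lemma dbound_Suc_le: "dbound l U (Suc k) C w f \<Longrightarrow> dbound l U k C w f"
  by (induction k arbitrary: w f) auto

lemma dbound_le: "dbound l U k C w f \<Longrightarrow> j \<le> k \<Longrightarrow> dbound l U j C w f"
proof (induction k)
  case (Suc k)
  then show ?case by (cases "j = Suc k") (auto dest: dbound_Suc_le simp del: dbound.simps)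
qed simp

text \<open>Every clause of \<open>dbound\<close> is pointwise and speaks of derivatives of the
  globally given function. So arbitrarily many sets can be united with the same constant, which
  allows cutoffs and locally finite sums to be treated region by region.\<close>

lemma dbound_Union: "(\<And>V. V \<in> \<V> \<Longrightarrow> dbound l V k C w f) \<Longrightarrow> dbound l (\<Union>\<V>) k C w f"
  by (induction k arbitrary: w f) auto

lemma dbound_add:
  assumes "open U" "dbound l U k C w f" "dbound l U k C' w g"
  shows "dbound l U k (C + C') w (\<lambda>z. f z + g z)"
  using assms(2-)
proof (induction k arbitrary: w f g)
  case 0
  then show ?case by (auto simp: distrib_right intro!: norm_triangle_mono)
next
  case (Suc k)
  have "dbound l U k (C + C') (\<lambda>z. w z * l b z) (dir_deriv b (\<lambda>z. f z + g z))" if b: "b \<in> Basis" for b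
    by (rule dbound_cong[OF assms(1) Suc.IH[OF dbound_SucD(2)[OF Suc.prems(1) b] dbound_SucD(2)[OF Suc.prems(2) b]]])
      (use Suc.prems in \<open>auto simp: dir_deriv_add\<close>)
  then show ?case using Suc.prems by (auto simp: distrib_right intro!: norm_triangle_mono)
qed

lemma dbound_const_mult:
  assumes "open U" "dbound l U k C w f"
  shows "dbound l U k (norm c * C) w (\<lambda>z. c * f z)"
  using assms(2-)
proof (induction k arbitrary: w f)
  case 0
  then show ?case by (auto simp: norm_mult mult.assoc intro!: mult_left_mono)
next
  case (Suc k)
  have "dbound l U k (norm c * C) (\<lambda>z. w z * l b z) (dir_deriv b (\<lambda>z. c * f z))" if b: "b \<in> Basis" for b
    by (rule dbound_cong[OF assms(1) Suc.IH[OF dbound_SucD(2)[OF Suc.prems(1) b]]])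
      (use Suc.prems in \<open>auto simp: dir_deriv_cmult\<close>)
  then show ?case using Suc.prems by (auto simp: norm_mult mult.assoc intro!: mult_left_mono)
qed

lemma dbound_const:
  assumes "\<And>z. z \<in> U \<Longrightarrow> norm c \<le> C * w z" "\<And>b z. 0 \<le> l b z"
  shows "dbound l U k C w (\<lambda>z. c)"
proof -
  have Z: "dbound l U k C w (\<lambda>z. 0)" if "\<And>z. z \<in> U \<Longrightarrow> 0 \<le> C * w z" for w k
    using that
  proof (induction k arbitrary: w)
    case (Suc k)
    then show ?case using assms(2) by (auto simp: mult.assoc[symmetric] intro!: Suc.IH)
  qed auto
  have [simp]: "0 \<le> C * w z" if "z \<in> U" for z using assms(1)[OF that] norm_ge_zero order_trans by blast
  show ?thesis
    by (cases k) (use assms in \<open>auto intro!: Z simp: mult.assoc[symmetric]\<close>)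
qed

lemma dbound_sum:
  assumes "open U" "finite I" "\<And>i. i \<in> I \<Longrightarrow> dbound l U k (C i) w (f i)" "\<And>b z. 0 \<le> l b z"
  shows "dbound l U k (\<Sum>i\<in>I. C i) w (\<lambda>z. \<Sum>i\<in>I. f i z)"
  using assms(2,3)
proof (induction I rule: finite_induct)
  case empty
  show ?case by (simp, rule dbound_const) (use assms in auto)
next
  case (insert i I)
  have "dbound l U k (C i + (\<Sum>i\<in>I. C i)) w (\<lambda>z. f i z + (\<Sum>i\<in>I. f i z))"
    by (intro dbound_add assms(1) insert) (use insert in auto)
  then show ?case using insert by simp
qed

text \<open>Each differentiation splits the product into two terms, whence the factor
  \<open>2 ^ k\<close>; the gain \<open>l\<close> is the same whichever factor is
  differentiated.\<close>

lemma dbound_mult: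
  assumes "open U" "dbound l U k C w f" "dbound l U k C' w' g"
  shows "dbound l U k (2 ^ k * (C * C')) (\<lambda>z. w z * w' z) (\<lambda>z. f z * g z)"
  using assms(2-)
proof (induction k arbitrary: w w' f g)
  case 0
  have "norm (f z) * norm (g z) \<le> (C * w z) * (C' * w' z)" if "z \<in> U" for z
    by (rule mult_mono) (use 0 that order_trans[OF norm_ge_zero] in auto)
  then show ?case by (auto simp: norm_mult mult_ac)
next
  case (Suc k)
  have n: "norm (f z) * norm (g z) \<le> (C * w z) * (C' * w' z)" if "z \<in> U" for z
    by (rule mult_mono) (use Suc.prems that order_trans[OF norm_ge_zero] in auto)
  have "norm (f z * g z) \<le> 2 ^ Suc k * (C * C') * (w z * w' z)" if "z \<in> U" for z
  proof -
    have "norm (f z * g z) \<le> 1 * ((C * w z) * (C' * w' z))"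
      using n[OF that] by (simp add: norm_mult)
    also have "\<dots> \<le> 2 ^ Suc k * ((C * w z) * (C' * w' z))"
      by (rule mult_right_mono) (use n[OF that] order_trans[OF mult_nonneg_nonneg[OF norm_ge_zero norm_ge_zero]] one_le_power[of "2::real" "Suc k"] in auto)
    finally show ?thesis by (simp add: mult_ac)
  qed
  moreover have "dbound l U k (2 ^ Suc k * (C * C')) (\<lambda>z. w z * w' z * l b z) (dir_deriv b (\<lambda>z. f z * g z))"
    if b: "b \<in> Basis" for b
  proof -
    note df = dbound_SucD(2)[OF Suc.prems(1) b] and dg = dbound_SucD(2)[OF Suc.prems(2) b]
    note f = dbound_Suc_le[OF Suc.prems(1)] and g = dbound_Suc_le[OF Suc.prems(2)]
    have 1: "dbound l U k (2 ^ k * (C * C')) (\<lambda>z. w z * w' z * l b z) (\<lambda>z. dir_deriv b f z * g z)"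
      by (rule dbound_cong[OF assms(1) Suc.IH[OF df g]]) auto
    have 2: "dbound l U k (2 ^ k * (C * C')) (\<lambda>z. w z * w' z * l b z) (\<lambda>z. f z * dir_deriv b g z)"
      by (rule dbound_cong[OF assms(1) Suc.IH[OF f dg]]) auto
    have 3: "2 ^ k * (C * C') + 2 ^ k * (C * C') = 2 ^ Suc k * (C * C')" by simp
    show ?thesis
      by (rule dbound_cong[OF assms(1) dbound_add[OF assms(1) 1 2, unfolded 3]])
        (use Suc.prems(1,2) in \<open>simp_all add: dir_deriv_mult\<close>)
  qed
  ultimately show ?case using Suc.prems by auto
qed

text \<open>A direction off the basis is a combination of basis vectors and inherits the weakest of
  their gains, bounded by \<open>\<mu>\<close>.\<close>

lemma dbound_dir_deriv:
  assumes "open U" "dbound l U (Suc k) C w f" "\<And>b z. 0 \<le> l b z"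
    "\<And>b z. b \<in> Basis \<Longrightarrow> v \<bullet> b \<noteq> 0 \<Longrightarrow> z \<in> U \<Longrightarrow> l b z \<le> \<mu> z"
    "\<And>z. z \<in> U \<Longrightarrow> 0 \<le> \<mu> z"
  shows "dbound l U k ((\<Sum>b\<in>Basis. \<bar>v \<bullet> b\<bar>) * C) (\<lambda>z. w z * \<mu> z) (dir_deriv v f)"
proof -
  have nn: "0 \<le> C * w z" if "z \<in> U" for z
    using dbound_0[OF assms(2) that] norm_ge_zero order_trans by blast
  have "dbound l U k (\<bar>v \<bullet> b\<bar> * C) (\<lambda>z. w z * \<mu> z) (\<lambda>z. complex_of_real (v \<bullet> b) * dir_deriv b f z)"
    if b: "b \<in> Basis" for b
  proof (cases "v \<bullet> b = 0")
    case True
    then show ?thesis by (simp, intro dbound_const) (use assms in auto)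
  next
    case False
    have "dbound l U k C (\<lambda>z. w z * \<mu> z) (dir_deriv b f)"
      by (rule dbound_mono[OF dbound_SucD(2)[OF assms(2) b]])
        (use assms(3) assms(4)[OF b False] nn in \<open>auto simp: mult.assoc[symmetric] intro!: mult_left_mono\<close>)
    from dbound_const_mult[OF assms(1) this, of "complex_of_real (v \<bullet> b)"] show ?thesis by simp
  qed
  note * = dbound_sum[OF assms(1) finite_Basis this assms(3), folded sum_distrib_right]
  show ?thesis
    by (rule dbound_cong[OF assms(1) *])
      (use assms(2) in \<open>simp_all add: dir_deriv_expand[symmetric]\<close>)
qed

section \<open>Symmetry of mixed second derivatives\<close>

text \<open>A mean value estimate for the first difference in direction \<open>w\<close>, regarded
  as a function of the step \<open>s\<close> along \<open>v\<close>, after its linear part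
  \<open>(s * t) *\<^sub>R A w\<close> has been subtracted.\<close>

lemma second_difference_limit:
  fixes f :: "'a::euclidean_space \<Rightarrow> complex"
  assumes "open U" "x \<in> U" "\<And>y. y \<in> U \<Longrightarrow> f differentiable (at y)"
    "dir_deriv v f differentiable (at x)"
  shows "((\<lambda>t. (f (x + t *\<^sub>R v + t *\<^sub>R w) - f (x + t *\<^sub>R v) - f (x + t *\<^sub>R w) + f x) / (complex_of_real t)\<^sup>2)
      \<longlongrightarrow> dir_deriv w (dir_deriv v f) x) (at_right 0)"
proof (rule tendstoI)
  fix e :: real assume "e > 0"
  define g where "g = dir_deriv v f"
  define A where "A = frechet_derivative g (at x)"
  define M where "M = norm v + norm w + 1"
  have M: "M > 0" unfolding M_def by (smt (verit) norm_ge_zero)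
  \<comment> \<open>The derivative of \<open>F\<close> below is at most
    \<open>2 * e' * t * M\<close> on the interval from 0 to \<open>t\<close>; after division by the
    square of \<open>t\<close> there remains \<open>2 * e' * M\<close>, which is half of
    \<open>e\<close>.\<close>
  define e' where "e' = e / (4 * M)"
  have e': "e' > 0" using M \<open>e > 0\<close> by (simp add: e'_def)
  have gA: "(g has_derivative A) (at x)"
    using assms(4) unfolding A_def g_def by (simp add: frechet_derivative_works)
  then have lin: "linear A" by (rule has_derivative_linear)
  obtain r where r: "r > 0" "ball x r \<subseteq> U" using assms(1,2) open_contains_ball by blast
  from gA[unfolded has_derivative_at_alt] e' obtain d where d: "d > 0"
    "\<And>y. norm (y - x) < d \<Longrightarrow> norm (g y - g x - A (y - x)) \<le> e' * norm (y - x)"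
    by blast
  define \<delta> where "\<delta> = min r d / M"
  have \<delta>: "\<delta> > 0" using r d M by (simp add: \<delta>_def)
  show "\<forall>\<^sub>F t in at_right 0. dist ((f (x + t *\<^sub>R v + t *\<^sub>R w) - f (x + t *\<^sub>R v) - f (x + t *\<^sub>R w) + f x) / (complex_of_real t)\<^sup>2)
      (dir_deriv w (dir_deriv v f) x) < e"
  proof (rule eventually_at_rightI[OF _ \<delta>])
    fix t assume t: "t \<in> {0<..<\<delta>}"
    then have tM: "t * M < min r d" "t > 0" using M by (auto simp: \<delta>_def pos_less_divide_eq)
    have small: "norm (s *\<^sub>R v + u *\<^sub>R w) \<le> t * (norm v + norm w)" "norm (s *\<^sub>R v + u *\<^sub>R w) < min r d"
      if "0 \<le> s" "s \<le> t" "0 \<le> u" "u \<le> t" for s u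
    proof -
      have "norm (s *\<^sub>R v + u *\<^sub>R w) \<le> s * norm v + u * norm w"
        using that norm_triangle_ineq[of "s *\<^sub>R v" "u *\<^sub>R w"] by simp
      also have "\<dots> \<le> t * norm v + t * norm w" using that by (intro add_mono mult_right_mono) auto
      finally show 1: "norm (s *\<^sub>R v + u *\<^sub>R w) \<le> t * (norm v + norm w)" by (simp add: algebra_simps)
      also have "\<dots> \<le> t * M" using tM by (simp add: M_def)
      finally show "norm (s *\<^sub>R v + u *\<^sub>R w) < min r d" using tM by simp
    qed
    define F where "F s = f (x + s *\<^sub>R v + t *\<^sub>R w) - f (x + s *\<^sub>R v) - (s * t) *\<^sub>R A w" for s
    define F' where "F' s = g (x + s *\<^sub>R v + t *\<^sub>R w) - g (x + s *\<^sub>R v) - t *\<^sub>R A w" for s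
    have der: "(F has_vector_derivative F' s) (at s)" if s: "0 \<le> s" "s \<le> t" for s
    proof -
      have *: "((\<lambda>s. f (c + s *\<^sub>R v)) has_vector_derivative g (c + s *\<^sub>R v)) (at s)"
        if "c + s *\<^sub>R v \<in> U" for c
      proof -
        have 0: "(f has_derivative frechet_derivative f (at (c + s *\<^sub>R v))) (at (c + s *\<^sub>R v))"
          using assms(3)[OF that] by (simp add: frechet_derivative_works)
        have 1: "((\<lambda>s. c + s *\<^sub>R v) has_derivative (\<lambda>s. s *\<^sub>R v)) (at s)"
          by (auto intro!: derivative_eq_intros)
        show ?thesis
          using has_derivative_compose[OF 1 0] assms(3)[OF that]
          unfolding has_vector_derivative_def g_def
          by (simp add: dir_deriv_frechet linear_cmul[OF linear_frechet_derivative])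
      qed
      have "(x + t *\<^sub>R w) + s *\<^sub>R v \<in> U" "x + s *\<^sub>R v \<in> U"
        using small(2)[of s t] small(2)[of s 0] s r(2) tM
        by (auto simp: subset_iff dist_norm norm_minus_commute algebra_simps)
      from *[OF this(1)] *[OF this(2)] show ?thesis
        unfolding F_def F'_def by (auto intro!: derivative_eq_intros simp: algebra_simps)
    qed
    have bd: "norm (F' s) \<le> 2 * e' * t * M" if s: "0 \<le> s" "s \<le> t" for s
    proof -
      have 1: "norm (g (x + s *\<^sub>R v + t *\<^sub>R w) - g x - A (s *\<^sub>R v + t *\<^sub>R w)) \<le> e' * norm (s *\<^sub>R v + t *\<^sub>R w)"
        using d(2)[of "x + s *\<^sub>R v + t *\<^sub>R w"] small(2)[of s t] s tM by (simp add: algebra_simps)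
      have 2: "norm (g (x + s *\<^sub>R v) - g x - A (s *\<^sub>R v)) \<le> e' * norm (s *\<^sub>R v)"
        using d(2)[of "x + s *\<^sub>R v"] small(2)[of s 0] s tM by (simp add: algebra_simps)
      have "F' s = (g (x + s *\<^sub>R v + t *\<^sub>R w) - g x - A (s *\<^sub>R v + t *\<^sub>R w)) - (g (x + s *\<^sub>R v) - g x - A (s *\<^sub>R v))"
        unfolding F'_def by (simp add: linear_add[OF lin] linear_cmul[OF lin] algebra_simps)
      then have "norm (F' s) \<le> e' * norm (s *\<^sub>R v + t *\<^sub>R w) + e' * norm (s *\<^sub>R v)"
        using 1 2 norm_triangle_ineq4 by (smt (verit))
      also have "\<dots> \<le> e' * (t * (norm v + norm w)) + e' * (t * (norm v + norm w))"
        using small(1)[of s t] small(1)[of s 0] s tM e' by (intro add_mono mult_left_mono) auto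
      also have "\<dots> \<le> 2 * e' * t * M" using e' tM by (simp add: M_def)
      finally show ?thesis .
    qed
    have "norm (F t - F 0) \<le> 2 * e' * t * M * norm (t - 0)"
    proof (rule differentiable_bound)
      show "(F has_derivative (\<lambda>h. h *\<^sub>R F' s)) (at s within {0..t})" if "s \<in> {0..t}" for s
        using der[of s] that has_vector_derivative_at_within unfolding has_vector_derivative_def
        by (auto intro: has_derivative_at_withinI)
      show "onorm (\<lambda>h. h *\<^sub>R F' s) \<le> 2 * e' * t * M" if "s \<in> {0..t}" for s
        using bd[of s] that by (intro onorm_le) (simp add: mult.commute[of _ "\<bar>_\<bar>"] mult_left_mono)
    qed (use tM in auto)
    moreover have "F t - F 0 = (f (x + t *\<^sub>R v + t *\<^sub>R w) - f (x + t *\<^sub>R v) - f (x + t *\<^sub>R w) + f x) - complex_of_real (t\<^sup>2) * A w"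
      by (simp add: F_def algebra_simps power2_eq_square scaleR_conv_of_real)
    ultimately have "norm ((f (x + t *\<^sub>R v + t *\<^sub>R w) - f (x + t *\<^sub>R v) - f (x + t *\<^sub>R w) + f x) - complex_of_real (t\<^sup>2) * A w) \<le> 2 * e' * M * t\<^sup>2"
      using tM by (simp add: power2_eq_square mult_ac)
    moreover have "(f (x + t *\<^sub>R v + t *\<^sub>R w) - f (x + t *\<^sub>R v) - f (x + t *\<^sub>R w) + f x) / (complex_of_real t)\<^sup>2 - A w
       = ((f (x + t *\<^sub>R v + t *\<^sub>R w) - f (x + t *\<^sub>R v) - f (x + t *\<^sub>R w) + f x) - complex_of_real (t\<^sup>2) * A w) / complex_of_real (t\<^sup>2)"
      using tM by (simp add: diff_divide_distrib)
    ultimately have "norm ((f (x + t *\<^sub>R v + t *\<^sub>R w) - f (x + t *\<^sub>R v) - f (x + t *\<^sub>R w) + f x) / (complex_of_real t)\<^sup>2 - A w) \<le> 2 * e' * M"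
      using tM by (simp add: norm_divide divide_le_eq power2_eq_square norm_mult)
    also have "\<dots> < e" using M \<open>e > 0\<close> by (simp add: e'_def field_simps)
    finally show "dist ((f (x + t *\<^sub>R v + t *\<^sub>R w) - f (x + t *\<^sub>R v) - f (x + t *\<^sub>R w) + f x) / (complex_of_real t)\<^sup>2)
      (dir_deriv w (dir_deriv v f) x) < e"
      using dir_deriv_eq[OF gA, of w] by (simp add: dist_norm g_def)
  qed
qed

text \<open>The second difference quotient is symmetric in \<open>v\<close> and \<open>w\<close>,
  and its limit is unique.\<close>

lemma dir_deriv_commute:
  fixes f :: "'a::euclidean_space \<Rightarrow> complex"
  assumes "open U" "x \<in> U" "\<And>y. y \<in> U \<Longrightarrow> f differentiable (at y)"
    "dir_deriv v f differentiable (at x)" "dir_deriv w f differentiable (at x)"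
  shows "dir_deriv v (dir_deriv w f) x = dir_deriv w (dir_deriv v f) x"
proof -
  have "((\<lambda>t. (f (x + t *\<^sub>R v + t *\<^sub>R w) - f (x + t *\<^sub>R v) - f (x + t *\<^sub>R w) + f x) / (complex_of_real t)\<^sup>2)
      \<longlongrightarrow> dir_deriv v (dir_deriv w f) x) (at_right 0)"
    using second_difference_limit[OF assms(1,2,3,5), of v]
    by (rule Lim_transform_eventually) (auto simp: algebra_simps intro!: always_eventually)
  with second_difference_limit[OF assms(1-4), of w] show ?thesis
    using tendsto_unique trivial_limit_at_right_real by blast
qed

section \<open>Smooth functions on open sets\<close>

text \<open>The weight is existentially quantified, so no size is prescribed and only iterated
  differentiability on \<open>U\<close> remains. This encoding lets the calculus of
  \<open>dbound\<close> be reused for smoothness.\<close>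

definition smooth_on :: "'a set \<Rightarrow> ('a::euclidean_space \<Rightarrow> complex) \<Rightarrow> bool" where
  "smooth_on U f \<longleftrightarrow> (\<forall>k. \<exists>w. dbound (\<lambda>_ _. 1) U k 1 w f)"

definition diff_on :: "nat \<Rightarrow> 'a set \<Rightarrow> ('a::euclidean_space \<Rightarrow> complex) \<Rightarrow> bool" where
  "diff_on k U f \<longleftrightarrow> (\<exists>w. dbound (\<lambda>_ _. 1) U k 1 w f)"

lemma smooth_on_diff_on: "smooth_on U f \<longleftrightarrow> (\<forall>k. diff_on k U f)"
  by (simp add: smooth_on_def diff_on_def)

lemma diff_on_0 [simp]: "diff_on 0 U f"
  by (auto simp: diff_on_def intro!: exI[of _ "\<lambda>z. norm (f z)"])

lemma diff_on_Suc:
  "diff_on (Suc k) U f \<longleftrightarrow> (\<forall>z\<in>U. f differentiable (at z)) \<and> (\<forall>b\<in>Basis. diff_on k U (dir_deriv b f))"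
    (is "?l \<longleftrightarrow> ?r")
proof
  assume ?l then show ?r by (fastforce simp: diff_on_def)
next
  assume r: ?r
  then obtain w where w: "\<And>b. b \<in> Basis \<Longrightarrow> dbound (\<lambda>_ _. 1) U k 1 (w b) (dir_deriv b f)"
    unfolding diff_on_def by metis
  let ?w = "\<lambda>z. norm (f z) + (\<Sum>b\<in>Basis. \<bar>w b z\<bar>)"
  have "dbound (\<lambda>_ _. 1) U k 1 (\<lambda>z. ?w z * 1) (dir_deriv b f)" if b: "b \<in> Basis" for b
  proof (rule dbound_mono[OF w[OF b]])
    fix z
    have "\<bar>w b z\<bar> \<le> (\<Sum>b\<in>Basis. \<bar>w b z\<bar>)" by (rule member_le_sum) (use b in auto)
    then show "1 * w b z \<le> 1 * (?w z * 1)" by (smt (verit) norm_ge_zero mult_1 mult_1_right)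
  qed simp
  then have "dbound (\<lambda>_ _. 1) U (Suc k) 1 ?w f" using r by (auto intro!: sum_nonneg)
  then show ?l unfolding diff_on_def by blast
qed

lemma diff_on_dbound: "dbound l U k C w f \<Longrightarrow> diff_on k U f"
  by (induction k arbitrary: w f) (auto simp: diff_on_Suc)

lemma diff_on_le: "diff_on k U f \<Longrightarrow> j \<le> k \<Longrightarrow> diff_on j U f"
  unfolding diff_on_def using dbound_le by blast

lemma diff_on_cong:
  "open U \<Longrightarrow> diff_on k U f \<Longrightarrow> (\<And>z. z \<in> U \<Longrightarrow> f z = g z) \<Longrightarrow> diff_on k U g"
  unfolding diff_on_def using dbound_cong by metis

lemma diff_on_const [simp]: "diff_on k U (\<lambda>z. c)"
  by (auto simp: diff_on_def intro!: exI[of _ "\<lambda>z. norm c"] dbound_const)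

lemma diff_on_mult:
  assumes "open U" "diff_on k U f" "diff_on k U g" shows "diff_on k U (\<lambda>z. f z * g z)"
  using assms dbound_mult diff_on_dbound unfolding diff_on_def[of k U f] diff_on_def[of k U g]
  by metis

lemma diff_on_add:
  assumes "open U" "diff_on k U f" "diff_on k U g" shows "diff_on k U (\<lambda>z. f z + g z)"
  using assms(2,3)
proof (induction k arbitrary: f g)
  case (Suc k)
  have "diff_on k U (dir_deriv b (\<lambda>z. f z + g z))" if "b \<in> Basis" for b
    by (rule diff_on_cong[OF assms(1) Suc.IH[of "dir_deriv b f" "dir_deriv b g"]])
       (use Suc.prems that in \<open>auto simp: diff_on_Suc dir_deriv_add\<close>)
  then show ?case using Suc.prems by (auto simp: diff_on_Suc)
qed simp

lemma diff_on_sum: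
  assumes "open U" "\<And>i. i \<in> I \<Longrightarrow> diff_on k U (f i)" shows "diff_on k U (\<lambda>z. \<Sum>i\<in>I. f i z)"
  using assms(2) by (induction I rule: infinite_finite_induct) (auto intro!: diff_on_add assms(1))

lemma diff_on_cmult: "open U \<Longrightarrow> diff_on k U f \<Longrightarrow> diff_on k U (\<lambda>z. c * f z)"
  by (rule diff_on_mult) auto

lemma diff_on_power: "open U \<Longrightarrow> diff_on k U f \<Longrightarrow> diff_on k U (\<lambda>z. f z ^ n)"
  by (induction n) (auto intro!: diff_on_mult)

lemma diff_on_dir_deriv:
  assumes "open U" "diff_on (Suc k) U f" shows "diff_on k U (dir_deriv v f)"
proof -
  have "diff_on k U (\<lambda>z. \<Sum>b\<in>Basis. complex_of_real (v \<bullet> b) * dir_deriv b f z)"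
    using assms by (intro diff_on_sum diff_on_cmult) (auto simp: diff_on_Suc)
  then show ?thesis
    by (rule diff_on_cong[OF assms(1)]) (use assms in \<open>auto simp: diff_on_Suc dir_deriv_expand\<close>)
qed

lemma diff_on_affine:
  assumes "diff_on k UNIV f" "linear L" shows "diff_on k U (\<lambda>x. f (L x + c))"
  using assms(1)
proof (induction k arbitrary: f)
  case (Suc k)
  have 1: "(\<lambda>x. f (L x + c)) differentiable (at z)" for z
  proof -
    have "(\<lambda>x. L x + c) differentiable (at z)"
      by (intro differentiable_add linear_imp_differentiable differentiable_const assms(2))
    moreover have "f differentiable (at (L z + c))" using Suc.prems by (simp add: diff_on_Suc)
    ultimately show ?thesis using differentiable_chain_at[of "\<lambda>x. L x + c" z f] by (simp add: o_def)
  qed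
  have "dir_deriv b (\<lambda>x. f (L x + c)) = (\<lambda>x. dir_deriv (L b) f (L x + c))" for b
    using dir_deriv_affine[OF assms(2)] by blast
  moreover have "diff_on k U (\<lambda>x. dir_deriv (L b) f (L x + c))" for b
    by (rule Suc.IH[OF diff_on_dir_deriv[OF open_UNIV Suc.prems]])
  ultimately show ?case using 1 by (auto simp: diff_on_Suc)
qed simp

text \<open>The chain rule for a scalar inner function, as bump functions of the squared norm
  require. The inner function appears cast to the complex numbers because \<open>diff_on\<close>
  speaks of complex-valued functions.\<close>

lemma diff_on_compose_real:
  fixes \<phi> :: "'a::euclidean_space \<Rightarrow> real" and h :: "real \<Rightarrow> complex"
  assumes "open U" "diff_on k U (\<lambda>x. complex_of_real (\<phi> x))" "\<phi> ` U \<subseteq> V" "diff_on k V h"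
  shows "diff_on k U (\<lambda>x. h (\<phi> x))"
  using assms(2,4)
proof (induction k arbitrary: h)
  case (Suc k)
  have d\<phi>: "\<phi> differentiable (at z)" if "z \<in> U" for z
  proof -
    obtain D where "((\<lambda>x. complex_of_real (\<phi> x)) has_derivative D) (at z)"
      using Suc.prems(1) \<open>z \<in> U\<close> by (auto simp: diff_on_Suc differentiable_def)
    from has_derivative_Re[OF this] show ?thesis by (auto simp: differentiable_def)
  qed
  have dh: "h differentiable (at (\<phi> z))" if "z \<in> U" for z
    using Suc.prems(2) that assms(3) by (auto simp: diff_on_Suc)
  have D: "dir_deriv b (\<lambda>x. h (\<phi> x)) z = dir_deriv 1 h (\<phi> z) * dir_deriv b (\<lambda>x. complex_of_real (\<phi> x)) z"
    if z: "z \<in> U" for b z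
  proof -
    let ?\<phi>' = "frechet_derivative \<phi> (at z)" and ?h' = "frechet_derivative h (at (\<phi> z))"
    have 1: "(\<phi> has_derivative ?\<phi>') (at z)" "(h has_derivative ?h') (at (\<phi> z))"
      using d\<phi>[OF z] dh[OF z] by (simp_all add: frechet_derivative_works)
    have "dir_deriv b (\<lambda>x. h (\<phi> x)) z = ?h' (?\<phi>' b *\<^sub>R 1)"
      using dir_deriv_eq[OF has_derivative_compose[OF 1]] by simp
    also have "\<dots> = ?\<phi>' b *\<^sub>R ?h' 1"
      by (rule linear_cmul[OF linear_frechet_derivative[OF dh[OF z]]])
    also have "\<dots> = dir_deriv 1 h (\<phi> z) * complex_of_real (?\<phi>' b)"
      using dh[OF z] by (simp add: dir_deriv_frechet scaleR_conv_of_real mult.commute)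
    also have "complex_of_real (?\<phi>' b) = dir_deriv b (\<lambda>x. complex_of_real (\<phi> x)) z"
    proof -
      have "((\<lambda>x. complex_of_real (\<phi> x)) has_derivative (\<lambda>x. complex_of_real (?\<phi>' x))) (at z)"
        by (rule has_derivative_of_real[OF 1(1)])
      then show ?thesis by (rule dir_deriv_eq[symmetric])
    qed
    finally show ?thesis .
  qed
  have "diff_on k U (dir_deriv b (\<lambda>x. h (\<phi> x)))" if b: "b \<in> Basis" for b
  proof (rule diff_on_cong[OF assms(1)])
    show "diff_on k U (\<lambda>z. dir_deriv 1 h (\<phi> z) * dir_deriv b (\<lambda>x. complex_of_real (\<phi> x)) z)"
      by (rule diff_on_mult[OF assms(1) Suc.IH[OF diff_on_le[OF Suc.prems(1) le_SucI[OF order_refl]]]])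
        (use Suc.prems b in \<open>auto simp: diff_on_Suc\<close>)
  qed (use D in auto)
  moreover have "(\<lambda>x. h (\<phi> x)) differentiable (at z)" if "z \<in> U" for z
    using differentiable_chain_at[OF d\<phi>[OF that] dh[OF that]] by (simp add: o_def)
  ultimately show ?case by (auto simp: diff_on_Suc)
qed simp

lemma dir_deriv_inverse:
  fixes f :: "'a::real_normed_vector \<Rightarrow> complex"
  assumes "f differentiable (at x)" "f x \<noteq> 0"
  shows "(\<lambda>x. inverse (f x)) differentiable (at x)"
    "dir_deriv v (\<lambda>x. inverse (f x)) x = - (inverse (f x) * inverse (f x) * dir_deriv v f x)"
proof -
  from assms obtain f' where *: "(f has_derivative f') (at x)" unfolding differentiable_def by auto
  note D = Deriv.has_derivative_inverse[OF assms(2) *]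
  show "(\<lambda>x. inverse (f x)) differentiable (at x)"
    unfolding differentiable_def using D by blast
  show "dir_deriv v (\<lambda>x. inverse (f x)) x = - (inverse (f x) * inverse (f x) * dir_deriv v f x)"
    using dir_deriv_eq[OF D, of v] dir_deriv_eq[OF *, of v] by simp
qed

lemma diff_on_inverse:
  assumes "open U" "diff_on k U f" "\<And>z. z \<in> U \<Longrightarrow> f z \<noteq> 0"
  shows "diff_on k U (\<lambda>z. inverse (f z))"
  using assms(2)
proof (induction k)
  case (Suc k)
  have "diff_on k U f" by (rule diff_on_le[OF Suc.prems]) simp
  note IH = Suc.IH[OF this]
  have "diff_on k U (dir_deriv b (\<lambda>z. inverse (f z)))" if "b \<in> Basis" for b
  proof (rule diff_on_cong[OF assms(1)])
    show "diff_on k U (\<lambda>z. (- 1) * (inverse (f z) * inverse (f z) * dir_deriv b f z))"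
      using Suc.prems that by (intro diff_on_cmult diff_on_mult assms(1) IH) (auto simp: diff_on_Suc)
  qed (use Suc.prems assms(3) in \<open>auto simp: diff_on_Suc dir_deriv_inverse\<close>)
  then show ?case using Suc.prems assms(3) by (auto simp: diff_on_Suc intro!: dir_deriv_inverse)
qed simp

lemma smooth_on_differentiable: "smooth_on U f \<Longrightarrow> z \<in> U \<Longrightarrow> f differentiable (at z)"
  unfolding smooth_on_diff_on using diff_on_Suc by blast

lemma smooth_on_dir_deriv: "open U \<Longrightarrow> smooth_on U f \<Longrightarrow> smooth_on U (dir_deriv v f)"
  unfolding smooth_on_diff_on using diff_on_dir_deriv by blast

lemma smooth_on_foldr: "open U \<Longrightarrow> smooth_on U f \<Longrightarrow> smooth_on U (foldr dir_deriv vs f)"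
  by (induction vs) (auto intro: smooth_on_dir_deriv)

lemma smooth_on_dbound: "(\<And>k. \<exists>C w. dbound l U k C w f) \<Longrightarrow> smooth_on U f"
  unfolding smooth_on_diff_on using diff_on_dbound by blast

text \<open>Peeling the last vector off a list of directions turns iterated derivatives of
  \<open>f\<close> into those of \<open>dir_deriv b f\<close>, which is the recursion of
  \<open>diff_on\<close>.\<close>

lemma smooth_iff: "smooth f \<longleftrightarrow> smooth_on UNIV f" for f :: "'a::euclidean_space \<Rightarrow> complex"
proof
  assume "smooth f"
  have "diff_on k UNIV f" if "\<And>vs x. set vs \<subseteq> Basis \<Longrightarrow> foldr dir_deriv vs f differentiable (at x)"
    for k and f :: "'a \<Rightarrow> complex"
    using that
  proof (induction k arbitrary: f)
    case (Suc k)
    have "diff_on k UNIV (dir_deriv b f)" if "b \<in> Basis" for b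
    proof (rule Suc.IH)
      show "foldr dir_deriv vs (dir_deriv b f) differentiable at x" if "set vs \<subseteq> Basis" for vs x
        using Suc.prems[of "vs @ [b]"] that \<open>b \<in> Basis\<close> by simp
    qed
    then show ?case using Suc.prems[of "[]"] by (simp add: diff_on_Suc)
  qed simp
  with \<open>smooth f\<close> show "smooth_on UNIV f" unfolding smooth_def smooth_on_diff_on by blast
next
  assume "smooth_on UNIV f"
  then show "smooth f"
    unfolding smooth_def using smooth_on_foldr[OF open_UNIV] smooth_on_differentiable by blast
qed

lemma smooth_on_continuous: "smooth_on U f \<Longrightarrow> continuous_on U f"
  by (auto intro!: continuous_at_imp_continuous_on differentiable_imp_continuous_within
      smooth_on_differentiable)

lemma foldr_dir_deriv_commute:
  assumes "open U" "smooth_on U f" "x \<in> U"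
  shows "foldr dir_deriv vs (dir_deriv v f) x = dir_deriv v (foldr dir_deriv vs f) x"
  using assms(3)
proof (induction vs arbitrary: x)
  case (Cons w vs)
  let ?g = "foldr dir_deriv vs f"
  have s: "smooth_on U ?g" by (rule smooth_on_foldr[OF assms(1,2)])
  have "foldr dir_deriv (w # vs) (dir_deriv v f) x = dir_deriv w (dir_deriv v ?g) x"
    using dir_deriv_cong[OF assms(1) Cons.prems Cons.IH] by simp
  also have "\<dots> = dir_deriv v (dir_deriv w ?g) x"
    by (rule dir_deriv_commute[OF assms(1) Cons.prems])
      (use s assms(1) Cons.prems in \<open>auto intro!: smooth_on_differentiable smooth_on_dir_deriv\<close>)
  finally show ?case by simp
qed simp

text \<open>Bridges the fixed order of differentiation in \<open>mderiv\<close> and the arbitrary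
  orders in \<open>dbound\<close>.\<close>

lemma foldr_dir_deriv_perm:
  assumes "open U" "smooth_on U f" "x \<in> U" "mset vs = mset ws"
  shows "foldr dir_deriv vs f x = foldr dir_deriv ws f x"
  using assms(3,4)
proof (induction vs arbitrary: ws x)
  case (Cons v vs)
  from Cons.prems(2) have "v \<in> set ws" by (metis list.set_intros(1) set_mset_mset)
  then obtain ws1 ws2 where ws: "ws = ws1 @ v # ws2" by (meson split_list)
  have "foldr dir_deriv ws f x = foldr dir_deriv ws1 (dir_deriv v (foldr dir_deriv ws2 f)) x"
    by (simp add: ws)
  also have "\<dots> = dir_deriv v (foldr dir_deriv (ws1 @ ws2) f) x"
    using foldr_dir_deriv_commute[OF assms(1) smooth_on_foldr[OF assms(1,2)] Cons.prems(1)] by simp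
  also have "\<dots> = dir_deriv v (foldr dir_deriv vs f) x"
    by (rule dir_deriv_cong[OF assms(1) Cons.prems(1) Cons.IH[symmetric]])
      (use Cons.prems in \<open>auto simp: ws\<close>)
  finally show ?case by simp
qed simp

lemma dbound_foldr:
  assumes "dbound l U k C w f" "length vs \<le> k" "set vs \<subseteq> Basis" "z \<in> U"
  shows "norm (foldr dir_deriv vs f z) \<le> C * (w z * prod_list (map (\<lambda>b. l b z) vs))"
  using assms(1-3)
proof (induction vs arbitrary: k w f rule: rev_induct)
  case Nil
  then show ?case using dbound_0[OF _ assms(4)] by simp
next
  case (snoc v vs)
  then obtain k' where k: "k = Suc k'" by (cases k) auto
  have "norm (foldr dir_deriv vs (dir_deriv v f) z) \<le> C * ((w z * l v z) * prod_list (map (\<lambda>b. l b z) vs))"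
    by (rule snoc.IH[of k']) (use snoc.prems k in auto)
  then show ?case by (simp add: mult_ac)
qed

lemma dbound_lists:
  assumes "diff_on k U f"
    "\<And>vs z. length vs \<le> k \<Longrightarrow> set vs \<subseteq> Basis \<Longrightarrow> z \<in> U \<Longrightarrow>
      norm (foldr dir_deriv vs f z) \<le> C * (w z * prod_list (map (\<lambda>b. l b z) vs))"
  shows "dbound l U k C w f"
  using assms
proof (induction k arbitrary: w f)
  case 0
  show ?case using 0(2)[of "[]"] by simp
next
  case (Suc k)
  have "dbound l U k C (\<lambda>z. w z * l b z) (dir_deriv b f)" if b: "b \<in> Basis" for b
  proof (rule Suc.IH)
    show "norm (foldr dir_deriv vs (dir_deriv b f) z) \<le> C * (w z * l b z * prod_list (map (\<lambda>b. l b z) vs))"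
      if "length vs \<le> k" "set vs \<subseteq> Basis" "z \<in> U" for vs z
      using Suc.prems(2)[of "vs @ [b]" z] that b by (simp add: mult_ac)
  qed (use Suc.prems(1) b in \<open>auto simp: diff_on_Suc\<close>)
  moreover have "norm (f z) \<le> C * w z" if "z \<in> U" for z
    using Suc.prems(2)[of "[]" z] that by simp
  ultimately show ?case using Suc.prems(1) by (auto simp: diff_on_Suc)
qed

section \<open>Weights of symbols\<close>

lemma dbound_nonneg: "dbound l U k C w f \<Longrightarrow> z \<in> U \<Longrightarrow> 0 \<le> C * w z"
  by (rule order_trans[OF norm_ge_zero dbound_0])

section \<open>The weight and Peetre's inequality\<close>

lemma jbracket_ge1: "1 \<le> jbracket \<xi>"
  by (simp add: jbracket_def)

lemma jbracket_pos [simp]: "0 < jbracket \<xi>"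
  using jbracket_ge1[of \<xi>] by linarith

lemma jbracket_nonneg [simp]: "0 \<le> jbracket \<xi>" "jbracket \<xi> \<noteq> 0"
  using jbracket_ge1[of \<xi>] by linarith+

lemma jbracket_sq: "(jbracket \<xi>)\<^sup>2 = 1 + (norm \<xi>)\<^sup>2"
  by (simp add: jbracket_def)

lemma norm_le_jbracket: "norm \<xi> \<le> jbracket \<xi>"
  unfolding jbracket_def by (rule real_le_rsqrt) simp

lemma component_le_jbracket: "\<bar>\<xi> $ i\<bar> \<le> jbracket \<xi>"
  using component_le_norm_cart[of \<xi> i] norm_le_jbracket[of \<xi>] by linarith

lemma jbracket_le: "jbracket \<xi> \<le> 1 + norm \<xi>"
  unfolding jbracket_def by (rule real_le_lsqrt) (auto simp: power2_eq_square algebra_simps)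

lemma jbracket_powr_mono: "s \<le> t \<Longrightarrow> jbracket \<xi> powr s \<le> jbracket \<xi> powr t"
  by (intro powr_mono jbracket_ge1)

lemma jbracket_0 [simp]: "jbracket 0 = 1"
  by (simp add: jbracket_def)

lemma jbracket_minus [simp]: "jbracket (- x) = jbracket x"
  by (simp add: jbracket_def)

lemma continuous_jbracket [continuous_intros]:
  "continuous_on S g \<Longrightarrow> continuous_on S (\<lambda>x. jbracket (g x))"
  unfolding jbracket_def by (intro continuous_intros)

text \<open>Peetre's inequality. It will separate a translated weight into a function of the point
  times a function of the translation.\<close>

lemma jbracket_peetre: "jbracket x \<le> 2 * (jbracket (x + y) * jbracket y)"
proof (rule power2_le_imp_le)
  have "norm x \<le> norm (x + y) + norm y" using norm_triangle_ineq4[of "x + y" y] by simp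
  then have "(norm x)\<^sup>2 \<le> (norm (x + y) + norm y)\<^sup>2" by (intro power_mono) auto
  also have "\<dots> \<le> 2 * (norm (x + y))\<^sup>2 + 2 * (norm y)\<^sup>2"
    using sum_squares_bound[of "norm (x + y)" "norm y"] by (simp add: power2_sum)
  finally have "(jbracket x)\<^sup>2 \<le> 4 * ((1 + (norm (x + y))\<^sup>2) * (1 + (norm y)\<^sup>2))"
    by (simp add: jbracket_sq algebra_simps add_nonneg_nonneg)
      (smt (verit) zero_le_power2 mult_nonneg_nonneg)
  then show "(jbracket x)\<^sup>2 \<le> (2 * (jbracket (x + y) * jbracket y))\<^sup>2"
    by (simp add: jbracket_sq power_mult_distrib)
qed simp

lemma jbracket_peetre_powr:
  assumes "0 \<le> M"
  shows "jbracket (x + y) powr (- M) \<le> 2 powr M * (jbracket y powr M * jbracket x powr (- M))"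
proof -
  have "jbracket x powr M \<le> (2 * (jbracket (x + y) * jbracket y)) powr M"
    by (intro powr_mono2 assms jbracket_peetre) auto
  also have "\<dots> = 2 powr M * (jbracket (x + y) powr M * jbracket y powr M)"
    by (simp add: powr_mult)
  finally show ?thesis by (simp add: powr_minus field_simps)
qed

text \<open>A derivative of the composite is a derivative of \<open>f\<close> along
  \<open>L b\<close>; expanding \<open>L b\<close> in the basis costs at most \<open>B\<close>. The
  constant \<open>B\<close> is fixed before the function, its bound and the translation, which keeps
  later constants uniform.\<close>

lemma dbound_linear:
  fixes L :: "'a::euclidean_space \<Rightarrow> 'b::euclidean_space"
  assumes "linear L"
  obtains B where "1 \<le> B"
    "\<And>k C w f U c. dbound (\<lambda>_ _. 1) UNIV k C w f \<Longrightarrow>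
      dbound (\<lambda>_ _. 1) U k (B ^ k * C) (\<lambda>z. w (L z + c)) (\<lambda>z. f (L z + c))"
proof -
  define B where "B = 1 + (\<Sum>b\<in>Basis. \<Sum>b'\<in>Basis. \<bar>L b \<bullet> b'\<bar>)"
  have B1: "1 \<le> B" unfolding B_def by (simp add: sum_nonneg)
  have Bb: "(\<Sum>b'\<in>Basis. \<bar>L b \<bullet> b'\<bar>) \<le> B" if "b \<in> Basis" for b
    unfolding B_def using member_le_sum[of b Basis "\<lambda>b. \<Sum>b'\<in>Basis. \<bar>L b \<bullet> b'\<bar>"] that
    by (simp add: sum_nonneg)
  have "dbound (\<lambda>_ _. 1) U k (B ^ k * C) (\<lambda>z. w (L z + c)) (\<lambda>z. f (L z + c))"
    if "dbound (\<lambda>_ _. 1) UNIV k C w f" for k C w f U c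
    using that
  proof (induction k arbitrary: C w f)
    case (Suc k)
    have nn: "0 \<le> C * w z" for z
      by (rule dbound_nonneg[OF Suc.prems]) simp
    have "dbound (\<lambda>_ _. 1) U k (B ^ Suc k * C) (\<lambda>z. w (L z + c) * 1) (dir_deriv b (\<lambda>z. f (L z + c)))"
      if b: "b \<in> Basis" for b
    proof -
      let ?S = "\<Sum>b'\<in>Basis. \<bar>L b \<bullet> b'\<bar>"
      have "dbound (\<lambda>_ _. 1) UNIV k (?S * C) (\<lambda>z. w z * 1) (dir_deriv (L b) f)"
        by (rule dbound_dir_deriv[OF open_UNIV Suc.prems]) auto
      from Suc.IH[OF this]
      have "dbound (\<lambda>_ _. 1) U k (B ^ k * (?S * C)) (\<lambda>z. w (L z + c) * 1) (dir_deriv b (\<lambda>z. f (L z + c)))"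
        by (simp add: dir_deriv_affine[OF assms, abs_def])
      then show ?thesis
      proof (rule dbound_mono)
        fix z
        have "0 \<le> B ^ k * ((B - ?S) * (C * w (L z + c)))"
          using Bb[OF b] B1 mult_nonneg_nonneg[of "B - ?S" "C * w (L z + c)"] nn
          by (intro mult_nonneg_nonneg[of "B ^ k"]) (auto simp: mult.assoc)
        then show "B ^ k * (?S * C) * (w (L z + c) * 1) \<le> B ^ Suc k * C * (w (L z + c) * 1)"
          by (simp add: algebra_simps)
      qed simp
    qed
    moreover have "norm (f (L z + c)) \<le> B ^ Suc k * C * w (L z + c)" for z
    proof -
      have "norm (f (L z + c)) \<le> 1 * (C * w (L z + c))" using dbound_0[OF Suc.prems, of "L z + c"] by simp
      also have "\<dots> \<le> B ^ Suc k * (C * w (L z + c))"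
        by (intro mult_right_mono nn one_le_power B1)
      finally show ?thesis by (simp add: mult.assoc)
    qed
    moreover have "(\<lambda>z. f (L z + c)) differentiable (at z)" for z
      using diff_on_affine[OF diff_on_dbound[OF Suc.prems] assms, of UNIV c]
      by (simp add: diff_on_Suc)
    ultimately show ?case by auto
  qed simp
  with B1 show thesis by (rule that)
qed

text \<open>The two gains of a symbol derivative: a factor \<open>1 / jbracket \<xi>\<close> in the covariable directions
  (the vectors with vanishing first component), nothing in the others.\<close>

definition lam :: "('a::real_vector \<times> (real ^ 'n::finite)) \<Rightarrow> ('a \<times> (real ^ 'n)) \<Rightarrow> real" where
  "lam v z = (if fst v = 0 then 1 / jbracket (snd z) else 1)"

lemma lam_nonneg [simp]: "0 \<le> lam v z"
  by (simp add: lam_def)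

lemma lam_le_1: "lam v z \<le> 1"
  using jbracket_ge1[of "snd z"] by (simp add: lam_def)

text \<open>Covariable derivatives of a function of the position alone vanish, and the other
  directions have gain 1; so plain bounds are already symbol bounds.\<close>

lemma dbound_fst:
  fixes f :: "'a::euclidean_space \<Rightarrow> complex"
  assumes "dbound (\<lambda>_ _. 1) UNIV k C w f"
  shows "dbound lam (UNIV :: ('a \<times> (real ^ 'n::finite)) set) k C (\<lambda>z. w (fst z)) (\<lambda>z. f (fst z))"
  using assms
proof (induction k arbitrary: w f)
  case (Suc k)
  have nn: "0 \<le> C * w z" for z
    by (rule dbound_nonneg[OF Suc.prems]) simp
  have d: "dir_deriv b (\<lambda>z. f (fst z)) = (\<lambda>z::'a \<times> (real ^ 'n). dir_deriv (fst b) f (fst z))" for b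
    using dir_deriv_affine[OF linear_fst, of b f 0] by auto
  have "dbound lam UNIV k C (\<lambda>z. w (fst z) * lam b z) (dir_deriv b (\<lambda>z::'a \<times> (real ^ 'n). f (fst z)))"
    if b: "b \<in> Basis" for b :: "'a \<times> (real ^ 'n)"
  proof (cases "fst b = 0")
    case True
    then show ?thesis
      using nn by (simp add: d) (intro dbound_const, auto simp: mult.assoc[symmetric] intro!: mult_nonneg_nonneg)
  next
    case False
    then have "fst b \<in> Basis" using b by (auto simp: Basis_prod_def)
    from Suc.IH[OF dbound_SucD(2)[OF Suc.prems this]] show ?thesis
      using False by (simp add: d) (simp add: lam_def[of b])
  qed
  moreover have "(\<lambda>z::'a \<times> (real ^ 'n). f (fst z)) differentiable (at z)" for z
  proof -
    have "diff_on (Suc k) UNIV (\<lambda>z::'a \<times> (real ^ 'n). f (fst z))"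
      using diff_on_affine[OF diff_on_dbound[OF Suc.prems] linear_fst, of UNIV 0] by simp
    then show ?thesis unfolding diff_on_Suc by blast
  qed
  ultimately show ?case using Suc.prems by auto
qed simp

lemma dbound_snd:
  fixes f :: "real ^ 'n::finite \<Rightarrow> complex"
  assumes "dbound (\<lambda>_ \<xi>. 1 / jbracket \<xi>) UNIV k C w f"
  shows "dbound lam (UNIV :: ('a::euclidean_space \<times> (real ^ 'n)) set) k C (\<lambda>z. w (snd z)) (\<lambda>z. f (snd z))"
  using assms
proof (induction k arbitrary: w f)
  case (Suc k)
  have nn: "0 \<le> C * w z" for z
    by (rule dbound_nonneg[OF Suc.prems]) simp
  have d: "dir_deriv b (\<lambda>z. f (snd z)) = (\<lambda>z::'a \<times> (real ^ 'n). dir_deriv (snd b) f (snd z))" for b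
    using dir_deriv_affine[OF linear_snd, of b f 0] by auto
  have "dbound lam UNIV k C (\<lambda>z. w (snd z) * lam b z) (dir_deriv b (\<lambda>z::'a \<times> (real ^ 'n). f (snd z)))"
    if b: "b \<in> Basis" for b :: "'a \<times> (real ^ 'n)"
  proof (cases "fst b = 0")
    case False
    then have "snd b = 0" using b by (auto simp: Basis_prod_def)
    then show ?thesis
      using nn by (simp add: d) (intro dbound_const, auto simp: mult.assoc[symmetric] intro!: mult_nonneg_nonneg)
  next
    case True
    then have "snd b \<in> Basis" using b by (auto simp: Basis_prod_def)
    from Suc.IH[OF dbound_SucD(2)[OF Suc.prems this]] show ?thesis
      using True by (simp add: d) (simp add: lam_def[of b])
  qed
  moreover have "(\<lambda>z::'a \<times> (real ^ 'n). f (snd z)) differentiable (at z)" for z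
  proof -
    have "diff_on (Suc k) UNIV (\<lambda>z::'a \<times> (real ^ 'n). f (snd z))"
      using diff_on_affine[OF diff_on_dbound[OF Suc.prems] linear_snd, of UNIV 0] by simp
    then show ?thesis unfolding diff_on_Suc by blast
  qed
  ultimately show ?case using Suc.prems by auto
qed simp

lemma dir_deriv_linear:
  assumes "bounded_linear L" shows "dir_deriv v L = (\<lambda>z. L v)"
  using dir_deriv_eq[OF bounded_linear_imp_has_derivative[OF assms]] by blast

lemma dbound_coordinate:
  "dbound (\<lambda>_ \<xi>. 1 / jbracket \<xi>) UNIV k 1 jbracket (\<lambda>\<xi>::real^'n::finite. complex_of_real (\<xi> $ i))"
proof -
  have bl: "bounded_linear (\<lambda>\<xi>::real^'n. complex_of_real (\<xi> $ i))"
    by (intro bounded_linear_compose[OF bounded_linear_of_real] bounded_linear_vec_nth)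
  have "norm (complex_of_real (b $ i)) \<le> 1" if "b \<in> Basis" for b :: "real^'n"
    using component_le_norm_cart[of b i] norm_Basis[OF that] by simp
  then show ?thesis
    using dir_deriv_linear[OF bl] bounded_linear_imp_differentiable[OF bl]
    by (cases k) (auto simp: component_le_jbracket intro!: dbound_const)
qed

lemma dbound_prod_list:
  assumes "\<And>i. i \<in> set is \<Longrightarrow> dbound l U k (C i) (w i) (f i)" "open U" "\<And>b z. 0 \<le> l b z"
  shows "\<exists>C. dbound l U k C (\<lambda>z. prod_list (map (\<lambda>i. w i z) is)) (\<lambda>z. prod_list (map (\<lambda>i. f i z) is))"
  using assms(1)
proof (induction "is")
  case Nil
  then show ?case using assms(3) by (auto intro!: exI[of _ 1] dbound_const)
next
  case (Cons i "is")
  then obtain C' where "dbound l U k C' (\<lambda>z. prod_list (map (\<lambda>i. w i z) is)) (\<lambda>z. prod_list (map (\<lambda>i. f i z) is))"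
    by auto
  from dbound_mult[OF assms(2) Cons.prems[of i] this] show ?case by auto
qed

section \<open>Multi-indices as lists of directions\<close>

text \<open>The list folded over in \<open>mderiv\<close>, made explicit so that it can be permuted,
  mapped and multiplied out; with coordinates in place of directions its product is
  \<open>mpow\<close>.\<close>

definition mlist :: "('n::finite \<Rightarrow> 'a) \<Rightarrow> 'n mindex \<Rightarrow> 'a list" where
  "mlist e \<alpha> = concat (map (\<lambda>i. replicate (\<alpha> i) (e i)) index_enum)"

lemma index_enum: "distinct (index_enum :: 'n::finite list)" "set (index_enum :: 'n list) = UNIV"
proof -
  have "\<exists>is::'n list. distinct is \<and> set is = UNIV"
    using finite_distinct_list[of "UNIV :: 'n set"] by auto
  then show "distinct (index_enum :: 'n list)" "set (index_enum :: 'n list) = UNIV"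
    unfolding index_enum_def by (metis (mono_tags, lifting) someI_ex)+
qed

lemma sum_list_index_enum: "sum_list (map f (index_enum :: 'n::finite list)) = (\<Sum>i\<in>UNIV. f i)"
  using index_enum by (metis sum_list_distinct_conv_sum_set)

lemma set_mlist: "set (mlist e \<alpha>) \<subseteq> range e"
  by (auto simp: mlist_def)

lemma map_mlist: "map g (mlist e \<alpha>) = mlist (\<lambda>i. g (e i)) \<alpha>"
  by (simp add: mlist_def map_concat o_def)

lemma length_mlist [simp]: "length (mlist e \<alpha>) = mlen \<alpha>"
  by (simp add: mlist_def length_concat o_def mlen_def sum_list_index_enum)

lemma prod_list_mlist:
  fixes e :: "'n::finite \<Rightarrow> 'a::comm_monoid_mult"
  shows "prod_list (mlist e \<alpha>) = (\<Prod>i\<in>UNIV. e i ^ \<alpha> i)"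
proof -
  have "prod_list (concat (map (\<lambda>i. replicate (\<alpha> i) (e i)) is)) = prod_list (map (\<lambda>i. e i ^ \<alpha> i) is)" for "is" :: "'n list"
    by (induction "is") (auto simp: prod_list_replicate)
  moreover have "prod_list (map (\<lambda>i. e i ^ \<alpha> i) index_enum) = (\<Prod>i\<in>UNIV. e i ^ \<alpha> i)"
    using index_enum prod.distinct_set_conv_list by metis
  ultimately show ?thesis by (simp add: mlist_def)
qed

lemma mpow_mlist: "mpow \<xi> \<alpha> = prod_list (mlist (\<lambda>i. complex_of_real (\<xi> $ i)) \<alpha>)"
  by (simp add: mpow_def prod_list_mlist)

lemma count_mlist:
  assumes "inj e"
  shows "count (mset (mlist e \<alpha>)) v = (if v \<in> range e then \<alpha> (inv e v) else 0)"
proof -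
  have "count (mset (concat (map (\<lambda>i. replicate (\<alpha> i) (e i)) is))) v = (\<Sum>i\<leftarrow>is. if e i = v then \<alpha> i else 0)" for "is"
    by (induction "is") auto
  then have "count (mset (mlist e \<alpha>)) v = (\<Sum>i\<in>UNIV. if e i = v then \<alpha> i else 0)"
    by (simp add: mlist_def sum_list_index_enum)
  also have "\<dots> = (if v \<in> range e then \<alpha> (inv e v) else 0)"
  proof (cases "v \<in> range e")
    case True
    then obtain j where "v = e j" by auto
    then show ?thesis using assms by (simp add: inj_eq inv_f_f)
  next
    case False
    then have "e i \<noteq> v" for i by auto
    then show ?thesis using False by simp
  qed
  finally show ?thesis .
qed

lemma mderiv_mlist: "mderiv e \<alpha> f = foldr dir_deriv (mlist e \<alpha>) f"
  by (simp add: mderiv_def mlist_def)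

lemma pd_xi_pd_x:
  "pd_xi \<alpha> (pd_x \<beta> f) = foldr dir_deriv (mlist (\<lambda>i. (0, axis i 1)) \<alpha> @ mlist (\<lambda>i. (axis i 1, 0)) \<beta>) f"
  by (simp add: pd_xi_def pd_x_def mderiv_mlist)

lemma Basis_axis: "(Basis :: (real ^ 'n::finite) set) = range (\<lambda>i. axis i 1)"
  by (auto simp: Basis_vec_def)

lemma Basis_pair_axis:
  "(Basis :: ((real ^ 'n::finite) \<times> (real ^ 'm::finite)) set) = range (\<lambda>i. (axis i 1, 0)) \<union> range (\<lambda>i. (0, axis i 1))"
  by (auto simp: Basis_prod_def Basis_axis)

lemma mset_mlist_single:
  assumes "set vs \<subseteq> range e" "inj e"
  obtains \<alpha> where "mset vs = mset (mlist e \<alpha>)"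
proof
  show "mset vs = mset (mlist e (\<lambda>i. count (mset vs) (e i)))"
  proof (rule multiset_eqI)
    fix v
    show "count (mset vs) v = count (mset (mlist e (\<lambda>i. count (mset vs) (e i)))) v"
      using assms by (auto simp: count_mlist[OF assms(2)] inv_f_f f_inv_into_f count_eq_zero_iff)
  qed
qed

lemma mset_mlist_pair:
  fixes vs :: "((real ^ 'n::finite) \<times> (real ^ 'm::finite)) list"
  assumes "set vs \<subseteq> Basis"
  obtains \<alpha> \<beta> where "mset vs = mset (mlist (\<lambda>i. (0, axis i 1)) \<alpha> @ mlist (\<lambda>i. (axis i 1, 0)) \<beta>)"
proof -
  let ?P = "\<lambda>v::(real ^ 'n) \<times> (real ^ 'm). fst v = 0"
  have "set (filter ?P vs) \<subseteq> range (\<lambda>i. (0, axis i 1))"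
    "set (filter (\<lambda>v. \<not> ?P v) vs) \<subseteq> range (\<lambda>i. (axis i 1, 0))"
    using assms by (auto simp: Basis_pair_axis)
  moreover have "inj (\<lambda>i. (0::real^'n, axis i (1::real)::real^'m))" "inj (\<lambda>i. (axis i (1::real)::real^'n, 0::real^'m))"
    by (auto simp: inj_def axis_eq_axis)
  ultimately obtain \<alpha> \<beta> where
    "mset (filter ?P vs) = mset (mlist (\<lambda>i. (0, axis i 1)) \<alpha>)"
    "mset (filter (\<lambda>v. \<not> ?P v) vs) = mset (mlist (\<lambda>i. (axis i 1, 0)) \<beta>)"
    by (metis (no_types, lifting) mset_mlist_single)
  then have "mset vs = mset (mlist (\<lambda>i. (0, axis i 1)) \<alpha> @ mlist (\<lambda>i. (axis i 1, 0)) \<beta>)"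
    by (metis mset_append mset_filter multiset_partition)
  then show thesis by (rule that)
qed

text \<open>Converts the gains accumulated by \<open>dbound\<close> into the exponent occurring in
  \<open>symb_weight\<close>: only covariable directions contribute.\<close>

lemma prod_list_lam:
  fixes z :: "(real ^ 'n::finite) \<times> (real ^ 'm::finite)"
  shows "prod_list (map (\<lambda>b. lam b z) (mlist (\<lambda>i. (0, axis i 1)) \<alpha> @ mlist (\<lambda>i. (axis i 1, 0)) \<beta>))
    = jbracket (snd z) powr (- real (mlen \<alpha>))"
proof -
  have "(\<Prod>i\<in>UNIV. (1 / jbracket (snd z)) ^ \<alpha> i) = (1 / jbracket (snd z)) ^ mlen \<alpha>"
    by (simp add: mlen_def power_sum)
  then show ?thesis
    by (simp add: map_mlist prod_list_mlist lam_def powr_minus powr_realpow power_inverse divide_inverse)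
qed

section \<open>Estimates for nets\<close>

text \<open>Nonnegativity is imposed for every \<epsilon>, not only near 0, so that these nets can
  multiply inequalities throughout the unit interval.\<close>

definition O1 :: "real net \<Rightarrow> bool" where
  "O1 C \<longleftrightarrow> (\<forall>\<epsilon>. 0 \<le> C \<epsilon>) \<and> C \<in> O[at_right 0](\<lambda>_. 1)"

lemma O1_const: "0 \<le> c \<Longrightarrow> O1 (\<lambda>\<epsilon>. c)"
  by (simp add: O1_def)

lemma O1_add: "O1 C \<Longrightarrow> O1 D \<Longrightarrow> O1 (\<lambda>\<epsilon>. C \<epsilon> + D \<epsilon>)"
  by (auto simp: O1_def intro: sum_in_bigo)

lemma O1_mult: "O1 C \<Longrightarrow> O1 D \<Longrightarrow> O1 (\<lambda>\<epsilon>. C \<epsilon> * D \<epsilon>)"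
  using landau_o.big.mult[of C "at_right 0" "\<lambda>_. 1" D "\<lambda>_. 1"] by (auto simp: O1_def)

lemma O1_power: "O1 C \<Longrightarrow> O1 (\<lambda>\<epsilon>. C \<epsilon> ^ n)"
  by (induction n) (auto intro: O1_const O1_mult)

lemma O1_sum: "(\<And>i. i \<in> I \<Longrightarrow> O1 (C i)) \<Longrightarrow> O1 (\<lambda>\<epsilon>. \<Sum>i\<in>I. C i \<epsilon>)"
  by (induction I rule: infinite_finite_induct) (auto intro: O1_const O1_add)

lemma O1_nonneg: "O1 C \<Longrightarrow> 0 \<le> C \<epsilon>"
  by (simp add: O1_def)

lemma O1_abs: "C \<in> O[at_right 0](\<lambda>_. 1) \<Longrightarrow> O1 (\<lambda>\<epsilon>. \<bar>C \<epsilon>\<bar>)"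
  by (simp add: O1_def)

text \<open>The bound holds for every \<epsilon> of the unit interval, whereas its constant is
  controlled only as \<epsilon> tends to 0. This matches the hypotheses, in which finiteness is
  known for each \<epsilon> but size only asymptotically.\<close>

definition estk :: "nat \<Rightarrow> ('a \<Rightarrow> 'a \<Rightarrow> real) \<Rightarrow> 'a set \<Rightarrow> (real \<Rightarrow> 'a \<Rightarrow> real) \<Rightarrow>
    (real \<Rightarrow> 'a::euclidean_space \<Rightarrow> complex) \<Rightarrow> bool" where
  "estk k l U w f \<longleftrightarrow> (\<exists>C. O1 C \<and> (\<forall>\<epsilon>\<in>{0<..1}. dbound l U k (C \<epsilon>) (w \<epsilon>) (f \<epsilon>)))"

definition est :: "('a \<Rightarrow> 'a \<Rightarrow> real) \<Rightarrow> 'a set \<Rightarrow> (real \<Rightarrow> 'a \<Rightarrow> real) \<Rightarrow>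
    (real \<Rightarrow> 'a::euclidean_space \<Rightarrow> complex) \<Rightarrow> bool" where
  "est l U w f \<longleftrightarrow> (\<forall>k. estk k l U w f)"

lemma estD: "est l U w f \<Longrightarrow> estk k l U w f"
  by (simp add: est_def)

lemma estk_cong:
  assumes "estk k l U w f" "open U" "\<And>\<epsilon> z. \<epsilon> \<in> {0<..1} \<Longrightarrow> z \<in> U \<Longrightarrow> f \<epsilon> z = g \<epsilon> z"
    "\<And>\<epsilon> z. \<epsilon> \<in> {0<..1} \<Longrightarrow> z \<in> U \<Longrightarrow> w \<epsilon> z = w' \<epsilon> z"
  shows "estk k l U w' g"
proof -
  obtain C where C: "O1 C" "\<And>\<epsilon>. \<epsilon> \<in> {0<..1} \<Longrightarrow> dbound l U k (C \<epsilon>) (w \<epsilon>) (f \<epsilon>)"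
    using assms(1) unfolding estk_def by blast
  have "dbound l U k (C \<epsilon>) (w' \<epsilon>) (g \<epsilon>)" if "\<epsilon> \<in> {0<..1}" for \<epsilon>
    by (rule dbound_cong[OF assms(2) C(2)[OF that]]) (use assms(3,4) that in auto)
  with C(1) show ?thesis unfolding estk_def by blast
qed

lemma estk_mono:
  assumes "estk k l U w f" "\<And>b z. 0 \<le> l b z" "0 \<le> c"
    "\<And>\<epsilon> z. \<epsilon> \<in> {0<..1} \<Longrightarrow> z \<in> U \<Longrightarrow> w \<epsilon> z \<le> c * w' \<epsilon> z"
  shows "estk k l U w' f"
proof -
  obtain C where C: "O1 C" "\<And>\<epsilon>. \<epsilon> \<in> {0<..1} \<Longrightarrow> dbound l U k (C \<epsilon>) (w \<epsilon>) (f \<epsilon>)"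
    using assms(1) unfolding estk_def by blast
  have "dbound l U k (c * C \<epsilon>) (w' \<epsilon>) (f \<epsilon>)" if \<epsilon>: "\<epsilon> \<in> {0<..1}" for \<epsilon>
  proof (rule dbound_mono[OF C(2)[OF \<epsilon>]])
    fix z assume "z \<in> U"
    from mult_left_mono[OF assms(4)[OF \<epsilon> this] O1_nonneg[OF C(1)]]
    show "C \<epsilon> * w \<epsilon> z \<le> c * C \<epsilon> * w' \<epsilon> z" by (simp add: mult_ac)
  qed (rule assms(2))
  then show ?thesis unfolding estk_def using O1_mult[OF O1_const[OF assms(3)] C(1)] by blast
qed

lemma estk_add:
  assumes "open U" "estk k l U w f" "estk k l U w g"
  shows "estk k l U w (\<lambda>\<epsilon> z. f \<epsilon> z + g \<epsilon> z)"
proof -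
  obtain C D where "O1 C" "O1 D" "\<And>\<epsilon>. \<epsilon> \<in> {0<..1} \<Longrightarrow> dbound l U k (C \<epsilon>) (w \<epsilon>) (f \<epsilon>)"
    "\<And>\<epsilon>. \<epsilon> \<in> {0<..1} \<Longrightarrow> dbound l U k (D \<epsilon>) (w \<epsilon>) (g \<epsilon>)"
    using assms(2,3) unfolding estk_def by blast
  then show ?thesis
    unfolding estk_def by (intro exI[of _ "\<lambda>\<epsilon>. C \<epsilon> + D \<epsilon>"]) (auto intro: O1_add dbound_add[OF assms(1)])
qed

lemma estk_mult:
  assumes "open U" "estk k l U w f" "estk k l U w' g"
  shows "estk k l U (\<lambda>\<epsilon> z. w \<epsilon> z * w' \<epsilon> z) (\<lambda>\<epsilon> z. f \<epsilon> z * g \<epsilon> z)"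
proof -
  obtain C D where "O1 C" "O1 D" "\<And>\<epsilon>. \<epsilon> \<in> {0<..1} \<Longrightarrow> dbound l U k (C \<epsilon>) (w \<epsilon>) (f \<epsilon>)"
    "\<And>\<epsilon>. \<epsilon> \<in> {0<..1} \<Longrightarrow> dbound l U k (D \<epsilon>) (w' \<epsilon>) (g \<epsilon>)"
    using assms(2,3) unfolding estk_def by blast
  then show ?thesis
    unfolding estk_def by (intro exI[of _ "\<lambda>\<epsilon>. 2 ^ k * (C \<epsilon> * D \<epsilon>)"] conjI ballI
        O1_mult[OF O1_const O1_mult] dbound_mult[OF assms(1)]) auto
qed

lemma estk_const:
  assumes "\<And>b z. 0 \<le> l b z" "\<And>\<epsilon> z. \<epsilon> \<in> {0<..1} \<Longrightarrow> z \<in> U \<Longrightarrow> norm (c \<epsilon>) \<le> w \<epsilon> z"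
  shows "estk k l U w (\<lambda>\<epsilon> z. c \<epsilon>)"
  unfolding estk_def
  by (intro exI[of _ "\<lambda>_. 1"]) (auto intro!: O1_const dbound_const assms)

lemma estk_cmult:
  assumes "open U" "estk k l U w f"
  shows "estk k l U w (\<lambda>\<epsilon> z. c * f \<epsilon> z)"
proof -
  obtain C where "O1 C" "\<And>\<epsilon>. \<epsilon> \<in> {0<..1} \<Longrightarrow> dbound l U k (C \<epsilon>) (w \<epsilon>) (f \<epsilon>)"
    using assms(2) unfolding estk_def by blast
  then show ?thesis
    unfolding estk_def by (intro exI[of _ "\<lambda>\<epsilon>. norm c * C \<epsilon>"] conjI ballI
        O1_mult[OF O1_const] dbound_const_mult[OF assms(1)]) auto
qed

lemma estk_deriv:
  assumes "estk (Suc k) l U w f" "b \<in> Basis"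
  shows "estk k l U (\<lambda>\<epsilon> z. w \<epsilon> z * l b z) (\<lambda>\<epsilon>. dir_deriv b (f \<epsilon>))"
  using assms unfolding estk_def by (auto simp del: dbound.simps dest!: dbound_SucD(2))

lemma estk_0I:
  assumes "O1 C" "\<And>\<epsilon> z. \<epsilon> \<in> {0<..1} \<Longrightarrow> z \<in> U \<Longrightarrow> norm (f \<epsilon> z) \<le> C \<epsilon> * w \<epsilon> z"
  shows "estk 0 l U w f"
  using assms unfolding estk_def by auto

lemma estk_SucI:
  assumes "estk 0 l U w f" "\<And>\<epsilon> z. \<epsilon> \<in> {0<..1} \<Longrightarrow> z \<in> U \<Longrightarrow> f \<epsilon> differentiable (at z)"
    "\<And>b z. 0 \<le> l b z" "\<And>\<epsilon> z. \<epsilon> \<in> {0<..1} \<Longrightarrow> z \<in> U \<Longrightarrow> 0 \<le> w \<epsilon> z"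
    "\<And>b. b \<in> Basis \<Longrightarrow> estk k l U (\<lambda>\<epsilon> z. w \<epsilon> z * l b z) (\<lambda>\<epsilon>. dir_deriv b (f \<epsilon>))"
  shows "estk (Suc k) l U w f"
proof -
  from assms(5) obtain D where D: "\<And>b. b \<in> Basis \<Longrightarrow> O1 (D b)"
    "\<And>b \<epsilon>. b \<in> Basis \<Longrightarrow> \<epsilon> \<in> {0<..1} \<Longrightarrow> dbound l U k (D b \<epsilon>) (\<lambda>z. w \<epsilon> z * l b z) (dir_deriv b (f \<epsilon>))"
    unfolding estk_def by metis
  from assms(1) obtain C where C: "O1 C" "\<And>\<epsilon>. \<epsilon> \<in> {0<..1} \<Longrightarrow> dbound l U 0 (C \<epsilon>) (w \<epsilon>) (f \<epsilon>)"
    unfolding estk_def by blast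
  define E where "E \<epsilon> = C \<epsilon> + (\<Sum>b\<in>Basis. D b \<epsilon>)" for \<epsilon>
  have E: "O1 E" unfolding E_def by (rule O1_add[OF C(1) O1_sum[OF D(1)]])
  have CE: "C \<epsilon> \<le> E \<epsilon>" for \<epsilon> by (simp add: E_def sum_nonneg O1_nonneg[OF D(1)])
  have DE: "D b \<epsilon> \<le> E \<epsilon>" if "b \<in> Basis" for b \<epsilon>
  proof -
    have "D b \<epsilon> \<le> (\<Sum>b\<in>Basis. D b \<epsilon>)"
      using that by (intro member_le_sum) (auto simp: O1_nonneg[OF D(1)])
    then show ?thesis by (simp add: E_def O1_nonneg[OF C(1)] add_increasing)
  qed
  have "dbound l U (Suc k) (E \<epsilon>) (w \<epsilon>) (f \<epsilon>)" if \<epsilon>: "\<epsilon> \<in> {0<..1}" for \<epsilon>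
  proof -
    have "norm (f \<epsilon> z) \<le> E \<epsilon> * w \<epsilon> z" if "z \<in> U" for z
      by (rule order_trans[OF dbound_0[OF C(2)[OF \<epsilon>] that] mult_right_mono[OF CE assms(4)[OF \<epsilon> that]]])
    moreover have "dbound l U k (E \<epsilon>) (\<lambda>z. w \<epsilon> z * l b z) (dir_deriv b (f \<epsilon>))" if "b \<in> Basis" for b
      by (rule dbound_mono[OF D(2)[OF that \<epsilon>]])
        (use DE[OF that] assms(3) assms(4)[OF \<epsilon>] in \<open>auto intro!: mult_right_mono\<close>)
    ultimately show ?thesis using assms(2) \<epsilon> by auto
  qed
  then show ?thesis unfolding estk_def using E by blast
qed

lemma estk_differentiable:
  "estk (Suc k) l U w f \<Longrightarrow> \<epsilon> \<in> {0<..1} \<Longrightarrow> z \<in> U \<Longrightarrow> f \<epsilon> differentiable (at z)"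
  unfolding estk_def by auto

text \<open>A function bounded, with its derivatives, relative to its own modulus has an inverse
  with the same property: in \<open>- f' / f^2\<close> the weights \<open>norm f\<close> and
  \<open>1 / (norm f)^2\<close> combine to \<open>1 / norm f\<close>. This is how hypothesis (iii)
  passes from \<open>P\<close> to \<open>1 / P\<close>.\<close>

lemma estk_inverse:
  assumes "open U" "\<And>k. estk k l U (\<lambda>\<epsilon> z. norm (f \<epsilon> z)) f" "\<And>b z. 0 \<le> l b z"
    "\<And>\<epsilon> z. \<epsilon> \<in> {0<..1} \<Longrightarrow> z \<in> U \<Longrightarrow> f \<epsilon> z \<noteq> 0"
  shows "estk k l U (\<lambda>\<epsilon> z. inverse (norm (f \<epsilon> z))) (\<lambda>\<epsilon> z. inverse (f \<epsilon> z))"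
proof (induction k)
  case 0
  show ?case by (rule estk_0I[of "\<lambda>_. 1"]) (auto simp: norm_inverse O1_const)
next
  case (Suc k)
  show ?case
  proof (rule estk_SucI[OF _ _ assms(3)])
    show "estk 0 l U (\<lambda>\<epsilon> z. inverse (norm (f \<epsilon> z))) (\<lambda>\<epsilon> z. inverse (f \<epsilon> z))"
      by (rule estk_0I[of "\<lambda>_. 1"]) (auto simp: norm_inverse O1_const)
    show "(\<lambda>z. inverse (f \<epsilon> z)) differentiable (at z)" if "\<epsilon> \<in> {0<..1}" "z \<in> U" for \<epsilon> z
      using dir_deriv_inverse(1) estk_differentiable[OF assms(2)] that assms(4) by blast
    show "estk k l U (\<lambda>\<epsilon> z. inverse (norm (f \<epsilon> z)) * l b z) (\<lambda>\<epsilon>. dir_deriv b (\<lambda>z. inverse (f \<epsilon> z)))"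
      if b: "b \<in> Basis" for b
    proof (rule estk_cong[OF estk_cmult[OF assms(1), of k l _ _ "-1"] assms(1)])
      show "estk k l U (\<lambda>\<epsilon> z. inverse (norm (f \<epsilon> z)) * inverse (norm (f \<epsilon> z)) * (norm (f \<epsilon> z) * l b z))
        (\<lambda>\<epsilon> z. inverse (f \<epsilon> z) * inverse (f \<epsilon> z) * dir_deriv b (f \<epsilon>) z)"
        by (intro estk_mult assms(1) Suc.IH estk_deriv[OF assms(2) b])
    next
      fix \<epsilon> :: real and z assume *: "\<epsilon> \<in> {0<..1}" "z \<in> U"
      show "- 1 * (inverse (f \<epsilon> z) * inverse (f \<epsilon> z) * dir_deriv b (f \<epsilon>) z) = dir_deriv b (\<lambda>z. inverse (f \<epsilon> z)) z"
        using dir_deriv_inverse(2)[OF estk_differentiable[OF assms(2)] assms(4)] * by simp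
      show "inverse (norm (f \<epsilon> z)) * inverse (norm (f \<epsilon> z)) * (norm (f \<epsilon> z) * l b z) = inverse (norm (f \<epsilon> z)) * l b z"
        using assms(4)[OF *] by simp
    qed
  qed auto
qed

lemma est_cong:
  "est l U w f \<Longrightarrow> open U \<Longrightarrow> (\<And>\<epsilon> z. \<epsilon> \<in> {0<..1} \<Longrightarrow> z \<in> U \<Longrightarrow> f \<epsilon> z = g \<epsilon> z) \<Longrightarrow>
    (\<And>\<epsilon> z. \<epsilon> \<in> {0<..1} \<Longrightarrow> z \<in> U \<Longrightarrow> w \<epsilon> z = w' \<epsilon> z) \<Longrightarrow> est l U w' g"
  unfolding est_def using estk_cong[of _ l U w f g w'] by blast

lemma est_mono:
  assumes "est l U w f" "\<And>b z. 0 \<le> l b z" "0 \<le> c"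
    "\<And>\<epsilon> z. \<epsilon> \<in> {0<..1} \<Longrightarrow> z \<in> U \<Longrightarrow> w \<epsilon> z \<le> c * w' \<epsilon> z"
  shows "est l U w' f"
  using assms(1) estk_mono[of _ l U w f c w', OF _ assms(2-4)] unfolding est_def by blast

lemma est_add:
  "open U \<Longrightarrow> est l U w f \<Longrightarrow> est l U w g \<Longrightarrow> est l U w (\<lambda>\<epsilon> z. f \<epsilon> z + g \<epsilon> z)"
  unfolding est_def using estk_add by blast

lemma est_mult:
  "open U \<Longrightarrow> est l U w f \<Longrightarrow> est l U w' g \<Longrightarrow> est l U (\<lambda>\<epsilon> z. w \<epsilon> z * w' \<epsilon> z) (\<lambda>\<epsilon> z. f \<epsilon> z * g \<epsilon> z)"
  unfolding est_def using estk_mult by blast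

lemma est_cmult: "open U \<Longrightarrow> est l U w f \<Longrightarrow> est l U w (\<lambda>\<epsilon> z. c * f \<epsilon> z)"
  unfolding est_def using estk_cmult by blast

lemma est_const:
  assumes "\<And>b z. 0 \<le> l b z" "\<And>\<epsilon> z. \<epsilon> \<in> {0<..1} \<Longrightarrow> z \<in> U \<Longrightarrow> norm (c \<epsilon>) \<le> w \<epsilon> z"
  shows "est l U w (\<lambda>\<epsilon> z. c \<epsilon>)"
  unfolding est_def by (intro allI estk_const assms)

lemma est_sum:
  assumes "open U" "\<And>i. i \<in> I \<Longrightarrow> est l U w (f i)" "\<And>b z. 0 \<le> l b z"
    "\<And>\<epsilon> z. \<epsilon> \<in> {0<..1} \<Longrightarrow> z \<in> U \<Longrightarrow> 0 \<le> w \<epsilon> z"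
  shows "est l U w (\<lambda>\<epsilon> z. \<Sum>i\<in>I. f i \<epsilon> z)"
  using assms(2)
  by (induction I rule: infinite_finite_induct)
    (auto intro!: est_add assms(1) est_const assms(3,4))

lemma est_deriv:
  "est l U w f \<Longrightarrow> b \<in> Basis \<Longrightarrow> est l U (\<lambda>\<epsilon> z. w \<epsilon> z * l b z) (\<lambda>\<epsilon>. dir_deriv b (f \<epsilon>))"
  unfolding est_def using estk_deriv by blast

lemma est_inverse:
  assumes "open U" "est l U (\<lambda>\<epsilon> z. norm (f \<epsilon> z)) f" "\<And>b z. 0 \<le> l b z"
    "\<And>\<epsilon> z. \<epsilon> \<in> {0<..1} \<Longrightarrow> z \<in> U \<Longrightarrow> f \<epsilon> z \<noteq> 0"
  shows "est l U (\<lambda>\<epsilon> z. inverse (norm (f \<epsilon> z))) (\<lambda>\<epsilon> z. inverse (f \<epsilon> z))"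
  using assms(2) estk_inverse[of U l f, OF assms(1) _ assms(3,4)] unfolding est_def by blast

lemma est_smooth: "est l U w f \<Longrightarrow> \<epsilon> \<in> {0<..1} \<Longrightarrow> smooth_on U (f \<epsilon>)"
  by (rule smooth_on_dbound[of l]) (metis est_def estk_def)

lemma est_subset: "est l U w f \<Longrightarrow> V \<subseteq> U \<Longrightarrow> est l V w f"
  unfolding est_def estk_def using dbound_subset[of l U _ _ _ _ V] by blast

lemma est_one:
  assumes "est lam U w f" "\<And>\<epsilon> z. \<epsilon> \<in> {0<..1} \<Longrightarrow> 0 \<le> w \<epsilon> z"
  shows "est (\<lambda>_ _. 1) U w f"
  unfolding est_def
proof
  fix k
  obtain C where C: "O1 C" "\<And>\<epsilon>. \<epsilon> \<in> {0<..1} \<Longrightarrow> dbound lam U k (C \<epsilon>) (w \<epsilon>) (f \<epsilon>)"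
    using estD[OF assms(1)] unfolding estk_def by blast
  have "dbound (\<lambda>_ _. 1) U k (C \<epsilon>) (w \<epsilon>) (f \<epsilon>)" if "\<epsilon> \<in> {0<..1}" for \<epsilon>
    by (rule dbound_mono_dir[OF C(2)[OF that]])
      (auto simp: lam_le_1 O1_nonneg[OF C(1)] assms(2)[OF that])
  with C(1) show "estk k (\<lambda>_ _. 1) U w f" unfolding estk_def by blast
qed

text \<open>If the bounds hold for one order of the partial derivatives they hold for all, since mixed
  partial derivatives of smooth functions commute.\<close>

lemma est_of_mderiv:
  fixes f :: "((real ^ 'n::finite) \<times> (real ^ 'n) \<Rightarrow> complex) net"
  assumes "open U" "\<And>\<epsilon>. \<epsilon> \<in> {0<..1} \<Longrightarrow> smooth_on U (f \<epsilon>)"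
    "\<And>\<alpha> \<beta>. \<exists>C. O1 C \<and> (\<forall>\<epsilon>\<in>{0<..1}. \<forall>z\<in>U. norm (pd_xi \<alpha> (pd_x \<beta> (f \<epsilon>)) z)
       \<le> C \<epsilon> * (w \<epsilon> z * jbracket (snd z) powr (- real (mlen \<alpha>))))"
    "\<And>\<epsilon> z. \<epsilon> \<in> {0<..1} \<Longrightarrow> z \<in> U \<Longrightarrow> 0 \<le> w \<epsilon> z"
  shows "est lam U w f"
  unfolding est_def
proof
  fix k
  define Ls where "Ls = {vs::((real ^ 'n) \<times> (real ^ 'n)) list. set vs \<subseteq> Basis \<and> length vs \<le> k}"
  have fin: "finite Ls" unfolding Ls_def by (rule finite_lists_length_le) simp
  have "\<exists>C. O1 C \<and> (\<forall>\<epsilon>\<in>{0<..1}. \<forall>z\<in>U. norm (foldr dir_deriv vs (f \<epsilon>) z)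
       \<le> C \<epsilon> * (w \<epsilon> z * prod_list (map (\<lambda>b. lam b z) vs)))" if "vs \<in> Ls" for vs
  proof -
    have "set vs \<subseteq> Basis" using that by (auto simp: Ls_def)
    then obtain \<alpha> \<beta> where ms: "mset vs = mset (mlist (\<lambda>i. (0, axis i 1)) \<alpha> @ mlist (\<lambda>i. (axis i 1, 0)) \<beta>)"
      by (rule mset_mlist_pair)
    \<comment> \<open>The product of the gains depends only on the multiset of directions, so it may
      be evaluated on the ordered list.\<close>
    have pl: "prod_list (map (\<lambda>b. lam b z) vs) = jbracket (snd z) powr (- real (mlen \<alpha>))" for z
      unfolding prod_list_lam[symmetric, of _ _ \<beta>]
      using arg_cong[OF ms, of "\<lambda>M. prod_mset (image_mset (\<lambda>b. lam b z) M)"]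
      by (simp only: mset_map[symmetric] prod_mset_prod_list)
    from assms(3)[of \<alpha> \<beta>] show ?thesis
      using foldr_dir_deriv_perm[OF assms(1,2) _ ms] by (auto simp: pl pd_xi_pd_x)
  qed
  then obtain C where C: "\<And>vs. vs \<in> Ls \<Longrightarrow> O1 (C vs)"
    "\<And>vs \<epsilon> z. vs \<in> Ls \<Longrightarrow> \<epsilon>\<in>{0<..1} \<Longrightarrow> z\<in>U \<Longrightarrow> norm (foldr dir_deriv vs (f \<epsilon>) z)
       \<le> C vs \<epsilon> * (w \<epsilon> z * prod_list (map (\<lambda>b. lam b z) vs))"
    by metis
  have "O1 (\<lambda>\<epsilon>. \<Sum>vs\<in>Ls. C vs \<epsilon>)" by (intro O1_sum C)
  moreover have "dbound lam U k (\<Sum>vs\<in>Ls. C vs \<epsilon>) (w \<epsilon>) (f \<epsilon>)" if \<epsilon>: "\<epsilon> \<in> {0<..1}" for \<epsilon>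
  proof (rule dbound_lists)
    show "diff_on k U (f \<epsilon>)" using assms(2)[OF \<epsilon>] by (simp add: smooth_on_diff_on)
    fix vs :: "((real ^ 'n) \<times> (real ^ 'n)) list" and z assume vs: "length vs \<le> k" "set vs \<subseteq> Basis" "z \<in> U"
    then have "vs \<in> Ls" by (simp add: Ls_def)
    note C(2)[OF this \<epsilon> vs(3)]
    also have "C vs \<epsilon> * (w \<epsilon> z * prod_list (map (\<lambda>b. lam b z) vs))
        \<le> (\<Sum>vs\<in>Ls. C vs \<epsilon>) * (w \<epsilon> z * prod_list (map (\<lambda>b. lam b z) vs))"
      using fin \<open>vs \<in> Ls\<close> C(1) assms(4)[OF \<epsilon> vs(3)]
      by (intro mult_right_mono member_le_sum mult_nonneg_nonneg prod_list_nonneg) (auto intro: O1_nonneg)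
    finally show "norm (foldr dir_deriv vs (f \<epsilon>) z) \<le> (\<Sum>vs\<in>Ls. C vs \<epsilon>) * (w \<epsilon> z * prod_list (map (\<lambda>b. lam b z) vs))" .
  qed
  ultimately show "estk k lam U w f" unfolding estk_def by blast
qed

section \<open>Passage between \<open>est\<close> and the symbol seminorms\<close>

lemma norm_pd_le:
  fixes f :: "(real ^ 'n::finite) \<times> (real ^ 'n) \<Rightarrow> complex"
  assumes "dbound l UNIV (mlen \<alpha> + mlen \<beta>) C w f"
  shows "norm (pd_xi \<alpha> (pd_x \<beta> f) z) \<le> C * (w z *
    prod_list (map (\<lambda>b. l b z) (mlist (\<lambda>i. (0, axis i 1)) \<alpha> @ mlist (\<lambda>i. (axis i 1, 0)) \<beta>)))"
  unfolding pd_xi_pd_x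
proof (rule dbound_foldr[OF assms])
  show "set (mlist (\<lambda>i. (0, axis i 1)) \<alpha> @ mlist (\<lambda>i. (axis i 1, 0)) \<beta>) \<subseteq> (Basis :: ((real ^ 'n) \<times> (real ^ 'n)) set)"
    using set_mlist[of "\<lambda>i. (0, axis i 1)" \<alpha>] set_mlist[of "\<lambda>i. (axis i 1, 0)" \<beta>]
    by (auto simp: Basis_pair_axis)
qed auto

lemma symb_weight_nonneg: "0 \<le> symb_weight m \<alpha> \<beta> a z"
  by (simp add: symb_weight_def)

lemma M_symb_aux:
  assumes "\<And>\<alpha> \<beta>. \<exists>C. O1 C \<and> (\<forall>\<epsilon>\<in>{0<..1}. \<forall>z. symb_weight m \<alpha> \<beta> (f \<epsilon>) z \<le> C \<epsilon> * \<epsilon> powr b)"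
    "\<And>\<epsilon>. \<epsilon> \<in> {0<..1} \<Longrightarrow> smooth_on UNIV (f \<epsilon>)"
  shows "\<epsilon> \<in> {0<..1} \<Longrightarrow> f \<epsilon> \<in> S_symb m"
    "(\<lambda>\<epsilon>. symb_seminorm m \<alpha> \<beta> (f \<epsilon>)) \<in> O[at_right 0](\<lambda>\<epsilon>. \<epsilon> powr b)"
proof -
  have bdd: "bdd_above (range (symb_weight m \<alpha> \<beta> (f \<epsilon>)))" if "\<epsilon> \<in> {0<..1}" for \<alpha> \<beta> \<epsilon>
  proof -
    obtain C where "\<And>z. symb_weight m \<alpha> \<beta> (f \<epsilon>) z \<le> C \<epsilon> * \<epsilon> powr b"
      using assms(1)[of \<alpha> \<beta>] \<open>\<epsilon> \<in> {0<..1}\<close> by blast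
    then show ?thesis by (rule bdd_aboveI2)
  qed
  then show "\<epsilon> \<in> {0<..1} \<Longrightarrow> f \<epsilon> \<in> S_symb m"
    using assms(2) by (auto simp: S_symb_def smooth_iff)
  obtain C where C: "O1 C" "\<And>\<epsilon> z. \<epsilon> \<in> {0<..1} \<Longrightarrow> symb_weight m \<alpha> \<beta> (f \<epsilon>) z \<le> C \<epsilon> * \<epsilon> powr b"
    using assms(1)[of \<alpha> \<beta>] by blast
  have "norm (symb_seminorm m \<alpha> \<beta> (f \<epsilon>)) \<le> norm (C \<epsilon> * \<epsilon> powr b)" if \<epsilon>: "\<epsilon> \<in> {0<..1}" for \<epsilon>
  proof -
    have "0 \<le> symb_seminorm m \<alpha> \<beta> (f \<epsilon>)"
      unfolding symb_seminorm_def
      by (rule order_trans[OF symb_weight_nonneg cSUP_upper[OF UNIV_I bdd[OF \<epsilon>]]])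
    moreover have "symb_seminorm m \<alpha> \<beta> (f \<epsilon>) \<le> C \<epsilon> * \<epsilon> powr b"
      unfolding symb_seminorm_def by (rule cSUP_least) (use C(2)[OF \<epsilon>] in auto)
    ultimately show ?thesis by auto
  qed
  then have "(\<lambda>\<epsilon>. symb_seminorm m \<alpha> \<beta> (f \<epsilon>)) \<in> O[at_right 0](\<lambda>\<epsilon>. C \<epsilon> * \<epsilon> powr b)"
    by (intro landau_o.big_mono eventually_at_rightI[of 0 1]) auto
  also have "(\<lambda>\<epsilon>. C \<epsilon> * \<epsilon> powr b) \<in> O[at_right 0](\<lambda>\<epsilon>. 1 * \<epsilon> powr b)"
    using C(1) by (intro landau_o.big.mult) (auto simp: O1_def)
  finally show "(\<lambda>\<epsilon>. symb_seminorm m \<alpha> \<beta> (f \<epsilon>)) \<in> O[at_right 0](\<lambda>\<epsilon>. \<epsilon> powr b)" by simp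
qed

lemma M_symb_est:
  assumes "est lam UNIV (\<lambda>\<epsilon> z. \<epsilon> powr b * jbracket (snd z) powr m) f"
  shows "f \<in> M_symb m b"
proof -
  have 1: "\<exists>C. O1 C \<and> (\<forall>\<epsilon>\<in>{0<..1}. \<forall>z. symb_weight m \<alpha> \<beta> (f \<epsilon>) z \<le> C \<epsilon> * \<epsilon> powr b)" for \<alpha> \<beta>
  proof -
    obtain C where C: "O1 C" "\<And>\<epsilon>. \<epsilon> \<in> {0<..1} \<Longrightarrow>
      dbound lam UNIV (mlen \<alpha> + mlen \<beta>) (C \<epsilon>) (\<lambda>z. \<epsilon> powr b * jbracket (snd z) powr m) (f \<epsilon>)"
      using estD[OF assms] unfolding estk_def by blast
    have "symb_weight m \<alpha> \<beta> (f \<epsilon>) z \<le> C \<epsilon> * \<epsilon> powr b" if "\<epsilon> \<in> {0<..1}" for \<epsilon> z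
    proof -
      have "symb_weight m \<alpha> \<beta> (f \<epsilon>) z \<le> jbracket (snd z) powr (- m + real (mlen \<alpha>)) *
        (C \<epsilon> * (\<epsilon> powr b * jbracket (snd z) powr m * jbracket (snd z) powr (- real (mlen \<alpha>))))"
        unfolding symb_weight_def using norm_pd_le[OF C(2)[OF that], of z, unfolded prod_list_lam]
        by (intro mult_left_mono) auto
      also have "\<dots> = C \<epsilon> * \<epsilon> powr b * (jbracket (snd z) powr (- m + real (mlen \<alpha>) + m + - real (mlen \<alpha>)))"
        by (simp only: powr_add mult_ac)
      finally show ?thesis by simp
    qed
    then show ?thesis using C(1) by blast
  qed
  note aux = M_symb_aux[OF 1 est_smooth[OF assms]]
  show "f \<in> M_symb m b" using aux by (auto simp: M_symb_def)
qed

text \<open>The decay that covariable derivatives ought to gain is bought by a larger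
  \<open>N\<close>, since every order is available. Hence bounds without gain suffice for order -
  \<infinity>.\<close>

lemma M_symb_minf_est:
  assumes "\<And>N. est (\<lambda>_ _. 1) UNIV (\<lambda>\<epsilon> z. \<epsilon> powr b * jbracket (snd z) powr (- real N)) f"
  shows "f \<in> M_symb_minf b"
proof -
  have 1: "\<exists>C. O1 C \<and> (\<forall>\<epsilon>\<in>{0<..1}. \<forall>z. symb_weight m \<alpha> \<beta> (f \<epsilon>) z \<le> C \<epsilon> * \<epsilon> powr b)" for m \<alpha> \<beta>
  proof -
    obtain N :: nat where N: "- m + real (mlen \<alpha>) \<le> real N" using real_arch_simple by blast
    obtain C where C: "O1 C" "\<And>\<epsilon>. \<epsilon> \<in> {0<..1} \<Longrightarrow>
      dbound (\<lambda>_ _. 1) UNIV (mlen \<alpha> + mlen \<beta>) (C \<epsilon>) (\<lambda>z. \<epsilon> powr b * jbracket (snd z) powr (- real N)) (f \<epsilon>)"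
      using estD[OF assms[of N]] unfolding estk_def by blast
    have "symb_weight m \<alpha> \<beta> (f \<epsilon>) z \<le> C \<epsilon> * \<epsilon> powr b" if "\<epsilon> \<in> {0<..1}" for \<epsilon> z
    proof -
      have "symb_weight m \<alpha> \<beta> (f \<epsilon>) z \<le> jbracket (snd z) powr real N *
        (C \<epsilon> * (\<epsilon> powr b * jbracket (snd z) powr (- real N)))"
        unfolding symb_weight_def using norm_pd_le[OF C(2)[OF that], of z] N
        by (intro mult_mono jbracket_powr_mono) (auto simp: map_mlist prod_list_mlist)
      also have "\<dots> = C \<epsilon> * \<epsilon> powr b"
        by (simp add: powr_minus field_simps)
      finally show ?thesis by simp
    qed
    then show ?thesis using C(1) by blast
  qed
  note aux = M_symb_aux[OF 1]
  have "smooth_on UNIV (f \<epsilon>)" if "\<epsilon> \<in> {0<..1}" for \<epsilon> using est_smooth[OF assms that] .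
  then show ?thesis using aux by (auto simp: M_symb_minf_def)
qed

lemma est_of_seminorm:
  assumes "\<And>\<epsilon>. \<epsilon> \<in> {0<..1} \<Longrightarrow> f \<epsilon> \<in> S_symb m"
    "\<And>\<alpha> \<beta>. (\<lambda>\<epsilon>. symb_seminorm m \<alpha> \<beta> (f \<epsilon>)) \<in> O[at_right 0](\<lambda>\<epsilon>. \<epsilon> powr b)"
  shows "est lam UNIV (\<lambda>\<epsilon> z. \<epsilon> powr b * jbracket (snd z) powr m) f"
proof (rule est_of_mderiv)
  fix \<alpha> \<beta> :: "'a mindex"
  \<comment> \<open>The seminorm divided by the expected power of \<epsilon>. The absolute value
    changes nothing on the unit interval and provides the nonnegativity in \<open>O1\<close>
    elsewhere.\<close>
  define C where "C \<epsilon> = \<bar>symb_seminorm m \<alpha> \<beta> (f \<epsilon>) * \<epsilon> powr (- b)\<bar>" for \<epsilon>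
  have "(\<lambda>\<epsilon>. symb_seminorm m \<alpha> \<beta> (f \<epsilon>) * \<epsilon> powr (- b)) \<in> O[at_right 0](\<lambda>\<epsilon>. \<epsilon> powr b * \<epsilon> powr (- b))"
    by (intro landau_o.big.mult assms(2)) auto
  also have "(\<lambda>\<epsilon>. \<epsilon> powr b * \<epsilon> powr (- b)) \<in> O[at_right (0::real)](\<lambda>_. 1)"
    by (intro landau_o.big_mono eventually_at_rightI[of 0 1]) (auto simp: powr_minus)
  finally have "O1 C" unfolding C_def by (rule O1_abs)
  moreover have "norm (pd_xi \<alpha> (pd_x \<beta> (f \<epsilon>)) z) \<le> C \<epsilon> * (\<epsilon> powr b * jbracket (snd z) powr m * jbracket (snd z) powr (- real (mlen \<alpha>)))"
    if \<epsilon>: "\<epsilon> \<in> {0<..1}" for \<epsilon> z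
  proof -
    have bdd: "bdd_above (range (symb_weight m \<alpha> \<beta> (f \<epsilon>)))"
      using assms(1)[OF \<epsilon>] by (simp add: S_symb_def)
    have s: "symb_weight m \<alpha> \<beta> (f \<epsilon>) z \<le> symb_seminorm m \<alpha> \<beta> (f \<epsilon>)"
      unfolding symb_seminorm_def by (rule cSUP_upper[OF UNIV_I bdd])
    then have "0 \<le> symb_seminorm m \<alpha> \<beta> (f \<epsilon>)" using symb_weight_nonneg order_trans by blast
    then have C: "C \<epsilon> * \<epsilon> powr b = symb_seminorm m \<alpha> \<beta> (f \<epsilon>)"
      using \<epsilon> by (simp add: C_def powr_minus abs_mult)
    have "norm (pd_xi \<alpha> (pd_x \<beta> (f \<epsilon>)) z) = symb_weight m \<alpha> \<beta> (f \<epsilon>) z * jbracket (snd z) powr (m - real (mlen \<alpha>))"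
      by (simp add: symb_weight_def powr_diff powr_minus powr_add field_simps)
    also have "\<dots> \<le> symb_seminorm m \<alpha> \<beta> (f \<epsilon>) * jbracket (snd z) powr (m - real (mlen \<alpha>))"
      by (intro mult_right_mono s) auto
    also have "\<dots> = C \<epsilon> * (\<epsilon> powr b * jbracket (snd z) powr m * jbracket (snd z) powr (- real (mlen \<alpha>)))"
      unfolding C[symmetric] by (simp add: powr_diff powr_minus field_simps)
    finally show ?thesis .
  qed
  ultimately show "\<exists>C. O1 C \<and> (\<forall>\<epsilon>\<in>{0<..1}. \<forall>z\<in>UNIV. norm (pd_xi \<alpha> (pd_x \<beta> (f \<epsilon>)) z)
       \<le> C \<epsilon> * (\<epsilon> powr b * jbracket (snd z) powr m * jbracket (snd z) powr (- real (mlen \<alpha>))))"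
    by blast
qed (use assms(1) in \<open>auto simp: S_symb_def smooth_iff\<close>)

section \<open>Partial Fourier transforms\<close>

lemma integrable_prod_Basis:
  fixes g :: "'a::euclidean_space \<Rightarrow> real \<Rightarrow> real"
  assumes "\<And>b. b \<in> Basis \<Longrightarrow> integrable lborel (g b)"
  shows "integrable lborel (\<lambda>x. \<Prod>b\<in>Basis. g b (x \<bullet> b))"
    "(LINT x|lborel. (\<Prod>b\<in>Basis. g b (x \<bullet> b))) = (\<Prod>b\<in>Basis. LINT t|lborel. g b t)"
proof -
  interpret product_sigma_finite "\<lambda>_::'a. lborel :: real measure" by standard
  let ?P = "\<Pi>\<^sub>M b\<in>Basis. (lborel :: real measure)"
  let ?T = "\<lambda>f. \<Sum>b\<in>Basis. f b *\<^sub>R b :: 'a"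
  have gm: "g b \<in> borel_measurable borel" if "b \<in> Basis" for b
    using borel_measurable_integrable[OF assms[OF that]] by simp
  have m: "(\<lambda>x. \<Prod>b\<in>Basis. g b (x \<bullet> b)) \<in> borel_measurable borel"
    by (intro borel_measurable_prod measurable_compose[OF _ gm]) auto
  have T: "?T \<in> measurable ?P borel" by measurable
  have eq: "(\<Prod>b\<in>Basis. g b (?T f \<bullet> b)) = (\<Prod>b\<in>Basis. g b (f b))" for f
    by (intro prod.cong refl) (simp add: inner_sum_left inner_Basis if_distrib sum.If_cases)
  have "integrable ?P (\<lambda>f. \<Prod>b\<in>Basis. g b (f b))"
    by (rule product_integrable_prod) (use assms in auto)
  then show "integrable lborel (\<lambda>x. \<Prod>b\<in>Basis. g b (x \<bullet> b))"
    by (subst lborel_eq, subst integrable_distr_eq[OF T m]) (simp only: eq)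
  show "(LINT x|lborel. (\<Prod>b\<in>Basis. g b (x \<bullet> b))) = (\<Prod>b\<in>Basis. LINT t|lborel. g b t)"
    by (subst lborel_eq, subst integral_distr[OF T m])
      (simp only: eq, rule product_integral_prod, use assms in auto)
qed

text \<open>The exponent \<open>2 * CARD('n)\<close> lies above the sharp threshold, but permits
  comparison with a product of one-dimensional functions \<open>1 / (1 + t^2)\<close>: each factor
  is at least the inverse square of \<open>jbracket \<xi>\<close>.\<close>

lemma integrable_jbracket:
  assumes "2 * real CARD('n) \<le> M"
  shows "integrable lborel (\<lambda>\<xi>::real^'n::finite. jbracket \<xi> powr (- M))"
proof (rule Bochner_Integration.integrable_bound)
  have "integrable lborel (\<lambda>t::real. inverse (1 + t\<^sup>2))"
    using integrable_inverse_1_plus_square by (simp add: set_integrable_def)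
  then show "integrable lborel (\<lambda>\<xi>::real^'n. \<Prod>b\<in>Basis. inverse (1 + (\<xi> \<bullet> b)\<^sup>2))"
    using integrable_prod_Basis(1)[of "\<lambda>b t. inverse (1 + t\<^sup>2)"] by simp
  show "(\<lambda>\<xi>::real^'n. jbracket \<xi> powr (- M)) \<in> borel_measurable lborel"
    by (simp, intro borel_measurable_continuous_onI continuous_intros) auto
  have "jbracket \<xi> powr (- M) \<le> (\<Prod>b\<in>Basis. inverse (1 + (\<xi> \<bullet> b)\<^sup>2))" for \<xi> :: "real^'n"
  proof -
    have "jbracket \<xi> powr (- M) \<le> jbracket \<xi> powr (- real (2 * CARD('n)))"
      using assms by (intro jbracket_powr_mono) auto
    also have "\<dots> = (\<Prod>b\<in>(Basis::(real^'n) set). inverse ((jbracket \<xi>)\<^sup>2))"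
      by (subst powr_minus, subst powr_realpow) (auto simp: power_mult power_inverse)
    also have "\<dots> \<le> (\<Prod>b\<in>Basis. inverse (1 + (\<xi> \<bullet> b)\<^sup>2))"
    proof (intro prod_mono conjI)
      fix b :: "real^'n" assume "b \<in> Basis"
      then have "(\<xi> \<bullet> b)\<^sup>2 \<le> (norm \<xi>)\<^sup>2" using Basis_le_norm[of b \<xi>] by (metis abs_ge_zero power2_abs power_mono)
      then show "inverse ((jbracket \<xi>)\<^sup>2) \<le> inverse (1 + (\<xi> \<bullet> b)\<^sup>2)"
        unfolding jbracket_sq by (intro le_imp_inverse_le) (auto simp: add_pos_nonneg)
    qed auto
    finally show ?thesis .
  qed
  then show "AE \<xi> in lborel. norm (jbracket \<xi> powr (- M)) \<le> norm (\<Prod>b\<in>Basis. inverse (1 + ((\<xi>::real^'n) \<bullet> b)\<^sup>2))"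
    by (auto simp: prod_nonneg)
qed

section \<open>Differentiation under the integral sign\<close>

lemma norm_diff_le_of_dir_deriv:
  fixes f :: "'a::euclidean_space \<Rightarrow> complex"
  assumes "\<And>z. z \<in> S \<Longrightarrow> f differentiable (at z)" "convex S" "x \<in> S" "y \<in> S"
    "\<And>z b. z \<in> S \<Longrightarrow> b \<in> Basis \<Longrightarrow> norm (dir_deriv b f z) \<le> K"
  shows "norm (f x - f y) \<le> real DIM('a) * K * norm (x - y)"
proof (rule differentiable_bound[OF assms(2)])
  fix z assume z: "z \<in> S"
  show "(f has_derivative frechet_derivative f (at z)) (at z within S)"
    using assms(1)[OF z] by (simp add: frechet_derivative_works has_derivative_at_withinI)
  show "onorm (frechet_derivative f (at z)) \<le> real DIM('a) * K"
  proof (rule onorm_le)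
    fix v
    have "norm (frechet_derivative f (at z) v) = norm (\<Sum>b\<in>Basis. complex_of_real (v \<bullet> b) * dir_deriv b f z)"
      using dir_deriv_expand[OF assms(1)[OF z], of v] dir_deriv_frechet[OF assms(1)[OF z], of v] by simp
    also have "\<dots> \<le> (\<Sum>b\<in>(Basis::'a set). norm v * K)"
      using assms(5)[OF z] by (intro sum_norm_le) (auto simp: norm_mult Basis_le_norm intro!: mult_mono)
    finally show "norm (frechet_derivative f (at z) v) \<le> real DIM('a) * K * norm v" by (simp add: mult_ac)
  qed
qed (use assms in auto)

text \<open>Exhibits the derivative as a limit of difference quotients along a sequence, from which
  its measurability in a parameter follows.\<close>

lemma dir_deriv_LIMSEQ:
  fixes f :: "'a::euclidean_space \<Rightarrow> complex"
  assumes "f differentiable (at x)"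
  shows "(\<lambda>n. (f (x + inverse (real (Suc n)) *\<^sub>R v) - f x) / complex_of_real (inverse (real (Suc n)))) \<longlonglongrightarrow> dir_deriv v f x"
proof (cases "v = 0")
  case False
  obtain f' where f': "(f has_derivative f') (at x)" using assms by (auto simp: differentiable_def)
  have lin: "linear f'" using f' by (rule has_derivative_linear)
  define h where "h n = inverse (real (Suc n))" for n
  have h: "h n > 0" for n by (simp add: h_def)
  have hlim: "h \<longlonglongrightarrow> 0" unfolding h_def by (rule LIMSEQ_inverse_real_of_nat)
  have "(\<lambda>n. x + h n *\<^sub>R v) \<longlonglongrightarrow> x + 0 *\<^sub>R v" by (intro tendsto_intros hlim)
  then have "filterlim (\<lambda>n. x + h n *\<^sub>R v) (at x) sequentially"
    unfolding filterlim_at using h False by (auto intro!: always_eventually simp: less_imp_neq[symmetric])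
  moreover have "((\<lambda>y. norm (f y - f x - f' (y - x)) / norm (y - x)) \<longlongrightarrow> 0) (at x)"
    using f' by (simp add: has_derivative_iff_norm)
  ultimately have "(\<lambda>n. norm (f (x + h n *\<^sub>R v) - f x - f' (h n *\<^sub>R v)) / norm (h n *\<^sub>R v)) \<longlonglongrightarrow> 0"
    using filterlim_compose[of _ "nhds 0" "at x" "\<lambda>n. x + h n *\<^sub>R v" sequentially] by fastforce
  from tendsto_mult_left[OF this, of "norm v"]
  have lim: "(\<lambda>n. norm v * (norm (f (x + h n *\<^sub>R v) - f x - f' (h n *\<^sub>R v)) / norm (h n *\<^sub>R v))) \<longlonglongrightarrow> 0"
    by simp
  have "norm v * (norm (f (x + h n *\<^sub>R v) - f x - f' (h n *\<^sub>R v)) / norm (h n *\<^sub>R v))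
     = norm ((f (x + h n *\<^sub>R v) - f x) / complex_of_real (h n) - f' v)" for n
  proof -
    have "(f (x + h n *\<^sub>R v) - f x) / complex_of_real (h n) - f' v = (f (x + h n *\<^sub>R v) - f x - f' (h n *\<^sub>R v)) / complex_of_real (h n)"
      using h[of n] by (simp add: linear_cmul[OF lin] diff_divide_distrib scaleR_conv_of_real)
    then show ?thesis using h[of n] False by (simp add: norm_divide)
  qed
  with lim have "(\<lambda>n. norm ((f (x + h n *\<^sub>R v) - f x) / complex_of_real (h n) - f' v)) \<longlonglongrightarrow> 0"
    by simp
  then have "(\<lambda>n. (f (x + h n *\<^sub>R v) - f x) / complex_of_real (h n)) \<longlonglongrightarrow> f' v"
    using LIM_zero_iff tendsto_norm_zero_iff by blast
  then show ?thesis using dir_deriv_eq[OF f', of v] by (simp add: h_def)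
qed simp

text \<open>Dominated convergence for the normalised first-order remainder. Total differentiability
  is obtained, not only the existence of partial derivatives, so that the result can be iterated
  within \<open>dbound\<close>.\<close>

lemma has_derivative_integral:
  fixes g :: "'t::euclidean_space \<Rightarrow> 'a::euclidean_space \<Rightarrow> complex"
  assumes meas: "\<And>x. (\<lambda>t. g t x) \<in> borel_measurable lborel"
    and diff: "\<And>t x. g t differentiable (at x)"
    and bound: "\<And>t x b. b \<in> Basis \<Longrightarrow> norm (dir_deriv b (g t) x) \<le> H t * \<omega> x"
    and H: "integrable lborel H" "\<And>t. 0 \<le> H t"
    and int: "\<And>x. integrable lborel (\<lambda>t. g t x)"
    and \<omega>: "continuous_on UNIV \<omega>"
  shows "(\<lambda>t. dir_deriv v (g t) x) \<in> borel_measurable lborel"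
    "b \<in> Basis \<Longrightarrow> integrable lborel (\<lambda>t. dir_deriv b (g t) x)"
    "(\<lambda>x. LINT t|lborel. g t x) differentiable (at x)"
    "b \<in> Basis \<Longrightarrow> dir_deriv b (\<lambda>x. LINT t|lborel. g t x) x = (LINT t|lborel. dir_deriv b (g t) x)"
proof -
  show md: "(\<lambda>t. dir_deriv v (g t) x) \<in> borel_measurable lborel" for v
    by (rule borel_measurable_LIMSEQ_metric[OF _ dir_deriv_LIMSEQ[OF diff]])
      (use meas in simp)
  show intd: "integrable lborel (\<lambda>t. dir_deriv b (g t) x)" if "b \<in> Basis" for b
    by (rule Bochner_Integration.integrable_bound[of _ "\<lambda>t. H t * \<omega> x"])
      (use H md bound[OF that] in \<open>auto intro!: AE_I2 order_trans[OF _ abs_ge_self]\<close>)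
  define D where "D v = (\<Sum>b\<in>Basis. complex_of_real (v \<bullet> b) * (LINT t|lborel. dir_deriv b (g t) x))" for v
  have blD: "bounded_linear D"
    unfolding D_def
    by (intro bounded_linear_sum bounded_linear_mult_const bounded_linear_compose[OF bounded_linear_of_real]
        bounded_linear_inner_left)
  \<comment> \<open>The continuous weight is bounded on the unit ball about \<open>x\<close>; there
    \<open>g t\<close> is Lipschitz with a constant proportional to \<open>H t\<close>.\<close>
  obtain W where W: "\<And>y. y \<in> cball x 1 \<Longrightarrow> \<omega> y \<le> W"
  proof -
    have "compact (\<omega> ` cball x 1)"
      by (intro compact_continuous_image continuous_on_subset[OF \<omega>]) auto
    then have "bdd_above (\<omega> ` cball x 1)" by (simp add: bounded_imp_bdd_above compact_imp_bounded)
    then show ?thesis using that unfolding bdd_above_def by blast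
  qed
  let ?K = "real DIM('a)"
  have lip: "norm (g t y - g t x) \<le> ?K * (H t * W) * norm (y - x)" if "y \<in> cball x 1" for t y
  proof (rule norm_diff_le_of_dir_deriv[where S = "cball x 1"])
    show "norm (dir_deriv b (g t) z) \<le> H t * W" if "z \<in> cball x 1" "b \<in> Basis" for z b
      by (rule order_trans[OF bound[OF that(2)] mult_left_mono[OF W[OF that(1)] H(2)]])
  qed (use that diff in auto)
  have bd: "norm (dir_deriv v (g t) x) \<le> ?K * (H t * W) * norm v" for t v
  proof -
    have "norm (dir_deriv v (g t) x) = norm (\<Sum>b\<in>Basis. complex_of_real (v \<bullet> b) * dir_deriv b (g t) x)"
      by (simp only: dir_deriv_expand[OF diff, of v])
    also have "\<dots> \<le> (\<Sum>b\<in>(Basis::'a set). norm v * (H t * W))"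
    proof (intro sum_norm_le)
      fix b :: 'a assume b: "b \<in> Basis"
      have "norm (dir_deriv b (g t) x) \<le> H t * W"
        by (rule order_trans[OF bound[OF b] mult_left_mono[OF W H(2)]]) simp
      then show "norm (complex_of_real (v \<bullet> b) * dir_deriv b (g t) x) \<le> norm v * (H t * W)"
        using b by (auto simp: norm_mult Basis_le_norm intro!: mult_mono)
    qed
    finally show ?thesis by (simp add: mult_ac)
  qed
  \<comment> \<open>The normalised remainder: for fixed \<open>t\<close> it tends to 0 as
    \<open>y\<close> tends to \<open>x\<close>, and the Lipschitz bound together with the derivative
    bound dominates it by \<open>2 * ?K * (H t * W)\<close>.\<close>
  define Q where "Q y t = (g t y - g t x - dir_deriv (y - x) (g t) x) / complex_of_real (norm (y - x))" for y t
  have Qint: "(LINT t|lborel. Q y t) = ((LINT t|lborel. g t y) - (LINT t|lborel. g t x) - D (y - x)) / complex_of_real (norm (y - x))" for y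
  proof -
    have "(LINT t|lborel. g t y - g t x - dir_deriv (y - x) (g t) x) =
        (LINT t|lborel. g t y) - (LINT t|lborel. g t x) - (LINT t|lborel. (\<Sum>b\<in>Basis. complex_of_real ((y - x) \<bullet> b) * dir_deriv b (g t) x))"
      unfolding dir_deriv_expand[OF diff, of "y - x"]
      using intd int by (simp add: Bochner_Integration.integral_diff)
    also have "(LINT t|lborel. (\<Sum>b\<in>Basis. complex_of_real ((y - x) \<bullet> b) * dir_deriv b (g t) x)) = D (y - x)"
      unfolding D_def by (subst Bochner_Integration.integral_sum) (auto intro: intd)
    finally show ?thesis unfolding Q_def by simp
  qed
  have main: "((\<lambda>y. LINT t|lborel. Q y t) \<longlongrightarrow> 0) (at x)"
    unfolding tendsto_at_iff_sequentially
  proof (intro allI impI)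
    fix X :: "nat \<Rightarrow> 'a" assume X: "\<forall>i. X i \<in> UNIV - {x}" "X \<longlonglongrightarrow> x"
    \<comment> \<open>Domination holds only inside the unit ball, so an initial segment of the
      sequence is dropped.\<close>
    obtain N where N: "\<And>n. n \<ge> N \<Longrightarrow> dist (X n) x < 1" using X(2) by (meson LIMSEQ_D lim_sequentially zero_less_one)
    define Y where "Y n = X (n + N)" for n
    have Y: "Y n \<noteq> x" "Y n \<in> cball x 1" for n
      using X(1) N[of "n + N"] by (auto simp: Y_def dist_commute less_imp_le)
    have Ylim: "Y \<longlonglongrightarrow> x" unfolding Y_def by (rule LIMSEQ_ignore_initial_segment[OF X(2)])
    have "(\<lambda>n. LINT t|lborel. Q (Y n) t) \<longlonglongrightarrow> (LINT t|(lborel::'t measure). 0)"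
    proof (rule integral_dominated_convergence[where w = "\<lambda>t. 2 * ?K * (H t * W)"])
      show "(\<lambda>t. Q (Y n) t) \<in> borel_measurable lborel" for n
        unfolding Q_def using meas md by simp
      show "integrable lborel (\<lambda>t. 2 * ?K * (H t * W))" using H(1) by simp
      show "AE t in lborel. (\<lambda>n. Q (Y n) t) \<longlonglongrightarrow> 0"
      proof (rule AE_I2)
        fix t
        have "(g t has_derivative (\<lambda>v. dir_deriv v (g t) x)) (at x)"
          using diff[of t x] by (simp add: dir_deriv_frechet frechet_derivative_works)
        then have *: "((\<lambda>y. norm (g t y - g t x - dir_deriv (y - x) (g t) x) / norm (y - x)) \<longlongrightarrow> 0) (at x)"
          by (simp add: has_derivative_iff_norm)
        have "filterlim Y (at x) sequentially" unfolding filterlim_at using Ylim Y by auto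
        from filterlim_compose[OF * this]
        have "(\<lambda>n. norm (Q (Y n) t)) \<longlonglongrightarrow> 0" by (simp add: Q_def norm_divide)
        then show "(\<lambda>n. Q (Y n) t) \<longlonglongrightarrow> 0" by (simp add: tendsto_norm_zero_iff)
      qed
      show "AE t in lborel. norm (Q (Y n) t) \<le> 2 * ?K * (H t * W)" for n
      proof (rule AE_I2)
        fix t
        have "norm (g t (Y n) - g t x - dir_deriv (Y n - x) (g t) x) \<le> ?K * (H t * W) * norm (Y n - x) + ?K * (H t * W) * norm (Y n - x)"
          using lip[OF Y(2), of t n] bd[of "Y n - x" t] norm_triangle_ineq4 by (smt (verit))
        then show "norm (Q (Y n) t) \<le> 2 * ?K * (H t * W)"
          using Y(1)[of n] by (simp add: Q_def norm_divide divide_le_eq mult_ac)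
      qed
    qed auto
    then have "(\<lambda>n. LINT t|lborel. Q (X (n + N)) t) \<longlonglongrightarrow> 0" by (simp add: Y_def)
    then show "((\<lambda>y. LINT t|lborel. Q y t) \<circ> X) \<longlonglongrightarrow> 0"
      unfolding o_def by (rule LIMSEQ_offset)
  qed
  have "((\<lambda>x. LINT t|lborel. g t x) has_derivative D) (at x)"
    unfolding has_derivative_iff_norm
    using blD tendsto_norm_zero[OF main] by (simp add: Qint norm_divide)
  then show "(\<lambda>x. LINT t|lborel. g t x) differentiable (at x)"
    "b \<in> Basis \<Longrightarrow> dir_deriv b (\<lambda>x. LINT t|lborel. g t x) x = (LINT t|lborel. dir_deriv b (g t) x)"
    by (auto simp: differentiable_def dir_deriv_eq D_def inner_Basis if_distrib sum.If_cases
        if_distribR cong: if_cong)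
qed

lemma dbound_integral:
  fixes g :: "'t::euclidean_space \<Rightarrow> 'a::euclidean_space \<Rightarrow> complex"
  assumes "\<And>x. (\<lambda>t. g t x) \<in> borel_measurable lborel"
    "\<And>t. dbound (\<lambda>_ _. 1) UNIV k (H t) \<omega> (g t)"
    "integrable lborel H" "\<And>t. 0 \<le> H t" "continuous_on UNIV \<omega>"
  shows "integrable lborel (\<lambda>t. g t x)"
    "dbound (\<lambda>_ _. 1) UNIV k (LINT t|lborel. H t) \<omega> (\<lambda>x. LINT t|lborel. g t x)"
proof -
  have *: "integrable lborel (\<lambda>t. g t x) \<and> norm (LINT t|lborel. g t x) \<le> (LINT t|lborel. H t) * \<omega> x"
    if "\<And>x. (\<lambda>t. g t x) \<in> borel_measurable lborel" "\<And>t. norm (g t x) \<le> H t * \<omega> x" for g :: "'t \<Rightarrow> 'a \<Rightarrow> complex" and x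
  proof
    have nn: "0 \<le> H t * \<omega> x" for t using that(2)[of t] norm_ge_zero order_trans by blast
    show i: "integrable lborel (\<lambda>t. g t x)"
      by (rule Bochner_Integration.integrable_bound[of _ "\<lambda>t. H t * \<omega> x"])
        (use assms(3) that nn in auto)
    have "norm (LINT t|lborel. g t x) \<le> (LINT t|lborel. norm (g t x))" by simp
    also have "\<dots> \<le> (LINT t|lborel. H t * \<omega> x)"
      by (intro integral_mono) (use i assms(3) that(2) in auto)
    finally show "norm (LINT t|lborel. g t x) \<le> (LINT t|lborel. H t) * \<omega> x" by simp
  qed
  show "integrable lborel (\<lambda>t. g t x)" using *[of g x, OF assms(1) dbound_0[OF assms(2)]] by blast
  show "dbound (\<lambda>_ _. 1) UNIV k (LINT t|lborel. H t) \<omega> (\<lambda>x. LINT t|lborel. g t x)"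
    using assms(1,2)
  proof (induction k arbitrary: g)
    case 0
    then show ?case using *[of g] by simp
  next
    case (Suc k)
    have b0: "norm (g t x) \<le> H t * \<omega> x" for t x using dbound_0[OF Suc.prems(2)] by blast
    note d = dbound_SucD[OF Suc.prems(2)]
    have b1: "norm (dir_deriv b (g t) x) \<le> H t * \<omega> x" if "b \<in> Basis" for b t x
      using dbound_0[OF d(2)[OF that], of x t] by simp
    have int: "integrable lborel (\<lambda>t. g t x)" for x using *[of g x, OF Suc.prems(1) b0] by blast
    note D = has_derivative_integral[of g H \<omega>, OF Suc.prems(1) d(1)[OF UNIV_I] _ assms(3,4) int assms(5)]
    have "dbound (\<lambda>_ _. 1) UNIV k (LINT t|lborel. H t) (\<lambda>z. \<omega> z * 1) (dir_deriv b (\<lambda>x. LINT t|lborel. g t x))"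
      if b: "b \<in> Basis" for b
    proof -
      have "dir_deriv b (\<lambda>x. LINT t|lborel. g t x) = (\<lambda>x. LINT t|lborel. dir_deriv b (g t) x)"
        using D(4)[OF b1 b] by blast
      moreover have "dbound (\<lambda>_ _. 1) UNIV k (LINT t|lborel. H t) \<omega> (\<lambda>x. LINT t|lborel. dir_deriv b (g t) x)"
        by (rule Suc.IH) (use D(1)[OF b1] d(2)[OF b] in auto)
      ultimately show ?thesis by simp
    qed
    then show ?case using *[of g, OF Suc.prems(1) b0] D(3)[OF b1] by auto
  qed
qed

lemma dbound_slice:
  fixes f :: "'a::euclidean_space \<times> 'b::euclidean_space \<Rightarrow> complex"
  assumes "dbound (\<lambda>_ _. 1) UNIV k C w f"
  shows "dbound (\<lambda>_ _. 1) UNIV k C (\<lambda>x. w (x, y)) (\<lambda>x. f (x, y))"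
    "dbound (\<lambda>_ _. 1) UNIV k C (\<lambda>y. w (x, y)) (\<lambda>y. f (x, y))"
proof -
  have l: "linear (\<lambda>x::'a. (x, 0::'b))" "linear (\<lambda>y::'b. (0::'a, y))"
    by (auto intro!: linearI)
  show "dbound (\<lambda>_ _. 1) UNIV k C (\<lambda>x. w (x, y)) (\<lambda>x. f (x, y))"
    using assms
  proof (induction k arbitrary: w f)
    case (Suc k)
    have "dir_deriv b (\<lambda>x. f (x, y)) = (\<lambda>x. dir_deriv (b, 0) f (x, y))" for b
      using dir_deriv_affine[OF l(1), of b f "(0, y)"] by auto
    moreover have "(\<lambda>x. f (x, y)) differentiable (at x)" for x
      using diff_on_affine[OF diff_on_dbound[OF Suc.prems] l(1), of UNIV "(0, y)"]
      by (simp add: diff_on_Suc)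
    moreover have "dbound (\<lambda>_ _. 1) UNIV k C (\<lambda>x. w (x, y) * 1) (\<lambda>x. dir_deriv (b, 0) f (x, y))" if "b \<in> Basis" for b
      by (rule Suc.IH[OF dbound_SucD(2)[OF Suc.prems]]) (use that in \<open>simp add: Basis_prod_def\<close>)
    ultimately show ?case using dbound_0[OF Suc.prems] by auto
  qed simp
  show "dbound (\<lambda>_ _. 1) UNIV k C (\<lambda>y. w (x, y)) (\<lambda>y. f (x, y))"
    using assms
  proof (induction k arbitrary: w f)
    case (Suc k)
    have "dir_deriv b (\<lambda>y. f (x, y)) = (\<lambda>y. dir_deriv (0, b) f (x, y))" for b
      using dir_deriv_affine[OF l(2), of b f "(x, 0)"] by auto
    moreover have "(\<lambda>y. f (x, y)) differentiable (at y)" for y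
      using diff_on_affine[OF diff_on_dbound[OF Suc.prems] l(2), of UNIV "(x, 0)"]
      by (simp add: diff_on_Suc)
    moreover have "dbound (\<lambda>_ _. 1) UNIV k C (\<lambda>y. w (x, y) * 1) (\<lambda>y. dir_deriv (0, b) f (x, y))" if "b \<in> Basis" for b
      by (rule Suc.IH[OF dbound_SucD(2)[OF Suc.prems]]) (use that in \<open>simp add: Basis_prod_def\<close>)
    ultimately show ?case using dbound_0[OF Suc.prems] by auto
  qed simp
qed

lemma dbound_one_SucD:
  "dbound (\<lambda>_ _. 1) U (Suc k) C w f \<Longrightarrow> b \<in> Basis \<Longrightarrow> dbound (\<lambda>_ _. 1) U k C w (dir_deriv b f)"
  by simp

lemma Basis_0_pair: "b \<in> Basis \<Longrightarrow> (0, b) \<in> Basis" "b \<in> Basis \<Longrightarrow> (b, 0) \<in> Basis"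
  by (auto simp: Basis_prod_def)

lemma has_derivative_iexp:
  "((\<lambda>z. exp (\<i> * complex_of_real (z \<bullet> t))) has_derivative
    (\<lambda>v. complex_of_real (v \<bullet> t) * (\<i> * exp (\<i> * complex_of_real (z \<bullet> t))))) (at z)"
proof -
  have 1: "((\<lambda>z. \<i> * complex_of_real (z \<bullet> t)) has_derivative (\<lambda>v. \<i> * complex_of_real (v \<bullet> t))) (at z)"
    by (auto intro!: derivative_eq_intros)
  have 2: "(exp has_derivative (\<lambda>x. exp (\<i> * complex_of_real (z \<bullet> t)) * x)) (at (\<i> * complex_of_real (z \<bullet> t)))"
    using DERIV_exp unfolding has_field_derivative_def by blast
  show ?thesis using has_derivative_compose[OF 1 2] by (simp add: mult_ac)
qed

lemma dir_deriv_iexp: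
  "dir_deriv v (\<lambda>z. exp (\<i> * complex_of_real (z \<bullet> t))) = (\<lambda>z. (\<i> * complex_of_real (v \<bullet> t)) * exp (\<i> * complex_of_real (z \<bullet> t)))"
  using dir_deriv_eq[OF has_derivative_iexp] by (auto simp: mult_ac)

lemma dbound_iexp:
  "dbound (\<lambda>_ _. 1) UNIV k ((1 + norm t) ^ k) (\<lambda>_. 1) (\<lambda>z::'a::euclidean_space. exp (\<i> * complex_of_real (z \<bullet> t)))"
proof (induction k)
  case (Suc k)
  have "dbound (\<lambda>_ _. 1) UNIV k ((1 + norm t) ^ Suc k) (\<lambda>_. 1 * 1)
      (dir_deriv b (\<lambda>z::'a. exp (\<i> * complex_of_real (z \<bullet> t))))" if b: "b \<in> Basis" for b
  proof -
    have "\<bar>b \<bullet> t\<bar> \<le> 1 + norm t" using Basis_le_norm[OF b, of t] by (simp add: inner_commute)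
    from mult_right_mono[OF this, of "(1 + norm t) ^ k"]
    show ?thesis
      unfolding dir_deriv_iexp
      by (intro dbound_mono[OF dbound_const_mult[OF open_UNIV Suc.IH]]) (auto simp: norm_mult)
  qed
  moreover have "(\<lambda>z::'a. exp (\<i> * complex_of_real (z \<bullet> t))) differentiable (at z)" for z
    using has_derivative_iexp differentiable_def by blast
  ultimately show ?case by (auto simp: one_le_power simp del: power_Suc)
qed simp

lemma integral_lborel_shift:
  fixes f :: "'a::euclidean_space \<Rightarrow> complex"
  assumes "f \<in> borel_measurable borel"
  shows "(LINT x|lborel. f (x + v)) = (LINT x|lborel. f x)"
proof -
  have "(LINT x|lborel. f x) = (LINT x|distr lborel borel ((+) v). f x)"
    by (simp add: lborel_distr_plus)
  also have "\<dots> = (LINT x|lborel. f (v + x))" by (rule integral_distr) (use assms in auto)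
  finally show ?thesis by (simp add: add.commute)
qed

text \<open>Integration by parts, as the derivative of the translation invariance of the integral.\<close>

lemma integral_dir_deriv:
  fixes F :: "real ^ 'n::finite \<Rightarrow> complex"
  assumes F: "dbound (\<lambda>_ _. 1) UNIV 1 C (\<lambda>x. jbracket x powr (- M)) F" and M: "2 * real CARD('n) \<le> M"
    and b: "b \<in> Basis"
  shows "integrable lborel (dir_deriv b F)" "(LINT x|lborel. dir_deriv b F x) = 0"
proof -
  have M0: "0 \<le> M" using M by linarith
  have C: "0 \<le> C" using dbound_nonneg[OF F, of 0] by simp
  \<comment> \<open>Peetre's inequality separates the bound for \<open>F (x + v)\<close> into an
    integrable function of \<open>x\<close> and a continuous function of \<open>v\<close>, the shape
    demanded by \<open>has_derivative_integral\<close>.\<close>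
  let ?H = "\<lambda>x::real^'n. C * (2 powr M * jbracket x powr (- M))"
  let ?\<omega> = "\<lambda>v::real^'n. jbracket v powr M"
  have d: "F differentiable (at x)" for x using dbound_SucD(1)[of _ _ 0] F by auto
  have cont: "continuous_on UNIV F"
    using d by (simp add: continuous_on_eq_continuous_at differentiable_imp_continuous_within)
  then have meas: "F \<in> borel_measurable borel" by (rule borel_measurable_continuous_onI)
  have D: "dir_deriv b (\<lambda>v. F (x + v)) v = dir_deriv b F (x + v)" for x v b
    using dir_deriv_affine[OF linear_id, of b F x v] by (simp add: add.commute)
  have le: "C * jbracket (x + v) powr (- M) \<le> ?H x * ?\<omega> v" for x v
    using mult_left_mono[OF jbracket_peetre_powr[OF M0, of x v] C] by (simp add: mult_ac)
  have bd: "norm (dir_deriv b (\<lambda>v. F (x + v)) v) \<le> ?H x * ?\<omega> v" if "b \<in> Basis" for b x v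
  proof -
    have "norm (dir_deriv b F (x + v)) \<le> C * jbracket (x + v) powr (- M)" using F that by auto
    also note le
    finally show ?thesis by (simp add: D)
  qed
  have H: "integrable lborel ?H" "\<And>x. 0 \<le> ?H x"
    using integrable_jbracket[OF M] C by auto
  have int: "integrable lborel (\<lambda>x. F (x + v))" for v
  proof (rule Bochner_Integration.integrable_bound[of _ "\<lambda>x. ?H x * ?\<omega> v"])
    have "norm (F (x + v)) \<le> ?H x * ?\<omega> v" for x
      using dbound_0[OF F, of "x + v"] le[of x v] by simp
    then show "AE x in lborel. norm (F (x + v)) \<le> norm (?H x * ?\<omega> v)"
      by (auto intro!: AE_I2 intro: order_trans[OF _ abs_ge_self])
  qed (use H(1) meas in auto)
  have "(\<lambda>v. F (x + v)) differentiable (at v)" for x v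
  proof -
    have 1: "F differentiable (at (x + v))" by (rule d)
    have "(\<lambda>v. x + v) differentiable (at v)" by simp
    from differentiable_chain_at[OF this 1] show ?thesis by (simp add: o_def)
  qed
  note G = has_derivative_integral[of "\<lambda>x v. F (x + v)" ?H ?\<omega>, OF _ this bd H int]
  have m: "(\<lambda>x. F (x + v)) \<in> borel_measurable lborel" for v using meas by simp
  have c\<omega>: "continuous_on UNIV ?\<omega>" by (intro continuous_intros) auto
  have i: "integrable lborel (\<lambda>x. dir_deriv b (\<lambda>v. F (x + v)) 0)"
    by (rule G(2)) (use m c\<omega> b in auto)
  then show "integrable lborel (dir_deriv b F)" by (simp add: D)
  have "dir_deriv b (\<lambda>v. LINT x|lborel. F (x + v)) 0 = (LINT x|lborel. dir_deriv b (\<lambda>v. F (x + v)) 0)"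
    by (rule G(4)) (use m c\<omega> b in auto)
  moreover have "(\<lambda>v. LINT x|lborel. F (x + v)) = (\<lambda>v. LINT x|lborel. F x)"
    using integral_lborel_shift[OF meas] by blast
  ultimately show "(LINT x|lborel. dir_deriv b F x) = 0" by (simp add: D)
qed

text \<open>For a symbol \<open>g\<close>, \<open>ftr g (x, x - y)\<close> is up to a constant the integral kernel of its operator.\<close>

definition ftr :: "('w \<times> (real ^ 'n::finite) \<Rightarrow> complex) \<Rightarrow> 'w \<times> (real ^ 'n) \<Rightarrow> complex" where
  "ftr g p = (LINT \<eta>|lborel. exp (\<i> * complex_of_real (snd p \<bullet> \<eta>)) * g (fst p, \<eta>))"

text \<open>A bound for all weight integrals with exponent at least \<open>2 * CARD('n)\<close>, so
  that constants do not depend on the decay \<open>M\<close>.\<close>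

definition jint :: "'n::finite itself \<Rightarrow> real" where
  "jint _ = (LINT \<eta>|lborel. jbracket (\<eta>::real^'n) powr (- 2 * real CARD('n)))"

lemma jint_nonneg: "0 \<le> jint TYPE('n::finite)"
  by (simp add: jint_def)

lemma integral_jbracket_le:
  assumes "2 * real CARD('n) \<le> M"
  shows "(LINT \<eta>|lborel. jbracket (\<eta>::real^'n::finite) powr (- M)) \<le> jint TYPE('n)"
  unfolding jint_def using assms
  by (intro integral_mono integrable_jbracket jbracket_powr_mono)
    (auto intro: integrable_jbracket[of "2 * real CARD('n)", simplified])

text \<open>The constant \<open>C\<close> bounds only \<open>k\<close> derivatives and is kept
  explicit, so that all conclusions are linear in it; applied to nets, this preserves powers of
  \<epsilon>. The parameter \<open>w\<close> carries its own weight \<open>\<omega>\<close>, which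
  may grow.\<close>

locale ftr_bound =
  fixes g :: "'w::euclidean_space \<times> (real ^ 'n::finite) \<Rightarrow> complex" and C M :: real and \<omega> :: "'w \<Rightarrow> real" and k :: nat
  assumes smooth: "smooth_on UNIV g"
    and g: "dbound (\<lambda>_ _. 1) UNIV k C (\<lambda>p. \<omega> (fst p) * jbracket (snd p) powr (- M)) g"
    and C: "0 \<le> C" and M: "2 * real CARD('n) \<le> M"
    and \<omega>: "continuous_on UNIV \<omega>" "\<And>w. 0 \<le> \<omega> w"
begin

lemma continuous: "continuous_on UNIV g"
  by (rule smooth_on_continuous[OF smooth])

lemma meas: "(\<lambda>\<eta>. exp (\<i> * complex_of_real (z \<bullet> \<eta>)) * g (w, \<eta>)) \<in> borel_measurable lborel"
proof -
  have "continuous_on UNIV (\<lambda>\<eta>. g (w, \<eta>))"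
    by (rule continuous_on_compose2[OF continuous]) (auto intro!: continuous_intros)
  then show ?thesis
    by (simp, intro borel_measurable_continuous_onI continuous_intros)
qed

lemma slice:
  "dbound (\<lambda>_ _. 1) UNIV k (C * jbracket \<eta> powr (- M)) \<omega> (\<lambda>w. exp (\<i> * complex_of_real (z \<bullet> \<eta>)) * g (w, \<eta>))"
  using dbound_const_mult[OF open_UNIV dbound_slice(1)[OF g, of \<eta>], of "exp (\<i> * complex_of_real (z \<bullet> \<eta>))"]
  by (rule dbound_mono) (simp_all add: mult_ac)

lemma integrable: "integrable lborel (\<lambda>\<eta>. exp (\<i> * complex_of_real (z \<bullet> \<eta>)) * g (w, \<eta>))"
  using dbound_integral(1)[OF meas slice _ _ \<omega>(1)] integrable_jbracket[OF M] C by auto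

lemma ftr_slice: "dbound (\<lambda>_ _. 1) UNIV k (C * jint TYPE('n)) \<omega> (\<lambda>w. ftr g (w, z))"
proof -
  have "dbound (\<lambda>_ _. 1) UNIV k (LINT \<eta>|lborel. C * jbracket (\<eta>::real^'n) powr (- M)) \<omega> (\<lambda>w. ftr g (w, z))"
    unfolding ftr_def fst_conv snd_conv
    by (rule dbound_integral(2)[OF meas slice _ _ \<omega>(1)]) (use integrable_jbracket[OF M] C in auto)
  then show ?thesis
    by (rule dbound_mono) (use \<omega>(2) C integral_jbracket_le[OF M] in \<open>auto intro!: mult_right_mono mult_left_mono\<close>)
qed

text \<open>The derivative of the exponential times \<open>g\<close> integrates to zero, so a
  covariable derivative of \<open>g\<close> can be moved onto the exponential.\<close>

lemma ftr_dir_deriv: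
  assumes "1 \<le> k" "b \<in> Basis"
  shows "ftr (dir_deriv (0, b) g) (w, z) = - \<i> * complex_of_real (z \<bullet> b) * ftr g (w, z)"
proof -
  let ?e = "\<lambda>\<eta>::real^'n. exp (\<i> * complex_of_real (\<eta> \<bullet> z))"
  let ?F = "\<lambda>\<eta>. ?e \<eta> * g (w, \<eta>)"
  have g1: "dbound (\<lambda>_ _. 1) UNIV 1 C (\<lambda>p. \<omega> (fst p) * jbracket (snd p) powr (- M)) g"
    by (rule dbound_le[OF g assms(1)])
  have "dbound (\<lambda>_ _. 1) UNIV 1 (2 ^ 1 * ((1 + norm z) ^ 1 * C)) (\<lambda>\<eta>. 1 * (\<omega> w * jbracket \<eta> powr (- M))) ?F"
    using dbound_mult[OF open_UNIV dbound_iexp dbound_slice(2)[OF g1, of w]] by simp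
  then have F: "dbound (\<lambda>_ _. 1) UNIV 1 (2 ^ 1 * ((1 + norm z) ^ 1 * C) * \<omega> w) (\<lambda>\<eta>. jbracket \<eta> powr (- M)) ?F"
    by (rule dbound_mono) (auto simp: mult_ac)
  have l: "linear (\<lambda>y::real^'n. (0::'w, y))" by (auto intro!: linearI)
  have d: "dir_deriv b (\<lambda>\<eta>. g (w, \<eta>)) \<eta> = dir_deriv (0, b) g (w, \<eta>)" for \<eta>
    using dir_deriv_affine[OF l(1), of b g "(w, 0)" \<eta>] by auto
  have gd: "(\<lambda>\<eta>. g (w, \<eta>)) differentiable (at \<eta>)" for \<eta>
    using dbound_slice(2)[OF g1, of w] by auto
  have ed: "?e differentiable (at \<eta>)" for \<eta> using has_derivative_iexp differentiable_def by blast
  have D: "dir_deriv b ?F \<eta> = \<i> * complex_of_real (z \<bullet> b) * ?F \<eta> + ?e \<eta> * dir_deriv (0, b) g (w, \<eta>)" for \<eta>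
    unfolding dir_deriv_mult[OF ed gd] by (simp add: dir_deriv_iexp d inner_commute)
  have i1: "integrable lborel ?F" using integrable[of z w] by (simp add: inner_commute)
  have i2: "integrable lborel (dir_deriv b ?F)" and z: "(LINT \<eta>|lborel. dir_deriv b ?F \<eta>) = 0"
    using integral_dir_deriv[OF F M assms(2)] by auto
  have "integrable lborel (\<lambda>\<eta>. dir_deriv b ?F \<eta> - \<i> * complex_of_real (z \<bullet> b) * ?F \<eta>)"
    using i1 i2 by auto
  have "(LINT \<eta>|lborel. ?e \<eta> * dir_deriv (0, b) g (w, \<eta>)) = (LINT \<eta>|lborel. dir_deriv b ?F \<eta> - \<i> * complex_of_real (z \<bullet> b) * ?F \<eta>)"
    by (simp add: D)
  also have "\<dots> = - (\<i> * complex_of_real (z \<bullet> b)) * (LINT \<eta>|lborel. ?F \<eta>)"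
    by (subst Bochner_Integration.integral_diff) (use i1 i2 z in auto)
  finally show ?thesis by (simp add: ftr_def inner_commute)
qed

end

section \<open>Decay of the partial Fourier transform\<close>

text \<open>The operator 1 minus the Laplacian in the covariable; \<open>ftr\<close> turns it into
  multiplication by the square of \<open>jbracket z\<close>.\<close>

definition flap :: "('w::euclidean_space \<times> (real ^ 'n::finite) \<Rightarrow> complex) \<Rightarrow> 'w \<times> (real ^ 'n) \<Rightarrow> complex" where
  "flap g p = g p + (- 1) * (\<Sum>b\<in>Basis. dir_deriv (0, b) (dir_deriv (0, b) g) p)"

lemma smooth_on_flap:
  assumes "smooth_on UNIV g" shows "smooth_on UNIV (flap g)"
proof -
  have "diff_on k UNIV (\<lambda>p. g p + (- 1) * (\<Sum>b\<in>Basis. dir_deriv (0, b) (dir_deriv (0, b) g) p))" for k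
    by (intro diff_on_add diff_on_cmult diff_on_sum open_UNIV
        assms[unfolded smooth_on_diff_on, rule_format]
        smooth_on_dir_deriv[OF open_UNIV smooth_on_dir_deriv[OF open_UNIV assms], unfolded smooth_on_diff_on, rule_format])
  then show ?thesis unfolding smooth_on_diff_on flap_def[abs_def] by blast
qed

lemma dbound_flap:
  fixes g :: "'w::euclidean_space \<times> (real ^ 'n::finite) \<Rightarrow> complex"
  assumes "dbound (\<lambda>_ _. 1) UNIV (k + 2) C W g"
  shows "dbound (\<lambda>_ _. 1) UNIV k ((1 + real CARD('n)) * C) W (flap g)"
proof -
  have "dbound (\<lambda>_ _. 1) UNIV k C W (dir_deriv (0, b) (dir_deriv (0, b) g))" if "b \<in> Basis" for b
    using dbound_one_SucD[OF dbound_one_SucD Basis_0_pair(1)[OF that], OF _ Basis_0_pair(1)[OF that]] assms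
    by (simp add: numeral_2_eq_2 del: dbound.simps)
  then have "dbound (\<lambda>_ _. 1) UNIV k (\<Sum>b\<in>(Basis :: (real^'n) set). C) W (\<lambda>p. \<Sum>b\<in>Basis. dir_deriv (0, b) (dir_deriv (0, b) g) p)"
    by (intro dbound_sum) auto
  then have "dbound (\<lambda>_ _. 1) UNIV k (real CARD('n) * C) W (\<lambda>p. \<Sum>b\<in>Basis. dir_deriv (0, b) (dir_deriv (0, b) g) p)"
    by simp
  from dbound_add[OF open_UNIV dbound_le[OF assms, of k] dbound_const_mult[OF open_UNIV this, of "-1"]]
  show ?thesis unfolding flap_def[abs_def] by (simp add: algebra_simps)
qed

lemma flap_pow:
  fixes g :: "'w::euclidean_space \<times> (real ^ 'n::finite) \<Rightarrow> complex"
  assumes "dbound (\<lambda>_ _. 1) UNIV (k + 2 * N) C W g" "smooth_on UNIV g"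
  shows "dbound (\<lambda>_ _. 1) UNIV k ((1 + real CARD('n)) ^ N * C) W ((flap ^^ N) g)"
    "smooth_on UNIV ((flap ^^ N) g)"
proof -
  show "smooth_on UNIV ((flap ^^ N) g)" by (induction N) (auto intro: assms(2) smooth_on_flap)
  show "dbound (\<lambda>_ _. 1) UNIV k ((1 + real CARD('n)) ^ N * C) W ((flap ^^ N) g)"
    using assms(1)
  proof (induction N arbitrary: k)
    case (Suc N)
    have "dbound (\<lambda>_ _. 1) UNIV (k + 2) ((1 + real CARD('n)) ^ N * C) W ((flap ^^ N) g)"
      by (rule Suc.IH) (use Suc.prems in \<open>simp add: add_ac\<close>)
    from dbound_flap[OF this] show ?case by (simp add: mult_ac)
  qed simp
qed

lemma ftr_bound_flap:
  fixes g :: "'w::euclidean_space \<times> (real ^ 'n::finite) \<Rightarrow> complex"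
  assumes "ftr_bound g C M \<omega> (k + 2 * N)"
  shows "ftr_bound ((flap ^^ N) g) ((1 + real CARD('n)) ^ N * C) M \<omega> k"
proof -
  interpret ftr_bound g C M \<omega> "k + 2 * N" by (rule assms)
  show ?thesis by unfold_locales (use flap_pow[OF g smooth] C M \<omega> in auto)
qed

lemma ftr_flap1:
  fixes g :: "'w::euclidean_space \<times> (real ^ 'n::finite) \<Rightarrow> complex"
  assumes "ftr_bound g C M \<omega> 2"
  shows "ftr (flap g) (w, z) = complex_of_real ((jbracket z)\<^sup>2) * ftr g (w, z)"
proof -
  interpret ftr_bound g C M \<omega> 2 by (rule assms)
  have b1: "ftr_bound (dir_deriv (0, b) g) C M \<omega> 1" if "b \<in> Basis" for b
  proof unfold_locales
    show "dbound (\<lambda>_ _. 1) UNIV 1 C (\<lambda>p. \<omega> (fst p) * jbracket (snd p) powr - M) (dir_deriv (0, b) g)"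
      using dbound_one_SucD[OF _ Basis_0_pair(1)[OF that], of UNIV 1] g by (simp add: numeral_2_eq_2 del: dbound.simps)
  qed (use C M \<omega> smooth_on_dir_deriv[OF open_UNIV smooth] in auto)
  have b2: "ftr_bound (dir_deriv (0, b) (dir_deriv (0, b) g)) C M \<omega> 0" if b: "b \<in> Basis" for b
  proof -
    interpret b: ftr_bound "dir_deriv (0, b) g" C M \<omega> 1 by (rule b1[OF b])
    show ?thesis
    proof unfold_locales
      show "dbound (\<lambda>_ _. 1) UNIV 0 C (\<lambda>p. \<omega> (fst p) * jbracket (snd p) powr - M) (dir_deriv (0, b) (dir_deriv (0, b) g))"
        using dbound_one_SucD[OF _ Basis_0_pair(1)[OF b], of UNIV 0] b.g by (simp del: dbound.simps)
    qed (use C M \<omega> smooth_on_dir_deriv[OF open_UNIV b.smooth] in auto)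
  qed
  have ii: "\<i> * a * (\<i> * a * T) = - (a * a * T)" for a T
  proof -
    have "\<i> * a * (\<i> * a * T) = (\<i> * \<i>) * (a * a * T)" by (simp only: mult_ac)
    then show ?thesis by simp
  qed
  have f2: "ftr (dir_deriv (0, b) (dir_deriv (0, b) g)) (w, z) = - complex_of_real ((z \<bullet> b)\<^sup>2) * ftr g (w, z)"
    if b: "b \<in> Basis" for b
    unfolding ftr_bound.ftr_dir_deriv[OF b1[OF b] order_refl b] ftr_dir_deriv[OF one_le_numeral b]
    by (simp add: power2_eq_square ii)
  have "ftr (flap g) (w, z) = (LINT \<eta>|lborel. exp (\<i> * complex_of_real (z \<bullet> \<eta>)) * g (w, \<eta>)
      - (\<Sum>b\<in>Basis. exp (\<i> * complex_of_real (z \<bullet> \<eta>)) * dir_deriv (0, b) (dir_deriv (0, b) g) (w, \<eta>)))"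
    by (simp add: ftr_def flap_def algebra_simps sum_distrib_left sum_negf)
  also have "\<dots> = ftr g (w, z) - (\<Sum>b\<in>Basis. ftr (dir_deriv (0, b) (dir_deriv (0, b) g)) (w, z))"
    by (subst Bochner_Integration.integral_diff)
      (use integrable ftr_bound.integrable[OF b2] in
       \<open>auto simp: ftr_def Bochner_Integration.integral_sum intro!: Bochner_Integration.integrable_sum\<close>)
  also have "\<dots> = complex_of_real (1 + (\<Sum>b\<in>Basis. (z \<bullet> b)\<^sup>2)) * ftr g (w, z)"
    by (simp add: f2 sum_distrib_left sum_negf algebra_simps)
  also have "(\<Sum>b\<in>Basis. (z \<bullet> b)\<^sup>2) = (norm z)\<^sup>2"
    unfolding power2_norm_eq_inner
    by (subst euclidean_inner) (simp add: power2_eq_square)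
  finally show ?thesis by (simp add: jbracket_sq)
qed

lemma ftr_flap:
  fixes g :: "'w::euclidean_space \<times> (real ^ 'n::finite) \<Rightarrow> complex"
  assumes "ftr_bound g C M \<omega> (2 * N)"
  shows "ftr ((flap ^^ N) g) (w, z) = complex_of_real (jbracket z ^ (2 * N)) * ftr g (w, z)"
  using assms
proof (induction N)
  case (Suc N)
  have b: "ftr_bound ((flap ^^ N) g) ((1 + real CARD('n)) ^ N * C) M \<omega> 2"
    by (rule ftr_bound_flap) (use Suc.prems in \<open>simp add: add_ac\<close>)
  interpret S: ftr_bound g C M \<omega> "2 * Suc N" by (rule Suc.prems)
  have "ftr_bound g C M \<omega> (2 * N)"
    by unfold_locales (use S.smooth S.C S.M S.\<omega> dbound_le[OF S.g, of "2 * N"] in auto)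
  from Suc.IH[OF this] ftr_flap1[OF b, of w z] show ?case
    by (simp add: power_add power2_eq_square mult_ac)
qed simp

lemma dbound_weight_mono:
  assumes "dbound l UNIV k C w f" "\<And>z. w z \<le> w' z" "0 \<le> C" "\<And>b z. 0 \<le> l b z"
  shows "dbound l UNIV k C w' f"
  by (rule dbound_mono[OF assms(1)]) (use assms in \<open>auto intro!: mult_left_mono\<close>)

lemma dbound_const_mono:
  assumes "dbound l UNIV k C w f" "C \<le> C'" "\<And>z. 0 \<le> w z" "\<And>b z. 0 \<le> l b z"
  shows "dbound l UNIV k C' w f"
  by (rule dbound_mono[OF assms(1)]) (use assms in \<open>auto intro!: mult_right_mono\<close>)

lemma dbound_snd_inner:
  fixes b :: "real ^ 'n::finite"
  assumes b: "b \<in> Basis"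
  shows "dbound (\<lambda>_ _. 1) UNIV k 1 (\<lambda>p. jbracket (snd p))
    (\<lambda>p::'w::euclidean_space \<times> (real ^ 'n). complex_of_real (snd p \<bullet> b))"
proof -
  let ?L = "\<lambda>p::'w \<times> (real ^ 'n). complex_of_real (snd p \<bullet> b)"
  have bl: "bounded_linear ?L"
    by (intro bounded_linear_compose[OF bounded_linear_of_real] bounded_linear_compose[OF bounded_linear_inner_left] bounded_linear_snd)
  have 1: "\<bar>x \<bullet> b\<bar> \<le> jbracket x" for x
    using Basis_le_norm[OF b, of x] norm_le_jbracket[of x] by linarith
  have "norm (?L v) \<le> 1 * jbracket y" if "v \<in> Basis" for v y
  proof -
    have "\<bar>snd v \<bullet> b\<bar> \<le> norm (snd v)" using Basis_le_norm[OF b, of "snd v"] .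
    also have "\<dots> \<le> norm v" using norm_snd_le[of "snd v" "fst v"] by simp
    also have "\<dots> = 1" using that by simp
    finally show ?thesis using jbracket_ge1[of y] by simp
  qed
  then show ?thesis
    using dir_deriv_linear[OF bl] bounded_linear_imp_differentiable[OF bl] 1
    by (cases k) (auto intro!: dbound_const)
qed

lemma ftr_bound_times:
  fixes g :: "'w::euclidean_space \<times> (real ^ 'n::finite) \<Rightarrow> complex"
  assumes "ftr_bound g C M \<omega> k" "2 * real CARD('n) + 1 \<le> M" "b \<in> Basis"
  shows "ftr_bound (\<lambda>p. \<i> * complex_of_real (snd p \<bullet> b) * g p) (2 ^ k * C) (M - 1) \<omega> k"
proof -
  interpret ftr_bound g C M \<omega> k by (rule assms)
  have *: "dbound (\<lambda>_ _. 1) UNIV j 1 (\<lambda>p. jbracket (snd p))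
    (\<lambda>p::'w \<times> (real ^ 'n). \<i> * complex_of_real (snd p \<bullet> b))" for j
    using dbound_const_mult[OF open_UNIV dbound_snd_inner[OF assms(3)], of j \<i>] by simp
  show ?thesis
  proof unfold_locales
    show "smooth_on UNIV (\<lambda>p. \<i> * complex_of_real (snd p \<bullet> b) * g p)"
      using diff_on_mult[OF open_UNIV diff_on_dbound[OF *]] smooth unfolding smooth_on_diff_on by blast
    show "dbound (\<lambda>_ _. 1) UNIV k (2 ^ k * C) (\<lambda>p. \<omega> (fst p) * jbracket (snd p) powr - (M - 1))
      (\<lambda>p. \<i> * complex_of_real (snd p \<bullet> b) * g p)"
    proof (rule dbound_cong[OF open_UNIV dbound_mult[OF open_UNIV * g], unfolded mult_1])
      show "jbracket (snd z) * (\<omega> (fst z) * jbracket (snd z) powr - M) = \<omega> (fst z) * jbracket (snd z) powr - (M - 1)" for z :: "'w \<times> (real ^ 'n)"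
        by (simp add: powr_diff powr_minus divide_simps)
    qed simp
  qed (use assms C \<omega> in auto)
qed

context ftr_bound
begin

text \<open>Differentiation in the dual variable brings a factor \<eta> out of the exponential, so
  one power of decay beyond integrability is spent.\<close>

lemma ftr_derivative:
  assumes k: "1 \<le> k" and M1: "2 * real CARD('n) + 1 \<le> M"
  shows "ftr g differentiable (at p)"
    "b \<in> Basis \<Longrightarrow> dir_deriv (b, 0) (ftr g) p = ftr (dir_deriv (b, 0) g) p"
    "b' \<in> Basis \<Longrightarrow> dir_deriv (0, b') (ftr g) p = ftr (\<lambda>q. \<i> * complex_of_real (snd q \<bullet> b') * g q) p"
proof -
  let ?G = "\<lambda>(\<eta>::real^'n) (p::'w \<times> (real^'n)). exp (\<i> * complex_of_real (snd p \<bullet> \<eta>)) * g (fst p, \<eta>)"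
  let ?H = "\<lambda>\<eta>::real^'n. C * jbracket \<eta> powr (- (M - 1))"
  have g1: "dbound (\<lambda>_ _. 1) UNIV 1 C (\<lambda>p. \<omega> (fst p) * jbracket (snd p) powr (- M)) g"
    by (rule dbound_le[OF g k])
  have l: "linear (\<lambda>p::'w \<times> (real^'n). (fst p, 0::real^'n))" by (auto intro!: linearI)
  have d1: "dir_deriv v (\<lambda>p::'w \<times> (real^'n). g (fst p, \<eta>)) p = dir_deriv (fst v, 0) g (fst p, \<eta>)" for v p \<eta>
    using dir_deriv_affine[OF l, of v g "(0, \<eta>)" p] by simp
  have d2: "dir_deriv v (\<lambda>p::'w \<times> (real^'n). exp (\<i> * complex_of_real (snd p \<bullet> \<eta>))) p
      = \<i> * complex_of_real (snd v \<bullet> \<eta>) * exp (\<i> * complex_of_real (snd p \<bullet> \<eta>))" for v p \<eta>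
    using dir_deriv_affine[OF linear_snd, of v "\<lambda>z. exp (\<i> * complex_of_real (z \<bullet> \<eta>))" 0 p]
    by (simp add: dir_deriv_iexp)
  have f1: "(\<lambda>p::'w \<times> (real^'n). g (fst p, \<eta>)) differentiable (at p)" for p \<eta>
  proof -
    have "diff_on 1 UNIV (\<lambda>p::'w \<times> (real^'n). g (fst p, \<eta>))"
      using diff_on_affine[OF diff_on_dbound[OF g1] l, of UNIV "(0, \<eta>)"] by simp
    then show ?thesis unfolding One_nat_def diff_on_Suc by blast
  qed
  have f2: "(\<lambda>p::'w \<times> (real^'n). exp (\<i> * complex_of_real (snd p \<bullet> \<eta>))) differentiable (at p)" for p \<eta>
  proof -
    have "(\<lambda>z. exp (\<i> * complex_of_real (z \<bullet> \<eta>))) differentiable (at (snd p))"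
      using has_derivative_iexp differentiable_def by blast
    from differentiable_chain_at[OF linear_imp_differentiable[OF linear_snd] this] show ?thesis by (simp add: o_def)
  qed
  have dG: "dir_deriv v (?G \<eta>) p = \<i> * complex_of_real (snd v \<bullet> \<eta>) * ?G \<eta> p
      + exp (\<i> * complex_of_real (snd p \<bullet> \<eta>)) * dir_deriv (fst v, 0) g (fst p, \<eta>)" for v \<eta> p
    unfolding dir_deriv_mult[OF f2 f1] by (simp add: d1 d2)
  have J: "jbracket \<eta> powr - M \<le> jbracket \<eta> powr - (M - 1)" for \<eta> :: "real^'n"
    by (rule jbracket_powr_mono) simp
  have bd: "norm (dir_deriv v (?G \<eta>) p) \<le> ?H \<eta> * \<omega> (fst p)" if v: "v \<in> Basis" for v \<eta> p
  proof (cases "fst v = 0")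
    case True
    then have s: "snd v \<in> Basis" using v by (auto simp: Basis_prod_def)
    have "norm (dir_deriv v (?G \<eta>) p) = \<bar>snd v \<bullet> \<eta>\<bar> * norm (g (fst p, \<eta>))"
      using True by (simp add: dG norm_mult zero_prod_def[symmetric])
    also have "\<dots> \<le> jbracket \<eta> * (C * (\<omega> (fst p) * jbracket \<eta> powr - M))"
    proof (intro mult_mono)
      show "\<bar>snd v \<bullet> \<eta>\<bar> \<le> jbracket \<eta>"
        using Basis_le_norm[OF s, of \<eta>] norm_le_jbracket[of \<eta>] by (simp add: inner_commute)
    qed (use dbound_0[OF g, of "(fst p, \<eta>)"] in auto)
    also have "\<dots> = ?H \<eta> * \<omega> (fst p)" by (simp add: powr_diff powr_minus divide_simps)
    finally show ?thesis .
  next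
    case False
    then have s: "snd v = 0" "(fst v, 0) \<in> (Basis :: ('w \<times> (real^'n)) set)" using v by (auto simp: Basis_prod_def)
    have "norm (dir_deriv v (?G \<eta>) p) = norm (dir_deriv (fst v, 0) g (fst p, \<eta>))"
      using s by (simp add: dG norm_mult)
    also have "\<dots> \<le> C * (\<omega> (fst p) * jbracket \<eta> powr - M)"
      using g1 s(2) by auto
    also have "\<dots> \<le> C * (\<omega> (fst p) * jbracket \<eta> powr - (M - 1))"
      by (intro mult_left_mono J \<omega> C)
    finally show ?thesis by (simp add: mult_ac)
  qed
  have H: "integrable lborel ?H" "\<And>\<eta>. 0 \<le> ?H \<eta>"
    using integrable_jbracket[of "M - 1", where 'n='n] M1 C by auto
  have c\<omega>: "continuous_on UNIV (\<lambda>p::'w \<times> (real^'n). \<omega> (fst p))"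
    by (rule continuous_on_compose2[OF \<omega>(1)]) (auto intro!: continuous_intros)
  have diff: "?G \<eta> differentiable (at p)" for \<eta> p by (intro differentiable_mult f1 f2)
  note D = has_derivative_integral[of ?G ?H "\<lambda>p. \<omega> (fst p)", OF meas diff bd H integrable c\<omega>]
  show "ftr g differentiable (at p)" using D(3) by (simp add: ftr_def[abs_def])
  show "dir_deriv (b, 0) (ftr g) p = ftr (dir_deriv (b, 0) g) p" if "b \<in> Basis"
    using D(4)[of "(b, 0)" p] that by (simp add: ftr_def[abs_def] dG Basis_prod_def)
  show "dir_deriv (0, b') (ftr g) p = ftr (\<lambda>q. \<i> * complex_of_real (snd q \<bullet> b') * g q) p" if "b' \<in> Basis"
  proof -
    have "dir_deriv (0, b') (ftr g) p = (LINT \<eta>|lborel. dir_deriv (0, b') (?G \<eta>) p)"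
      using D(4)[OF _ Basis_0_pair(1)[OF that], of p] by (simp add: ftr_def[abs_def])
    also have "\<dots> = (LINT \<eta>|lborel. exp (\<i> * complex_of_real (snd p \<bullet> \<eta>)) * (\<i> * complex_of_real (\<eta> \<bullet> b') * g (fst p, \<eta>)))"
      unfolding dG by (simp add: zero_prod_def[symmetric] inner_commute mult_ac)
    finally show ?thesis by (simp add: ftr_def)
  qed
qed

text \<open>Apply \<open>flap\<close> \<open>N\<close> times and divide by its multiplier:
  \<open>2 * N\<close> derivatives of the integrand buy \<open>2 * N\<close> powers of
  decay.\<close>

lemma ftr_decay:
  assumes k: "2 * N \<le> k"
  shows "norm (ftr g (w, z)) \<le> ((1 + real CARD('n)) ^ N * jint TYPE('n)) * C * (\<omega> w * jbracket z powr (- 2 * real N))"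
proof -
  have b: "ftr_bound g C M \<omega> (0 + 2 * N)"
    by unfold_locales (use smooth C M \<omega> dbound_le[OF g k] in auto)
  interpret F: ftr_bound "(flap ^^ N) g" "(1 + real CARD('n)) ^ N * C" M \<omega> 0
    by (rule ftr_bound_flap[OF b])
  have "norm (ftr ((flap ^^ N) g) (w, z)) \<le> (1 + real CARD('n)) ^ N * C * jint TYPE('n) * \<omega> w"
    using dbound_0[OF F.ftr_slice[of z], of w] by simp
  then have *: "jbracket z ^ (2 * N) * norm (ftr g (w, z)) \<le> (1 + real CARD('n)) ^ N * C * jint TYPE('n) * \<omega> w"
    using ftr_flap[of g C M \<omega> N w z] b by (simp add: norm_mult norm_power)
  have "jbracket z powr (- 2 * real N) = inverse (jbracket z ^ (2 * N))"
    using powr_realpow[of "jbracket z" "2 * N"] by (simp add: powr_minus)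
  moreover have "norm (ftr g (w, z)) \<le> (1 + real CARD('n)) ^ N * C * jint TYPE('n) * \<omega> w / jbracket z ^ (2 * N)"
    using * by (simp add: pos_le_divide_eq mult.commute)
  ultimately show ?thesis by (simp only: divide_inverse mult_ac)
qed

end

text \<open>Joint bounds cost one order of decay per derivative (those in the dual variable produce
  factors \<open>\<eta>\<close>), and bounds on the slices do not.\<close>

lemma ftr_joint:
  "\<exists>c\<ge>0. \<forall>(g :: 'w::euclidean_space \<times> (real ^ 'n::finite) \<Rightarrow> complex) C M \<omega>.
    ftr_bound g C M \<omega> (k + 2 * N) \<longrightarrow> 2 * real CARD('n) + real k \<le> M \<longrightarrow>
      dbound (\<lambda>_ _. 1) UNIV k (c * C) (\<lambda>p. \<omega> (fst p) * jbracket (snd p) powr (- 2 * real N)) (ftr g)"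
proof (induction k)
  case 0
  have "0 \<le> (1 + real CARD('n)) ^ N * jint TYPE('n)" by (intro mult_nonneg_nonneg jint_nonneg) auto
  then show ?case
    by (intro exI[of _ "(1 + real CARD('n)) ^ N * jint TYPE('n)"])
      (use ftr_bound.ftr_decay[where k = "2 * N" and N = N] in fastforce)
next
  case (Suc k)
  then obtain c where c: "c \<ge> 0" and IH: "\<And>(g :: 'w \<times> (real ^ 'n) \<Rightarrow> complex) C M \<omega>.
      ftr_bound g C M \<omega> (k + 2 * N) \<Longrightarrow> 2 * real CARD('n) + real k \<le> M \<Longrightarrow>
      dbound (\<lambda>_ _. 1) UNIV k (c * C) (\<lambda>p. \<omega> (fst p) * jbracket (snd p) powr (- 2 * real N)) (ftr g)"
    by blast
  define c0 where "c0 = (1 + real CARD('n)) ^ N * jint TYPE('n)"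
  have c0: "0 \<le> c0" unfolding c0_def by (intro mult_nonneg_nonneg jint_nonneg) auto
  \<comment> \<open>\<open>c0\<close> covers the values, \<open>c\<close> the derivatives in the
    parameter, and \<open>c * 2 ^ (k + 2 * N)\<close> those in the dual variable, where the Leibniz
    constant of the product with a coordinate appears.\<close>
  define c' where "c' = c0 + c * 2 ^ (k + 2 * N)"
  have c1: "c0 \<le> c'" "c \<le> c'" "c * 2 ^ (k + 2 * N) \<le> c'" "0 \<le> c'"
    using c c0 mult_left_mono[OF one_le_power[of "2::real" "k + 2 * N"] c] by (auto simp: c'_def)
  have "dbound (\<lambda>_ _. 1) UNIV (Suc k) (c' * C) (\<lambda>p. \<omega> (fst p) * jbracket (snd p) powr (- 2 * real N)) (ftr g)"
    if b: "ftr_bound g C M \<omega> (Suc k + 2 * N)" and Mk: "2 * real CARD('n) + real (Suc k) \<le> M"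
    for g :: "'w \<times> (real ^ 'n) \<Rightarrow> complex" and C M \<omega>
  proof -
    interpret ftr_bound g C M \<omega> "Suc k + 2 * N" by (rule b)
    let ?W = "\<lambda>p::'w \<times> (real ^ 'n). \<omega> (fst p) * jbracket (snd p) powr (- 2 * real N)"
    have W: "0 \<le> ?W p" for p using \<omega> by auto
    have M1: "2 * real CARD('n) + 1 \<le> M" using Mk by simp
    have k1: "1 \<le> Suc k + 2 * N" by simp
    note D = ftr_derivative[OF k1 M1]
    have "dbound (\<lambda>_ _. 1) UNIV k (c' * C) (\<lambda>p. ?W p * 1) (dir_deriv b (ftr g))" if "b \<in> Basis" for b
    proof (cases "fst b = 0")
      case True
      then have b': "b = (0, snd b)" "snd b \<in> Basis" using that by (auto simp: Basis_prod_def prod_eq_iff)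
      have "ftr_bound g C M \<omega> (k + 2 * N)"
        by unfold_locales (use smooth C M \<omega> dbound_le[OF g, of "k + 2 * N"] in auto)
      from IH[OF ftr_bound_times[OF this M1 b'(2)]] Mk
      have "dbound (\<lambda>_ _. 1) UNIV k (c * (2 ^ (k + 2 * N) * C)) ?W (ftr (\<lambda>q. \<i> * complex_of_real (snd q \<bullet> snd b) * g q))"
        by simp
      moreover have "dir_deriv b (ftr g) = ftr (\<lambda>q. \<i> * complex_of_real (snd q \<bullet> snd b) * g q)"
        using D(3)[OF b'(2)] b'(1) by auto
      ultimately show ?thesis
        using mult_right_mono[OF mult_right_mono[OF c1(3) C] W]
        by (auto intro: dbound_mono simp: mult.assoc)
    next
      case False
      then have b': "b = (fst b, 0)" "fst b \<in> Basis" using that by (auto simp: Basis_prod_def prod_eq_iff)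
      have "ftr_bound (dir_deriv b g) C M \<omega> (k + 2 * N)"
        by unfold_locales (use smooth_on_dir_deriv[OF open_UNIV smooth] C M \<omega> dbound_one_SucD[OF _ that, of UNIV "k + 2 * N"] g in \<open>auto simp del: dbound.simps\<close>)
      from IH[OF this] Mk
      have "dbound (\<lambda>_ _. 1) UNIV k (c * C) ?W (ftr (dir_deriv b g))" by simp
      moreover have "dir_deriv b (ftr g) = ftr (dir_deriv b g)"
        using D(2)[OF b'(2)] b'(1) by auto
      ultimately show ?thesis
        using mult_right_mono[OF mult_right_mono[OF c1(2) C] W] by (auto intro: dbound_mono)
    qed
    moreover have "norm (ftr g p) \<le> c' * C * ?W p" for p
    proof -
      have "norm (ftr g p) \<le> c0 * C * ?W p"
        using ftr_decay[of N "fst p" "snd p"] by (simp add: c0_def)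
      also have "\<dots> \<le> c' * C * ?W p" by (intro mult_right_mono c1 C W)
      finally show ?thesis .
    qed
    ultimately show ?thesis using D(1) by auto
  qed
  then show ?case using c1(4) by blast
qed

text \<open>Rapid decrease concerns the last variable only, for derivatives in all variables; in the
  parameter nothing beyond the weight \<open>\<omega>\<close> is asked.\<close>

definition rapid :: "('w \<Rightarrow> real) \<Rightarrow> ('w::euclidean_space \<times> (real ^ 'n::finite) \<Rightarrow> complex) \<Rightarrow> bool" where
  "rapid \<omega> g \<longleftrightarrow> (\<forall>k N. \<exists>C\<ge>0. dbound (\<lambda>_ _. 1) UNIV k C (\<lambda>p. \<omega> (fst p) * jbracket (snd p) powr (- real N)) g)"

lemma rapid_smooth: "rapid \<omega> g \<Longrightarrow> smooth_on UNIV g"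
proof (rule smooth_on_dbound[of "\<lambda>_ _. 1"])
  fix k
  assume "rapid \<omega> g"
  then show "\<exists>C w. dbound (\<lambda>_ _. 1) UNIV k C w g" unfolding rapid_def by blast
qed

lemma rapid_ftr_bound:
  assumes "rapid \<omega> g" "continuous_on UNIV \<omega>" "\<And>w. 0 \<le> \<omega> w" "2 * CARD('n) \<le> N"
  obtains C where "ftr_bound (g :: _ \<times> (real ^ 'n::finite) \<Rightarrow> _) C (real N) \<omega> k"
proof -
  obtain C where "C \<ge> 0" "dbound (\<lambda>_ _. 1) UNIV k C (\<lambda>p. \<omega> (fst p) * jbracket (snd p) powr (- real N)) g"
    using assms(1) unfolding rapid_def by blast
  then show thesis
    using rapid_smooth[OF assms(1)] assms by (intro that[of C]) (unfold_locales, auto)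
qed

lemma rapid_ftr:
  assumes "rapid \<omega> g" "continuous_on UNIV \<omega>" "\<And>w. 0 \<le> \<omega> w"
  shows "rapid \<omega> (ftr (g :: _ \<times> (real ^ 'n::finite) \<Rightarrow> _))"
  unfolding rapid_def
proof (intro allI)
  fix k N
  obtain C where C: "ftr_bound g C (real (2 * CARD('n) + k)) \<omega> (k + 2 * N)"
    by (rule rapid_ftr_bound[OF assms, of "2 * CARD('n) + k" "k + 2 * N"]) auto
  obtain c where "c \<ge> 0" "dbound (\<lambda>_ _. 1) UNIV k (c * C) (\<lambda>p. \<omega> (fst p) * jbracket (snd p) powr (- 2 * real N)) (ftr g)"
    using ftr_joint[of k N] C by fastforce
  moreover from this have "0 \<le> c * C" using C by (simp add: ftr_bound_def)
  ultimately show "\<exists>C\<ge>0. dbound (\<lambda>_ _. 1) UNIV k C (\<lambda>p. \<omega> (fst p) * jbracket (snd p) powr (- real N)) (ftr g)"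
    using assms(3) by (intro exI[of _ "c * C"]) (auto intro!: mult_left_mono jbracket_powr_mono elim!: dbound_weight_mono)
qed

text \<open>Covers the restrictions used later: the slice \<open>x \<mapsto> (0, x)\<close>, its
  reflection, and the diagonal \<open>x \<mapsto> (x, x)\<close> on which operators evaluate
  \<open>ftr\<close>.\<close>

lemma rapid_linear:
  assumes "rapid (\<lambda>_. 1) g" "linear L" "\<And>x. snd (L x) = x \<or> snd (L x) = - x"
  shows "\<exists>C\<ge>0. dbound (\<lambda>_ _. 1) UNIV k C (\<lambda>x. jbracket x powr (- real N)) (\<lambda>x::real^'n::finite. g (L x))"
proof -
  obtain C where C: "C \<ge> 0" "dbound (\<lambda>_ _. 1) UNIV k C (\<lambda>p. 1 * jbracket (snd p) powr (- real N)) g"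
    using assms(1) unfolding rapid_def by blast
  have e: "jbracket (snd (L x)) = jbracket x" for x using assms(3)[of x] by (metis jbracket_minus)
  obtain B where B: "1 \<le> B"
    "\<And>k C w f U c. dbound (\<lambda>_ _. 1) UNIV k C w f \<Longrightarrow>
      dbound (\<lambda>_ _. 1) U k (B ^ k * C) (\<lambda>z. w (L z + c)) (\<lambda>z. f (L z + c))"
    using dbound_linear[OF assms(2)] by metis
  show ?thesis
    using B(2)[OF C(2), of UNIV 0] C(1) B(1) by (intro exI[of _ "B ^ k * C"]) (auto simp: e)
qed

section \<open>Rapidly decreasing functions and Fourier inversion\<close>

lemma lborel_integral_affine:
  fixes f :: "'a::euclidean_space \<Rightarrow> complex"
  assumes "f \<in> borel_measurable borel" "c \<noteq> 0"
  shows "(LINT x|lborel. f x) = \<bar>c\<bar> ^ DIM('a) *\<^sub>R (LINT x|lborel. f (t + c *\<^sub>R x))"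
proof -
  have "(LINT x|lborel. f x) = (LINT x|density (distr lborel borel (\<lambda>x. t + c *\<^sub>R x)) (\<lambda>_. ennreal (\<bar>c\<bar> ^ DIM('a))). f x)"
    using lborel_affine[OF assms(2), of t] by simp
  also have "\<dots> = (LINT x|distr lborel borel (\<lambda>x. t + c *\<^sub>R x). \<bar>c\<bar> ^ DIM('a) *\<^sub>R f x)"
    by (rule integral_density) (use assms in auto)
  also have "\<dots> = (LINT x|lborel. \<bar>c\<bar> ^ DIM('a) *\<^sub>R f (t + c *\<^sub>R x))"
    by (rule integral_distr) (use assms in auto)
  finally show ?thesis by simp
qed

lemma Fubini_bound:
  fixes h :: "'a::euclidean_space \<times> 'b::euclidean_space \<Rightarrow> complex"
  assumes "continuous_on UNIV h" "\<And>x y. norm (h (x, y)) \<le> H1 x * H2 y"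
    "integrable lborel H1" "integrable lborel H2"
  shows "(LINT x|lborel. LINT y|lborel. h (x, y)) = (LINT y|lborel. LINT x|lborel. h (x, y))"
    "integrable lborel (\<lambda>x. LINT y|lborel. h (x, y))"
proof -
  have m: "(\<lambda>p. h p) \<in> borel_measurable (lborel \<Otimes>\<^sub>M lborel)"
    using borel_measurable_continuous_onI[OF assms(1)] by (simp add: lborel_prod)
  have "integrable (lborel \<Otimes>\<^sub>M lborel) (\<lambda>p. H1 (fst p) * H2 (snd p))"
  proof (rule lborel_pair.Fubini_integrable)
    show "(\<lambda>p. H1 (fst p) * H2 (snd p)) \<in> borel_measurable (lborel \<Otimes>\<^sub>M lborel)"
      using borel_measurable_integrable[OF assms(3)] borel_measurable_integrable[OF assms(4)]
      by (intro borel_measurable_times measurable_compose[OF measurable_fst] measurable_compose[OF measurable_snd]) auto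
    show "integrable lborel (\<lambda>x. LINT y|lborel. norm (H1 (fst (x, y)) * H2 (snd (x, y))))"
      using assms(3) by (simp add: abs_mult)
  qed (use assms(4) in simp)
  then have i: "integrable (lborel \<Otimes>\<^sub>M lborel) h"
    by (rule Bochner_Integration.integrable_bound)
      (use m assms(2) in \<open>auto intro!: AE_I2 order_trans[OF _ abs_ge_self]\<close>)
  then show "(LINT x|lborel. LINT y|lborel. h (x, y)) = (LINT y|lborel. LINT x|lborel. h (x, y))"
    using lborel_pair.Fubini_integral[of "\<lambda>x y. h (x, y)"] by (simp add: case_prod_beta')
  show "integrable lborel (\<lambda>x. LINT y|lborel. h (x, y))"
    by (rule lborel_pair.integrable_fst[of "\<lambda>x y. h (x, y)", simplified]) (use i in \<open>simp add: case_prod_beta'\<close>)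
qed

section \<open>The Fourier transform of rapidly decreasing functions\<close>

definition rapid1 :: "(real ^ 'n::finite \<Rightarrow> complex) \<Rightarrow> bool" where
  "rapid1 u \<longleftrightarrow> (\<forall>k N. \<exists>C\<ge>0. dbound (\<lambda>_ _. 1) UNIV k C (\<lambda>x. jbracket x powr (- real N)) u)"

text \<open>With the positive sign this is \<open>ftr\<close> without parameter, whose theory then
  applies directly; \<open>fourier\<close> is its reflection.\<close>

definition ft :: "(real ^ 'n::finite \<Rightarrow> complex) \<Rightarrow> real ^ 'n \<Rightarrow> complex" where
  "ft u z = (LINT \<eta>|lborel. exp (\<i> * complex_of_real (z \<bullet> \<eta>)) * u \<eta>)"

lemma ft_ftr: "ft u z = ftr (\<lambda>p. u (snd p)) (w, z)"
  by (simp add: ft_def ftr_def)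

lemma rapid1_smooth: "rapid1 u \<Longrightarrow> smooth_on UNIV u"
  by (rule smooth_on_dbound[of "\<lambda>_ _. 1"]) (use rapid1_def in blast)

lemma rapid1_rapid:
  assumes "rapid1 u" shows "rapid (\<lambda>_. 1) (\<lambda>p::'w::euclidean_space \<times> (real ^ 'n::finite). u (snd p))"
  unfolding rapid_def
proof (intro allI)
  fix k N
  obtain B where B: "1 \<le> B"
    "\<And>k C w f U c. dbound (\<lambda>_ _. 1) UNIV k C w f \<Longrightarrow>
      dbound (\<lambda>_ _. 1) U k (B ^ k * C) (\<lambda>z::'w \<times> (real ^ 'n). w (snd z + c)) (\<lambda>z. f (snd z + c))"
    using dbound_linear[OF linear_snd] by metis
  obtain C where C: "C \<ge> 0" "dbound (\<lambda>_ _. 1) UNIV k C (\<lambda>x. jbracket x powr (- real N)) u"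
    using assms unfolding rapid1_def by blast
  show "\<exists>C\<ge>0. dbound (\<lambda>_ _. 1) UNIV k C (\<lambda>p::'w \<times> (real ^ 'n). 1 * jbracket (snd p) powr (- real N)) (\<lambda>p. u (snd p))"
    using B(2)[OF C(2), of UNIV 0] B(1) C(1) by (intro exI[of _ "B ^ k * C"]) auto
qed

lemma rapid1_ft: assumes "rapid1 u" shows "rapid1 (ft u)"
proof -
  have "rapid (\<lambda>_. 1) (ftr (\<lambda>p::(real^'a) \<times> (real^'a). u (snd p)))"
    by (intro rapid_ftr rapid1_rapid assms) auto
  moreover have e: "ft u = (\<lambda>x. ftr (\<lambda>p::(real^'a) \<times> (real^'a). u (snd p)) (0, x))"
    by (intro ext ft_ftr)
  moreover have "linear (\<lambda>x::real^'a. (0::real^'a, x))" by (auto intro!: linearI)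
  ultimately show ?thesis
    unfolding rapid1_def e by (intro allI rapid_linear[where L = "\<lambda>x. (0, x)"]) auto
qed

lemma rapid1_dir_deriv: "rapid1 u \<Longrightarrow> b \<in> Basis \<Longrightarrow> rapid1 (dir_deriv b u)"
  unfolding rapid1_def using dbound_one_SucD[of UNIV _ _ _ u b] by blast

lemma dbound_inner:
  fixes b :: "real ^ 'n::finite"
  assumes b: "b \<in> Basis"
  shows "dbound (\<lambda>_ _. 1) UNIV k 1 jbracket (\<lambda>x::real ^ 'n. complex_of_real (x \<bullet> b))"
  using dbound_slice(2)[OF dbound_snd_inner[OF b], where x = "0::real"] by simp

lemma rapid1_cmult: "rapid1 u \<Longrightarrow> rapid1 (\<lambda>x. c * u x)"
  unfolding rapid1_def
  using dbound_const_mult[OF open_UNIV, of "\<lambda>_ _. 1" _ _ _ u c] mult_nonneg_nonneg[OF norm_ge_zero[of c]] by blast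

lemma rapid1_add: "rapid1 u \<Longrightarrow> rapid1 v \<Longrightarrow> rapid1 (\<lambda>x. u x + v x)"
  unfolding rapid1_def
  using dbound_add[OF open_UNIV, of "\<lambda>_ _. 1" _ _ _ u _ v] add_nonneg_nonneg by blast

lemma rapid1_bound:
  assumes "rapid1 u" obtains C where "C \<ge> 0" "\<And>x. norm (u x) \<le> C * jbracket x powr (- real N)"
proof -
  obtain C where C: "C \<ge> 0" "dbound (\<lambda>_ _. 1) UNIV 0 C (\<lambda>x. jbracket x powr (- real N)) u"
    using assms unfolding rapid1_def by blast
  then show thesis by (intro that[of C]) auto
qed

lemma rapid1_continuous: "rapid1 u \<Longrightarrow> continuous_on UNIV u"
  by (rule smooth_on_continuous[OF rapid1_smooth])

lemma rapid1_integrable: assumes "rapid1 (u :: real ^ 'n::finite \<Rightarrow> _)" shows "integrable lborel u"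
proof -
  obtain C where C: "C \<ge> 0" "\<And>x. norm (u x) \<le> C * jbracket x powr (- real (2 * CARD('n)))"
    using rapid1_bound[OF assms] by metis
  have "integrable lborel (\<lambda>x::real^'n. C * jbracket x powr (- real (2 * CARD('n))))"
    by (intro integrable_mult_right integrable_jbracket) simp
  then show ?thesis
    by (rule Bochner_Integration.integrable_bound)
      (use C borel_measurable_continuous_onI[OF rapid1_continuous[OF assms]] in auto)
qed

lemma ft_bound_obtain:
  fixes u :: "real ^ 'n::finite \<Rightarrow> complex"
  assumes "rapid1 u"
  obtains C where "ftr_bound (\<lambda>p::(real^'n) \<times> (real^'n). u (snd p)) C (real (2 * CARD('n) + 1)) (\<lambda>_. 1) 1"
  by (rule rapid_ftr_bound[OF rapid1_rapid[OF assms], of "2 * CARD('n) + 1" 1]) auto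

lemma ft_dir_deriv:
  assumes "rapid1 u" "b \<in> Basis"
  shows "ft (dir_deriv b u) z = - \<i> * complex_of_real (z \<bullet> b) * ft u z"
    "dir_deriv b (ft u) z = ft (\<lambda>\<eta>. \<i> * complex_of_real (\<eta> \<bullet> b) * u \<eta>) z"
proof -
  obtain C where "ftr_bound (\<lambda>p::(real^'a) \<times> (real^'a). u (snd p)) C (real (2 * CARD('a) + 1)) (\<lambda>_. 1) 1"
    by (rule ft_bound_obtain[OF assms(1)])
  then interpret ftr_bound "\<lambda>p::(real^'a) \<times> (real^'a). u (snd p)" C "real (2 * CARD('a) + 1)" "\<lambda>_. 1" 1 .
  have "dir_deriv (0, b) (\<lambda>p::(real^'a) \<times> (real^'a). u (snd p)) = (\<lambda>p::(real^'a) \<times> (real^'a). dir_deriv b u (snd p))"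
    using dir_deriv_affine[OF linear_snd, of "(0::real^'a, b)" u 0] by auto
  with ftr_dir_deriv[OF order_refl assms(2), of 0 z]
  show "ft (dir_deriv b u) z = - \<i> * complex_of_real (z \<bullet> b) * ft u z"
    by (simp add: ft_ftr[of _ _ "0::real^'a"])
  have l: "linear (\<lambda>y::real^'a. (0::real^'a, y))" by (auto intro!: linearI)
  have e: "ft u = (\<lambda>x. ftr (\<lambda>p::(real^'a) \<times> (real^'a). u (snd p)) (0, x))"
    by (intro ext ft_ftr)
  have "dir_deriv b (ft u) z = dir_deriv (0, b) (ftr (\<lambda>p::(real^'a) \<times> (real^'a). u (snd p))) (0, z)"
    using dir_deriv_affine[OF l, of b "ftr (\<lambda>p::(real^'a) \<times> (real^'a). u (snd p))" 0 z]
    by (simp add: e)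
  also have "\<dots> = ft (\<lambda>\<eta>. \<i> * complex_of_real (\<eta> \<bullet> b) * u \<eta>) z"
    by (subst ftr_derivative(3)[OF order_refl _ assms(2)]) (simp_all add: ft_ftr[of _ _ "0::real^'a"])
  finally show "dir_deriv b (ft u) z = ft (\<lambda>\<eta>. \<i> * complex_of_real (\<eta> \<bullet> b) * u \<eta>) z" .
qed

section \<open>Gaussians and Fourier inversion\<close>

definition gauss :: "real ^ 'n::finite \<Rightarrow> complex" where
  "gauss x = complex_of_real (exp (- (x \<bullet> x) / 2))"

lemma has_derivative_gauss:
  "((\<lambda>x. complex_of_real (exp (c * (x \<bullet> x) / 2))) has_derivative
    (\<lambda>v. complex_of_real (c * (x \<bullet> v)) * complex_of_real (exp (c * (x \<bullet> x) / 2)))) (at x)"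
proof -
  have 1: "((\<lambda>x. c * (x \<bullet> x) / 2) has_derivative (\<lambda>v. c * (x \<bullet> v))) (at x)"
    by (auto intro!: derivative_eq_intros simp: inner_commute)
  have 2: "(exp has_derivative (\<lambda>t. exp (c * (x \<bullet> x) / 2) * t)) (at (c * (x \<bullet> x) / 2))"
    using DERIV_exp unfolding has_field_derivative_def by blast
  from has_derivative_of_real[OF has_derivative_compose[OF 1 2]]
  show ?thesis by (simp add: mult_ac)
qed

lemma dir_deriv_gauss: "dir_deriv b gauss x = - complex_of_real (x \<bullet> b) * gauss x"
  using dir_deriv_eq[OF has_derivative_gauss[of "-1"]] by (simp add: gauss_def[abs_def])

lemma gauss_decay: "\<exists>C\<ge>0. \<forall>x::real ^ 'n::finite. norm (gauss x) \<le> C * jbracket x powr (- real N)"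
proof (intro exI conjI allI)
  \<comment> \<open>\<open>Suc N\<close> instead of \<open>N\<close> avoids a division by zero in
    the case \<open>N = 0\<close>.\<close>
  let ?M = "real (Suc N)"
  show "0 \<le> (2 * ?M) ^ N * exp (1/2)" by simp
  fix x :: "real^'n"
  define t where "t = x \<bullet> x"
  have t: "t \<ge> 0" by (simp add: t_def)
  have j: "(jbracket x)\<^sup>2 = 1 + t" by (simp add: jbracket_sq t_def power2_norm_eq_inner)
  have "jbracket x ^ N \<le> ((jbracket x)\<^sup>2) ^ N"
    by (intro power_mono) (simp_all add: power2_eq_square jbracket_ge1 mult_le_cancel_left1)
  also have "\<dots> = (1 + t) ^ N" by (simp add: j)
  also have "\<dots> \<le> (2 * ?M * exp ((1 + t) / (2 * ?M))) ^ N"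
  proof (intro power_mono)
    have "(1 + t) / (2 * ?M) \<le> exp ((1 + t) / (2 * ?M))" using exp_ge_add_one_self[of "(1 + t) / (2 * ?M)"] by linarith
    then show "1 + t \<le> 2 * ?M * exp ((1 + t) / (2 * ?M))" by (simp add: divide_le_eq mult.commute)
  qed (use t in auto)
  also have "\<dots> = (2 * ?M) ^ N * exp (real N * ((1 + t) / (2 * ?M)))"
    by (simp only: power_mult_distrib exp_of_nat_mult)
  also have "\<dots> \<le> (2 * ?M) ^ N * exp ((1 + t) / 2)"
  proof -
    have "real N * ((1 + t) / (2 * ?M)) \<le> ?M * ((1 + t) / (2 * ?M))" using t by (intro mult_right_mono) auto
    also have "\<dots> = (1 + t) / 2" by (simp add: field_simps del: of_nat_Suc)
    finally show ?thesis by (intro mult_left_mono) auto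
  qed
  finally have "jbracket x ^ N \<le> (2 * ?M) ^ N * exp (1/2) * exp (t / 2)"
    by (simp add: add_divide_distrib exp_add)
  then have "exp (- t / 2) * jbracket x ^ N \<le> (2 * ?M) ^ N * exp (1/2)"
    by (simp add: exp_minus field_simps)
  then have "exp (- t / 2) \<le> (2 * ?M) ^ N * exp (1/2) * inverse (jbracket x ^ N)"
    by (simp add: field_simps)
  then show "norm (gauss x) \<le> (2 * ?M) ^ N * exp (1/2) * jbracket x powr (- real N)"
    by (simp add: gauss_def t_def powr_minus powr_realpow)
qed

lemma rapid1_gauss: "rapid1 gauss"
  unfolding rapid1_def
proof
  fix k
  show "\<forall>N. \<exists>C\<ge>0. dbound (\<lambda>_ _. 1) UNIV k C (\<lambda>x. jbracket x powr (- real N)) (gauss :: real^'a \<Rightarrow> _)"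
  proof (induction k)
    case 0
    then show ?case using gauss_decay by auto
  next
    case (Suc k)
    show ?case
    proof
      fix N
      obtain C where C: "C \<ge> 0" "dbound (\<lambda>_ _. 1) UNIV k C (\<lambda>x. jbracket x powr (- real (Suc N))) (gauss :: real^'a \<Rightarrow> _)"
        using Suc by blast
      obtain C' where C': "C' \<ge> 0" "\<And>x::real^'a. norm (gauss x) \<le> C' * jbracket x powr (- real N)"
        using gauss_decay by blast
      define D where "D = C' + 2 ^ k * (1 * C)"
      have D: "C' \<le> D" "2 ^ k * (1 * C) \<le> D" using C C' by (auto simp: D_def)
      have e: "jbracket x * jbracket x powr (- real (Suc N)) = jbracket x powr (- real N)" for x :: "real^'a"
        using powr_add[of "jbracket x" 1 "- real (Suc N)"] by simp
      have "dbound (\<lambda>_ _. 1) UNIV k D (\<lambda>x. jbracket x powr (- real N) * 1) (dir_deriv b (gauss :: real^'a \<Rightarrow> _))" if b: "b \<in> Basis" for b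
      proof -
        have "dbound (\<lambda>_ _. 1) UNIV k (norm (-1::complex) * (2 ^ k * (1 * C))) (\<lambda>x::real^'a. jbracket x powr (- real N) * 1)
           (\<lambda>x. (- 1) * (complex_of_real (x \<bullet> b) * gauss x))"
          using dbound_const_mult[OF open_UNIV dbound_mult[OF open_UNIV dbound_inner[OF b] C(2)], of "-1"]
          by (simp only: e mult_1_right)
        then have "dbound (\<lambda>_ _. 1) UNIV k (2 ^ k * (1 * C)) (\<lambda>x::real^'a. jbracket x powr (- real N) * 1) (dir_deriv b gauss)"
          by (simp add: dir_deriv_gauss[abs_def])
        then show ?thesis by (rule dbound_const_mono) (use D in auto)
      qed
      moreover have "norm (gauss x) \<le> D * jbracket x powr (- real N)" for x :: "real^'a"
        by (rule order_trans[OF C'(2) mult_right_mono[OF D(1)]]) simp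
      moreover have "gauss differentiable (at x)" for x :: "real^'a"
        using has_derivative_gauss[of "-1" x] by (auto simp: differentiable_def gauss_def[abs_def])
      ultimately show "\<exists>C\<ge>0. dbound (\<lambda>_ _. 1) UNIV (Suc k) C (\<lambda>x. jbracket x powr (- real N)) (gauss :: real^'a \<Rightarrow> _)"
        using D C' by (intro exI[of _ D]) auto
    qed
  qed
qed

lemma integral_gauss: "(LINT x|lborel. gauss (x::real^'n::finite)) = complex_of_real (sqrt (2 * pi) ^ CARD('n))"
proof -
  have d: "exp (- t\<^sup>2 / 2) = sqrt (2 * pi) * std_normal_density t" for t
    by (simp add: std_normal_density_def)
  have i: "integrable lborel (\<lambda>t::real. exp (- t\<^sup>2 / 2))"
    unfolding d using integrable_std_normal_moment[of 0] by (intro integrable_mult_right) simp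
  have v: "(LINT t|lborel. exp (- t\<^sup>2 / 2)) = sqrt (2 * pi)"
    unfolding d using integral_std_normal_moment_even[of 0] by simp
  have g: "gauss x = complex_of_real (\<Prod>b\<in>Basis. exp (- (x \<bullet> b)\<^sup>2 / 2))" for x :: "real^'n"
  proof -
    have "- (x \<bullet> x) / 2 = (\<Sum>b\<in>Basis. - (x \<bullet> b)\<^sup>2 / 2)"
      by (subst euclidean_inner) (simp add: sum_negf sum_divide_distrib power2_eq_square)
    then show ?thesis by (simp add: gauss_def exp_sum)
  qed
  show ?thesis
    unfolding g integral_complex_of_real
    by (subst integrable_prod_Basis(2)[of "\<lambda>(b::real^'n) t. exp (- t\<^sup>2 / 2)", OF i]) (simp only: v prod_constant DIM_cart DIM_real mult_1_right)
qed

text \<open>Both \<open>ft gauss\<close> and \<open>gauss\<close> solve \<open>dir_deriv b G z = - (z \<bullet> b) G z\<close>.\<close>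

lemma ft_gauss: "ft gauss (z::real^'n::finite) = complex_of_real (sqrt (2 * pi) ^ CARD('n)) * gauss z"
proof -
  \<comment> \<open>The reciprocal of \<open>gauss\<close>; the product of \<open>ft gauss\<close>
    with it has vanishing derivative, hence is constant and equal to its value at 0, the Gaussian
    integral.\<close>
  let ?E = "\<lambda>z::real^'n. complex_of_real (exp (1 * (z \<bullet> z) / 2))"
  let ?h = "\<lambda>z. ft gauss z * ?E z"
  have dE: "?E differentiable (at z)" "dir_deriv b ?E z = complex_of_real (z \<bullet> b) * ?E z" for z b
    using has_derivative_gauss[of 1 z] dir_deriv_eq[OF has_derivative_gauss[of 1 z]]
    by (auto simp: differentiable_def)
  have df: "ft gauss differentiable (at z)" for z :: "real^'n"
    by (rule smooth_on_differentiable[OF rapid1_smooth[OF rapid1_ft[OF rapid1_gauss]] UNIV_I])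
  have D: "dir_deriv b (ft gauss) z = - complex_of_real (z \<bullet> b) * ft gauss z" if b: "b \<in> Basis" for b z :: "real^'n"
  proof -
    have "dir_deriv b (ft gauss) z = ft (\<lambda>\<eta>. \<i> * complex_of_real (\<eta> \<bullet> b) * gauss \<eta>) z"
      by (rule ft_dir_deriv(2)[OF rapid1_gauss b])
    also have "\<dots> = - \<i> * ft (dir_deriv b gauss) z"
      unfolding ft_def dir_deriv_gauss by (subst integral_mult_right_zero[symmetric]) (simp add: mult_ac)
    also have "\<dots> = - complex_of_real (z \<bullet> b) * ft gauss z"
      by (simp add: ft_dir_deriv(1)[OF rapid1_gauss b] mult.assoc[symmetric])
    finally show ?thesis .
  qed
  have hd: "?h differentiable (at z)" for z by (intro differentiable_mult df dE)
  have "dir_deriv b ?h z = 0" if "b \<in> Basis" for b z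
    unfolding dir_deriv_mult[OF df dE(1)] using D[OF that] dE(2) by simp
  then have "dir_deriv v ?h z = 0" for v z using dir_deriv_expand[OF hd, of v z] by simp
  then have "(?h has_derivative (\<lambda>v. 0)) (at z)" for z
  proof -
    have "frechet_derivative ?h (at z) = (\<lambda>v. 0)"
      using dir_deriv_frechet[OF hd, of _ z] \<open>\<And>v z. dir_deriv v ?h z = 0\<close> by auto
    then show ?thesis using hd[of z] frechet_derivative_works[of ?h "at z"] by simp
  qed
  then have "?h z = ?h 0"
    by (intro has_derivative_zero_unique[of UNIV]) auto
  also have "?h 0 = complex_of_real (sqrt (2 * pi) ^ CARD('n))"
    by (simp add: ft_def integral_gauss)
  finally have 1: "?h z * gauss z = complex_of_real (sqrt (2 * pi) ^ CARD('n)) * gauss z" by simp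
  have "?E z * gauss z = 1"
    unfolding gauss_def of_real_mult[symmetric] exp_add[symmetric] by simp
  then have "ft gauss z = ?h z * gauss z" by (simp only: mult.assoc mult_1_right)
  from trans[OF this 1] show ?thesis .
qed

lemma jbracket_scale:
  assumes "0 < \<delta>" "\<delta> \<le> 1" shows "\<delta> * jbracket x \<le> jbracket (\<delta> *\<^sub>R x)"
proof (rule power2_le_imp_le)
  have "\<delta>\<^sup>2 \<le> 1" using assms by (simp add: power_le_one)
  then show "(\<delta> * jbracket x)\<^sup>2 \<le> (jbracket (\<delta> *\<^sub>R x))\<^sup>2"
    by (simp add: power_mult_distrib jbracket_sq algebra_simps)
qed simp

lemma integrable_gauss_scale:
  assumes "0 < \<delta>" "\<delta> \<le> 1" shows "integrable lborel (\<lambda>x::real^'n::finite. norm (gauss (\<delta> *\<^sub>R x)))"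
proof -
  obtain C where C: "C \<ge> 0" "\<And>x::real^'n. norm (gauss x) \<le> C * jbracket x powr (- real (2 * CARD('n)))"
    using gauss_decay by metis
  let ?N = "2 * CARD('n)"
  have bd: "norm (gauss (\<delta> *\<^sub>R x)) \<le> C * \<delta> powr (- real ?N) * jbracket x powr (- real ?N)" for x :: "real^'n"
  proof -
    have "jbracket (\<delta> *\<^sub>R x) powr (- real ?N) \<le> (\<delta> * jbracket x) powr (- real ?N)"
      by (rule powr_mono2') (use assms jbracket_scale[OF assms, of x] in auto)
    also have "\<dots> = \<delta> powr (- real ?N) * jbracket x powr (- real ?N)"
      using assms by (simp add: powr_mult)
    finally have "C * jbracket (\<delta> *\<^sub>R x) powr (- real ?N) \<le> C * (\<delta> powr (- real ?N) * jbracket x powr (- real ?N))"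
      using C(1) by (rule mult_left_mono)
    with C(2)[of "\<delta> *\<^sub>R x"] show ?thesis by simp
  qed
  have it: "integrable lborel (\<lambda>x::real^'n. C * \<delta> powr (- real ?N) * jbracket x powr (- real ?N))"
    by (intro integrable_mult_right integrable_jbracket) simp
  have "continuous_on UNIV (\<lambda>x::real^'n. norm (gauss (\<delta> *\<^sub>R x)))"
    unfolding gauss_def by (intro continuous_intros) auto
  then have m: "(\<lambda>x::real^'n. norm (gauss (\<delta> *\<^sub>R x))) \<in> borel_measurable lborel"
    using borel_measurable_continuous_onI by simp
  show ?thesis
  proof (rule Bochner_Integration.integrable_bound[OF it m], rule AE_I2)
    show "norm (norm (gauss (\<delta> *\<^sub>R x))) \<le> norm (C * \<delta> powr (- real ?N) * jbracket x powr (- real ?N))" for x :: "real^'n"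
      using order_trans[OF bd[of x] abs_ge_self] by simp
  qed
qed

lemma continuous_gauss [continuous_intros]:
  "continuous_on S f \<Longrightarrow> continuous_on S (\<lambda>x. gauss (f x))"
  unfolding gauss_def by (intro continuous_intros) auto

lemma norm_gauss_le_1: "norm (gauss x) \<le> 1"
  by (simp add: gauss_def)

text \<open>The factor \<open>gauss (d *\<^sub>R \<xi>)\<close> makes the double integral absolutely
  convergent. After Fubini the inner integral is again a Gaussian, so the whole is an average of
  \<open>u\<close> near \<open>- z\<close> at scale \<open>d\<close>; then \<open>d\<close> tends to
  0 on both sides.\<close>

theorem ft_inversion:
  fixes u :: "real ^ 'n::finite \<Rightarrow> complex"
  assumes u: "rapid1 u"
  shows "ft (ft u) z = complex_of_real ((2 * pi) ^ CARD('n)) * u (- z)"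
proof -
  let ?c = "complex_of_real (sqrt (2 * pi) ^ CARD('n))"
  have cu: "continuous_on UNIV u" by (rule rapid1_continuous[OF u])
  have cfu: "continuous_on UNIV (ft u)" by (rule rapid1_continuous[OF rapid1_ft[OF u]])
  have iu: "integrable lborel u" by (rule rapid1_integrable[OF u])
  have ifu: "integrable lborel (ft u)" by (rule rapid1_integrable[OF rapid1_ft[OF u]])
  define \<delta> where "\<delta> k = inverse (real (Suc k))" for k
  have \<delta>: "0 < \<delta> k" "\<delta> k \<le> 1" for k by (simp_all add: \<delta>_def inverse_le_1_iff)
  have \<delta>lim: "\<delta> \<longlonglongrightarrow> 0" unfolding \<delta>_def by (rule LIMSEQ_inverse_real_of_nat)
  have key: "(LINT \<xi>|lborel. gauss (d *\<^sub>R \<xi>) * (exp (\<i> * complex_of_real (z \<bullet> \<xi>)) * ft u \<xi>))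
      = ?c * (LINT w|lborel. u (- z + d *\<^sub>R w) * gauss w)" if d: "0 < d" "d \<le> 1" for d
  proof -
    let ?h = "\<lambda>p::(real^'n) \<times> (real^'n). gauss (d *\<^sub>R fst p) * exp (\<i> * complex_of_real ((snd p + z) \<bullet> fst p)) * u (snd p)"
    have cont: "continuous_on UNIV ?h"
      by (intro continuous_intros continuous_on_compose2[OF cu]) auto
    have "(LINT \<xi>|lborel. gauss (d *\<^sub>R \<xi>) * (exp (\<i> * complex_of_real (z \<bullet> \<xi>)) * ft u \<xi>))
      = (LINT \<xi>|lborel. LINT y|lborel. ?h (\<xi>, y))"
    proof (rule Bochner_Integration.integral_cong[OF refl])
      fix \<xi> :: "real^'n"
      have "?h (\<xi>, y) = (gauss (d *\<^sub>R \<xi>) * exp (\<i> * complex_of_real (z \<bullet> \<xi>))) * (exp (\<i> * complex_of_real (\<xi> \<bullet> y)) * u y)" for y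
        by (simp add: inner_add_left inner_add_right distrib_left exp_add inner_commute mult_ac)
      then have *: "(LINT y|lborel. ?h (\<xi>, y)) = (LINT y|lborel. (gauss (d *\<^sub>R \<xi>) * exp (\<i> * complex_of_real (z \<bullet> \<xi>))) * (exp (\<i> * complex_of_real (\<xi> \<bullet> y)) * u y))"
        by (rule Bochner_Integration.integral_cong[OF refl])
      show "gauss (d *\<^sub>R \<xi>) * (exp (\<i> * complex_of_real (z \<bullet> \<xi>)) * ft u \<xi>) = (LINT y|lborel. ?h (\<xi>, y))"
        unfolding * ft_def by (simp add: mult.assoc)
    qed
    also have "\<dots> = (LINT y|lborel. LINT \<xi>|lborel. ?h (\<xi>, y))"
      by (rule Fubini_bound(1)[OF cont _ integrable_gauss_scale[OF d] integrable_norm[OF iu]])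
        (simp add: norm_mult)
    also have "\<dots> = (LINT y|lborel. ?c * (inverse d ^ CARD('n) *\<^sub>R (u y * gauss (inverse d *\<^sub>R (y + z)))))"
    proof (rule Bochner_Integration.integral_cong[OF refl])
      fix y :: "real^'n"
      have c1: "continuous_on UNIV (\<lambda>\<xi>. ?h (\<xi>, y))"
        by (rule continuous_on_compose2[OF cont]) (auto intro!: continuous_intros)
      have "(LINT \<xi>|lborel. ?h (\<xi>, y)) = \<bar>inverse d\<bar> ^ DIM(real^'n) *\<^sub>R (LINT \<eta>|lborel. ?h (0 + inverse d *\<^sub>R \<eta>, y))"
        by (rule lborel_integral_affine) (use d borel_measurable_continuous_onI[OF c1] in auto)
      also have "(LINT \<eta>|lborel. ?h (0 + inverse d *\<^sub>R \<eta>, y)) = u y * ft gauss (inverse d *\<^sub>R (y + z))"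
        unfolding ft_def using d by (subst integral_mult_right_zero[symmetric]) (simp add: mult_ac inner_commute)
      finally show "(LINT \<xi>|lborel. ?h (\<xi>, y)) = ?c * (inverse d ^ CARD('n) *\<^sub>R (u y * gauss (inverse d *\<^sub>R (y + z))))"
        using d by (simp add: ft_gauss mult_ac scaleR_conv_of_real)
    qed
    also have "\<dots> = ?c * inverse d ^ CARD('n) *\<^sub>R (LINT y|lborel. u y * gauss (inverse d *\<^sub>R (y + z)))"
      by simp
    also have "(LINT y|lborel. u y * gauss (inverse d *\<^sub>R (y + z)))
        = \<bar>d\<bar> ^ DIM(real^'n) *\<^sub>R (LINT w|lborel. u (- z + d *\<^sub>R w) * gauss (inverse d *\<^sub>R ((- z + d *\<^sub>R w) + z)))"
      by (rule lborel_integral_affine)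
        (use d in \<open>auto intro!: borel_measurable_continuous_onI continuous_intros cu\<close>)
    finally show ?thesis using d by (simp add: power_mult_distrib[symmetric])
  qed
  have L: "(\<lambda>k. LINT \<xi>|lborel. gauss (\<delta> k *\<^sub>R \<xi>) * (exp (\<i> * complex_of_real (z \<bullet> \<xi>)) * ft u \<xi>)) \<longlonglongrightarrow> (LINT \<xi>|lborel. exp (\<i> * complex_of_real (z \<bullet> \<xi>)) * ft u \<xi>)"
  proof (rule integral_dominated_convergence[where w = "\<lambda>\<xi>. norm (ft u \<xi>)"])
    show "AE \<xi> in lborel. (\<lambda>k. gauss (\<delta> k *\<^sub>R \<xi>) * (exp (\<i> * complex_of_real (z \<bullet> \<xi>)) * ft u \<xi>)) \<longlonglongrightarrow> exp (\<i> * complex_of_real (z \<bullet> \<xi>)) * ft u \<xi>"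
    proof (rule AE_I2)
      fix \<xi> :: "real^'n"
      have "(\<lambda>k. gauss (\<delta> k *\<^sub>R \<xi>)) \<longlonglongrightarrow> gauss (0 *\<^sub>R \<xi>)"
        unfolding gauss_def by (intro tendsto_intros \<delta>lim) auto
      then show "(\<lambda>k. gauss (\<delta> k *\<^sub>R \<xi>) * (exp (\<i> * complex_of_real (z \<bullet> \<xi>)) * ft u \<xi>)) \<longlonglongrightarrow> exp (\<i> * complex_of_real (z \<bullet> \<xi>)) * ft u \<xi>"
        using tendsto_mult_right[of "\<lambda>k. gauss (\<delta> k *\<^sub>R \<xi>)" 1] by (fastforce simp: gauss_def)
    qed
  qed (use ifu norm_gauss_le_1 in \<open>auto simp: norm_mult intro!: AE_I2 borel_measurable_continuous_onI continuous_intros cfu mult_left_le_one_le\<close>)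
  obtain K where K: "K \<ge> 0" "\<And>x. norm (u x) \<le> K * jbracket x powr (- real 0)"
    using rapid1_bound[OF u] by metis
  have R: "(\<lambda>k. LINT w|lborel. u (- z + \<delta> k *\<^sub>R w) * gauss w) \<longlonglongrightarrow> (LINT w|lborel. u (- z) * gauss (w::real^'n))"
  proof (rule integral_dominated_convergence[where w = "\<lambda>w::real^'n. K * norm (gauss w)"])
    show "AE w in lborel. (\<lambda>k. u (- z + \<delta> k *\<^sub>R w) * gauss w) \<longlonglongrightarrow> u (- z) * gauss w"
    proof (rule AE_I2)
      fix w :: "real^'n"
      have "(\<lambda>k. - z + \<delta> k *\<^sub>R w) \<longlonglongrightarrow> - z + 0 *\<^sub>R w" by (intro tendsto_intros \<delta>lim)
      moreover have "isCont u (- z + 0 *\<^sub>R w)" using cu by (simp add: continuous_on_eq_continuous_at)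
      ultimately have "(\<lambda>k. u (- z + \<delta> k *\<^sub>R w)) \<longlonglongrightarrow> u (- z + 0 *\<^sub>R w)" by (rule isCont_tendsto_compose[rotated])
      then show "(\<lambda>k. u (- z + \<delta> k *\<^sub>R w) * gauss w) \<longlonglongrightarrow> u (- z) * gauss w"
        by (intro tendsto_mult_right) simp
    qed
    show "integrable lborel (\<lambda>w::real^'n. K * norm (gauss w))"
      using rapid1_integrable[OF rapid1_gauss] by auto
  qed (use K in \<open>auto simp: norm_mult intro!: borel_measurable_continuous_onI continuous_intros cu mult_right_mono continuous_on_compose2[OF cu]\<close>)
  have "(\<lambda>k. ?c * (LINT w|lborel. u (- z + \<delta> k *\<^sub>R w) * gauss w)) \<longlonglongrightarrow> ?c * (LINT w|lborel. u (- z) * gauss (w::real^'n))"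
    by (intro tendsto_mult_left R)
  with L have "ft (ft u) z = ?c * (LINT w|lborel. u (- z) * gauss (w::real^'n))"
    unfolding key[OF \<delta>] ft_def[of "ft u"] by (rule LIMSEQ_unique)
  also have "\<dots> = (?c * ?c) * u (- z)" by (simp add: integral_gauss mult_ac)
  also have "?c * ?c = complex_of_real ((2 * pi) ^ CARD('n))"
    unfolding of_real_mult[symmetric] power_mult_distrib[symmetric] by simp
  finally show ?thesis .
qed

lemma fourier_ft: "fourier u \<xi> = ft u (- \<xi>)"
  by (simp add: fourier_def ft_def inner_commute)

lemma rapid1_reflect: assumes "rapid1 u" shows "rapid1 (\<lambda>x. u (- x))"
proof -
  have "rapid (\<lambda>_. 1) (\<lambda>p::(real^'a) \<times> (real^'a). u (snd p))" by (rule rapid1_rapid[OF assms])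
  moreover have "linear (\<lambda>x::real^'a. (0::real^'a, - x))" by (auto intro!: linearI)
  ultimately have "\<exists>C\<ge>0. dbound (\<lambda>_ _. 1) UNIV k C (\<lambda>x. jbracket x powr (- real N))
      (\<lambda>x. (\<lambda>p::(real^'a) \<times> (real^'a). u (snd p)) (0, - x))" for k N
    by (rule rapid_linear) auto
  then show ?thesis unfolding rapid1_def by simp
qed

lemma rapid1_fourier: "rapid1 u \<Longrightarrow> rapid1 (fourier u)"
  using rapid1_reflect[OF rapid1_ft] by (simp add: fourier_ft[abs_def])

lemma fourier_ft_inverse:
  fixes u :: "real ^ 'n::finite \<Rightarrow> complex"
  shows "rapid1 u \<Longrightarrow> fourier (ft u) \<xi> = complex_of_real ((2 * pi) ^ CARD('n)) * u \<xi>"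
  by (simp add: fourier_ft ft_inversion)

lemma ft_fourier_inverse:
  fixes u :: "real ^ 'n::finite \<Rightarrow> complex"
  assumes "rapid1 u" shows "ft (fourier u) x = complex_of_real ((2 * pi) ^ CARD('n)) * u x"
proof -
  have "continuous_on UNIV (fourier u)" by (rule rapid1_continuous[OF rapid1_fourier[OF assms]])
  then have m: "(\<lambda>\<eta>. exp (\<i> * complex_of_real (x \<bullet> \<eta>)) * fourier u \<eta>) \<in> borel_measurable borel"
    by (intro borel_measurable_continuous_onI continuous_intros)
  have "ft (fourier u) x = (LINT \<eta>|lborel. exp (\<i> * complex_of_real (x \<bullet> (0 + (- 1) *\<^sub>R \<eta>))) * fourier u (0 + (- 1) *\<^sub>R \<eta>))"
    unfolding ft_def by (subst lborel_integral_affine[OF m, of "-1" 0]) auto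
  also have "\<dots> = ft (ft u) (- x)" by (simp add: ft_def[of "ft u"] fourier_ft)
  finally show ?thesis by (simp add: ft_inversion[OF assms])
qed

section \<open>Identification with the Schwartz space\<close>

lemma rapid1I:
  assumes "smooth_on UNIV u"
    "\<And>vs N. set vs \<subseteq> Basis \<Longrightarrow> \<exists>C. \<forall>x. norm (foldr dir_deriv vs u x) \<le> C * jbracket x powr (- real N)"
  shows "rapid1 u"
  unfolding rapid1_def
proof (intro allI)
  fix k N
  define Ls where "Ls = {vs::(real ^ 'a) list. set vs \<subseteq> Basis \<and> length vs \<le> k}"
  have fin: "finite Ls" unfolding Ls_def by (rule finite_lists_length_le) simp
  have "\<forall>vs\<in>Ls. \<exists>C. \<forall>x. norm (foldr dir_deriv vs u x) \<le> C * jbracket x powr (- real N)"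
    using assms(2) by (auto simp: Ls_def)
  from bchoice[OF this] obtain C where C: "\<And>vs x. vs \<in> Ls \<Longrightarrow> norm (foldr dir_deriv vs u x) \<le> C vs * jbracket x powr (- real N)"
    by blast
  have "norm (foldr dir_deriv vs u x) \<le> (\<Sum>vs\<in>Ls. \<bar>C vs\<bar>) * jbracket x powr (- real N)" if "vs \<in> Ls" for vs x
  proof -
    have "C vs \<le> \<bar>C vs\<bar>" by simp
    also have "\<dots> \<le> (\<Sum>vs\<in>Ls. \<bar>C vs\<bar>)" using fin that by (intro member_le_sum) auto
    finally show ?thesis
      by (intro order_trans[OF C[OF that] mult_right_mono]) auto
  qed
  then have "dbound (\<lambda>_ _. 1) UNIV k (\<Sum>vs\<in>Ls. \<bar>C vs\<bar>) (\<lambda>x. jbracket x powr (- real N)) u"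
    by (intro dbound_lists) (use assms(1) in \<open>auto simp: smooth_on_diff_on Ls_def map_replicate_const\<close>)
  then show "\<exists>C\<ge>0. dbound (\<lambda>_ _. 1) UNIV k C (\<lambda>x. jbracket x powr (- real N)) u"
    by (intro exI[of _ "\<Sum>vs\<in>Ls. \<bar>C vs\<bar>"]) (auto intro: sum_nonneg)
qed

text \<open>Pure powers of single coordinates, which the monomials in \<open>schwartz\<close>
  provide, already control the full weight.\<close>

lemma jbracket_power_le:
  fixes x :: "real ^ 'n::finite"
  shows "jbracket x ^ N \<le> (1 + real CARD('n)) ^ N * (1 + (\<Sum>i\<in>UNIV. \<bar>x $ i\<bar> ^ N))"
proof -
  define M where "M = Max (insert 1 (range (\<lambda>i. \<bar>x $ i\<bar>)))"
  have M: "1 \<le> M" "\<bar>x $ i\<bar> \<le> M" for i unfolding M_def by (intro Max_ge; simp)+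
  have "jbracket x \<le> 1 + norm x" by (rule jbracket_le)
  also have "norm x \<le> (\<Sum>i\<in>UNIV. \<bar>x $ i\<bar>)" by (rule norm_le_l1_cart)
  also have "\<dots> \<le> (\<Sum>i\<in>(UNIV::'n set). M)" by (intro sum_mono M)
  finally have "jbracket x \<le> (1 + real CARD('n)) * M" using M(1) by (simp add: algebra_simps)
  then have "jbracket x ^ N \<le> ((1 + real CARD('n)) * M) ^ N" by (intro power_mono) auto
  also have "\<dots> = (1 + real CARD('n)) ^ N * M ^ N" by (simp add: power_mult_distrib)
  also have "M ^ N \<le> 1 + (\<Sum>i\<in>UNIV. \<bar>x $ i\<bar> ^ N)"
  proof -
    have "M \<in> insert 1 (range (\<lambda>i. \<bar>x $ i\<bar>))" unfolding M_def by (intro Max_in) auto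
    then show ?thesis
    proof (elim insertE)
      assume "M \<in> range (\<lambda>i. \<bar>x $ i\<bar>)"
      then obtain i where "M = \<bar>x $ i\<bar>" by auto
      then have "M ^ N \<le> (\<Sum>i\<in>UNIV. \<bar>x $ i\<bar> ^ N)"
        using member_le_sum[of i UNIV "\<lambda>i. \<bar>x $ i\<bar> ^ N"] by simp
      then show ?thesis by simp
    qed (simp add: sum_nonneg)
  qed
  finally show ?thesis by (simp add: mult_left_mono)
qed

lemma norm_mpow_le: "norm (mpow x \<alpha>) \<le> jbracket x ^ mlen \<alpha>"
proof -
  have "norm (mpow x \<alpha>) = (\<Prod>i\<in>UNIV. \<bar>x $ i\<bar> ^ \<alpha> i)"
    by (simp add: mpow_def prod_norm[symmetric] norm_power)
  also have "\<dots> \<le> (\<Prod>i\<in>UNIV. jbracket x ^ \<alpha> i)"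
    by (intro prod_mono conjI power_mono component_le_jbracket) auto
  finally show ?thesis by (simp add: mlen_def power_sum)
qed

theorem schwartz_iff: "u \<in> schwartz \<longleftrightarrow> rapid1 u"
proof
  assume u: "u \<in> schwartz"
  then have sm: "smooth_on UNIV u" by (simp add: schwartz_def smooth_iff)
  show "rapid1 u"
  proof (rule rapid1I[OF sm])
    fix vs :: "(real^'a) list" and N assume "set vs \<subseteq> Basis"
    moreover have inj: "inj (\<lambda>i::'a. axis i (1::real))" by (auto simp: inj_def axis_eq_axis)
    ultimately obtain \<beta> where \<beta>: "mset vs = mset (mlist (\<lambda>i::'a. axis i (1::real)) \<beta>)"
      using mset_mlist_single[of vs "\<lambda>i. axis i 1"] by (auto simp: Basis_axis)
    have e: "foldr dir_deriv vs u x = pd \<beta> u x" for x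
      unfolding pd_def mderiv_mlist by (rule foldr_dir_deriv_perm[OF open_UNIV sm UNIV_I \<beta>])
    \<comment> \<open>The multi-index with the single entry \<open>N\<close> in place
      \<open>i\<close>.\<close>
    let ?a = "\<lambda>i j. if j = i then N else (0::nat)"
    have mp: "norm (mpow x (?a i)) = \<bar>x $ i\<bar> ^ N" for i and x :: "real^'a"
      by (simp add: mpow_def prod_norm[symmetric] norm_power if_distrib cong: if_cong)
    have "\<forall>i. \<exists>B. \<forall>x. norm (mpow x (?a i) * pd \<beta> u x) \<le> B"
      using u unfolding schwartz_def bounded_iff by blast
    then obtain B where B: "\<And>i x. \<bar>x $ i\<bar> ^ N * norm (pd \<beta> u x) \<le> B i"
      by (metis mp norm_mult)
    have "\<exists>B. \<forall>x. norm (mpow x (\<lambda>_. 0) * pd \<beta> u x) \<le> B"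
      using u unfolding schwartz_def bounded_iff by blast
    then obtain B0 where B0: "\<And>x. norm (pd \<beta> u x) \<le> B0" by (auto simp: mpow_def)
    have "norm (foldr dir_deriv vs u x) \<le> (1 + real CARD('a)) ^ N * (B0 + (\<Sum>i\<in>UNIV. B i)) * jbracket x powr (- real N)" for x
    proof -
      have "jbracket x ^ N * norm (pd \<beta> u x) \<le> (1 + real CARD('a)) ^ N * (1 + (\<Sum>i\<in>UNIV. \<bar>x $ i\<bar> ^ N)) * norm (pd \<beta> u x)"
        by (intro mult_right_mono jbracket_power_le) auto
      also have "\<dots> = (1 + real CARD('a)) ^ N * (norm (pd \<beta> u x) + (\<Sum>i\<in>UNIV. \<bar>x $ i\<bar> ^ N * norm (pd \<beta> u x)))"
        by (simp add: algebra_simps sum_distrib_left)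
      also have "\<dots> \<le> (1 + real CARD('a)) ^ N * (B0 + (\<Sum>i\<in>UNIV. B i))"
        by (intro mult_left_mono add_mono sum_mono B B0) auto
      finally have "norm (pd \<beta> u x) \<le> (1 + real CARD('a)) ^ N * (B0 + (\<Sum>i\<in>UNIV. B i)) / jbracket x ^ N"
        by (simp add: pos_le_divide_eq mult.commute)
      then show ?thesis by (simp add: e powr_minus powr_realpow divide_inverse)
    qed
    then show "\<exists>C. \<forall>x. norm (foldr dir_deriv vs u x) \<le> C * jbracket x powr (- real N)" by blast
  qed
next
  assume u: "rapid1 u"
  have "bounded (range (\<lambda>x. mpow x \<alpha> * pd \<beta> u x))" for \<alpha> \<beta>
  proof -
    obtain C where C: "C \<ge> 0" "dbound (\<lambda>_ _. 1) UNIV (mlen \<beta>) C (\<lambda>x. jbracket x powr (- real (mlen \<alpha>))) u"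
      using u unfolding rapid1_def by blast
    have "norm (mpow x \<alpha> * pd \<beta> u x) \<le> C" for x
    proof -
      have s: "set (mlist (\<lambda>i::'a. axis i (1::real)) \<beta>) \<subseteq> Basis" using set_mlist by (fastforce simp: Basis_axis)
      have "norm (pd \<beta> u x) \<le> C * jbracket x powr (- real (mlen \<alpha>))"
        using dbound_foldr[OF C(2) _ s, of x] unfolding pd_def mderiv_mlist by (simp add: map_replicate_const)
      then have "norm (mpow x \<alpha>) * norm (pd \<beta> u x) \<le> jbracket x ^ mlen \<alpha> * (C * jbracket x powr (- real (mlen \<alpha>)))"
        by (intro mult_mono norm_mpow_le) auto
      also have "\<dots> = C" by (simp add: powr_minus powr_realpow field_simps)
      finally show ?thesis by (simp add: norm_mult)
    qed
    then show ?thesis unfolding bounded_iff by blast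
  qed
  then show "u \<in> schwartz" using rapid1_smooth[OF u] by (auto simp: schwartz_def smooth_iff)
qed

section \<open>Smooth bump functions and the space \<open>E_space\<close>\<close>

text \<open>The family of functions \<open>exp (- 1 / t) / t ^ j\<close>, extended by 0. All
  \<open>j\<close> are taken together because differentiation maps each member to a combination of
  two others, so smoothness is one induction for the family.\<close>

definition flat :: "nat \<Rightarrow> real \<Rightarrow> real" where
  "flat j t = (if 0 < t then inverse t ^ j * exp (- inverse t) else 0)"

lemma power_le_exp:
  fixes s :: real assumes "0 \<le> s" shows "s ^ N \<le> real (Suc N) ^ N * exp s"
proof -
  have "s / real (Suc N) \<le> exp (s / real (Suc N))" using exp_ge_add_one_self[of "s / real (Suc N)"] by linarith
  then have "s \<le> real (Suc N) * exp (s / real (Suc N))" by (simp add: divide_le_eq mult.commute del: of_nat_Suc)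
  then have "s ^ N \<le> (real (Suc N) * exp (s / real (Suc N))) ^ N" using assms by (rule power_mono)
  also have "\<dots> = real (Suc N) ^ N * exp (real N * (s / real (Suc N)))"
    by (simp only: power_mult_distrib exp_of_nat_mult)
  also have "\<dots> \<le> real (Suc N) ^ N * exp s"
  proof -
    have "real N * (s / real (Suc N)) \<le> real (Suc N) * (s / real (Suc N))" using assms by (intro mult_right_mono) auto
    also have "\<dots> = s" by (simp del: of_nat_Suc)
    finally show ?thesis by (intro mult_left_mono) auto
  qed
  finally show ?thesis .
qed

text \<open>A quadratic bound at 0 suffices: it forces the derivative there to vanish, and induction
  over the family does the rest.\<close>

lemma flat_le: "\<exists>C\<ge>0. \<forall>t. \<bar>flat j t\<bar> \<le> C * t\<^sup>2"
proof (intro exI conjI allI)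
  let ?C = "real (Suc (j + 2)) ^ (j + 2)"
  show "0 \<le> ?C" by simp
  fix t
  show "\<bar>flat j t\<bar> \<le> ?C * t\<^sup>2"
  proof (cases "0 < t")
    case True
    have "inverse t ^ (j + 2) * exp (- inverse t) \<le> ?C * exp (inverse t) * exp (- inverse t)"
      using True power_le_exp[of "inverse t" "j + 2"] by (intro mult_right_mono) auto
    also have "\<dots> = ?C" by (simp add: exp_minus)
    finally have "inverse t ^ (j + 2) * exp (- inverse t) * t\<^sup>2 \<le> ?C * t\<^sup>2" by (rule mult_right_mono) simp
    also have "inverse t ^ (j + 2) * exp (- inverse t) * t\<^sup>2 = flat j t"
      using True by (simp add: flat_def power_add power2_eq_square field_simps)
    finally show ?thesis using True by (simp add: flat_def)
  qed (simp add: flat_def)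
qed

lemma DERIV_flat: "(flat j has_real_derivative (- real j * flat (Suc j) t + flat (Suc (Suc j)) t)) (at t)"
proof -
  consider "t > 0" | "t < 0" | "t = 0" by linarith
  then show ?thesis
  proof cases
    case 1
    have "((\<lambda>t. inverse t ^ j * exp (- inverse t)) has_real_derivative (- real j * flat (Suc j) t + flat (Suc (Suc j)) t)) (at t)"
    proof -
      have t: "t \<noteq> 0" using 1 by simp
      have a: "((\<lambda>t. inverse t ^ j) has_real_derivative (- real j * inverse t ^ Suc j)) (at t)"
        by (rule DERIV_cong[OF DERIV_power[OF DERIV_inverse[OF t], of j]]) (cases j, auto simp: algebra_simps)
      have b: "((\<lambda>t. exp (- inverse t)) has_real_derivative (exp (- inverse t) * inverse t ^ 2)) (at t)"
        by (rule DERIV_cong[OF DERIV_chain2[OF DERIV_exp DERIV_minus[OF DERIV_inverse[OF t]]]]) (simp add: numeral_2_eq_2)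
      show ?thesis
        by (rule DERIV_cong[OF DERIV_mult[OF a b]]) (use 1 in \<open>simp add: flat_def power2_eq_square mult_ac\<close>)
    qed
    then show ?thesis
      by (rule has_field_derivative_transform_within_open[of _ _ _ "{0<..}"]) (use 1 in \<open>auto simp: flat_def\<close>)
  next
    case 2
    have "((\<lambda>t. 0) has_real_derivative 0) (at t)" by simp
    then have "(flat j has_real_derivative 0) (at t)"
      by (rule has_field_derivative_transform_within_open[of _ _ _ "{..<0}"]) (use 2 in \<open>auto simp: flat_def\<close>)
    then show ?thesis using 2 by (simp add: flat_def)
  next
    case 3
    obtain C where C: "C \<ge> 0" "\<And>t. \<bar>flat j t\<bar> \<le> C * t\<^sup>2" using flat_le by blast
    have "((\<lambda>h. flat j h / h) \<longlongrightarrow> 0) (at 0)"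
    proof (rule Lim_null_comparison)
      show "\<forall>\<^sub>F h in at 0. norm (flat j h / h) \<le> C * \<bar>h\<bar>"
        using C(2) by (auto simp: eventually_at_filter divide_le_eq power2_eq_square abs_mult[symmetric] mult.assoc intro!: always_eventually)
      show "((\<lambda>h. C * \<bar>h\<bar>) \<longlongrightarrow> 0) (at 0)" by (auto intro!: tendsto_eq_intros)
    qed
    then show ?thesis using 3 by (simp add: DERIV_def flat_def)
  qed
qed

lemma dir_deriv_of_DERIV:
  assumes "(f has_real_derivative d) (at t)"
  shows "(\<lambda>t. complex_of_real (f t)) differentiable (at t)" "dir_deriv 1 (\<lambda>t. complex_of_real (f t)) t = complex_of_real d"
proof -
  have D: "((\<lambda>t. complex_of_real (f t)) has_derivative (\<lambda>h. complex_of_real (d * h))) (at t)"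
    using assms unfolding has_field_derivative_def by (rule has_derivative_of_real)
  then show "(\<lambda>t. complex_of_real (f t)) differentiable (at t)" by (auto simp: differentiable_def)
  show "dir_deriv 1 (\<lambda>t. complex_of_real (f t)) t = complex_of_real d" using dir_deriv_eq[OF D] by simp
qed

lemma diff_on_flat: "diff_on k UNIV (\<lambda>t. complex_of_real (flat j t))"
proof (induction k arbitrary: j)
  case (Suc k)
  have "dir_deriv 1 (\<lambda>t. complex_of_real (flat j t)) =
      (\<lambda>t. complex_of_real (- real j) * complex_of_real (flat (Suc j) t) + complex_of_real (flat (Suc (Suc j)) t))"
    using dir_deriv_of_DERIV(2)[OF DERIV_flat] by auto
  moreover have "diff_on k UNIV (\<lambda>t. complex_of_real (- real j) * complex_of_real (flat (Suc j) t) + complex_of_real (flat (Suc (Suc j)) t))"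
    by (intro diff_on_add diff_on_cmult Suc.IH open_UNIV)
  ultimately have "diff_on k UNIV (dir_deriv 1 (\<lambda>t. complex_of_real (flat j t)))" by (simp only:)
  then show ?case
    using dir_deriv_of_DERIV(1)[OF DERIV_flat] unfolding diff_on_Suc by simp
qed simp

lemma smooth_on_of_real_inner: "diff_on k U (\<lambda>x::'a::euclidean_space. complex_of_real (x \<bullet> b))"
proof (cases k)
  case (Suc k')
  have bl: "bounded_linear (\<lambda>x::'a. complex_of_real (x \<bullet> b))"
    by (intro bounded_linear_compose[OF bounded_linear_of_real] bounded_linear_inner_left)
  show ?thesis
    unfolding Suc diff_on_Suc using dir_deriv_linear[OF bl] bounded_linear_imp_differentiable[OF bl] by simp
qed simp

lemma diff_on_norm_sq: "diff_on k UNIV (\<lambda>x::'a::euclidean_space. complex_of_real (c * (norm (x - a))\<^sup>2 + d))"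
proof -
  have e: "(norm (x - a))\<^sup>2 = (\<Sum>b\<in>Basis. ((x \<bullet> b) - (a \<bullet> b))\<^sup>2)" for x
    unfolding power2_norm_eq_inner by (subst euclidean_inner) (simp add: power2_eq_square inner_diff_left)
  have "diff_on k UNIV (\<lambda>x. complex_of_real c * (\<Sum>b\<in>Basis. (complex_of_real (x \<bullet> b) + - complex_of_real (a \<bullet> b))\<^sup>2) + complex_of_real d)"
    by (intro diff_on_add diff_on_cmult diff_on_sum diff_on_power smooth_on_of_real_inner diff_on_const open_UNIV)
  then show ?thesis unfolding e by simp
qed

text \<open>Composing with the squared distance, a polynomial, avoids the singularity of the norm at
  the centre.\<close>

definition bump :: "'a::euclidean_space \<Rightarrow> real \<Rightarrow> 'a \<Rightarrow> real" where
  "bump a r x = flat 0 (r\<^sup>2 - (norm (x - a))\<^sup>2)"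

lemma smooth_on_bump: "smooth_on UNIV (\<lambda>x. complex_of_real (bump a r x))"
  unfolding smooth_on_diff_on bump_def
  using diff_on_compose_real[OF open_UNIV diff_on_norm_sq[of _ "-1" a "r\<^sup>2"] subset_UNIV diff_on_flat[of _ 0]]
  by simp

lemma bump_nonneg: "0 \<le> bump a r x"
  by (simp add: bump_def flat_def)

lemma bump_pos: "norm (x - a) < r \<Longrightarrow> 0 < bump a r x"
proof -
  assume "norm (x - a) < r"
  then have "(norm (x - a))\<^sup>2 < r\<^sup>2" by (intro power_strict_mono) auto
  then show ?thesis by (simp add: bump_def flat_def)
qed

lemma bump_zero: "0 < r \<Longrightarrow> x \<notin> cball a r \<Longrightarrow> bump a r x = 0"
proof -
  assume "0 < r" "x \<notin> cball a r"
  then have "r\<^sup>2 < (norm (x - a))\<^sup>2" by (intro power_strict_mono) (auto simp: dist_norm norm_minus_commute)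
  then show ?thesis by (simp add: bump_def flat_def)
qed

lemma bump_test_fun: "0 < r \<Longrightarrow> (\<lambda>x. complex_of_real (bump a r x)) \<in> test_fun"
  unfolding test_fun_def by (auto simp: smooth_iff smooth_on_bump bump_zero intro!: exI[of _ "cball a r"])

lemma rapid1_compact_support:
  fixes u :: "real ^ 'n::finite \<Rightarrow> complex"
  assumes "smooth_on UNIV u" "compact K" "\<And>x. x \<notin> K \<Longrightarrow> u x = 0"
  shows "rapid1 u"
proof (rule rapid1I[OF assms(1)])
  fix vs :: "(real^'n) list" and N assume "set vs \<subseteq> Basis"
  let ?D = "foldr dir_deriv vs u"
  have z: "?D x = 0" if "x \<notin> K" for x
  proof -
    have "open (- K)" using assms(2) by (simp add: compact_imp_closed open_Compl)
    then have "foldr dir_deriv vs u y = 0" if "y \<in> - K" for y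
      using that
    proof (induction vs arbitrary: y)
      case (Cons v vs)
      have "dir_deriv v (foldr dir_deriv vs u) y = dir_deriv v (\<lambda>x. 0) y"
        by (rule dir_deriv_cong[OF \<open>open (- K)\<close> Cons.prems(2)]) (use Cons in auto)
      then show ?case by simp
    qed (use assms(3) in auto)
    then show ?thesis using that by simp
  qed
  have "continuous_on UNIV ?D"
    by (rule smooth_on_continuous[OF smooth_on_foldr[OF open_UNIV assms(1)]])
  then have "compact ((\<lambda>x. norm (?D x) * jbracket x powr real N) ` K)"
    by (intro compact_continuous_image assms(2) continuous_intros) (auto elim: continuous_on_subset)
  then have "bdd_above ((\<lambda>x. norm (?D x) * jbracket x powr real N) ` K)"
    by (intro bounded_imp_bdd_above compact_imp_bounded)
  then obtain C where C: "\<And>x. x \<in> K \<Longrightarrow> norm (?D x) * jbracket x powr real N \<le> C"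
    by (auto simp: bdd_above_def)
  have "norm (?D x) \<le> \<bar>C\<bar> * jbracket x powr (- real N)" for x
  proof (cases "x \<in> K")
    case True
    then have "norm (?D x) * jbracket x powr real N \<le> \<bar>C\<bar>" using C[of x] by linarith
    then have "norm (?D x) \<le> \<bar>C\<bar> / jbracket x powr real N" by (simp add: pos_le_divide_eq)
    then show ?thesis by (simp add: powr_minus divide_inverse)
  qed (simp add: z)
  then show "\<exists>C. \<forall>x. norm (?D x) \<le> C * jbracket x powr (- real N)" by blast
qed

lemma test_fun_rapid1: "\<phi> \<in> test_fun \<Longrightarrow> rapid1 \<phi>"
  unfolding test_fun_def using rapid1_compact_support by (auto simp: smooth_iff)

lemma test_fun_mult:
  assumes "smooth_on UNIV u" "\<phi> \<in> test_fun" shows "(\<lambda>x. u x * \<phi> x) \<in> test_fun"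
proof -
  obtain K where K: "smooth_on UNIV \<phi>" "compact K" "\<And>x. x \<notin> K \<Longrightarrow> \<phi> x = 0"
    using assms by (auto simp: test_fun_def smooth_iff)
  have "smooth_on UNIV (\<lambda>x. u x * \<phi> x)"
    using assms(1) K(1) diff_on_mult[OF open_UNIV, of _ u \<phi>] unfolding smooth_on_diff_on by blast
  with K show ?thesis by (auto simp: test_fun_def smooth_iff)
qed

lemma test_fun_deriv:
  assumes "\<phi> \<in> test_fun" shows "dir_deriv v \<phi> \<in> test_fun"
proof -
  obtain K where K: "smooth_on UNIV \<phi>" "compact K" "\<And>x. x \<notin> K \<Longrightarrow> \<phi> x = 0"
    using assms by (auto simp: test_fun_def smooth_iff)
  have o: "open (- K)" using K(2) by (simp add: compact_imp_closed open_Compl)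
  have "dir_deriv v \<phi> x = 0" if "x \<notin> K" for x
    using dir_deriv_cong[OF o, of x \<phi> "\<lambda>x. 0" v] that K(3) by simp
  then show ?thesis using K smooth_on_dir_deriv[OF open_UNIV K(1)] by (auto simp: test_fun_def smooth_iff)
qed

section \<open>From weak derivatives to classical bounds\<close>

text \<open>Testing against a nonnegative bump concentrated where \<open>f\<close> is close to
  \<open>f a\<close> compares \<open>f a\<close> with an average of \<open>v\<close>. With
  \<open>v\<close> equal to 0 this is also the uniqueness statement used for symbols.\<close>

lemma weak_bound:
  fixes f v :: "real ^ 'n::finite \<Rightarrow> complex"
  assumes f: "continuous_on UNIV f" and v: "v \<in> borel_measurable lborel" "AE x in lborel. norm (v x) \<le> C"
    and eq: "\<And>\<phi>. \<phi> \<in> test_fun \<Longrightarrow> (LINT x|lborel. f x * \<phi> x) = (LINT x|lborel. v x * \<phi> x)"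
  shows "norm (f a) \<le> C"
proof (rule ccontr)
  assume "\<not> norm (f a) \<le> C"
  \<comment> \<open>Half the supposed excess: the oscillation of \<open>f\<close> on the support
    costs one \<open>\<delta>\<close>, so the argument ends in
    \<open>C + 2 * \<delta> \<le> C + \<delta>\<close>.\<close>
  define \<delta> where "\<delta> = (norm (f a) - C) / 2"
  have \<delta>: "\<delta> > 0" "C + 2 * \<delta> = norm (f a)" using \<open>\<not> norm (f a) \<le> C\<close> by (auto simp: \<delta>_def field_simps)
  have "isCont f a" using f by (simp add: continuous_on_eq_continuous_at)
  then obtain r0 where r0: "r0 > 0" "\<And>x. dist x a < r0 \<Longrightarrow> dist (f x) (f a) < \<delta>"
    using \<delta>(1) unfolding continuous_at_eps_delta by blast
  define r where "r = r0 / 2"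
  have r: "r > 0" "\<And>x. x \<in> cball a r \<Longrightarrow> norm (f x - f a) \<le> \<delta>"
    using r0 by (auto simp: r_def dist_commute dist_norm[symmetric] intro!: less_imp_le)
  let ?\<beta> = "bump a r" and ?\<phi> = "\<lambda>x. complex_of_real (bump a r x)"
  have \<phi>: "?\<phi> \<in> test_fun" by (rule bump_test_fun[OF r(1)])
  have i\<phi>: "integrable lborel ?\<phi>" by (rule rapid1_integrable[OF test_fun_rapid1[OF \<phi>]])
  then have i\<beta>: "integrable lborel ?\<beta>" using integrable_Re[OF i\<phi>] by simp
  have m\<phi>: "?\<phi> \<in> borel_measurable borel" using borel_measurable_integrable[OF i\<phi>] by simp
  have pos: "(LINT x|lborel. ?\<beta> x) > 0"
  proof -
    have "(LINT x|lborel. ?\<beta> x) \<noteq> 0"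
    proof
      assume "(LINT x|lborel. ?\<beta> x) = 0"
      then have "AE x in lborel. ?\<beta> x = 0"
        using integral_nonneg_eq_0_iff_AE[OF i\<beta>] bump_nonneg by auto
      then have "AE x in lborel. x \<notin> ball a r"
        by eventually_elim (use bump_pos[of _ a r] in \<open>fastforce simp: dist_norm norm_minus_commute\<close>)
      then have "emeasure lborel (ball a r) = 0"
        by (subst (asm) AE_iff_measurable[of "ball a r"]) auto
      then show False using content_ball_pos[OF r(1), of a] by (simp add: measure_def)
    qed
    moreover have "(LINT x|lborel. ?\<beta> x) \<ge> 0" by (intro Bochner_Integration.integral_nonneg bump_nonneg)
    ultimately show ?thesis by simp
  qed
  have bf: "norm ((f x - f a) * ?\<phi> x) \<le> \<delta> * ?\<beta> x" for x
  proof (cases "x \<in> cball a r")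
    case True
    then show ?thesis using r(2)[OF True] bump_nonneg[of a r x] by (simp add: norm_mult mult_right_mono)
  qed (simp add: bump_zero[OF r(1)])
  have mf: "f \<in> borel_measurable borel" by (rule borel_measurable_continuous_onI[OF f])
  have if1: "integrable lborel (\<lambda>x. (f x - f a) * ?\<phi> x)"
    by (rule Bochner_Integration.integrable_bound[of _ "\<lambda>x. \<delta> * ?\<beta> x"])
      (use i\<beta> mf m\<phi> in \<open>auto intro!: AE_I2 order_trans[OF bf abs_ge_self]\<close>)
  have fa: "integrable lborel (\<lambda>x. f a * ?\<phi> x)" using i\<phi> by simp
  have "(LINT x|lborel. f x * ?\<phi> x) = (LINT x|lborel. (f x - f a) * ?\<phi> x + f a * ?\<phi> x)"
    by (simp add: algebra_simps)
  also have "\<dots> = (LINT x|lborel. (f x - f a) * ?\<phi> x) + f a * (LINT x|lborel. ?\<phi> x)"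
    using if1 fa by simp
  finally have e1: "f a * (LINT x|lborel. ?\<phi> x) = (LINT x|lborel. v x * ?\<phi> x) - (LINT x|lborel. (f x - f a) * ?\<phi> x)"
    using eq[OF \<phi>] by (simp add: algebra_simps)
  have n1: "norm (LINT x|lborel. (f x - f a) * ?\<phi> x) \<le> \<delta> * (LINT x|lborel. ?\<beta> x)"
  proof -
    have "norm (LINT x|lborel. (f x - f a) * ?\<phi> x) \<le> (LINT x|lborel. norm ((f x - f a) * ?\<phi> x))" by simp
    also have "\<dots> \<le> (LINT x|lborel. \<delta> * ?\<beta> x)"
      by (intro integral_mono bf integrable_norm if1) (use i\<beta> in simp)
    finally show ?thesis by simp
  qed
  have n2: "norm (LINT x|lborel. v x * ?\<phi> x) \<le> C * (LINT x|lborel. ?\<beta> x)"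
  proof -
    have av: "AE x in lborel. norm (v x * ?\<phi> x) \<le> C * ?\<beta> x"
      using v(2) by eventually_elim (simp add: norm_mult bump_nonneg mult_right_mono)
    have iv: "integrable lborel (\<lambda>x. v x * ?\<phi> x)"
    proof (rule Bochner_Integration.integrable_bound[of _ "\<lambda>x. C * ?\<beta> x"])
      show "AE x in lborel. norm (v x * ?\<phi> x) \<le> norm (C * ?\<beta> x)"
        using av by eventually_elim (rule order_trans, assumption, simp)
    qed (use i\<beta> v(1) m\<phi> in auto)
    have "norm (LINT x|lborel. v x * ?\<phi> x) \<le> (LINT x|lborel. norm (v x * ?\<phi> x))" by simp
    also have "\<dots> \<le> (LINT x|lborel. C * ?\<beta> x)"
      by (intro integral_mono_AE integrable_norm iv av) (use i\<beta> in simp)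
    finally show ?thesis by simp
  qed
  have "norm (f a) * (LINT x|lborel. ?\<beta> x) = norm (f a * (LINT x|lborel. ?\<phi> x))"
    using pos by (simp add: norm_mult integral_complex_of_real)
  also have "\<dots> \<le> C * (LINT x|lborel. ?\<beta> x) + \<delta> * (LINT x|lborel. ?\<beta> x)"
    unfolding e1 by (rule order_trans[OF norm_triangle_ineq4 add_mono[OF n2 n1]])
  finally have "norm (f a) \<le> C + \<delta>" using pos by (simp add: distrib_right[symmetric])
  then show False using \<delta> by linarith
qed

lemma integral_by_parts:
  fixes u :: "real ^ 'n::finite \<Rightarrow> complex"
  assumes "smooth_on UNIV u" "\<phi> \<in> test_fun" "b \<in> Basis"
  shows "(LINT x|lborel. u x * dir_deriv b \<phi> x) = - (LINT x|lborel. dir_deriv b u x * \<phi> x)"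
proof -
  have t: "(\<lambda>x. u x * \<phi> x) \<in> test_fun" by (rule test_fun_mult[OF assms(1,2)])
  obtain C where C: "dbound (\<lambda>_ _. 1) UNIV 1 C (\<lambda>x. jbracket x powr (- real (2 * CARD('n)))) (\<lambda>x. u x * \<phi> x)"
    using test_fun_rapid1[OF t] unfolding rapid1_def by blast
  have D: "dir_deriv b (\<lambda>x. u x * \<phi> x) = (\<lambda>x. dir_deriv b u x * \<phi> x + u x * dir_deriv b \<phi> x)"
    by (intro ext dir_deriv_mult)
      (use assms in \<open>auto simp: test_fun_def smooth_iff intro: smooth_on_differentiable\<close>)
  have "(LINT x|lborel. dir_deriv b u x * \<phi> x + u x * dir_deriv b \<phi> x) = 0"
    using integral_dir_deriv(2)[OF C _ assms(3)] by (simp add: D)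
  moreover have "integrable lborel (\<lambda>x. dir_deriv b u x * \<phi> x)" "integrable lborel (\<lambda>x. u x * dir_deriv b \<phi> x)"
    by (intro rapid1_integrable test_fun_rapid1 test_fun_mult test_fun_deriv smooth_on_dir_deriv open_UNIV assms)+
  ultimately show ?thesis by (simp add: add_eq_0_iff2 add.commute)
qed

lemma integral_by_parts_list:
  fixes u :: "real ^ 'n::finite \<Rightarrow> complex"
  assumes "smooth_on UNIV u" "\<phi> \<in> test_fun" "set vs \<subseteq> Basis"
  shows "(LINT x|lborel. u x * foldr dir_deriv vs \<phi> x) = (-1) ^ length vs * (LINT x|lborel. foldr dir_deriv (rev vs) u x * \<phi> x)"
  using assms(1,3)
proof (induction vs arbitrary: u)
  case (Cons v vs)
  have t: "foldr dir_deriv vs \<phi> \<in> test_fun" by (induction vs) (auto intro: assms(2) test_fun_deriv)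
  have "(LINT x|lborel. u x * dir_deriv v (foldr dir_deriv vs \<phi>) x) = - (LINT x|lborel. dir_deriv v u x * foldr dir_deriv vs \<phi> x)"
    by (rule integral_by_parts) (use Cons.prems t in auto)
  also have "(LINT x|lborel. dir_deriv v u x * foldr dir_deriv vs \<phi> x) = (-1) ^ length vs * (LINT x|lborel. foldr dir_deriv (rev vs) (dir_deriv v u) x * \<phi> x)"
    by (rule Cons.IH) (use Cons.prems in \<open>auto intro: smooth_on_dir_deriv\<close>)
  finally show ?case by simp
qed simp

text \<open>Membership only supplies bounded weak derivatives. Integration by parts shows that the
  classical derivative represents the same functional, and \<open>weak_bound\<close> turns the
  essential bound into a pointwise one.\<close>

lemma E_space_bounded:
  fixes u :: "real ^ 'n::finite \<Rightarrow> complex"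
  assumes "u \<in> E_space" shows "\<exists>C. dbound (\<lambda>_ _. 1) UNIV k C (\<lambda>_. 1) u"
proof -
  have sm: "smooth_on UNIV u" using assms by (simp add: E_space_def smooth_iff)
  have inj: "inj (\<lambda>i::'n. axis i (1::real))" by (auto simp: inj_def axis_eq_axis)
  have "\<exists>C. \<forall>x. norm (foldr dir_deriv vs u x) \<le> C" if vs: "set vs \<subseteq> Basis" for vs
  proof -
    obtain \<alpha> where \<alpha>: "mset vs = mset (mlist (\<lambda>i::'n. axis i (1::real)) \<alpha>)"
      using mset_mlist_single[of vs "\<lambda>i. axis i 1"] inj vs by (auto simp: Basis_axis)
    let ?as = "mlist (\<lambda>i::'n. axis i (1::real)) \<alpha>"
    have as: "set ?as \<subseteq> Basis" using \<alpha> vs by (metis mset_eq_setD)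
    have "u \<in> Winf (mlen \<alpha>)" using assms by (simp add: E_space_def)
    then obtain v where v: "v \<in> Linf" "weak_deriv \<alpha> u v" by (auto simp: Winf_def)
    then obtain C where C: "AE x in lborel. norm (v x) \<le> C" by (auto simp: Linf_def)
    have "norm (foldr dir_deriv vs u x) \<le> C" for x
    proof (rule weak_bound[OF _ _ C])
      show "continuous_on UNIV (foldr dir_deriv vs u)"
        by (rule smooth_on_continuous[OF smooth_on_foldr[OF open_UNIV sm]])
      show "v \<in> borel_measurable lborel" using v(1) by (simp add: Linf_def)
      fix \<phi> :: "real^'n \<Rightarrow> complex" assume \<phi>: "\<phi> \<in> test_fun"
      have "(-1) ^ mlen \<alpha> * (LINT x|lborel. v x * \<phi> x) = (LINT x|lborel. u x * pd \<alpha> \<phi> x)"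
        using v(2) \<phi> by (simp add: weak_deriv_def)
      also have "\<dots> = (-1) ^ mlen \<alpha> * (LINT x|lborel. foldr dir_deriv (rev ?as) u x * \<phi> x)"
        unfolding pd_def mderiv_mlist using integral_by_parts_list[OF sm \<phi> as] by simp
      finally have "(LINT x|lborel. v x * \<phi> x) = (LINT x|lborel. foldr dir_deriv (rev ?as) u x * \<phi> x)" by simp
      moreover have "foldr dir_deriv (rev ?as) u = foldr dir_deriv vs u"
        by (intro ext foldr_dir_deriv_perm[OF open_UNIV sm UNIV_I]) (simp add: \<alpha>)
      ultimately show "(LINT x|lborel. foldr dir_deriv vs u x * \<phi> x) = (LINT x|lborel. v x * \<phi> x)" by simp
    qed
    then show ?thesis by blast
  qed
  then have "\<forall>vs\<in>{vs. set vs \<subseteq> Basis \<and> length vs \<le> k}. \<exists>C. \<forall>x. norm (foldr dir_deriv vs u x) \<le> C" by blast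
  from bchoice[OF this] obtain C where C: "\<And>vs x. set vs \<subseteq> Basis \<Longrightarrow> length vs \<le> k \<Longrightarrow> norm (foldr dir_deriv vs u x) \<le> C vs"
    by blast
  define Ls where "Ls = {vs::(real ^ 'n) list. set vs \<subseteq> Basis \<and> length vs \<le> k}"
  have fin: "finite Ls" unfolding Ls_def by (rule finite_lists_length_le) simp
  have "norm (foldr dir_deriv vs u x) \<le> (\<Sum>vs\<in>Ls. \<bar>C vs\<bar>)" if "vs \<in> Ls" for vs x
  proof -
    have "C vs \<le> \<bar>C vs\<bar>" by simp
    also have "\<dots> \<le> (\<Sum>vs\<in>Ls. \<bar>C vs\<bar>)" using fin that by (intro member_le_sum) auto
    finally show ?thesis using that C[of vs x] by (simp add: Ls_def)
  qed
  then have "dbound (\<lambda>_ _. 1) UNIV k (\<Sum>vs\<in>Ls. \<bar>C vs\<bar>) (\<lambda>x. 1) u"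
    by (intro dbound_lists) (use sm in \<open>auto simp: smooth_on_diff_on Ls_def map_replicate_const\<close>)
  then show ?thesis by blast
qed

section \<open>Operators, their symbols, and composition with differential operators\<close>

type_synonym 'n phase = "(real ^ 'n) \<times> (real ^ 'n)"

text \<open>Symbols of order \<open>s\<close> without gain under differentiation. The class contains
  the usual symbols and is closed under products, derivatives and the compositions below.\<close>

definition psym :: "real \<Rightarrow> ('n::finite phase \<Rightarrow> complex) \<Rightarrow> bool" where
  "psym s a \<longleftrightarrow> (\<forall>k. \<exists>C\<ge>0. dbound (\<lambda>_ _. 1) UNIV k C (\<lambda>p. jbracket (snd p) powr s) a)"

lemma psym_smooth: "psym s a \<Longrightarrow> smooth_on UNIV a"
  by (rule smooth_on_dbound[of "\<lambda>_ _. 1"]) (use psym_def in blast)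

lemma psym_mono:
  assumes "psym s a" "s \<le> t" shows "psym t a"
  unfolding psym_def
proof
  fix k
  obtain C where "C \<ge> 0" "dbound (\<lambda>_ _. 1) UNIV k C (\<lambda>p. jbracket (snd p) powr s) a"
    using assms(1) unfolding psym_def by blast
  then show "\<exists>C\<ge>0. dbound (\<lambda>_ _. 1) UNIV k C (\<lambda>p. jbracket (snd p) powr t) a"
    using assms(2) by (intro exI[of _ C]) (auto elim!: dbound_weight_mono intro: jbracket_powr_mono)
qed

lemma psym_add: "psym s a \<Longrightarrow> psym s b \<Longrightarrow> psym s (\<lambda>p. a p + b p)"
  unfolding psym_def
  using dbound_add[OF open_UNIV, of "\<lambda>_ _. 1" _ _ _ a _ b] add_nonneg_nonneg by blast

lemma psym_mult:
  assumes "psym s a" "psym t b" shows "psym (s + t) (\<lambda>p. a p * b p)"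
  unfolding psym_def
proof
  fix k
  obtain C D where C: "C \<ge> 0" "dbound (\<lambda>_ _. 1) UNIV k C (\<lambda>p. jbracket (snd p) powr s) a"
    and D: "D \<ge> 0" "dbound (\<lambda>_ _. 1) UNIV k D (\<lambda>p. jbracket (snd p) powr t) b"
    using assms unfolding psym_def by blast
  show "\<exists>C\<ge>0. dbound (\<lambda>_ _. 1) UNIV k C (\<lambda>p. jbracket (snd p) powr (s + t)) (\<lambda>p. a p * b p)"
    using dbound_mult[OF open_UNIV C(2) D(2)] C(1) D(1)
    by (intro exI[of _ "2 ^ k * (C * D)"]) (simp add: powr_add)
qed

lemma psym_const: "psym 0 (\<lambda>p. c)"
  unfolding psym_def by (auto intro!: exI[of _ "norm c"] dbound_const)

lemma psym_cmult: "psym s a \<Longrightarrow> psym s (\<lambda>p. c * a p)"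
  using psym_mult[OF psym_const] by fastforce

lemma psym_sum: "(\<And>i. i \<in> I \<Longrightarrow> psym s (f i)) \<Longrightarrow> psym s (\<lambda>p. \<Sum>i\<in>I. f i p)"
proof (induction I rule: infinite_finite_induct)
  case empty
  have "dbound (\<lambda>_ _. 1) UNIV k 0 (\<lambda>p. jbracket (snd p) powr s) (\<lambda>p::'b phase. 0)" for k
    by (rule dbound_const) auto
  then show ?case unfolding psym_def by auto
next
  case (infinite I)
  have "dbound (\<lambda>_ _. 1) UNIV k 0 (\<lambda>p. jbracket (snd p) powr s) (\<lambda>p::'b phase. 0)" for k
    by (rule dbound_const) auto
  then show ?case using infinite unfolding psym_def by auto
qed (auto intro: psym_add)

lemma psym_dir_deriv: "psym s a \<Longrightarrow> b \<in> Basis \<Longrightarrow> psym s (dir_deriv b a)"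
  unfolding psym_def using dbound_one_SucD[of UNIV _ _ _ a b] by blast

lemma psym_coordinate: "b \<in> Basis \<Longrightarrow> psym 1 (\<lambda>p. complex_of_real (snd p \<bullet> b))"
  unfolding psym_def using dbound_snd_inner[of b] by (auto intro!: exI[of _ 1] simp: jbracket_nonneg)

lemma psym_rapid:
  assumes "psym s a" "rapid1 v"
  shows "rapid (\<lambda>_. 1) (\<lambda>p::'n::finite phase. a p * v (snd p))"
  unfolding rapid_def
proof (intro allI)
  fix k N
  obtain N' :: nat where N': "s + real N \<le> real N'" using real_arch_simple by blast
  have "rapid (\<lambda>_. 1) (\<lambda>p::'n phase. v (snd p))" by (rule rapid1_rapid[OF assms(2)])
  then obtain C D where C: "C \<ge> 0" "dbound (\<lambda>_ _. 1) UNIV k C (\<lambda>p. jbracket (snd p) powr s) a"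
    and D: "D \<ge> 0" "dbound (\<lambda>_ _. 1) UNIV k D (\<lambda>p::'n phase. 1 * jbracket (snd p) powr (- real N')) (\<lambda>p. v (snd p))"
    using assms(1) unfolding psym_def rapid_def by blast
  have "dbound (\<lambda>_ _. 1) UNIV k (2 ^ k * (C * D)) (\<lambda>p::'n phase. 1 * jbracket (snd p) powr (- real N)) (\<lambda>p. a p * v (snd p))"
  proof (rule dbound_weight_mono[OF dbound_mult[OF open_UNIV C(2) D(2)]])
    fix z :: "'n phase"
    have "jbracket (snd z) powr (s + - real N') \<le> jbracket (snd z) powr (- real N)"
      using N' by (intro jbracket_powr_mono) simp
    then show "jbracket (snd z) powr s * (1 * jbracket (snd z) powr (- real N')) \<le> 1 * jbracket (snd z) powr (- real N)"
      by (simp add: powr_add[symmetric])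
  qed (use C D in auto)
  then show "\<exists>C\<ge>0. dbound (\<lambda>_ _. 1) UNIV k C (\<lambda>p::'n phase. 1 * jbracket (snd p) powr (- real N)) (\<lambda>p. a p * v (snd p))"
    using C D by (intro exI[of _ "2 ^ k * (C * D)"]) auto
qed

definition pnorm :: "'n::finite itself \<Rightarrow> complex" where
  "pnorm _ = complex_of_real ((2 * pi) powr (- real CARD('n)))"

lemma pnorm_inverse: "pnorm TYPE('n::finite) * complex_of_real ((2 * pi) ^ CARD('n)) = 1"
proof -
  have "(2 * pi) powr (- real CARD('n)) * (2 * pi) ^ CARD('n) = 1"
    by (subst powr_realpow[symmetric], simp, subst powr_add[symmetric], simp)
  then show ?thesis unfolding pnorm_def of_real_mult[symmetric] by simp
qed

text \<open>The point \<open>x\<close> occurs twice, in the symbol and in the exponential; keeping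
  the two occurrences apart and restricting to the diagonal makes the estimates for
  \<open>ftr\<close> available.\<close>

lemma psdo_ftr:
  "psdo a u (x::real^'n::finite) = pnorm TYPE('n) * ftr (\<lambda>p. a p * fourier u (snd p)) (x, x)"
  by (simp add: psdo_def ftr_def pnorm_def mult.assoc)

lemma rapid1_psdo:
  assumes "psym s a" "rapid1 u" shows "rapid1 (psdo a (u :: real^'n::finite \<Rightarrow> _))"
proof -
  have "rapid (\<lambda>_. 1) (ftr (\<lambda>p::'n phase. a p * fourier u (snd p)))"
    by (intro rapid_ftr psym_rapid assms rapid1_fourier) (use assms in auto)
  then have "rapid1 (\<lambda>x. ftr (\<lambda>p. a p * fourier u (snd p)) (x, x))"
    unfolding rapid1_def by (intro allI rapid_linear) (auto intro!: linearI)
  from rapid1_cmult[OF this, of "pnorm TYPE('n)"] show ?thesis by (simp add: psdo_ftr[abs_def])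
qed

lemma psdo_integrable:
  assumes "psym s a" "rapid1 (v :: real^'n::finite \<Rightarrow> _)"
  shows "integrable lborel (\<lambda>\<xi>. exp (\<i> * complex_of_real (z \<bullet> \<xi>)) * (a (x, \<xi>) * v \<xi>))"
proof -
  obtain C where "ftr_bound (\<lambda>p. a p * v (snd p)) C (real (2 * CARD('n))) (\<lambda>_. 1) 0"
    by (rule rapid_ftr_bound[OF psym_rapid[OF assms], of "2 * CARD('n)" 0]) auto
  then interpret ftr_bound "\<lambda>p. a p * v (snd p)" C "real (2 * CARD('n))" "\<lambda>_. 1" 0 .
  show ?thesis using integrable[of z x] by simp
qed

lemma psdo_add_symbol:
  assumes "psym s a" "psym t b" "rapid1 u"
  shows "psdo (\<lambda>p. a p + b p) u x = psdo a u x + psdo b u x"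
  using psdo_integrable[OF assms(1) rapid1_fourier[OF assms(3)], of x x]
    psdo_integrable[OF assms(2) rapid1_fourier[OF assms(3)], of x x]
  by (simp add: psdo_def algebra_simps)

lemma psdo_xmult_symbol: "psdo (\<lambda>p. c (fst p) * a p) u x = c x * psdo a u x"
proof -
  have "(LINT \<xi>|lborel. exp (\<i> * complex_of_real (x \<bullet> \<xi>)) * (c x * a (x, \<xi>)) * fourier u \<xi>)
    = (LINT \<xi>|lborel. c x * (exp (\<i> * complex_of_real (x \<bullet> \<xi>)) * a (x, \<xi>) * fourier u \<xi>))"
    by (simp add: mult_ac)
  then show ?thesis by (simp add: psdo_def)
qed

lemma psdo_sum_symbol:
  assumes "\<And>i. i \<in> I \<Longrightarrow> psym s (f i)" "rapid1 u"
  shows "psdo (\<lambda>p. \<Sum>i\<in>I. f i p) u x = (\<Sum>i\<in>I. psdo (f i) u x)"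
  using assms(1)
proof (induction I rule: infinite_finite_induct)
  case (insert i I)
  have "psym s (\<lambda>p. \<Sum>i\<in>I. f i p)" by (rule psym_sum) (use insert in auto)
  from psdo_add_symbol[OF insert.prems[of i] this assms(2), where x = x] insert
  show ?case by simp
qed (simp_all add: psdo_def)

lemma fourier_add:
  assumes "rapid1 u" "rapid1 v" shows "fourier (\<lambda>x. u x + v x) \<xi> = fourier u \<xi> + fourier v \<xi>"
proof -
  have "integrable lborel (\<lambda>x. exp (- \<i> * complex_of_real (x \<bullet> \<xi>)) * u x)" if "rapid1 u" for u :: "real^'a \<Rightarrow> complex"
    using psdo_integrable[OF psym_const that, of "- \<xi>" 1] by (simp add: inner_commute)
  from this[OF assms(1)] this[OF assms(2)] show ?thesis by (simp add: fourier_def distrib_left)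
qed

lemma psdo_add:
  assumes "psym s a" "rapid1 u" "rapid1 v"
  shows "psdo a (\<lambda>x. u x + v x) x = psdo a u x + psdo a v x"
  using psdo_integrable[OF assms(1) rapid1_fourier[OF assms(2)], of x x]
    psdo_integrable[OF assms(1) rapid1_fourier[OF assms(3)], of x x]
  by (simp add: psdo_def fourier_add[OF assms(2,3)] algebra_simps)

lemma psdo_1:
  assumes "rapid1 u" shows "psdo (\<lambda>p. 1) u x = u x"
proof -
  have "psdo (\<lambda>p. 1) u x = pnorm TYPE('a) * ft (fourier u) x"
    by (simp add: psdo_def ft_def pnorm_def)
  also have "\<dots> = (pnorm TYPE('a) * complex_of_real ((2 * pi) ^ CARD('a))) * u x"
    by (simp only: ft_fourier_inverse[OF assms] mult.assoc)
  finally show ?thesis by (simp only: pnorm_inverse mult_1_left)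
qed

text \<open>The conjugate of \<open>- \<i> \<partial>\<^sub>b\<close> by \<open>exp (\<i> x \<bullet> \<xi>)\<close>.\<close>

definition Lx :: "real ^ 'n \<Rightarrow> ('n::finite phase \<Rightarrow> complex) \<Rightarrow> 'n phase \<Rightarrow> complex" where
  "Lx b a p = complex_of_real (snd p \<bullet> b) * a p + (- \<i>) * dir_deriv (b, 0) a p"

definition Dx :: "real ^ 'n::finite \<Rightarrow> (real ^ 'n \<Rightarrow> complex) \<Rightarrow> real ^ 'n \<Rightarrow> complex" where
  "Dx b v x = (- \<i>) * dir_deriv b v x"

lemma psym_Lx: assumes "psym s a" "b \<in> Basis" shows "psym (s + 1) (Lx b a)"
proof -
  have "psym (s + 1) (\<lambda>p. complex_of_real (snd p \<bullet> b) * a p)"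
    using psym_mult[OF psym_coordinate[OF assms(2)] assms(1)] by (simp add: add.commute)
  moreover have "psym (s + 1) (\<lambda>p. (- \<i>) * dir_deriv (b, 0) a p)"
    by (rule psym_mono[OF psym_cmult[OF psym_dir_deriv[OF assms(1) Basis_0_pair(2)[OF assms(2)]]]]) simp
  ultimately show ?thesis unfolding Lx_def[abs_def] by (rule psym_add)
qed

text \<open>The derivative along the diagonal is the sum of a derivative of the symbol and one of
  the exponential, the latter contributing the factor \<xi>.\<close>

lemma psdo_Lx:
  assumes "psym s a" "rapid1 (u :: real^'n::finite \<Rightarrow> _)" "b \<in> Basis"
  shows "psdo (Lx b a) u = Dx b (psdo a u)"
proof
  fix x
  let ?v = "fourier u" and ?g = "\<lambda>p. a p * fourier u (snd p)"
  have v: "rapid1 ?v" by (rule rapid1_fourier[OF assms(2)])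
  obtain C where "ftr_bound ?g C (real (2 * CARD('n) + 1)) (\<lambda>_. 1) 1"
    by (rule rapid_ftr_bound[OF psym_rapid[OF assms(1) v], of "2 * CARD('n) + 1" 1]) auto
  then interpret ftr_bound ?g C "real (2 * CARD('n) + 1)" "\<lambda>_. 1" 1 .
  have D: "ftr ?g differentiable (at p)" "dir_deriv (b, 0) (ftr ?g) p = ftr (dir_deriv (b, 0) ?g) p"
    "dir_deriv (0, b) (ftr ?g) p = ftr (\<lambda>q. \<i> * complex_of_real (snd q \<bullet> b) * ?g q) p" for p
    by (rule ftr_derivative[OF order_refl]; use assms(3) in simp)+
  have l: "linear (\<lambda>x::real^'n. (x, x))" by (auto intro!: linearI)
  have e: "psdo a u = (\<lambda>x. pnorm TYPE('n) * ftr ?g (x, x))" by (simp add: psdo_ftr[abs_def])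
  have d: "(\<lambda>x. ftr ?g (x, x)) differentiable (at x)" for x
    using differentiable_chain_at[OF linear_imp_differentiable[OF l] D(1)] by (simp add: o_def)
  have "dir_deriv b (psdo a u) x = pnorm TYPE('n) * dir_deriv b (\<lambda>x. ftr ?g (x, x)) x"
    unfolding e by (rule dir_deriv_cmult[OF d])
  also have "dir_deriv b (\<lambda>x. ftr ?g (x, x)) x = dir_deriv (b, b) (ftr ?g) (x, x)"
    using dir_deriv_affine[OF l, of b "ftr ?g" 0 x] by (simp add: zero_prod_def)
  also have "\<dots> = dir_deriv (b, 0) (ftr ?g) (x, x) + dir_deriv (0, b) (ftr ?g) (x, x)"
    using linear_add[OF linear_frechet_derivative[OF D(1)[of "(x, x)"]], of "(b, 0)" "(0, b)"]
    by (simp add: dir_deriv_frechet[OF D(1)])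
  finally have 1: "dir_deriv b (psdo a u) x = pnorm TYPE('n) * (ftr (dir_deriv (b, 0) ?g) (x, x)
     + ftr (\<lambda>q. \<i> * complex_of_real (snd q \<bullet> b) * ?g q) (x, x))"
    using D(2,3)[of "(x, x)"] by simp
  have da: "a differentiable (at p)" for p by (rule smooth_on_differentiable[OF psym_smooth[OF assms(1)] UNIV_I])
  have dv: "?v differentiable (at p)" for p by (rule smooth_on_differentiable[OF rapid1_smooth[OF v] UNIV_I])
  have dv': "(\<lambda>p::'n phase. ?v (snd p)) differentiable (at p)" for p
    using differentiable_chain_at[OF linear_imp_differentiable[OF linear_snd] dv] by (simp add: o_def)
  have z: "dir_deriv (b, 0) (\<lambda>p::'n phase. ?v (snd p)) p = 0" for p
    using dir_deriv_affine[OF linear_snd, of "(b, 0::real^'n)" ?v 0 p] by simp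
  have 2: "dir_deriv (b, 0) ?g = (\<lambda>p. dir_deriv (b, 0) a p * ?v (snd p))"
    by (rule ext, subst dir_deriv_mult[OF da dv']) (simp add: z)
  have i1: "integrable lborel (\<lambda>\<xi>. exp (\<i> * complex_of_real (x \<bullet> \<xi>)) * (dir_deriv (b, 0) a (x, \<xi>) * ?v \<xi>))"
    by (rule psdo_integrable[OF psym_dir_deriv[OF assms(1) Basis_0_pair(2)[OF assms(3)]] v])
  have i2: "integrable lborel (\<lambda>\<xi>. exp (\<i> * complex_of_real (x \<bullet> \<xi>)) * ((complex_of_real (snd (x, \<xi>) \<bullet> b) * a (x, \<xi>)) * ?v \<xi>))"
    by (rule psdo_integrable[OF psym_mult[OF psym_coordinate[OF assms(3)] assms(1)] v])
  have f2: "ftr (\<lambda>q. \<i> * complex_of_real (snd q \<bullet> b) * ?g q) (x, x)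
      = \<i> * (LINT \<xi>|lborel. exp (\<i> * complex_of_real (x \<bullet> \<xi>)) * ((complex_of_real (snd (x, \<xi>) \<bullet> b) * a (x, \<xi>)) * ?v \<xi>))"
    unfolding ftr_def by (subst integral_mult_right_zero[symmetric]) (simp add: mult_ac)
  have "ftr (\<lambda>p. Lx b a p * ?v (snd p)) (x, x) =
     (LINT \<xi>|lborel. exp (\<i> * complex_of_real (x \<bullet> \<xi>)) * ((complex_of_real (snd (x, \<xi>) \<bullet> b) * a (x, \<xi>)) * ?v \<xi>)
      + (- \<i>) * (exp (\<i> * complex_of_real (x \<bullet> \<xi>)) * (dir_deriv (b, 0) a (x, \<xi>) * ?v \<xi>)))"
    unfolding ftr_def Lx_def by (simp add: algebra_simps)
  also have "\<dots> = (LINT \<xi>|lborel. exp (\<i> * complex_of_real (x \<bullet> \<xi>)) * ((complex_of_real (snd (x, \<xi>) \<bullet> b) * a (x, \<xi>)) * ?v \<xi>))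
      + (- \<i>) * (LINT \<xi>|lborel. exp (\<i> * complex_of_real (x \<bullet> \<xi>)) * (dir_deriv (b, 0) a (x, \<xi>) * ?v \<xi>))"
    by (subst Bochner_Integration.integral_add[OF i2 integrable_mult_right[OF i1]]) simp
  also have "\<dots> = (- \<i>) * (ftr (dir_deriv (b, 0) ?g) (x, x) + ftr (\<lambda>q. \<i> * complex_of_real (snd q \<bullet> b) * ?g q) (x, x))"
    unfolding f2 2 ftr_def by (simp add: algebra_simps)
  finally show "psdo (Lx b a) u x = Dx b (psdo a u) x"
    unfolding Dx_def 1 psdo_ftr[of "Lx b a"] by (simp add: mult_ac)
qed

definition monomial :: "(real ^ 'n) list \<Rightarrow> 'n::finite phase \<Rightarrow> complex" where
  "monomial bs p = prod_list (map (\<lambda>b. complex_of_real (snd p \<bullet> b)) bs)"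

lemma monomial_Cons: "monomial (b # bs) = (\<lambda>p. complex_of_real (snd p \<bullet> b) * monomial bs p)"
  by (auto simp: monomial_def)

lemma psym_foldr_Lx: "psym s a \<Longrightarrow> set bs \<subseteq> Basis \<Longrightarrow> psym (s + real (length bs)) (foldr Lx bs a)"
proof (induction bs)
  case (Cons b bs)
  then have "psym (s + real (length bs) + 1) (Lx b (foldr Lx bs a))" by (intro psym_Lx) auto
  then show ?case by (simp add: add_ac)
qed simp

lemma psdo_foldr_Lx:
  "psym s a \<Longrightarrow> rapid1 u \<Longrightarrow> set bs \<subseteq> Basis \<Longrightarrow> psdo (foldr Lx bs a) u = foldr Dx bs (psdo a u)"
  by (induction bs) (auto simp: psdo_Lx[OF psym_foldr_Lx])

lemma dir_deriv_snd: "dir_deriv v (\<lambda>p. f (snd p)) = (\<lambda>p::'n::finite phase. dir_deriv (snd v) f (snd p))"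
  using dir_deriv_affine[OF linear_snd, of v f 0] by auto

lemma dir_deriv_fst: "dir_deriv v (\<lambda>p. f (fst p)) = (\<lambda>p::'n::finite phase. dir_deriv (fst v) f (fst p))"
  using dir_deriv_affine[OF linear_fst, of v f 0] by auto

lemma foldr_Lx_1: "foldr Lx bs (\<lambda>p. 1) = monomial bs"
proof (induction bs)
  case (Cons b bs)
  have "dir_deriv (b, 0) (monomial bs) = (\<lambda>p. 0)"
    unfolding monomial_def[abs_def] by (subst dir_deriv_snd[of _ "\<lambda>\<xi>. prod_list (map (\<lambda>b. complex_of_real (\<xi> \<bullet> b)) bs)"]) simp
  then show ?case by (simp only: foldr.simps o_def Cons) (auto simp: Lx_def monomial_Cons)
qed (simp add: monomial_def[abs_def])

text \<open>The symbol 1 gives the identity, by Fourier inversion, and \<open>Lx\<close> applied to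
  monomials only multiplies by coordinates. So a monomial operator is an iterated \<open>Dx\<close>,
  which \<open>Lx\<close> transfers to the symbol \<open>a\<close>.\<close>

lemma psdo_monomial_psdo:
  assumes "psym s a" "rapid1 u" "set bs \<subseteq> Basis"
  shows "psdo (monomial bs) (psdo a u) = psdo (foldr Lx bs a) u"
proof -
  have "psdo (monomial bs) (psdo a u) = foldr Dx bs (psdo (\<lambda>p. 1) (psdo a u))"
    unfolding foldr_Lx_1[symmetric] by (rule psdo_foldr_Lx[OF psym_const rapid1_psdo[OF assms(1,2)] assms(3)])
  also have "psdo (\<lambda>p. 1) (psdo a u) = psdo a u" by (intro ext psdo_1 rapid1_psdo[OF assms(1,2)])
  finally show ?thesis by (simp add: psdo_foldr_Lx[OF assms])
qed

section \<open>Exact composition with a differential operator on the left\<close>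

definition Dp :: "real ^ 'n \<Rightarrow> ('n::finite phase \<Rightarrow> complex) \<Rightarrow> 'n phase \<Rightarrow> complex" where
  "Dp b f z = (- \<i>) * dir_deriv (b, 0) f z"

text \<open>The factor between consecutive parts \<open>Phi\<close>. Its accumulated product 1 / k!,
  together with sums over all sequences of directions, equals the sum over multi-indices of length
  \<open>k\<close> with coefficients 1 / \<alpha>!, as in the usual composition formula.\<close>

definition cinv :: "nat \<Rightarrow> complex" where
  "cinv k = complex_of_real (1 / real (Suc k))"

lemma cinv: "cinv k * of_nat (Suc k) = 1"
  by (simp add: cinv_def del: of_nat_Suc)

text \<open>The homogeneous parts of the Taylor expansion of the symbol \<open>p\<close> in the covariable, with
  \<open>- \<i> \<partial>\<^sub>x\<close> acting on \<open>f\<close> in place of the increment.\<close>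

primrec Phi :: "nat \<Rightarrow> ('n::finite phase \<Rightarrow> complex) \<Rightarrow> ('n phase \<Rightarrow> complex) \<Rightarrow> 'n phase \<Rightarrow> complex" where
  "Phi 0 p f = (\<lambda>z. p z * f z)"
| "Phi (Suc k) p f = (\<lambda>z. cinv k * (\<Sum>b\<in>Basis. Phi k (dir_deriv (0, b) p) (Dp b f) z))"

lemma smooth_on_cmult: "smooth_on UNIV f \<Longrightarrow> smooth_on UNIV (\<lambda>z. c * f z)"
  unfolding smooth_on_diff_on using diff_on_cmult[OF open_UNIV, of _ f c] by blast

lemma smooth_on_mult: "smooth_on UNIV f \<Longrightarrow> smooth_on UNIV g \<Longrightarrow> smooth_on UNIV (\<lambda>z. f z * g z)"
  unfolding smooth_on_diff_on using diff_on_mult[OF open_UNIV, of _ f g] by blast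

lemma smooth_on_sum: "(\<And>i. i \<in> I \<Longrightarrow> smooth_on UNIV (f i)) \<Longrightarrow> smooth_on UNIV (\<lambda>z. \<Sum>i\<in>I. f i z)"
  unfolding smooth_on_diff_on using diff_on_sum[OF open_UNIV, of I _ f] by blast

lemma smooth_differentiable: "smooth_on UNIV f \<Longrightarrow> f differentiable (at z)"
  by (erule smooth_on_differentiable) simp

lemma smooth_dir_deriv: "smooth_on UNIV f \<Longrightarrow> smooth_on UNIV (dir_deriv v f)"
  by (intro smooth_on_dir_deriv open_UNIV)

lemma smooth_Dp: "smooth_on UNIV f \<Longrightarrow> smooth_on UNIV (Dp b f)"
  unfolding Dp_def[abs_def] by (intro smooth_on_cmult smooth_dir_deriv)

lemma Dp_cmult: "smooth_on UNIV f \<Longrightarrow> Dp b (\<lambda>z. c * f z) = (\<lambda>z. c * Dp b f z)"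
  unfolding Dp_def[abs_def] by (auto simp: dir_deriv_cmult[OF smooth_differentiable])

lemma Dp_add: "smooth_on UNIV f \<Longrightarrow> smooth_on UNIV g \<Longrightarrow> Dp b (\<lambda>z. f z + g z) = (\<lambda>z. Dp b f z + Dp b g z)"
  unfolding Dp_def[abs_def] by (auto simp: dir_deriv_add[OF smooth_differentiable smooth_differentiable] algebra_simps)

lemma Dp_zero [simp]: "Dp b (\<lambda>z. 0) = (\<lambda>z. 0)"
  unfolding Dp_def[abs_def] by simp

lemma Dp_sum: "(\<And>i. i \<in> I \<Longrightarrow> smooth_on UNIV (f i)) \<Longrightarrow> Dp b (\<lambda>z. \<Sum>i\<in>I. f i z) = (\<lambda>z. \<Sum>i\<in>I. Dp b (f i) z)"
  by (induction I rule: infinite_finite_induct) (auto simp: Dp_add smooth_on_sum)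

lemma Dp_commute: "smooth_on UNIV f \<Longrightarrow> Dp b (Dp c f) = Dp c (Dp b f)"
proof
  fix z assume f: "smooth_on UNIV f"
  have "dir_deriv (b, 0) (dir_deriv (c, 0) f) z = dir_deriv (c, 0) (dir_deriv (b, 0) f) z"
    by (rule dir_deriv_commute[OF open_UNIV UNIV_I smooth_differentiable[OF f] smooth_differentiable[OF smooth_dir_deriv[OF f]] smooth_differentiable[OF smooth_dir_deriv[OF f]]])
  then show "Dp b (Dp c f) z = Dp c (Dp b f) z"
    unfolding Dp_def[abs_def] by (simp only: dir_deriv_cmult[OF smooth_differentiable[OF smooth_dir_deriv[OF f]]])
qed

lemma smooth_Phi: "smooth_on UNIV p \<Longrightarrow> smooth_on UNIV f \<Longrightarrow> smooth_on UNIV (Phi k p f)"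
proof (induction k arbitrary: p f)
  case (Suc k)
  show ?case
    unfolding Phi.simps by (intro smooth_on_cmult smooth_on_sum Suc.IH smooth_dir_deriv smooth_Dp Suc.prems)
qed (simp add: smooth_on_mult)

lemma Phi_zero [simp]: "Phi k (\<lambda>z. 0) f = (\<lambda>z. 0)"
  by (induction k arbitrary: f) auto

lemma Phi_add:
  "smooth_on UNIV p \<Longrightarrow> smooth_on UNIV q \<Longrightarrow> Phi k (\<lambda>z. p z + q z) f = (\<lambda>z. Phi k p f z + Phi k q f z)"
proof (induction k arbitrary: p q f)
  case (Suc k)
  have "dir_deriv v (\<lambda>z. p z + q z) = (\<lambda>z. dir_deriv v p z + dir_deriv v q z)" for v
    by (intro ext dir_deriv_add smooth_differentiable Suc.prems)
  then show ?case
    using Suc by (simp add: smooth_dir_deriv sum.distrib distrib_left)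
qed (simp add: distrib_right)

lemma Phi_sum:
  "(\<And>i. i \<in> I \<Longrightarrow> smooth_on UNIV (p i)) \<Longrightarrow> Phi k (\<lambda>z. \<Sum>i\<in>I. p i z) f = (\<lambda>z. \<Sum>i\<in>I. Phi k (p i) f z)"
  by (induction I rule: infinite_finite_induct) (auto simp: Phi_add smooth_on_sum)

lemma Phi_xmult:
  assumes "smooth_on UNIV (\<lambda>z::'n::finite phase. c (fst z))"
  shows "smooth_on UNIV p \<Longrightarrow> Phi k (\<lambda>z. c (fst z) * p z) f = (\<lambda>z. c (fst z) * Phi k p f z)"
proof (induction k arbitrary: p f)
  case (Suc k)
  have "dir_deriv (0, b) (\<lambda>z. c (fst z) * p z) = (\<lambda>z. c (fst z) * dir_deriv (0, b) p z)" for b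
    by (rule ext, subst dir_deriv_mult[OF smooth_differentiable[OF assms] smooth_differentiable[OF Suc.prems]]) (simp add: dir_deriv_fst)
  then show ?case
    by (simp add: Suc.IH[OF smooth_dir_deriv[OF Suc.prems]] sum_distrib_left mult.left_commute)
qed (simp add: mult.assoc)

lemma Phi_add2:
  "smooth_on UNIV f \<Longrightarrow> smooth_on UNIV g \<Longrightarrow> Phi k p (\<lambda>z. f z + g z) = (\<lambda>z. Phi k p f z + Phi k p g z)"
proof (induction k arbitrary: p f g)
  case (Suc k)
  then show ?case by (simp add: Dp_add smooth_Dp sum.distrib distrib_left)
qed (simp add: distrib_left)

lemma Phi_zero2 [simp]: "Phi k p (\<lambda>z. 0) = (\<lambda>z. 0)"
  by (induction k arbitrary: p) auto

lemma Phi_sum2: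
  "(\<And>i. i \<in> I \<Longrightarrow> smooth_on UNIV (f i)) \<Longrightarrow> Phi k p (\<lambda>z. \<Sum>i\<in>I. f i z) = (\<lambda>z. \<Sum>i\<in>I. Phi k p (f i) z)"
  by (induction I rule: infinite_finite_induct) (auto simp: Phi_add2 smooth_on_sum)

lemma smooth_coordinate: "smooth_on UNIV (\<lambda>p::'n::finite phase. complex_of_real (snd p \<bullet> b))"
proof -
  have "(\<lambda>p::'n phase. complex_of_real (snd p \<bullet> b)) = (\<lambda>p. complex_of_real (p \<bullet> (0, b)))"
    by (simp add: inner_prod_def)
  then show ?thesis unfolding smooth_on_diff_on using smooth_on_of_real_inner by metis
qed

lemma dir_deriv_coordinate:
  "dir_deriv v (\<lambda>p::'n::finite phase. complex_of_real (snd p \<bullet> b)) = (\<lambda>p. complex_of_real (snd v \<bullet> b))"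
  by (rule dir_deriv_linear)
    (intro bounded_linear_compose[OF bounded_linear_of_real] bounded_linear_compose[OF bounded_linear_inner_left] bounded_linear_snd)

text \<open>Leibniz's rule: the covariable derivatives all fall on \<open>p\<close>, or exactly one
  falls on the coordinate and leaves behind one \<open>Dp b\<close> on \<open>f\<close>.\<close>

lemma Phi_times_coordinate:
  assumes b: "b \<in> Basis"
  shows "smooth_on UNIV p \<Longrightarrow> smooth_on UNIV f \<Longrightarrow>
    Phi (Suc k) (\<lambda>z. complex_of_real (snd z \<bullet> b) * p z) f =
      (\<lambda>z. complex_of_real (snd z \<bullet> b) * Phi (Suc k) p f z + Phi k p (Dp b f) z)"
proof (induction k arbitrary: p f)
  case (0 p f)
  have D: "dir_deriv (0, c) (\<lambda>z. complex_of_real (snd z \<bullet> b) * p z) z =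
      (if c = b then p z else 0) + complex_of_real (snd z \<bullet> b) * dir_deriv (0, c) p z" if "c \<in> Basis" for c z
    by (subst dir_deriv_mult[OF smooth_differentiable[OF smooth_coordinate] smooth_differentiable[OF 0(1)]])
      (use b that in \<open>auto simp: dir_deriv_coordinate inner_Basis\<close>)
  have i: "(if c = b then p z else 0) * Dp c f z = (if c = b then p z * Dp b f z else 0)" for c z by simp
  show ?case
    using b by (simp add: D distrib_right sum.distrib i sum_distrib_left cinv_def mult.assoc add.commute)
next
  case (Suc k p f)
  let ?x = "\<lambda>z::'a phase. complex_of_real (snd z \<bullet> b)"
  have D: "dir_deriv (0, c) (\<lambda>z. ?x z * p z) = (\<lambda>z. (if c = b then p z else 0) + ?x z * dir_deriv (0, c) p z)"
    if "c \<in> Basis" for c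
    by (rule ext, subst dir_deriv_mult[OF smooth_differentiable[OF smooth_coordinate] smooth_differentiable[OF Suc(2)]])
      (use b that in \<open>auto simp: dir_deriv_coordinate inner_Basis\<close>)
  have P: "Phi (Suc k) (dir_deriv (0, c) (\<lambda>z. ?x z * p z)) (Dp c f) z =
      (if c = b then Phi (Suc k) p (Dp b f) z else 0) + (?x z * Phi (Suc k) (dir_deriv (0, c) p) (Dp c f) z
        + Phi k (dir_deriv (0, c) p) (Dp c (Dp b f)) z)" if c: "c \<in> Basis" for c z
  proof -
    have "smooth_on UNIV (\<lambda>z. if c = b then p z else 0)"
      using Suc(2) by (cases "c = b") (auto simp: smooth_on_diff_on)
    then have "Phi (Suc k) (dir_deriv (0, c) (\<lambda>z. ?x z * p z)) (Dp c f) z =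
        Phi (Suc k) (\<lambda>z. if c = b then p z else 0) (Dp c f) z + Phi (Suc k) (\<lambda>z. ?x z * dir_deriv (0, c) p z) (Dp c f) z"
      unfolding D[OF c] by (subst Phi_add) (auto intro!: smooth_on_mult smooth_coordinate smooth_dir_deriv Suc(2))
    also have "Phi (Suc k) (\<lambda>z. if c = b then p z else 0) (Dp c f) z = (if c = b then Phi (Suc k) p (Dp b f) z else 0)"
      by (cases "c = b") (auto simp del: Phi.simps)
    finally show ?thesis
      by (simp only: Suc.IH[OF smooth_dir_deriv[OF Suc(2)] smooth_Dp[OF Suc(3)]] Dp_commute[OF Suc(3), of b c])
  qed
  \<comment> \<open>The factor \<open>Suc (Suc k)\<close> is one copy from differentiating the
    coordinate and \<open>Suc k\<close> copies from the induction hypothesis, once the sum is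
    rewritten through \<open>cinv k\<close>. The outer \<open>cinv (Suc k)\<close> cancels
    it.\<close>
  have S: "(\<Sum>c\<in>Basis. Phi (Suc k) (dir_deriv (0, c) (\<lambda>z. ?x z * p z)) (Dp c f) z)
      = ?x z * (\<Sum>c\<in>Basis. Phi (Suc k) (dir_deriv (0, c) p) (Dp c f) z) + of_nat (Suc (Suc k)) * Phi (Suc k) p (Dp b f) z" for z
  proof -
    have "(\<Sum>c\<in>Basis. Phi (Suc k) (dir_deriv (0, c) (\<lambda>z. ?x z * p z)) (Dp c f) z)
      = (\<Sum>c\<in>Basis. if c = b then Phi (Suc k) p (Dp b f) z else 0) + (?x z * (\<Sum>c\<in>Basis. Phi (Suc k) (dir_deriv (0, c) p) (Dp c f) z)
        + (\<Sum>c\<in>Basis. Phi k (dir_deriv (0, c) p) (Dp c (Dp b f)) z))"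
      by (simp only: P sum.distrib sum_distrib_left cong: sum.cong)
    also have "(\<Sum>c\<in>Basis. if c = b then Phi (Suc k) p (Dp b f) z else 0) = Phi (Suc k) p (Dp b f) z"
      using b by (simp del: Phi.simps)
    also have "(\<Sum>c\<in>Basis. Phi k (dir_deriv (0, c) p) (Dp c (Dp b f)) z) = (cinv k * of_nat (Suc k)) * (\<Sum>c\<in>Basis. Phi k (dir_deriv (0, c) p) (Dp c (Dp b f)) z)"
      by (simp only: cinv mult_1_left)
    also have "\<dots> = of_nat (Suc k) * Phi (Suc k) p (Dp b f) z"
      by (simp only: Phi.simps mult_ac)
    finally show ?thesis by (simp add: algebra_simps del: Phi.simps)
  qed
  show ?case
    by (subst (1 2) Phi.simps(2)) (simp only: S distrib_left mult.left_commute[of "cinv (Suc k)"],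
      simp only: mult.assoc[symmetric] mult.commute[of "of_nat (Suc (Suc k))"] cinv mult_1_left)
qed

lemma smooth_monomial: "smooth_on UNIV (monomial bs)"
proof (induction bs)
  case Nil
  then show ?case by (simp add: monomial_def[abs_def] smooth_on_diff_on)
next
  case (Cons b bs)
  then show ?case using smooth_on_mult[OF smooth_coordinate Cons] by (simp add: monomial_def[abs_def])
qed

lemma Dp_Phi:
  "smooth_on UNIV (\<lambda>z::'n::finite phase. q (snd z)) \<Longrightarrow> smooth_on UNIV f \<Longrightarrow>
    Dp b (Phi k (\<lambda>z. q (snd z)) f) = Phi k (\<lambda>z. q (snd z)) (Dp b f)"
proof (induction k arbitrary: q f)
  case (0 q f)
  have "dir_deriv (b, 0) (\<lambda>z. q (snd z) * f z) z = q (snd z) * dir_deriv (b, 0) f z" for z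
    by (subst dir_deriv_mult[OF smooth_differentiable[OF 0(1)] smooth_differentiable[OF 0(2)]]) (simp add: dir_deriv_snd)
  then show ?case by (auto simp: Dp_def)
next
  case (Suc k q f)
  have s: "smooth_on UNIV (\<lambda>z::'n phase. dir_deriv c q (snd z))" for c
    using smooth_dir_deriv[OF Suc(2), of "(0, c)"] by (simp add: dir_deriv_snd)
  have "Dp b (Phi k (dir_deriv (0, c) (\<lambda>z. q (snd z))) (Dp c f)) = Phi k (dir_deriv (0, c) (\<lambda>z. q (snd z))) (Dp c (Dp b f))" for c
    unfolding dir_deriv_snd snd_conv by (simp only: Suc.IH[OF s smooth_Dp[OF Suc(3)]] Dp_commute[OF Suc(3), of b c])
  then show ?case
    unfolding Phi.simps
    by (subst Dp_cmult, intro smooth_on_sum smooth_Phi smooth_dir_deriv Suc(2) smooth_Dp Suc(3))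
      (subst Dp_sum, intro smooth_Phi smooth_dir_deriv Suc(2) smooth_Dp Suc(3), simp)
qed

text \<open>A polynomial in the covariable has no Taylor part above its degree; this makes the
  composition formula finite and exact.\<close>

lemma Phi_monomial:
  "set bs \<subseteq> Basis \<Longrightarrow> smooth_on UNIV f \<Longrightarrow> length bs < k \<Longrightarrow> Phi k (monomial bs) f = (\<lambda>z. 0)"
proof (induction bs arbitrary: k f)
  case (Nil k f)
  then obtain k' where k: "k = Suc k'" by (cases k) auto
  have "dir_deriv v (monomial []) = (\<lambda>z. 0)" for v :: "'a phase" by (simp add: monomial_def[abs_def])
  then show ?case by (simp add: k)
next
  case (Cons b bs k f)
  then obtain k' where k: "k = Suc k'" "length bs < k'" by (cases k) auto
  note m = monomial_Cons[of b bs]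
  have "Phi (Suc k') (monomial bs) f = (\<lambda>z. 0)" "Phi k' (monomial bs) (Dp b f) = (\<lambda>z. 0)"
    using Cons k by (intro Cons.IH smooth_Dp; simp)+
  then show ?case
    unfolding k m using Cons.prems by (subst Phi_times_coordinate) (auto simp: smooth_monomial simp del: Phi.simps)
qed

text \<open>Each \<open>Lx\<close> multiplies by a coordinate and adds one \<open>Dp\<close>, which
  is the recursion of \<open>Phi_times_coordinate\<close>. \<open>Dp\<close> commutes with
  \<open>Phi\<close> because a monomial does not depend on the position.\<close>

lemma foldr_Lx_Phi:
  "set bs \<subseteq> Basis \<Longrightarrow> smooth_on UNIV f \<Longrightarrow> length bs \<le> K \<Longrightarrow>
    foldr Lx bs f = (\<lambda>z. \<Sum>k\<le>K. Phi k (monomial bs) f z)"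
proof (induction bs arbitrary: K)
  case (Nil K)
  have "(\<Sum>k\<le>K. Phi k (monomial []) f z) = (\<Sum>k\<le>K. if k = 0 then f z else 0)" for z
  proof (rule sum.cong[OF refl])
    fix k
    show "Phi k (monomial []) f z = (if k = 0 then f z else 0)"
      using Phi_monomial[of "[]" f k] Nil by (cases "k = 0") (auto simp: monomial_def)
  qed
  then show ?case by simp
next
  case (Cons b bs K)
  then obtain K' where K: "K = Suc K'" "length bs \<le> K'" by (cases K) auto
  have b: "b \<in> Basis" "set bs \<subseteq> Basis" using Cons.prems by auto
  let ?m = "monomial bs" and ?x = "\<lambda>z::'a phase. complex_of_real (snd z \<bullet> b)"
  note m = monomial_Cons[of b bs]
  have IH: "foldr Lx bs f = (\<lambda>z. \<Sum>k\<le>K. Phi k ?m f z)" by (rule Cons.IH) (use Cons.prems K in auto)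
  have Dm: "Dp b (Phi k ?m f) = Phi k ?m (Dp b f)" for k
    using Dp_Phi[of "\<lambda>\<xi>. prod_list (map (\<lambda>b. complex_of_real (\<xi> \<bullet> b)) bs)" f b k] smooth_monomial[of bs] Cons.prems(2)
    by (simp add: monomial_def[abs_def])
  have "foldr Lx (b # bs) f = (\<lambda>z. ?x z * (\<Sum>k\<le>K. Phi k ?m f z) + Dp b (\<lambda>z. \<Sum>k\<le>K. Phi k ?m f z) z)"
    by (simp only: foldr.simps o_def IH) (simp add: Lx_def[abs_def] Dp_def)
  also have "Dp b (\<lambda>z. \<Sum>k\<le>K. Phi k ?m f z) = (\<lambda>z. \<Sum>k\<le>K. Phi k ?m (Dp b f) z)"
    by (subst Dp_sum) (use Cons.prems in \<open>auto simp: Dm intro: smooth_Phi smooth_monomial\<close>)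
  also have "(\<lambda>z. ?x z * (\<Sum>k\<le>K. Phi k ?m f z) + (\<Sum>k\<le>K. Phi k ?m (Dp b f) z)) = (\<lambda>z. \<Sum>k\<le>K. Phi k (monomial (b # bs)) f z)"
  proof
    fix z
    have "(\<Sum>k\<le>K. Phi k (monomial (b # bs)) f z) = ?x z * Phi 0 ?m f z + (\<Sum>k\<le>K'. Phi (Suc k) (monomial (b # bs)) f z)"
      unfolding K sum.atMost_Suc_shift by (simp add: m mult.assoc del: Phi.simps(2))
    also have "(\<Sum>k\<le>K'. Phi (Suc k) (monomial (b # bs)) f z) = (\<Sum>k\<le>K'. ?x z * Phi (Suc k) ?m f z + Phi k ?m (Dp b f) z)"
      unfolding m using Phi_times_coordinate[OF b(1) smooth_monomial Cons.prems(2)] by (simp del: Phi.simps)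
    also have "\<dots> = ?x z * (\<Sum>k\<le>K'. Phi (Suc k) ?m f z) + (\<Sum>k\<le>K'. Phi k ?m (Dp b f) z)"
      by (simp only: sum.distrib sum_distrib_left)
    also have "(\<Sum>k\<le>K'. Phi k ?m (Dp b f) z) = (\<Sum>k\<le>K. Phi k ?m (Dp b f) z)"
      using Phi_monomial[OF b(2) smooth_Dp[OF Cons.prems(2)], of K b] K by (simp del: Phi.simps)
    also have "?x z * Phi 0 ?m f z + (?x z * (\<Sum>k\<le>K'. Phi (Suc k) ?m f z) + (\<Sum>k\<le>K. Phi k ?m (Dp b f) z))
        = ?x z * (\<Sum>k\<le>K. Phi k ?m f z) + (\<Sum>k\<le>K. Phi k ?m (Dp b f) z)"
      unfolding K sum.atMost_Suc_shift[of "\<lambda>k. Phi k ?m f z"] by (simp only: distrib_left add.assoc)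
    finally show "?x z * (\<Sum>k\<le>K. Phi k ?m f z) + (\<Sum>k\<le>K. Phi k ?m (Dp b f) z) = (\<Sum>k\<le>K. Phi k (monomial (b # bs)) f z)"
      by (rule sym)
  qed
  finally show ?case .
qed

lemma mpow_monomial: "mpow (snd p) \<alpha> = monomial (mlist (\<lambda>i. axis i 1) \<alpha>) p"
  by (simp add: mpow_mlist monomial_def map_mlist inner_axis)

lemma set_mlist_axis: "set (mlist (\<lambda>i::'n::finite. axis i (1::real)) \<alpha>) \<subseteq> Basis"
  using set_mlist by (fastforce simp: Basis_axis)

lemma psym_monomial: "set bs \<subseteq> Basis \<Longrightarrow> psym (real (length bs)) (monomial bs)"
  using psym_foldr_Lx[OF psym_const, of bs 1] by (simp add: foldr_Lx_1)

text \<open>Coefficients depend on the position alone and factor out of both operators and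
  \<open>Phi\<close>, so everything reduces to monomials.\<close>

theorem psdo_differential_psdo:
  fixes P :: "'n::finite phase \<Rightarrow> complex"
  assumes P: "\<And>p. P p = (\<Sum>\<alpha>\<in>A. c \<alpha> (fst p) * mpow (snd p) \<alpha>)"
    and c: "\<And>\<alpha>. \<alpha> \<in> A \<Longrightarrow> psym 0 (\<lambda>p. c \<alpha> (fst p))" and m: "\<And>\<alpha>. \<alpha> \<in> A \<Longrightarrow> mlen \<alpha> \<le> m"
    and a: "psym s a" and u: "rapid1 u"
  shows "psdo P (psdo a u) = psdo (\<lambda>z. \<Sum>k\<le>m. Phi k P a z) u"
proof
  fix x
  let ?l = "\<lambda>\<alpha>::'n mindex. mlist (\<lambda>i. axis i (1::real)) \<alpha>"
  have P': "P = (\<lambda>p. \<Sum>\<alpha>\<in>A. c \<alpha> (fst p) * monomial (?l \<alpha>) p)"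
    using P by (auto simp: mpow_monomial)
  have v: "rapid1 (psdo a u)" by (rule rapid1_psdo[OF a u])
  have sc: "smooth_on UNIV (\<lambda>z::'n phase. c \<alpha> (fst z))" if "\<alpha> \<in> A" for \<alpha> using psym_smooth[OF c[OF that]] .
  have e1: "(\<Sum>k\<le>m. Phi k P a z) = (\<Sum>\<alpha>\<in>A. c \<alpha> (fst z) * foldr Lx (?l \<alpha>) a z)" for z
  proof -
    have "Phi k P a = (\<lambda>z. \<Sum>\<alpha>\<in>A. c \<alpha> (fst z) * Phi k (monomial (?l \<alpha>)) a z)" for k
      unfolding P' by (subst Phi_sum) (auto simp: Phi_xmult[OF sc smooth_monomial] intro!: smooth_on_mult sc smooth_monomial)
    then have "(\<Sum>k\<le>m. Phi k P a z) = (\<Sum>\<alpha>\<in>A. \<Sum>k\<le>m. c \<alpha> (fst z) * Phi k (monomial (?l \<alpha>)) a z)"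
      by (simp add: sum.swap[of _ A])
    also have "\<dots> = (\<Sum>\<alpha>\<in>A. c \<alpha> (fst z) * foldr Lx (?l \<alpha>) a z)"
      by (intro sum.cong refl, subst foldr_Lx_Phi[OF set_mlist_axis psym_smooth[OF a], where K = m])
        (use m in \<open>auto simp: sum_distrib_left\<close>)
    finally show ?thesis .
  qed
  have "psdo P (psdo a u) x = (\<Sum>\<alpha>\<in>A. c \<alpha> x * psdo (monomial (?l \<alpha>)) (psdo a u) x)"
  proof -
    have "psym (real m) (\<lambda>p. c \<alpha> (fst p) * monomial (?l \<alpha>) p)" if "\<alpha> \<in> A" for \<alpha>
      by (rule psym_mono[OF psym_mult[OF c[OF that] psym_monomial[OF set_mlist_axis]]]) (use m[OF that] in simp)
    from psdo_sum_symbol[of A, OF this v, where x = x] show ?thesis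
      unfolding P' by (simp only: psdo_xmult_symbol)
  qed
  also have "\<dots> = (\<Sum>\<alpha>\<in>A. c \<alpha> x * psdo (foldr Lx (?l \<alpha>) a) u x)"
    by (simp add: psdo_monomial_psdo[OF a u set_mlist_axis])
  also have "\<dots> = psdo (\<lambda>z. \<Sum>\<alpha>\<in>A. c \<alpha> (fst z) * foldr Lx (?l \<alpha>) a z) u x"
  proof -
    have "psym (s + real m) (\<lambda>p. c \<alpha> (fst p) * foldr Lx (?l \<alpha>) a p)" if "\<alpha> \<in> A" for \<alpha>
      by (rule psym_mono[OF psym_mult[OF c[OF that] psym_foldr_Lx[OF a set_mlist_axis]]]) (use m[OF that] in simp)
    from psdo_sum_symbol[of A, OF this u, where x = x] show ?thesis
      by (simp only: psdo_xmult_symbol)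
  qed
  finally show "psdo P (psdo a u) x = psdo (\<lambda>z. \<Sum>k\<le>m. Phi k P a z) u x" by (simp only: e1)
qed

text \<open>Every test function is the Fourier transform of a Schwartz function, so the integrals defining the
  two operators can be compared locally.\<close>

theorem psdo_symbol_unique:
  fixes a b :: "'n::finite phase \<Rightarrow> complex"
  assumes "psym s a" "psym t b" "\<And>u. rapid1 u \<Longrightarrow> psdo a u = psdo b u"
  shows "a = b"
proof
  fix p :: "'n phase"
  obtain x \<xi>0 where p: "p = (x, \<xi>0)" by (cases p)
  let ?f = "\<lambda>\<xi>. exp (\<i> * complex_of_real (x \<bullet> \<xi>)) * (a (x, \<xi>) - b (x, \<xi>))"
  have ca: "continuous_on UNIV a" "continuous_on UNIV b"
    using smooth_on_continuous psym_smooth assms(1,2) by blast+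
  have "norm (?f \<xi>0) \<le> 0"
  proof (rule weak_bound[where v = "\<lambda>_. 0"])
    show "continuous_on UNIV ?f"
      by (intro continuous_intros continuous_on_compose2[OF ca(1)] continuous_on_compose2[OF ca(2)]) auto
    fix \<phi> :: "real^'n \<Rightarrow> complex" assume "\<phi> \<in> test_fun"
    then have \<phi>: "rapid1 \<phi>" by (rule test_fun_rapid1)
    let ?u = "\<lambda>x. pnorm TYPE('n) * ft \<phi> x"
    have u: "rapid1 ?u" by (intro rapid1_cmult rapid1_ft \<phi>)
    have F: "fourier ?u = \<phi>"
    proof
      fix \<xi>
      have "fourier ?u \<xi> = pnorm TYPE('n) * fourier (ft \<phi>) \<xi>"
        unfolding fourier_def by (subst integral_mult_right_zero[symmetric]) (simp add: mult_ac)
      also have "\<dots> = (pnorm TYPE('n) * complex_of_real ((2 * pi) ^ CARD('n))) * \<phi> \<xi>"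
        by (simp only: fourier_ft_inverse[OF \<phi>] mult.assoc)
      finally show "fourier ?u \<xi> = \<phi> \<xi>" by (simp only: pnorm_inverse mult_1_left)
    qed
    have "pnorm TYPE('n) \<noteq> 0" by (simp add: pnorm_def)
    then have "ftr (\<lambda>p. a p * \<phi> (snd p)) (x, x) = ftr (\<lambda>p. b p * \<phi> (snd p)) (x, x)"
      using fun_cong[OF assms(3)[OF u], of x] by (simp add: psdo_ftr F)
    moreover have "(LINT \<xi>|lborel. ?f \<xi> * \<phi> \<xi>) = ftr (\<lambda>p. a p * \<phi> (snd p)) (x, x) - ftr (\<lambda>p. b p * \<phi> (snd p)) (x, x)"
      unfolding ftr_def
      by (subst Bochner_Integration.integral_diff[symmetric])
        (use psdo_integrable[OF assms(1) \<phi>, of x x] psdo_integrable[OF assms(2) \<phi>, of x x] in \<open>auto simp: algebra_simps\<close>)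
    ultimately show "(LINT \<xi>|lborel. ?f \<xi> * \<phi> \<xi>) = (LINT \<xi>|lborel. 0 * \<phi> \<xi>)" by simp
  qed auto
  then show "a p = b p" by (simp add: p norm_mult)
qed

section \<open>Composition with smoothing operators\<close>

text \<open>Here \<open>z\<close> is fixed and only the parameter is differentiated, so no power of
  \<eta> appears and decay in \<open>z\<close> comes with every order of derivatives, without a
  larger \<open>M\<close>.\<close>

lemma ftr_slice_decay:
  fixes g :: "'w::euclidean_space \<times> (real ^ 'n::finite) \<Rightarrow> complex"
  assumes "ftr_bound g C M \<omega> (k + 2 * N)"
  shows "dbound (\<lambda>_ _. 1) UNIV k ((1 + real CARD('n)) ^ N * jint TYPE('n) * C * jbracket z powr (- 2 * real N)) \<omega> (\<lambda>w. ftr g (w, z))"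
proof -
  interpret ftr_bound g C M \<omega> "k + 2 * N" by (rule assms)
  interpret F: ftr_bound "(flap ^^ N) g" "(1 + real CARD('n)) ^ N * C" M \<omega> k
    by (rule ftr_bound_flap[OF assms])
  have "ftr_bound g C M \<omega> (2 * N)"
    by unfold_locales (use smooth C M \<omega> dbound_le[OF g, of "2 * N"] in auto)
  then have e: "ftr g (w, z) = complex_of_real (inverse (jbracket z ^ (2 * N))) * ftr ((flap ^^ N) g) (w, z)" for w
    by (simp add: ftr_flap)
  have p: "jbracket z powr (- 2 * real N) = inverse (jbracket z ^ (2 * N))"
    using powr_realpow[of "jbracket z" "2 * N"] by (simp add: powr_minus)
  show ?thesis
    unfolding e p
    by (rule dbound_mono[OF dbound_const_mult[OF open_UNIV F.ftr_slice]]) (simp_all add: norm_inverse norm_power mult_ac)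
qed

text \<open>What remains after applying the operator of \<open>a\<close> to
  \<open>y \<mapsto> exp (\<i> y \<bullet> \<xi>) * b (y, \<xi>)\<close> and stripping off the
  exponential, with the operator written through its kernel. It is the symbol of the
  composition.\<close>

definition kcomp :: "('n::finite phase \<Rightarrow> complex) \<Rightarrow> ('n phase \<Rightarrow> complex) \<Rightarrow> 'n phase \<Rightarrow> complex" where
  "kcomp a b p = pnorm TYPE('n) * (LINT z|lborel. ftr a (fst p, z) * (exp (\<i> * complex_of_real (snd p \<bullet> (- z))) * b (p + (- z, 0))))"

text \<open>The order makes \<open>a\<close> integrable in the covariable, and its additional unit
  makes the kernel differentiable, hence continuous. Compositions are then absolutely convergent
  integrals.\<close>

locale kernel_symbol =
  fixes a :: "'n::finite phase \<Rightarrow> complex" and M :: real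
  assumes a: "\<And>k. \<exists>C. ftr_bound a C M (\<lambda>_. 1) k" and M1: "2 * real CARD('n) + 1 \<le> M"
begin

lemma continuous_kernel: "continuous_on UNIV (ftr a)"
proof -
  obtain C where "ftr_bound a C M (\<lambda>_. 1) 1" using a by blast
  then interpret ftr_bound a C M "\<lambda>_. 1" 1 .
  show ?thesis
    using ftr_derivative(1)[OF order_refl M1]
    by (simp add: continuous_on_eq_continuous_at differentiable_imp_continuous_within)
qed

lemma continuous_symbol: "continuous_on UNIV a"
proof -
  obtain C where "ftr_bound a C M (\<lambda>_. 1) 1" using a by blast
  then interpret ftr_bound a C M "\<lambda>_. 1" 1 .
  show ?thesis by (rule continuous)
qed

lemma kernel_integrable: "integrable lborel (\<lambda>z. norm (ftr a (x, z)))"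
proof -
  obtain C where "ftr_bound a C M (\<lambda>_. 1) (2 * CARD('n))" using a by blast
  then interpret ftr_bound a C M "\<lambda>_. 1" "2 * CARD('n)" .
  let ?c = "(1 + real CARD('n)) ^ CARD('n) * jint TYPE('n) * C"
  have m: "(\<lambda>z. norm (ftr a (x, z))) \<in> borel_measurable lborel"
    by (simp, intro borel_measurable_continuous_onI continuous_intros continuous_on_compose2[OF continuous_kernel]) auto
  have "integrable lborel (\<lambda>z::real^'n. ?c * jbracket z powr (- 2 * real CARD('n)))"
    using integrable_jbracket[of "2 * real CARD('n)", where 'n='n] by (intro integrable_mult_right) simp
  then show ?thesis
  proof (rule Bochner_Integration.integrable_bound[OF _ m], intro AE_I2)
    show "norm (norm (ftr a (x, z))) \<le> norm (?c * jbracket z powr (- 2 * real CARD('n)))" for z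
      using order_trans[OF ftr_decay[OF order_refl, of x z] abs_ge_self] by simp
  qed
qed

lemma symbol_integrable: "integrable lborel (\<lambda>\<eta>. norm (a (x, \<eta>)))"
proof -
  obtain C where "ftr_bound a C M (\<lambda>_. 1) 0" using a by blast
  then interpret ftr_bound a C M "\<lambda>_. 1" 0 .
  show ?thesis using integrable_norm[OF integrable[of 0 x]] by simp
qed

lemma psdo_kernel:
  assumes v: "rapid1 v"
  shows "psdo a v x = pnorm TYPE('n) * (LINT z|lborel. ftr a (x, z) * v (x - z))"
proof -
  have cv: "continuous_on UNIV v" by (rule rapid1_continuous[OF v])
  have F: "exp (\<i> * complex_of_real (x \<bullet> \<eta>)) * fourier v \<eta> = (LINT z|lborel. exp (\<i> * complex_of_real (z \<bullet> \<eta>)) * v (x - z))" for \<eta>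
  proof -
    have "(LINT y|lborel. exp (\<i> * complex_of_real (x \<bullet> \<eta>)) * (exp (- \<i> * complex_of_real (y \<bullet> \<eta>)) * v y))
      = \<bar>-1\<bar> ^ DIM(real^'n) *\<^sub>R (LINT z|lborel. exp (\<i> * complex_of_real (x \<bullet> \<eta>)) * (exp (- \<i> * complex_of_real ((x + (- 1) *\<^sub>R z) \<bullet> \<eta>)) * v (x + (- 1) *\<^sub>R z)))"
      by (rule lborel_integral_affine) (auto intro!: borel_measurable_continuous_onI continuous_intros cv)
    also have "\<dots> = (LINT z|lborel. exp (\<i> * complex_of_real (z \<bullet> \<eta>)) * v (x - z))"
      by (simp add: mult.assoc[symmetric] exp_add[symmetric] inner_diff_left algebra_simps)
    finally show ?thesis by (simp add: fourier_def)
  qed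
  let ?h = "\<lambda>p::(real^'n) \<times> (real^'n). a (x, fst p) * (exp (\<i> * complex_of_real (snd p \<bullet> fst p)) * v (x - snd p))"
  have ch: "continuous_on UNIV ?h"
    by (intro continuous_intros continuous_on_compose2[OF continuous_symbol] continuous_on_compose2[OF cv]) auto
  have iv: "integrable lborel (\<lambda>z. norm (v (x - z)))"
  proof -
    obtain C where C: "C \<ge> 0" "\<And>y. norm (v y) \<le> C * jbracket y powr (- real (2 * CARD('n)))"
      using rapid1_bound[OF v] by metis
    let ?N = "real (2 * CARD('n))"
    have b: "norm (v (x - z)) \<le> C * (2 powr ?N * (jbracket x powr ?N * jbracket z powr (- ?N)))" for z
    proof -
      have "jbracket (x - z) powr (- ?N) \<le> 2 powr ?N * (jbracket x powr ?N * jbracket z powr (- ?N))"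
        using jbracket_peetre_powr[of ?N "- z" x] by simp
      then show ?thesis using C(2)[of "x - z"] mult_left_mono[OF _ C(1)] order_trans by blast
    qed
    have m: "(\<lambda>z. norm (v (x - z))) \<in> borel_measurable lborel"
      by (simp, intro borel_measurable_continuous_onI continuous_intros continuous_on_compose2[OF cv]) auto
    have "integrable lborel (\<lambda>z::real^'n. C * (2 powr ?N * (jbracket x powr ?N * jbracket z powr (- ?N))))"
      by (intro integrable_mult_right integrable_jbracket) simp
    then show ?thesis
    proof (rule Bochner_Integration.integrable_bound[OF _ m], intro AE_I2)
      show "norm (norm (v (x - z))) \<le> norm (C * (2 powr ?N * (jbracket x powr ?N * jbracket z powr (- ?N))))" for z
        using order_trans[OF b[of z] abs_ge_self] by simp
    qed
  qed
  have "psdo a v x = pnorm TYPE('n) * (LINT \<eta>|lborel. a (x, \<eta>) * (exp (\<i> * complex_of_real (x \<bullet> \<eta>)) * fourier v \<eta>))"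
    by (simp add: psdo_def pnorm_def mult_ac)
  also have "(LINT \<eta>|lborel. a (x, \<eta>) * (exp (\<i> * complex_of_real (x \<bullet> \<eta>)) * fourier v \<eta>)) = (LINT \<eta>|lborel. LINT z|lborel. ?h (\<eta>, z))"
    unfolding F by simp
  also have "\<dots> = (LINT z|lborel. LINT \<eta>|lborel. ?h (\<eta>, z))"
    by (rule Fubini_bound(1)[OF ch _ symbol_integrable[of x] iv]) (simp add: norm_mult)
  also have "\<dots> = (LINT z|lborel. ftr a (x, z) * v (x - z))"
  proof (rule Bochner_Integration.integral_cong[OF refl])
    fix z
    have "(LINT \<eta>|lborel. ?h (\<eta>, z)) = (LINT \<eta>|lborel. (exp (\<i> * complex_of_real (z \<bullet> \<eta>)) * a (x, \<eta>)) * v (x - z))"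
      by (simp add: mult_ac)
    then show "(LINT \<eta>|lborel. ?h (\<eta>, z)) = ftr a (x, z) * v (x - z)"
      by (simp add: ftr_def)
  qed
  finally show ?thesis .
qed

text \<open>Insert the kernel form of \<open>a\<close> and the definition of the operator of
  \<open>b\<close>, then exchange the integrals; the kernel is integrable in \<open>z\<close> and
  the remaining factor in \<xi>.\<close>

theorem psdo_comp:
  assumes b: "psym s b" and u: "rapid1 u"
  shows "psdo a (psdo b u) = psdo (kcomp a b) u"
proof
  fix x
  let ?v = "fourier u"
  have rv: "rapid1 ?v" by (rule rapid1_fourier[OF u])
  have cv: "continuous_on UNIV ?v" by (rule rapid1_continuous[OF rv])
  have cb: "continuous_on UNIV b" by (rule smooth_on_continuous[OF psym_smooth[OF b]])
  obtain C where C: "C \<ge> 0" "\<And>p. norm (b p) \<le> C * jbracket (snd p) powr s"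
  proof -
    obtain C where "C \<ge> 0" "dbound (\<lambda>_ _. 1) UNIV 0 C (\<lambda>p. jbracket (snd p) powr s) b"
      using b unfolding psym_def by blast
    then show thesis by (intro that[of C]) auto
  qed
  let ?h = "\<lambda>p::(real^'n) \<times> (real^'n). ftr a (x, fst p) * (exp (\<i> * complex_of_real ((x - fst p) \<bullet> snd p)) * b (x - fst p, snd p) * ?v (snd p))"
  have ch: "continuous_on UNIV ?h"
    by (intro continuous_intros continuous_on_compose2[OF continuous_kernel] continuous_on_compose2[OF cb] continuous_on_compose2[OF cv]) auto
  have iv: "integrable lborel (\<lambda>\<xi>. C * jbracket \<xi> powr s * norm (?v \<xi>))"
  proof -
    obtain N :: nat where N: "s + 2 * real CARD('n) \<le> real N" using real_arch_simple by blast
    obtain D where D: "D \<ge> 0" "\<And>y. norm (?v y) \<le> D * jbracket y powr (- real N)"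
      using rapid1_bound[OF rv] by metis
    have m: "(\<lambda>\<xi>. C * jbracket \<xi> powr s * norm (?v \<xi>)) \<in> borel_measurable lborel"
      by (simp, intro borel_measurable_continuous_onI continuous_intros cv) auto
    have b: "C * jbracket \<xi> powr s * norm (?v \<xi>) \<le> C * D * jbracket \<xi> powr (- 2 * real CARD('n))" for \<xi>
    proof -
      have "C * jbracket \<xi> powr s * norm (?v \<xi>) \<le> C * jbracket \<xi> powr s * (D * jbracket \<xi> powr (- real N))"
        using C D by (intro mult_left_mono) auto
      also have "\<dots> = C * D * jbracket \<xi> powr (s + - real N)" by (simp only: powr_add mult_ac)
      also have "\<dots> \<le> C * D * jbracket \<xi> powr (- 2 * real CARD('n))"
        using C D N by (intro mult_left_mono jbracket_powr_mono) auto
      finally show ?thesis .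
    qed
    have "integrable lborel (\<lambda>\<xi>::real^'n. C * D * jbracket \<xi> powr (- 2 * real CARD('n)))"
      using integrable_jbracket[of "2 * real CARD('n)", where 'n='n] by (intro integrable_mult_right) simp
    then show ?thesis
    proof (rule Bochner_Integration.integrable_bound[OF _ m], intro AE_I2)
      show "norm (C * jbracket \<xi> powr s * norm (?v \<xi>)) \<le> norm (C * D * jbracket \<xi> powr (- 2 * real CARD('n)))" for \<xi>
        using order_trans[OF b[of \<xi>] abs_ge_self] C(1) by simp
    qed
  qed
  have "psdo a (psdo b u) x = pnorm TYPE('n) * (LINT z|lborel. pnorm TYPE('n) * (LINT \<xi>|lborel. ?h (z, \<xi>)))"
  proof -
    have "ftr a (x, z) * psdo b u (x - z) = pnorm TYPE('n) * (LINT \<xi>|lborel. ?h (z, \<xi>))" for z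
    proof -
      have "(LINT \<xi>|lborel. ?h (z, \<xi>)) = ftr a (x, z) * (LINT \<xi>|lborel. exp (\<i> * complex_of_real ((x - z) \<bullet> \<xi>)) * b (x - z, \<xi>) * ?v \<xi>)"
        by simp
      then show ?thesis by (simp only: psdo_def pnorm_def mult.left_commute)
    qed
    then show ?thesis unfolding psdo_kernel[OF rapid1_psdo[OF b u]] by (simp only:)
  qed
  also have "\<dots> = pnorm TYPE('n) * (pnorm TYPE('n) * (LINT z|lborel. LINT \<xi>|lborel. ?h (z, \<xi>)))"
    by simp
  also have "(LINT z|lborel. LINT \<xi>|lborel. ?h (z, \<xi>)) = (LINT \<xi>|lborel. LINT z|lborel. ?h (z, \<xi>))"
  proof (rule Fubini_bound(1)[OF ch _ kernel_integrable[of x] iv])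
    fix z \<xi>
    have "norm (ftr a (x, z)) * (norm (b (x - z, \<xi>)) * norm (?v \<xi>)) \<le> norm (ftr a (x, z)) * (C * jbracket \<xi> powr s * norm (?v \<xi>))"
      using C(2)[of "(x - z, \<xi>)"] by (intro mult_left_mono mult_right_mono) auto
    then show "norm (?h (z, \<xi>)) \<le> norm (ftr a (x, z)) * (C * jbracket \<xi> powr s * norm (?v \<xi>))"
      by (simp add: norm_mult)
  qed
  also have "pnorm TYPE('n) * (LINT \<xi>|lborel. LINT z|lborel. ?h (z, \<xi>)) = (LINT \<xi>|lborel. exp (\<i> * complex_of_real (x \<bullet> \<xi>)) * kcomp a b (x, \<xi>) * ?v \<xi>)"
  proof -
    have "exp (\<i> * complex_of_real (x \<bullet> \<xi>)) * kcomp a b (x, \<xi>) * ?v \<xi> = pnorm TYPE('n) * (LINT z|lborel. ?h (z, \<xi>))" for \<xi>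
    proof -
      have "?h (z, \<xi>) = (exp (\<i> * complex_of_real (x \<bullet> \<xi>)) * ?v \<xi>) * (ftr a (x, z) * (exp (\<i> * complex_of_real (\<xi> \<bullet> (- z))) * b ((x, \<xi>) + (- z, 0))))" for z
        by (simp add: inner_diff_left inner_commute[of z] right_diff_distrib exp_diff exp_minus divide_inverse mult_ac)
      then have "(LINT z|lborel. ?h (z, \<xi>)) = (exp (\<i> * complex_of_real (x \<bullet> \<xi>)) * ?v \<xi>) * (LINT z|lborel. ftr a (x, z) * (exp (\<i> * complex_of_real (\<xi> \<bullet> (- z))) * b ((x, \<xi>) + (- z, 0))))"
        by (simp only: integral_mult_right_zero)
      then show ?thesis by (simp only: kcomp_def fst_conv snd_conv mult_ac)
    qed
    then show ?thesis by simp
  qed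
  finally show "psdo a (psdo b u) x = psdo (kcomp a b) u x"
    by (simp only: psdo_def[of "kcomp a b" u x] pnorm_def)
qed

end

section \<open>Estimates for the symbol of a composition\<close>

text \<open>Shifts act on the position only, so the order \<open>s\<close> of \<open>b\<close> is
  preserved. Covariable derivatives of the exponential produce powers of \<open>z\<close>, absorbed
  by the decay of the kernel. The constant is bilinear in \<open>C1\<close> and \<open>C2\<close>,
  which transports powers of \<epsilon>.\<close>

lemma comp_bound:
  "\<exists>c\<ge>0. \<exists>k'. \<forall>(a :: 'n::finite phase \<Rightarrow> complex) b C1 C2 M s.
     kernel_symbol a M \<longrightarrow> ftr_bound a C1 M (\<lambda>_. 1) k' \<longrightarrow> smooth_on UNIV b \<longrightarrow> 0 \<le> C2 \<longrightarrow>
     dbound (\<lambda>_ _. 1) UNIV k C2 (\<lambda>p. jbracket (snd p) powr s) b \<longrightarrow>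
     dbound (\<lambda>_ _. 1) UNIV k (c * (C1 * C2)) (\<lambda>p. jbracket (snd p) powr s) (kcomp a b)"
proof -
  \<comment> \<open>The kernel decays with exponent \<open>2 * N\<close>; up to \<open>k\<close>
    powers of \<open>z\<close> are lost to the exponential and \<open>2 * CARD('n)\<close> remain
    for integrability.\<close>
  define N where "N = CARD('n) + k"
  obtain B1 where B1: "1 \<le> B1" "\<And>k C w (f :: real^'n \<Rightarrow> complex) U c. dbound (\<lambda>_ _. 1) UNIV k C w f \<Longrightarrow>
      dbound (\<lambda>_ _. 1) U k (B1 ^ k * C) (\<lambda>z::'n phase. w (fst z + c)) (\<lambda>z. f (fst z + c))"
    using dbound_linear[OF linear_fst] by metis
  obtain B2 where B2: "1 \<le> B2" "\<And>k C w (f :: real^'n \<Rightarrow> complex) U c. dbound (\<lambda>_ _. 1) UNIV k C w f \<Longrightarrow>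
      dbound (\<lambda>_ _. 1) U k (B2 ^ k * C) (\<lambda>z::'n phase. w (snd z + c)) (\<lambda>z. f (snd z + c))"
    using dbound_linear[OF linear_snd] by metis
  obtain B3 where B3: "1 \<le> B3" "\<And>k C w (f :: 'n phase \<Rightarrow> complex) U c. dbound (\<lambda>_ _. 1) UNIV k C w f \<Longrightarrow>
      dbound (\<lambda>_ _. 1) U k (B3 ^ k * C) (\<lambda>z::'n phase. w (z + c)) (\<lambda>z. f (z + c))"
    using dbound_linear[OF linear_ident] by metis
  define j where "j = (1 + real CARD('n)) ^ N * jint TYPE('n)"
  have j: "0 \<le> j" unfolding j_def by (intro mult_nonneg_nonneg jint_nonneg) auto
  define c0 where "c0 = 2 ^ k * (B1 ^ k * j) * (2 ^ k * (B2 ^ k * 2 ^ k * B3 ^ k))"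
  have c0: "0 \<le> c0" unfolding c0_def using B1(1) B2(1) B3(1) j by (intro mult_nonneg_nonneg) auto
  define c where "c = norm (pnorm TYPE('n)) * (c0 * jint TYPE('n))"
  have "dbound (\<lambda>_ _. 1) UNIV k (c * (C1 * C2)) (\<lambda>p. jbracket (snd p) powr s) (kcomp a b)"
    if ks: "kernel_symbol a M" and fa: "ftr_bound a C1 M (\<lambda>_. 1) (k + 2 * N)" and sb: "smooth_on UNIV b"
      and C2: "0 \<le> C2" and b: "dbound (\<lambda>_ _. 1) UNIV k C2 (\<lambda>p. jbracket (snd p) powr s) b"
    for a b :: "'n phase \<Rightarrow> complex" and C1 C2 M s
  proof -
    interpret kernel_symbol a M by (rule ks)
    have C1: "0 \<le> C1" using fa by (simp add: ftr_bound_def)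
    let ?g = "\<lambda>z p. ftr a (fst p, z) * (exp (\<i> * complex_of_real (snd p \<bullet> (- z))) * b (p + (- z, 0)))"
    have cb: "continuous_on UNIV b" by (rule smooth_on_continuous[OF sb])
    have meas: "(\<lambda>z. ?g z p) \<in> borel_measurable lborel" for p
      by (simp del: inner_minus_right, intro borel_measurable_continuous_onI continuous_intros
          continuous_on_compose2[OF continuous_kernel] continuous_on_compose2[OF cb]) auto
    let ?H = "\<lambda>z::real^'n. c0 * (C1 * C2) * jbracket z powr (- (2 * real N - real k))"
    have bd: "dbound (\<lambda>_ _. 1) UNIV k (?H z) (\<lambda>p. jbracket (snd p) powr s) (?g z)" for z
    proof -
      let ?J = "jbracket z powr (- 2 * real N)"
      have 1: "dbound (\<lambda>_ _. 1) UNIV k (B1 ^ k * (j * C1 * ?J)) (\<lambda>p::'n phase. 1) (\<lambda>p. ftr a (fst p, z))"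
        using B1(2)[OF ftr_slice_decay[OF fa, of z], of UNIV 0] by (simp add: j_def)
      have 2: "dbound (\<lambda>_ _. 1) UNIV k (B2 ^ k * (1 + norm z) ^ k) (\<lambda>p::'n phase. 1) (\<lambda>p. exp (\<i> * complex_of_real (snd p \<bullet> (- z))))"
        using B2(2)[OF dbound_iexp[where t = "- z"], of UNIV k 0] by simp
      have 3: "dbound (\<lambda>_ _. 1) UNIV k (B3 ^ k * C2) (\<lambda>p::'n phase. jbracket (snd p) powr s) (\<lambda>p. b (p + (- z, 0)))"
        using B3(2)[OF b, of UNIV "(- z, 0)"] by simp
      note P = dbound_mult[OF open_UNIV 1 dbound_mult[OF open_UNIV 2 3]]
      show ?thesis
      proof (rule dbound_mono[OF P])
        fix p :: "'n phase"
        have "1 + norm z \<le> 2 * jbracket z" using norm_le_jbracket[of z] jbracket_ge1[of z] by linarith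
        then have "(1 + norm z) ^ k \<le> (2 * jbracket z) ^ k" by (intro power_mono) auto
        also have "\<dots> = 2 ^ k * jbracket z powr real k" by (simp add: power_mult_distrib powr_realpow)
        finally have "?J * (1 + norm z) ^ k \<le> ?J * (2 ^ k * jbracket z powr real k)" by (intro mult_left_mono) auto
        also have "\<dots> = 2 ^ k * jbracket z powr (- (2 * real N - real k))"
          using powr_add[of "jbracket z" "- 2 * real N" "real k"] by simp
        finally have J: "?J * (1 + norm z) ^ k \<le> 2 ^ k * jbracket z powr (- (2 * real N - real k))" .
        have "2 ^ k * (B1 ^ k * (j * C1 * ?J) * (2 ^ k * (B2 ^ k * (1 + norm z) ^ k * (B3 ^ k * C2)))) * (1 * (1 * jbracket (snd p) powr s))
          = (2 ^ k * (B1 ^ k * j) * (2 ^ k * (B2 ^ k * B3 ^ k)) * (C1 * C2) * jbracket (snd p) powr s) * (?J * (1 + norm z) ^ k)"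
          by (simp add: mult_ac)
        also have "\<dots> \<le> (2 ^ k * (B1 ^ k * j) * (2 ^ k * (B2 ^ k * B3 ^ k)) * (C1 * C2) * jbracket (snd p) powr s) * (2 ^ k * jbracket z powr (- (2 * real N - real k)))"
          by (intro mult_left_mono[OF J] mult_nonneg_nonneg) (use B1(1) B2(1) B3(1) j C1 C2 in auto)
        also have "\<dots> = ?H z * jbracket (snd p) powr s" by (simp add: c0_def mult_ac)
        finally show "2 ^ k * (B1 ^ k * (j * C1 * ?J) * (2 ^ k * (B2 ^ k * (1 + norm z) ^ k * (B3 ^ k * C2)))) * (1 * (1 * jbracket (snd p) powr s))
          \<le> ?H z * jbracket (snd p) powr s" .
      qed simp
    qed
    have N2: "2 * real CARD('n) \<le> 2 * real N - real k" by (simp add: N_def)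
    have H: "integrable lborel ?H" "\<And>z. 0 \<le> ?H z"
      using integrable_jbracket[OF N2] c0 C1 C2 by auto
    have cw: "continuous_on UNIV (\<lambda>p::'n phase. jbracket (snd p) powr s)" by (intro continuous_intros) auto
    have "dbound (\<lambda>_ _. 1) UNIV k (LINT z|lborel. ?H z) (\<lambda>p. jbracket (snd p) powr s) (\<lambda>p. LINT z|lborel. ?g z p)"
      by (rule dbound_integral(2)[OF meas bd H cw])
    moreover have "(LINT z|lborel. ?H z) \<le> c0 * (C1 * C2) * jint TYPE('n)"
    proof -
      have "(LINT z|lborel. ?H z) = c0 * (C1 * C2) * (LINT z|lborel. jbracket (z::real^'n) powr (- (2 * real N - real k)))" by simp
      also have "\<dots> \<le> c0 * (C1 * C2) * jint TYPE('n)"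
        by (intro mult_left_mono integral_jbracket_le N2 mult_nonneg_nonneg c0 C1 C2)
      finally show ?thesis .
    qed
    ultimately have "dbound (\<lambda>_ _. 1) UNIV k (c0 * (C1 * C2) * jint TYPE('n)) (\<lambda>p. jbracket (snd p) powr s) (\<lambda>p. LINT z|lborel. ?g z p)"
      by (rule dbound_const_mono) auto
    from dbound_const_mult[OF open_UNIV this, of "pnorm TYPE('n)"]
    show ?thesis by (simp add: kcomp_def[abs_def] c_def mult_ac)
  qed
  moreover have "0 \<le> c" unfolding c_def by (intro mult_nonneg_nonneg c0 jint_nonneg) auto
  ultimately show ?thesis by blast
qed

lemma dbound_linear_ex:
  fixes L :: "'a::euclidean_space \<Rightarrow> 'b::euclidean_space"
  assumes "linear L"
  shows "\<exists>B\<ge>1. \<forall>k C w f U c. dbound (\<lambda>_ _. 1) UNIV k C w f \<longrightarrow>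
      dbound (\<lambda>_ _. 1) U k (B ^ k * C) (\<lambda>z. w (L z + c)) (\<lambda>z. f (L z + c))"
proof -
  obtain B where B: "1 \<le> B"
    "\<And>k C w f U c. dbound (\<lambda>_ _. 1) UNIV k C w f \<Longrightarrow>
      dbound (\<lambda>_ _. 1) U k (B ^ k * C) (\<lambda>z. w (L z + c)) (\<lambda>z. f (L z + c))"
    using dbound_linear[OF assms] by metis
  then show ?thesis by (intro exI[of _ B]) simp
qed

text \<open>For a rapidly decreasing symbol the kernel is smooth and decreasing in \<open>z\<close>,
  so the integral over \<open>z\<close> is itself a Fourier transform evaluated at - \<xi>.
  Smoothness in \<open>z\<close> then becomes decay in \<xi>, whatever the order of
  \<open>b\<close>.\<close>

lemma comp_rapid_bound:
  "\<exists>c\<ge>0. \<exists>k' M'. \<forall>(a :: 'n::finite phase \<Rightarrow> complex) b C1 C2 s.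
     rapid (\<lambda>_. 1) a \<longrightarrow> smooth_on UNIV b \<longrightarrow> 0 \<le> C1 \<longrightarrow> 0 \<le> C2 \<longrightarrow>
     dbound (\<lambda>_ _. 1) UNIV k' C1 (\<lambda>p. jbracket (snd p) powr (- real M')) a \<longrightarrow>
     dbound (\<lambda>_ _. 1) UNIV k' C2 (\<lambda>p. jbracket (snd p) powr s) b \<longrightarrow>
     dbound (\<lambda>_ _. 1) UNIV k (c * (C1 * C2)) (\<lambda>p. jbracket (snd p) powr (s - 2 * real N)) (kcomp a b)"
proof -
  \<comment> \<open>\<open>k1\<close> counts \<open>2 * N\<close> derivatives in \<open>z\<close> to
    be traded for decay in \<xi> and \<open>k\<close> that survive. \<open>N1\<close> gives the
    product in \<open>z\<close> the decay \<open>2 * CARD('n) + 2 * k\<close>, enough for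
    \<open>k\<close> joint derivatives, and \<open>M'\<close> is the decay of \<open>a\<close> that
    allows \<open>k1\<close> joint derivatives of its kernel.\<close>
  define k1 where "k1 = k + 2 * N"
  define N1 where "N1 = CARD('n) + k"
  define M' where "M' = 2 * CARD('n) + k1"
  obtain c1 where c1: "c1 \<ge> 0" "\<And>(g :: 'n phase \<Rightarrow> complex) C M \<omega>. ftr_bound g C M \<omega> (k1 + 2 * N1) \<Longrightarrow>
      2 * real CARD('n) + real k1 \<le> M \<Longrightarrow>
      dbound (\<lambda>_ _. 1) UNIV k1 (c1 * C) (\<lambda>p. \<omega> (fst p) * jbracket (snd p) powr (- 2 * real N1)) (ftr g)"
    using ftr_joint[where 'w = "real^'n" and 'n = 'n, of k1 N1] by blast
  obtain c3 where c3: "c3 \<ge> 0" "\<And>(g :: 'n phase \<times> (real^'n) \<Rightarrow> complex) C M \<omega>. ftr_bound g C M \<omega> (k + 2 * N) \<Longrightarrow>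
      2 * real CARD('n) + real k \<le> M \<Longrightarrow>
      dbound (\<lambda>_ _. 1) UNIV k (c3 * C) (\<lambda>p. \<omega> (fst p) * jbracket (snd p) powr (- 2 * real N)) (ftr g)"
    using ftr_joint[where 'w = "'n phase" and 'n = 'n, of k N] by blast
  have l1: "linear (\<lambda>q::'n phase \<times> (real^'n). (fst (fst q), snd q))" by (auto intro!: linearI)
  have l2: "linear (\<lambda>q::'n phase \<times> (real^'n). fst q + (- snd q, 0))" by (auto intro!: linearI simp: algebra_simps)
  have l3: "linear (\<lambda>p::'n phase. (p, - snd p))" by (auto intro!: linearI)
  obtain B1 where B1: "1 \<le> B1" "\<forall>k C w (f :: 'n phase \<Rightarrow> complex) U c. dbound (\<lambda>_ _. 1) UNIV k C w f \<longrightarrow>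
      dbound (\<lambda>_ _. 1) U k (B1 ^ k * C) (\<lambda>q::'n phase \<times> (real^'n). w ((fst (fst q), snd q) + c)) (\<lambda>q. f ((fst (fst q), snd q) + c))"
    using dbound_linear_ex[OF l1] by blast
  obtain B2 where B2: "1 \<le> B2" "\<forall>k C w (f :: 'n phase \<Rightarrow> complex) U c. dbound (\<lambda>_ _. 1) UNIV k C w f \<longrightarrow>
      dbound (\<lambda>_ _. 1) U k (B2 ^ k * C) (\<lambda>q::'n phase \<times> (real^'n). w ((fst q + (- snd q, 0)) + c)) (\<lambda>q. f ((fst q + (- snd q, 0)) + c))"
    using dbound_linear_ex[OF l2] by blast
  obtain B3 where B3: "1 \<le> B3" "\<forall>k C w (f :: 'n phase \<times> (real^'n) \<Rightarrow> complex) U c. dbound (\<lambda>_ _. 1) UNIV k C w f \<longrightarrow>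
      dbound (\<lambda>_ _. 1) U k (B3 ^ k * C) (\<lambda>p. w ((p, - snd p) + c)) (\<lambda>p. f ((p, - snd p) + c))"
    using dbound_linear_ex[OF l3] by blast
  define c2 where "c2 = 2 ^ k1 * (B1 ^ k1 * c1 * B2 ^ k1)"
  define c where "c = norm (pnorm TYPE('n)) * (B3 ^ k * (c3 * c2))"
  have c: "0 \<le> c2" "0 \<le> c" using c1(1) c3(1) B1(1) B2(1) B3(1) by (auto simp: c_def c2_def intro!: mult_nonneg_nonneg)
  have "dbound (\<lambda>_ _. 1) UNIV k (c * (C1 * C2)) (\<lambda>p. jbracket (snd p) powr (s - 2 * real N)) (kcomp a b)"
    if ra: "rapid (\<lambda>_. 1) a" and sb: "smooth_on UNIV b" and C: "0 \<le> C1" "0 \<le> C2"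
      and a: "dbound (\<lambda>_ _. 1) UNIV (k1 + 2 * N1) C1 (\<lambda>p. jbracket (snd p) powr (- real M')) a"
      and b: "dbound (\<lambda>_ _. 1) UNIV (k1 + 2 * N1) C2 (\<lambda>p. jbracket (snd p) powr s) b"
    for a b :: "'n phase \<Rightarrow> complex" and C1 C2 s
  proof -
    have fa: "ftr_bound a C1 (real M') (\<lambda>_. 1) (k1 + 2 * N1)"
      by unfold_locales (use rapid_smooth[OF ra] a C in \<open>auto simp: M'_def\<close>)
    have K: "dbound (\<lambda>_ _. 1) UNIV k1 (c1 * C1) (\<lambda>p. 1 * jbracket (snd p) powr (- 2 * real N1)) (ftr a)"
      by (rule c1(2)[OF fa]) (simp add: M'_def)
    have sK: "smooth_on UNIV (ftr a)" by (rule rapid_smooth[OF rapid_ftr[OF ra]]) auto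
    let ?G = "\<lambda>q::'n phase \<times> (real^'n). ftr a (fst (fst q), snd q) * b (fst q + (- snd q, 0))"
    have sG: "smooth_on UNIV ?G"
    proof -
      have "diff_on j UNIV (\<lambda>q::'n phase \<times> (real^'n). ftr a ((fst (fst q), snd q) + 0))" for j
        by (rule diff_on_affine[OF _ l1]) (use sK in \<open>simp add: smooth_on_diff_on\<close>)
      moreover have "diff_on j UNIV (\<lambda>q::'n phase \<times> (real^'n). b ((fst q + (- snd q, 0)) + 0))" for j
        by (rule diff_on_affine[OF _ l2]) (use sb in \<open>simp add: smooth_on_diff_on\<close>)
      ultimately show ?thesis
        unfolding smooth_on_diff_on using diff_on_mult[OF open_UNIV] by (simp only: add_0_right) blast
    qed
    have b': "dbound (\<lambda>_ _. 1) UNIV k1 C2 (\<lambda>p. jbracket (snd p) powr s) b" by (rule dbound_le[OF b]) simp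
    have G: "dbound (\<lambda>_ _. 1) UNIV k1 (c2 * (C1 * C2)) (\<lambda>q. jbracket (snd (fst q)) powr s * jbracket (snd q) powr (- (2 * real N1))) ?G"
      by (rule dbound_mono[OF dbound_mult[OF open_UNIV B1(2)[rule_format, OF K, of UNIV 0, unfolded add_0_right] B2(2)[rule_format, OF b', of UNIV 0, unfolded add_0_right]]])
        (simp_all add: c2_def mult_ac)
    have fG: "ftr_bound ?G (c2 * (C1 * C2)) (2 * real N1) (\<lambda>p. jbracket (snd p) powr s) (k + 2 * N)"
    proof unfold_locales
      show "0 \<le> c2 * (C1 * C2)" using c C by (intro mult_nonneg_nonneg)
      show "continuous_on UNIV (\<lambda>p::'n phase. jbracket (snd p) powr s)" by (intro continuous_intros) auto
    qed (use sG G in \<open>auto simp: k1_def N1_def\<close>)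
    have T: "dbound (\<lambda>_ _. 1) UNIV k (c3 * (c2 * (C1 * C2))) (\<lambda>p. jbracket (snd (fst p)) powr s * jbracket (snd p) powr (- 2 * real N)) (ftr ?G)"
      by (rule c3(2)[OF fG]) (simp add: N1_def)
    \<comment> \<open>Second use of \<open>ftr\<close>: the whole phase point is now the parameter,
      the integration variable is \<open>z\<close>, and the dual variable is set to - \<xi>.\<close>
    have e: "kcomp a b = (\<lambda>p. pnorm TYPE('n) * ftr ?G (p, - snd p))"
      by (auto simp: kcomp_def[abs_def] ftr_def mult_ac)
    show ?thesis
      unfolding e
    proof (rule dbound_mono[OF dbound_const_mult[OF open_UNIV B3(2)[rule_format, OF T, of UNIV 0, unfolded add_0_right]]])
      fix z :: "'n phase"
      show "norm (pnorm TYPE('n)) * (B3 ^ k * (c3 * (c2 * (C1 * C2)))) * (jbracket (snd (fst (z, - snd z))) powr s * jbracket (snd (z, - snd z)) powr (- 2 * real N))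
        \<le> c * (C1 * C2) * jbracket (snd z) powr (s - 2 * real N)"
        using powr_add[of "jbracket (snd z)" s "- 2 * real N"] by (simp add: c_def mult_ac)
    qed simp
  qed
  then show ?thesis using c by blast
qed

section \<open>Nets of symbols without gain\<close>

abbreviation esym :: "real \<Rightarrow> real \<Rightarrow> ('n::finite phase \<Rightarrow> complex) net \<Rightarrow> bool" where
  "esym \<alpha> s f \<equiv> est (\<lambda>_ _. 1) UNIV (\<lambda>\<epsilon> p. \<epsilon> powr \<alpha> * jbracket (snd p) powr s) f"

lemma esym_iff:
  "esym \<alpha> s f \<longleftrightarrow> (\<forall>k. \<exists>C. O1 C \<and> (\<forall>\<epsilon>\<in>{0<..1}.
     dbound (\<lambda>_ _. 1) UNIV k (C \<epsilon> * \<epsilon> powr \<alpha>) (\<lambda>p. jbracket (snd p) powr s) (f \<epsilon>)))"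
proof -
  have "dbound (\<lambda>_ _. 1) UNIV k C (\<lambda>p::'a phase. e * jbracket (snd p) powr s) g \<longleftrightarrow>
      dbound (\<lambda>_ _. 1) UNIV k (C * e) (\<lambda>p. jbracket (snd p) powr s) g" for k C e g
    by (auto elim!: dbound_mono simp: mult_ac)
  then show ?thesis unfolding est_def estk_def by simp
qed

lemma esymE:
  assumes "esym \<alpha> s f"
  obtains C where "O1 C" "\<And>\<epsilon>. \<epsilon> \<in> {0<..1} \<Longrightarrow>
    dbound (\<lambda>_ _. 1) UNIV k (C \<epsilon> * \<epsilon> powr \<alpha>) (\<lambda>p. jbracket (snd p) powr s) (f \<epsilon>)"
  using assms[unfolded esym_iff, rule_format, of k] by blast

lemma esym_psym: assumes "esym \<alpha> s f" "\<epsilon> \<in> {0<..1}" shows "psym s (f \<epsilon>)"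
  unfolding psym_def
proof
  fix k
  obtain C where C: "O1 C" "\<And>\<epsilon>. \<epsilon> \<in> {0<..1} \<Longrightarrow>
    dbound (\<lambda>_ _. 1) UNIV k (C \<epsilon> * \<epsilon> powr \<alpha>) (\<lambda>p. jbracket (snd p) powr s) (f \<epsilon>)"
    using esymE[OF assms(1)] by metis
  show "\<exists>C\<ge>0. dbound (\<lambda>_ _. 1) UNIV k C (\<lambda>p. jbracket (snd p) powr s) (f \<epsilon>)"
    by (rule exI[of _ "C \<epsilon> * \<epsilon> powr \<alpha>"]) (use C(2)[OF assms(2)] O1_nonneg[OF C(1)] in auto)
qed

lemma psym_esym: assumes "psym s a" shows "esym 0 s (\<lambda>_. a)"
  unfolding esym_iff
proof
  fix k
  obtain C where C: "C \<ge> 0" "dbound (\<lambda>_ _. 1) UNIV k C (\<lambda>p. jbracket (snd p) powr s) a"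
    using assms unfolding psym_def by blast
  show "\<exists>C. O1 C \<and> (\<forall>\<epsilon>\<in>{0<..1}. dbound (\<lambda>_ _. 1) UNIV k (C \<epsilon> * \<epsilon> powr 0) (\<lambda>p. jbracket (snd p) powr s) a)"
    by (rule exI[of _ "\<lambda>_. C"]) (use C in \<open>auto intro: O1_const\<close>)
qed

lemma esym_mult:
  assumes "esym \<alpha> s f" "esym \<beta> t g" shows "esym (\<alpha> + \<beta>) (s + t) (\<lambda>\<epsilon> p. f \<epsilon> p * g \<epsilon> p)"
  by (rule est_cong[OF est_mult[OF open_UNIV assms]]) (auto simp: powr_add)

lemma esym_mono:
  assumes "esym \<alpha> s f" "\<alpha>' \<le> \<alpha>" "s \<le> t" shows "esym \<alpha>' t f"
proof (rule est_mono[OF assms(1), where c = 1])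
  fix \<epsilon> :: real and z :: "'a phase" assume \<epsilon>: "\<epsilon> \<in> {0<..1}"
  then have "\<epsilon> powr \<alpha> \<le> \<epsilon> powr \<alpha>'" using powr_mono'[OF assms(2), of \<epsilon>] by auto
  then show "\<epsilon> powr \<alpha> * jbracket (snd z) powr s \<le> 1 * (\<epsilon> powr \<alpha>' * jbracket (snd z) powr t)"
    using assms(3) by (auto intro!: mult_mono jbracket_powr_mono)
qed auto

lemma esym_sum: "(\<And>i. i \<in> I \<Longrightarrow> esym \<alpha> s (f i)) \<Longrightarrow> esym \<alpha> s (\<lambda>\<epsilon> p. \<Sum>i\<in>I. f i \<epsilon> p)"
  by (rule est_sum) auto

lemma esym_dir_deriv: "esym \<alpha> s f \<Longrightarrow> b \<in> Basis \<Longrightarrow> esym \<alpha> s (\<lambda>\<epsilon>. dir_deriv b (f \<epsilon>))"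
  using est_deriv[of "\<lambda>_ _. 1" UNIV _ f b] by fastforce

lemma esym_kcomp:
  fixes a b :: "('n::finite phase \<Rightarrow> complex) net"
  assumes a: "esym \<alpha> (- M) a" and M: "2 * real CARD('n) + 1 \<le> M" and b: "esym \<beta> s b"
  shows "\<And>\<epsilon>. \<epsilon> \<in> {0<..1} \<Longrightarrow> kernel_symbol (a \<epsilon>) M" "esym (\<alpha> + \<beta>) s (\<lambda>\<epsilon>. kcomp (a \<epsilon>) (b \<epsilon>))"
proof -
  have fb: "ftr_bound (a \<epsilon>) C M (\<lambda>_. 1) k"
    if "\<epsilon> \<in> {0<..1}" "dbound (\<lambda>_ _. 1) UNIV k C (\<lambda>p. jbracket (snd p) powr (- M)) (a \<epsilon>)" "0 \<le> C" for \<epsilon> k C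
    by unfold_locales (use that est_smooth[OF a that(1)] M in auto)
  show ks: "kernel_symbol (a \<epsilon>) M" if e: "\<epsilon> \<in> {0<..1}" for \<epsilon>
  proof
    fix k
    obtain C where "C \<ge> 0" "dbound (\<lambda>_ _. 1) UNIV k C (\<lambda>p. jbracket (snd p) powr (- M)) (a \<epsilon>)"
      using esym_psym[OF a e] unfolding psym_def by blast
    then show "\<exists>C. ftr_bound (a \<epsilon>) C M (\<lambda>_. 1) k" using fb[OF e] by blast
  qed (rule M)
  show "esym (\<alpha> + \<beta>) s (\<lambda>\<epsilon>. kcomp (a \<epsilon>) (b \<epsilon>))"
    unfolding esym_iff
  proof
    fix k
    obtain c k' where c: "c \<ge> 0" "\<And>(a :: 'n phase \<Rightarrow> complex) b C1 C2 M s. kernel_symbol a M \<Longrightarrow> ftr_bound a C1 M (\<lambda>_. 1) k' \<Longrightarrow> smooth_on UNIV b \<Longrightarrow> 0 \<le> C2 \<Longrightarrow>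
     dbound (\<lambda>_ _. 1) UNIV k C2 (\<lambda>p. jbracket (snd p) powr s) b \<Longrightarrow>
     dbound (\<lambda>_ _. 1) UNIV k (c * (C1 * C2)) (\<lambda>p. jbracket (snd p) powr s) (kcomp a b)"
      using comp_bound[where 'n = 'n, of k] by blast
    obtain C where C: "O1 C" "\<And>\<epsilon>. \<epsilon> \<in> {0<..1} \<Longrightarrow>
      dbound (\<lambda>_ _. 1) UNIV k' (C \<epsilon> * \<epsilon> powr \<alpha>) (\<lambda>p. jbracket (snd p) powr (- M)) (a \<epsilon>)"
      using esymE[OF a] by metis
    obtain D where D: "O1 D" "\<And>\<epsilon>. \<epsilon> \<in> {0<..1} \<Longrightarrow>
      dbound (\<lambda>_ _. 1) UNIV k (D \<epsilon> * \<epsilon> powr \<beta>) (\<lambda>p. jbracket (snd p) powr s) (b \<epsilon>)"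
      using esymE[OF b] by metis
    have nn: "0 \<le> C \<epsilon> * \<epsilon> powr \<alpha>" "0 \<le> D \<epsilon> * \<epsilon> powr \<beta>" for \<epsilon>
      using O1_nonneg[OF C(1)] O1_nonneg[OF D(1)] by auto
    show "\<exists>C. O1 C \<and> (\<forall>\<epsilon>\<in>{0<..1}. dbound (\<lambda>_ _. 1) UNIV k (C \<epsilon> * \<epsilon> powr (\<alpha> + \<beta>)) (\<lambda>p. jbracket (snd p) powr s) (kcomp (a \<epsilon>) (b \<epsilon>)))"
    proof (intro exI conjI ballI)
      show "O1 (\<lambda>\<epsilon>. c * (C \<epsilon> * D \<epsilon>))" by (rule O1_mult[OF O1_const[OF c(1)] O1_mult[OF C(1) D(1)]])
      fix \<epsilon> :: real assume \<epsilon>: "\<epsilon> \<in> {0<..1}"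
      have "dbound (\<lambda>_ _. 1) UNIV k (c * ((C \<epsilon> * \<epsilon> powr \<alpha>) * (D \<epsilon> * \<epsilon> powr \<beta>))) (\<lambda>p. jbracket (snd p) powr s) (kcomp (a \<epsilon>) (b \<epsilon>))"
        by (rule c(2)[OF ks[OF \<epsilon>] fb[OF \<epsilon> C(2)[OF \<epsilon>] nn(1)] est_smooth[OF b \<epsilon>] nn(2) D(2)[OF \<epsilon>]])
      then show "dbound (\<lambda>_ _. 1) UNIV k (c * (C \<epsilon> * D \<epsilon>) * \<epsilon> powr (\<alpha> + \<beta>)) (\<lambda>p. jbracket (snd p) powr s) (kcomp (a \<epsilon>) (b \<epsilon>))"
        by (simp add: powr_add mult_ac)
    qed
  qed
qed

lemma esym_kcomp_rapid:
  fixes a b :: "('n::finite phase \<Rightarrow> complex) net"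
  assumes a: "\<And>N. esym \<alpha> (- real N) a" and b: "esym \<beta> s b"
  shows "esym (\<alpha> + \<beta>) (- real N) (\<lambda>\<epsilon>. kcomp (a \<epsilon>) (b \<epsilon>))"
proof -
  \<comment> \<open>\<open>2 * N'\<close> powers of decay outweigh the order \<open>s\<close> and
    still leave \<open>N\<close>.\<close>
  obtain N' :: nat where N': "s + real N \<le> 2 * real N'"
    using real_arch_simple[of "s + real N"] by (metis add_increasing mult_2 of_nat_0_le_iff)
  have ra: "rapid (\<lambda>_. 1) (a \<epsilon>)" if "\<epsilon> \<in> {0<..1}" for \<epsilon>
    using esym_psym[OF a that] unfolding rapid_def psym_def by simp
  have "esym (\<alpha> + \<beta>) (s - 2 * real N') (\<lambda>\<epsilon>. kcomp (a \<epsilon>) (b \<epsilon>))"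
    unfolding esym_iff
  proof
    fix k
    obtain c k' M' where c: "c \<ge> 0" "\<And>(a :: 'n phase \<Rightarrow> complex) b C1 C2 s. rapid (\<lambda>_. 1) a \<Longrightarrow> smooth_on UNIV b \<Longrightarrow> 0 \<le> C1 \<Longrightarrow> 0 \<le> C2 \<Longrightarrow>
     dbound (\<lambda>_ _. 1) UNIV k' C1 (\<lambda>p. jbracket (snd p) powr (- real M')) a \<Longrightarrow>
     dbound (\<lambda>_ _. 1) UNIV k' C2 (\<lambda>p. jbracket (snd p) powr s) b \<Longrightarrow>
     dbound (\<lambda>_ _. 1) UNIV k (c * (C1 * C2)) (\<lambda>p. jbracket (snd p) powr (s - 2 * real N')) (kcomp a b)"
      using comp_rapid_bound[where 'n = 'n, of k N'] by blast
    obtain C where C: "O1 C" "\<And>\<epsilon>. \<epsilon> \<in> {0<..1} \<Longrightarrow>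
      dbound (\<lambda>_ _. 1) UNIV k' (C \<epsilon> * \<epsilon> powr \<alpha>) (\<lambda>p. jbracket (snd p) powr (- real M')) (a \<epsilon>)"
      using esymE[OF a] by metis
    obtain D where D: "O1 D" "\<And>\<epsilon>. \<epsilon> \<in> {0<..1} \<Longrightarrow>
      dbound (\<lambda>_ _. 1) UNIV k' (D \<epsilon> * \<epsilon> powr \<beta>) (\<lambda>p. jbracket (snd p) powr s) (b \<epsilon>)"
      using esymE[OF b] by metis
    have nn: "0 \<le> C \<epsilon> * \<epsilon> powr \<alpha>" "0 \<le> D \<epsilon> * \<epsilon> powr \<beta>" for \<epsilon>
      using O1_nonneg[OF C(1)] O1_nonneg[OF D(1)] by auto
    show "\<exists>C. O1 C \<and> (\<forall>\<epsilon>\<in>{0<..1}. dbound (\<lambda>_ _. 1) UNIV k (C \<epsilon> * \<epsilon> powr (\<alpha> + \<beta>)) (\<lambda>p. jbracket (snd p) powr (s - 2 * real N')) (kcomp (a \<epsilon>) (b \<epsilon>)))"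
    proof (intro exI conjI ballI)
      show "O1 (\<lambda>\<epsilon>. c * (C \<epsilon> * D \<epsilon>))" by (rule O1_mult[OF O1_const[OF c(1)] O1_mult[OF C(1) D(1)]])
      fix \<epsilon> :: real assume \<epsilon>: "\<epsilon> \<in> {0<..1}"
      have "dbound (\<lambda>_ _. 1) UNIV k (c * ((C \<epsilon> * \<epsilon> powr \<alpha>) * (D \<epsilon> * \<epsilon> powr \<beta>))) (\<lambda>p. jbracket (snd p) powr (s - 2 * real N')) (kcomp (a \<epsilon>) (b \<epsilon>))"
        by (rule c(2)[OF ra[OF \<epsilon>] est_smooth[OF b \<epsilon>] nn(1) nn(2) C(2)[OF \<epsilon>] D(2)[OF \<epsilon>]])
      then show "dbound (\<lambda>_ _. 1) UNIV k (c * (C \<epsilon> * D \<epsilon>) * \<epsilon> powr (\<alpha> + \<beta>)) (\<lambda>p. jbracket (snd p) powr (s - 2 * real N')) (kcomp (a \<epsilon>) (b \<epsilon>))"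
        by (simp add: powr_add mult_ac)
    qed
  qed
  then show ?thesis by (rule esym_mono) (use N' in auto)
qed

lemma kernel_symbol_rapid:
  fixes a :: "('n::finite phase \<Rightarrow> complex) net"
  assumes a: "\<And>N. esym \<alpha> (- real N) a" and "\<epsilon> \<in> {0<..1}"
  shows "kernel_symbol (a \<epsilon>) (2 * real CARD('n) + 1)"
  using esym_kcomp(1)[of \<alpha> "2 * real CARD('n) + 1" a 0 0 "\<lambda>_ _. 1"] a[of "2 * CARD('n) + 1"] assms(2)
    psym_esym[OF psym_const[of 1]]
  by (simp add: add.commute)

section \<open>Composition with a left symbol of order at most 0\<close>

text \<open>The symbol of 1 minus the Laplacian composed with the operator of \<open>a\<close>:
  every \<open>Lx\<close> stands for - \<i> times a derivative, so the squares add up to minus the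
  Laplacian.\<close>

definition Lapsym :: "('n::finite phase \<Rightarrow> complex) \<Rightarrow> 'n phase \<Rightarrow> complex" where
  "Lapsym a p = a p + (\<Sum>b\<in>Basis. Lx b (Lx b a) p)"

definition Lap :: "(real ^ 'n::finite \<Rightarrow> complex) \<Rightarrow> real ^ 'n \<Rightarrow> complex" where
  "Lap v x = v x + (\<Sum>b\<in>Basis. Dx b (Dx b v) x)"

lemma esym_Lx: assumes "esym \<alpha> s f" "b \<in> Basis" shows "esym \<alpha> (s + 1) (\<lambda>\<epsilon>. Lx b (f \<epsilon>))"
proof -
  have "esym \<alpha> (s + 1) (\<lambda>\<epsilon> p. complex_of_real (snd p \<bullet> b) * f \<epsilon> p)"
    using esym_mult[OF psym_esym[OF psym_coordinate[OF assms(2)]] assms(1)] by (simp add: add.commute)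
  moreover have "esym \<alpha> (s + 1) (\<lambda>\<epsilon> p. (- \<i>) * dir_deriv (b, 0) (f \<epsilon>) p)"
    by (rule esym_mono[OF est_cmult[OF open_UNIV esym_dir_deriv[OF assms(1) Basis_0_pair(2)[OF assms(2)]]]]) auto
  ultimately show ?thesis unfolding Lx_def[abs_def] by (rule est_add[OF open_UNIV])
qed

lemma esym_Lapsym: assumes "esym \<alpha> s f" shows "esym \<alpha> (s + 2) (\<lambda>\<epsilon>. Lapsym (f \<epsilon>))"
proof -
  have "esym \<alpha> (s + 2) (\<lambda>\<epsilon>. Lx b (Lx b (f \<epsilon>)))" if "b \<in> Basis" for b
    using esym_Lx[OF esym_Lx[OF assms that] that] by (simp add: add.assoc)
  then show ?thesis
    unfolding Lapsym_def[abs_def] by (intro est_add open_UNIV esym_sum esym_mono[OF assms]) auto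
qed

lemma esym_Lapsym_pow: "esym \<alpha> s f \<Longrightarrow> esym \<alpha> (s + 2 * real k) (\<lambda>\<epsilon>. (Lapsym ^^ k) (f \<epsilon>))"
proof (induction k)
  case (Suc k)
  from esym_Lapsym[OF Suc.IH[OF Suc.prems]] show ?case by (simp add: algebra_simps)
qed simp

lemma rapid1_Dx: "rapid1 v \<Longrightarrow> b \<in> Basis \<Longrightarrow> rapid1 (Dx b v)"
  unfolding Dx_def[abs_def] by (intro rapid1_cmult rapid1_dir_deriv)

lemma rapid1_zero: "rapid1 (\<lambda>x. 0)"
  unfolding rapid1_def by (auto intro!: exI[of _ 0] dbound_const)

lemma rapid1_sum: "(\<And>i. i \<in> I \<Longrightarrow> rapid1 (f i)) \<Longrightarrow> rapid1 (\<lambda>x. \<Sum>i\<in>I. f i x)"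
  by (induction I rule: infinite_finite_induct) (auto intro: rapid1_add rapid1_zero)

lemma rapid1_Lap: "rapid1 v \<Longrightarrow> rapid1 (Lap v)"
  unfolding Lap_def[abs_def] by (intro rapid1_add rapid1_sum rapid1_Dx) auto

lemma fourier_Dx:
  assumes "rapid1 v" "b \<in> Basis" shows "fourier (Dx b v) \<xi> = complex_of_real (\<xi> \<bullet> b) * fourier v \<xi>"
proof -
  have "fourier (Dx b v) \<xi> = (- \<i>) * ft (dir_deriv b v) (- \<xi>)"
    unfolding fourier_ft ft_def Dx_def by (subst integral_mult_right_zero[symmetric]) (simp add: mult_ac)
  also have "\<dots> = complex_of_real (\<xi> \<bullet> b) * fourier v \<xi>"
    by (simp add: ft_dir_deriv(1)[OF assms] fourier_ft mult.assoc[symmetric])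
  finally show ?thesis .
qed

lemma fourier_sum:
  assumes "\<And>i. i \<in> I \<Longrightarrow> rapid1 (f i)"
  shows "fourier (\<lambda>x. \<Sum>i\<in>I. f i x) \<xi> = (\<Sum>i\<in>I. fourier (f i) \<xi>)"
  using assms
proof (induction I rule: infinite_finite_induct)
  case (insert i I)
  then show ?case by (simp add: fourier_add rapid1_sum)
qed (simp_all add: fourier_def)

lemma fourier_Lap:
  assumes "rapid1 v" shows "fourier (Lap v) \<xi> = complex_of_real ((jbracket \<xi>)\<^sup>2) * fourier v \<xi>"
proof -
  have "fourier (Lap v) \<xi> = fourier v \<xi> + (\<Sum>b\<in>Basis. complex_of_real (\<xi> \<bullet> b) * (complex_of_real (\<xi> \<bullet> b) * fourier v \<xi>))"
    unfolding Lap_def[abs_def]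
    by (subst fourier_add) (auto simp: fourier_sum fourier_Dx rapid1_Dx assms intro!: rapid1_sum)
  also have "\<dots> = complex_of_real (1 + (\<Sum>b\<in>Basis. (\<xi> \<bullet> b)\<^sup>2)) * fourier v \<xi>"
    by (simp add: sum_distrib_left sum_distrib_right algebra_simps power2_eq_square)
  also have "(\<Sum>b\<in>Basis. (\<xi> \<bullet> b)\<^sup>2) = (norm \<xi>)\<^sup>2"
    unfolding power2_norm_eq_inner by (subst euclidean_inner) (simp add: power2_eq_square)
  finally show ?thesis by (simp add: jbracket_sq)
qed

lemma Lap_pow:
  assumes "rapid1 v"
  shows "rapid1 ((Lap ^^ k) v)" "fourier ((Lap ^^ k) v) \<xi> = complex_of_real (jbracket \<xi> ^ (2 * k)) * fourier v \<xi>"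
proof -
  show r: "rapid1 ((Lap ^^ k) v)" for k by (induction k) (auto intro: assms rapid1_Lap)
  show "fourier ((Lap ^^ k) v) \<xi> = complex_of_real (jbracket \<xi> ^ (2 * k)) * fourier v \<xi>"
  proof (induction k)
    case (Suc k)
    then show ?case by (simp add: fourier_Lap[OF r] power2_eq_square mult_ac)
  qed simp
qed

lemma psdo_Lapsym:
  assumes "psym s a" "rapid1 u" shows "psdo (Lapsym a) u = Lap (psdo a u)"
proof
  fix x
  have L: "psym (s + 2) (Lx b (Lx b a))" if "b \<in> Basis" for b
    using psym_Lx[OF psym_Lx[OF assms(1) that] that] by (simp add: add.assoc)
  have e: "psdo (Lx b (Lx b a)) u = Dx b (Dx b (psdo a u))" if "b \<in> Basis" for b
    by (simp add: psdo_Lx[OF psym_Lx[OF assms(1) that] assms(2) that] psdo_Lx[OF assms that])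
  show "psdo (Lapsym a) u x = Lap (psdo a u) x"
    unfolding Lapsym_def[abs_def] Lap_def
    by (subst psdo_add_symbol[OF assms(1) psym_sum[OF L] assms(2)], simp)
      (simp add: psdo_sum_symbol[OF L assms(2)] e)
qed

lemma psdo_Lapsym_pow:
  assumes "psym s a" "rapid1 u" shows "psdo ((Lapsym ^^ k) a) u = (Lap ^^ k) (psdo a u)"
proof (induction k)
  case (Suc k)
  have "psym (s + 2 * real k) ((Lapsym ^^ k) a)"
    using esym_psym[OF esym_Lapsym_pow[OF psym_esym[OF assms(1)]], of 1] by simp
  from psdo_Lapsym[OF this assms(2)] show ?case by (simp add: Suc)
qed simp

definition jwt :: "nat \<Rightarrow> 'n::finite phase \<Rightarrow> complex" where
  "jwt k p = complex_of_real (inverse ((jbracket (snd p))\<^sup>2)) ^ k"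

text \<open>The square of \<open>jbracket \<xi>\<close> is a polynomial whose derivatives are
  bounded by the polynomial itself, so \<open>est_inverse\<close> applies.\<close>

lemma psym_jwt: "psym (- 2 * real k) (jwt k :: 'n::finite phase \<Rightarrow> complex)"
proof -
  let ?W = "\<lambda>p::'n phase. complex_of_real ((jbracket (snd p))\<^sup>2)"
  have e: "?W = (\<lambda>p. 1 + (\<Sum>b\<in>Basis. complex_of_real (snd p \<bullet> b) * complex_of_real (snd p \<bullet> b)))"
  proof
    fix p :: "'n phase"
    have "(norm (snd p))\<^sup>2 = (\<Sum>b\<in>Basis. (snd p \<bullet> b) * (snd p \<bullet> b))"
      unfolding power2_norm_eq_inner by (rule euclidean_inner)
    then show "?W p = 1 + (\<Sum>b\<in>Basis. complex_of_real (snd p \<bullet> b) * complex_of_real (snd p \<bullet> b))"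
      by (simp add: jbracket_sq)
  qed
  have c: "psym 2 (\<lambda>p::'n phase. complex_of_real (snd p \<bullet> b) * complex_of_real (snd p \<bullet> b))" if "b \<in> Basis" for b
    using psym_mult[OF psym_coordinate psym_coordinate, OF that that] by simp
  have "psym 2 ?W" unfolding e by (intro psym_add psym_sum c psym_mono[OF psym_const]) auto
  from psym_esym[OF this] have "est (\<lambda>_ _. 1) UNIV (\<lambda>\<epsilon> p. norm (?W p)) (\<lambda>_. ?W)"
    by (rule est_mono[where c = 1]) (auto simp: norm_power)
  from est_inverse[OF open_UNIV this] have "est (\<lambda>_ _. 1) UNIV (\<lambda>\<epsilon> p. inverse (norm (?W p))) (\<lambda>\<epsilon> p. inverse (?W p))"
    by simp
  then have "esym 0 (- 2) (\<lambda>\<epsilon> p. inverse (?W p))"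
    by (rule est_mono[where c = 1]) (auto simp: norm_power powr_minus)
  then have 1: "esym 0 (- 2) (\<lambda>_. jwt 1 :: 'n phase \<Rightarrow> complex)"
    by (rule est_cong) (auto simp: jwt_def)
  show ?thesis
  proof (induction k)
    case 0
    show ?case using psym_const[of 1] by (simp add: jwt_def[abs_def])
  next
    case (Suc k)
    from psym_mult[OF esym_psym[OF 1, of 1] Suc] show ?case
      by (simp add: jwt_def[abs_def] algebra_simps)
  qed
qed

lemma psdo_jwt:
  fixes v :: "real ^ 'n::finite \<Rightarrow> complex"
  assumes "rapid1 v" shows "psdo q v = psdo (\<lambda>p. q p * jwt k p) ((Lap ^^ k) v)"
proof
  fix x :: "real ^ 'n"
  have "exp (\<i> * complex_of_real (x \<bullet> \<xi>)) * (q (x, \<xi>) * jwt k (x, \<xi>)) * fourier ((Lap ^^ k) v) \<xi>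
      = exp (\<i> * complex_of_real (x \<bullet> \<xi>)) * q (x, \<xi>) * fourier v \<xi>" for \<xi> :: "real ^ 'n"
  proof -
    have "jwt k (x, \<xi>) * complex_of_real (jbracket \<xi> ^ (2 * k))
        = (complex_of_real (inverse ((jbracket \<xi>)\<^sup>2)) * complex_of_real ((jbracket \<xi>)\<^sup>2)) ^ k"
      by (simp only: jwt_def snd_conv of_real_power power_mult power_mult_distrib)
    also have "\<dots> = 1"
      using jbracket_pos[of \<xi>] by (simp flip: of_real_mult of_real_power)
    finally have 1: "jwt k (x, \<xi>) * complex_of_real (jbracket \<xi> ^ (2 * k)) = 1" .
    have "e * (r * j) * (l * f) = e * r * f" if "j * l = 1" for e r j l f :: complex
      proof -
      have "e * (r * j) * (l * f) = e * r * (j * l) * f" by (simp only: mult_ac)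
      then show ?thesis using that by simp
    qed
    from this[OF 1] show ?thesis unfolding Lap_pow(2)[OF assms] .
  qed
  then show "psdo q v x = psdo (\<lambda>p. q p * jwt k p) ((Lap ^^ k) v) x"
    unfolding psdo_def by (simp only:)
qed

text \<open>The factor \<open>jwt k\<close> makes the left symbol integrable, at the price of \<open>k\<close> Laplacians on the
  right.\<close>

definition qcomp :: "('n::finite phase \<Rightarrow> complex) \<Rightarrow> ('n phase \<Rightarrow> complex) \<Rightarrow> 'n phase \<Rightarrow> complex" where
  "qcomp q b = kcomp (\<lambda>p. q p * jwt (CARD('n) + 1) p) ((Lapsym ^^ (CARD('n) + 1)) b)"

lemma esym_qcomp:
  fixes q b :: "('n::finite phase \<Rightarrow> complex) net"
  assumes q: "esym \<alpha> t q" and t: "t \<le> 0" and b: "esym \<beta> s b"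
  shows "esym (\<alpha> + \<beta>) (s + 2 * real (CARD('n) + 1)) (\<lambda>\<epsilon>. qcomp (q \<epsilon>) (b \<epsilon>))"
    "\<epsilon> \<in> {0<..1} \<Longrightarrow> rapid1 u \<Longrightarrow> psdo (q \<epsilon>) (psdo (b \<epsilon>) u) = psdo (qcomp (q \<epsilon>) (b \<epsilon>)) u"
proof -
  \<comment> \<open>The order of \<open>q\<close> is at most 0, so the decay comes from
    \<open>jwt\<close> alone: its order \<open>- 2 * (CARD('n) + 1)\<close> is beyond what
    \<open>kernel_symbol\<close> requires.\<close>
  let ?k = "CARD('n) + 1"
  have a: "esym \<alpha> (- (2 * real ?k)) (\<lambda>\<epsilon> p. q \<epsilon> p * jwt ?k p)"
    by (rule esym_mono[OF esym_mult[OF q psym_esym[OF psym_jwt]]]) (use t in auto)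
  have M: "2 * real CARD('n) + 1 \<le> 2 * real ?k" by simp
  note L = esym_Lapsym_pow[OF b, of ?k]
  show "esym (\<alpha> + \<beta>) (s + 2 * real ?k) (\<lambda>\<epsilon>. qcomp (q \<epsilon>) (b \<epsilon>))"
    unfolding qcomp_def by (rule esym_kcomp(2)[OF a M L])
  assume \<epsilon>: "\<epsilon> \<in> {0<..1}" and u: "rapid1 u"
  note pb = esym_psym[OF b \<epsilon>]
  interpret kernel_symbol "\<lambda>p. q \<epsilon> p * jwt ?k p" "2 * real ?k" by (rule esym_kcomp(1)[OF a M L \<epsilon>])
  have "psdo (q \<epsilon>) (psdo (b \<epsilon>) u) = psdo (\<lambda>p. q \<epsilon> p * jwt ?k p) ((Lap ^^ ?k) (psdo (b \<epsilon>) u))"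
    by (rule psdo_jwt[OF rapid1_psdo[OF pb u]])
  also have "\<dots> = psdo (\<lambda>p. q \<epsilon> p * jwt ?k p) (psdo ((Lapsym ^^ ?k) (b \<epsilon>)) u)"
    by (simp only: psdo_Lapsym_pow[OF pb u])
  also have "\<dots> = psdo (qcomp (q \<epsilon>) (b \<epsilon>)) u"
    unfolding qcomp_def by (rule psdo_comp[OF esym_psym[OF L \<epsilon>] u])
  finally show "psdo (q \<epsilon>) (psdo (b \<epsilon>) u) = psdo (qcomp (q \<epsilon>) (b \<epsilon>)) u" .
qed

section \<open>Cutoffs and asymptotic summation\<close>

text \<open>The point is uniformity in \<open>t\<close>. On the support of the dilate,
  \<open>jbracket \<xi>\<close> is at most a multiple of \<open>t\<close>, so the factor
  \<open>1 / t\<close> from each derivative is as good as the gain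
  \<open>1 / jbracket \<xi>\<close>. The weight \<open>V\<close> is left open, being required only
  to exceed \<open>c\<close> on that support.\<close>

lemma dbound_dilate:
  fixes f :: "real ^ 'n::finite \<Rightarrow> complex"
  assumes "smooth_on UNIV f" "compact S" "S \<subseteq> cball 0 h" "\<And>\<eta>. \<eta> \<notin> S \<Longrightarrow> f \<eta> = 0"
  shows "\<exists>B\<ge>0. \<forall>t\<ge>1. \<forall>V c. 0 < c \<longrightarrow> (\<forall>\<xi>. 0 \<le> V \<xi>) \<longrightarrow> (\<forall>\<xi>. (1 / t) *\<^sub>R \<xi> \<in> S \<longrightarrow> c \<le> V \<xi>) \<longrightarrow>
    dbound (\<lambda>_ \<xi>. 1 / jbracket \<xi>) UNIV k (B / c) V (\<lambda>\<xi>. f ((1 / t) *\<^sub>R \<xi>))"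
  using assms(1,4)
proof (induction k arbitrary: f)
  case (0 f)
  obtain M where M: "\<And>\<eta>. \<eta> \<in> S \<Longrightarrow> norm (f \<eta>) \<le> M"
    using compact_imp_bounded[OF compact_continuous_image[OF continuous_on_subset[OF smooth_on_continuous[OF 0(1)]] assms(2)]]
    unfolding bounded_iff by auto
  have "norm (f ((1 / t) *\<^sub>R \<xi>)) \<le> max M 0 / c * V \<xi>"
    if "0 < c" "\<forall>\<xi>. 0 \<le> V \<xi>" "\<forall>\<xi>. (1 / t) *\<^sub>R \<xi> \<in> S \<longrightarrow> c \<le> V \<xi>" for t c :: real and V \<xi>
  proof (cases "(1 / t) *\<^sub>R \<xi> \<in> S")
    case True
    have "norm (f ((1 / t) *\<^sub>R \<xi>)) \<le> max M 0 / c * c" using M[OF True] that(1) by simp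
    also have "\<dots> \<le> max M 0 / c * V \<xi>" using True that by (intro mult_left_mono) auto
    finally show ?thesis .
  qed (use 0(2) that in auto)
  then show ?case by (intro exI[of _ "max M 0"]) auto
next
  case (Suc k f)
  define K where "K = sqrt (1 + h\<^sup>2)"
  have K: "K > 0" unfolding K_def by (simp add: add_pos_nonneg)
  have fd: "f differentiable (at z)" for z by (rule smooth_on_differentiable[OF Suc.prems(1)]) simp
  have z: "dir_deriv b f \<eta> = 0" if "\<eta> \<notin> S" for b \<eta>
    using dir_deriv_cong[of "- S" \<eta> f "\<lambda>_. 0" b] Suc.prems(2) compact_imp_closed[OF assms(2)] that
    by (simp add: open_Compl)
  define Q where "Q b B \<longleftrightarrow> 0 \<le> B \<and> (\<forall>t\<ge>1. \<forall>V c. 0 < c \<longrightarrow> (\<forall>\<xi>. 0 \<le> V \<xi>) \<longrightarrow> (\<forall>\<xi>. (1 / t) *\<^sub>R \<xi> \<in> S \<longrightarrow> c \<le> V \<xi>) \<longrightarrow>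
    dbound (\<lambda>_ \<xi>. 1 / jbracket \<xi>) UNIV k (B / c) V (\<lambda>\<xi>. dir_deriv b f ((1 / t) *\<^sub>R \<xi>)))" for b B
  have "\<exists>B. Q b B" for b
    unfolding Q_def by (rule Suc.IH[OF smooth_on_dir_deriv[OF open_UNIV Suc.prems(1)] z])
  then obtain D where Q: "\<And>b. Q b (D b)" by metis
  have D: "\<And>b. 0 \<le> D b" "\<And>b t V c. 1 \<le> t \<Longrightarrow> 0 < c \<Longrightarrow> (\<And>\<xi>. 0 \<le> V \<xi>) \<Longrightarrow> (\<And>\<xi>. (1 / t) *\<^sub>R \<xi> \<in> S \<Longrightarrow> c \<le> V \<xi>) \<Longrightarrow>
    dbound (\<lambda>_ \<xi>. 1 / jbracket \<xi>) UNIV k (D b / c) V (\<lambda>\<xi>. dir_deriv b f ((1 / t) *\<^sub>R \<xi>))"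
    using Q unfolding Q_def by simp_all
  obtain M where M: "\<And>\<eta>. \<eta> \<in> S \<Longrightarrow> norm (f \<eta>) \<le> M"
    using compact_imp_bounded[OF compact_continuous_image[OF continuous_on_subset[OF smooth_on_continuous[OF Suc.prems(1)]] assms(2)]]
    unfolding bounded_iff by auto
  define B where "B = max M 0 + (\<Sum>b\<in>Basis. D b * K)"
  have B: "max M 0 \<le> B" "b \<in> Basis \<Longrightarrow> D b * K \<le> B" for b
  proof -
    show "max M 0 \<le> B" unfolding B_def using D(1) K by (simp add: sum_nonneg)
    assume "b \<in> Basis"
    then have "D b * K \<le> (\<Sum>b\<in>Basis. D b * K)" using D(1) K by (intro member_le_sum) auto
    then show "D b * K \<le> B" by (simp add: B_def)
  qed
  have "dbound (\<lambda>_ \<xi>. 1 / jbracket \<xi>) UNIV (Suc k) (B / c) V (\<lambda>\<xi>. f ((1 / t) *\<^sub>R \<xi>))"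
    if t: "1 \<le> t" and c: "0 < c" and V: "\<forall>\<xi>. 0 \<le> V \<xi>" "\<forall>\<xi>. (1 / t) *\<^sub>R \<xi> \<in> S \<longrightarrow> c \<le> V \<xi>" for t c :: real and V
  proof -
    have lin: "linear (\<lambda>\<xi>::real^'n. (1 / t) *\<^sub>R \<xi>)" by (simp add: linear_scale_self)
    have 1: "norm (f ((1 / t) *\<^sub>R \<xi>)) \<le> B / c * V \<xi>" for \<xi>
    proof (cases "(1 / t) *\<^sub>R \<xi> \<in> S")
      case True
      have "norm (f ((1 / t) *\<^sub>R \<xi>)) \<le> B / c * c" using M[OF True] B(1) c by simp
      also have "\<dots> \<le> B / c * V \<xi>" using True V c B(1) by (intro mult_left_mono) auto
      finally show ?thesis .
    qed (use Suc.prems(2) V c B(1) in auto)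
    have 2: "(\<lambda>\<xi>. f ((1 / t) *\<^sub>R \<xi>)) differentiable (at \<xi>)" for \<xi>
      using differentiable_compose[of f "\<lambda>\<xi>. (1 / t) *\<^sub>R \<xi>" \<xi> UNIV] fd
      by (simp add: linear_imp_differentiable[OF lin])
    have 3: "dir_deriv b (\<lambda>\<xi>. f ((1 / t) *\<^sub>R \<xi>)) = (\<lambda>\<xi>. complex_of_real (1 / t) * dir_deriv b f ((1 / t) *\<^sub>R \<xi>))" for b
    proof
      fix \<xi>
      have "dir_deriv b (\<lambda>\<xi>. f ((1 / t) *\<^sub>R \<xi>)) \<xi> = dir_deriv ((1 / t) *\<^sub>R b) f ((1 / t) *\<^sub>R \<xi>)"
        using dir_deriv_affine[OF lin, of b f 0 \<xi>] by simp
      also have "\<dots> = complex_of_real (1 / t) * dir_deriv b f ((1 / t) *\<^sub>R \<xi>)"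
        unfolding dir_deriv_frechet[OF fd]
        by (subst linear_scale[OF has_derivative_linear[OF fd[unfolded frechet_derivative_works]]]) (simp add: scaleR_conv_of_real)
      finally show "dir_deriv b (\<lambda>\<xi>. f ((1 / t) *\<^sub>R \<xi>)) \<xi> = \<dots>" .
    qed
    have 4: "dbound (\<lambda>_ \<xi>. 1 / jbracket \<xi>) UNIV k (B / c) (\<lambda>\<xi>. V \<xi> * (1 / jbracket \<xi>)) (dir_deriv b (\<lambda>\<xi>. f ((1 / t) *\<^sub>R \<xi>)))"
      if b: "b \<in> Basis" for b
    proof -
      \<comment> \<open>For the derivative the induction hypothesis is used with weight
        \<open>t * V \<xi> / jbracket \<xi>\<close> and lower bound \<open>c / K\<close>; the extra
        \<open>t\<close> is cancelled by the chain rule factor.\<close>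
      have "c / K \<le> t * V \<xi> / jbracket \<xi>" if "(1 / t) *\<^sub>R \<xi> \<in> S" for \<xi>
      proof -
        have "norm \<xi> \<le> h * t" using subsetD[OF assms(3) that] t by (simp add: divide_le_eq)
        then have "(norm \<xi>)\<^sup>2 \<le> (h * t)\<^sup>2" by (rule power_mono) simp
        moreover have "1 \<le> t\<^sup>2" using t by simp
        ultimately have "1 + (norm \<xi>)\<^sup>2 \<le> (1 + h\<^sup>2) * t\<^sup>2"
          by (simp add: distrib_right power_mult_distrib)
        then have "sqrt (1 + (norm \<xi>)\<^sup>2) \<le> sqrt ((1 + h\<^sup>2) * t\<^sup>2)" by (rule real_sqrt_le_mono)
        also have "\<dots> = K * t" using t by (simp add: real_sqrt_mult K_def)
        finally have "jbracket \<xi> \<le> K * t" by (simp add: jbracket_def)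
        then have "c * jbracket \<xi> \<le> V \<xi> * (K * t)"
          using V that c jbracket_nonneg by (intro mult_mono) auto
        then show ?thesis using K jbracket_pos[of \<xi>] by (simp add: field_simps)
      qed
      then have "dbound (\<lambda>_ \<xi>. 1 / jbracket \<xi>) UNIV k (D b / (c / K)) (\<lambda>\<xi>. t * V \<xi> / jbracket \<xi>) (\<lambda>\<xi>. dir_deriv b f ((1 / t) *\<^sub>R \<xi>))"
        by (intro D(2)) (use V(1) t c K jbracket_nonneg in auto)
      from dbound_const_mult[OF open_UNIV this, of "complex_of_real (1 / t)"] show ?thesis
        unfolding 3
      proof (rule dbound_mono)
        fix \<xi>
        have "D b * K * (V \<xi> / (c * jbracket \<xi>)) \<le> B * (V \<xi> / (c * jbracket \<xi>))"
          using B(2)[OF b] V(1) c jbracket_nonneg by (intro mult_right_mono) auto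
        then show "norm (complex_of_real (1 / t)) * (D b / (c / K)) * (t * V \<xi> / jbracket \<xi>) \<le> B / c * (V \<xi> * (1 / jbracket \<xi>))"
          using t by (simp add: norm_divide mult_ac)
      qed (use jbracket_nonneg in auto)
    qed
    show ?thesis unfolding dbound.simps using 1 2 4 by blast
  qed
  note main = this
  have "0 \<le> B" using B(1) by simp
  show ?case
    apply (rule exI[of _ B])
    apply (rule conjI)
     apply (rule \<open>0 \<le> B\<close>)
    apply (intro allI impI)
    apply (rule main)
       apply assumption+
    done
qed

text \<open>The first summand of the denominator is positive outside the closed unit ball, the
  second inside the ball of radius 2, so the quotient is smooth; it is 0 on the unit ball and 1
  outside radius 2.\<close>

definition cutoff :: "real ^ 'n::finite \<Rightarrow> complex" where
  "cutoff \<eta> = complex_of_real (flat 0 ((norm \<eta>)\<^sup>2 - 1)) *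
    inverse (complex_of_real (flat 0 ((norm \<eta>)\<^sup>2 - 1)) + complex_of_real (bump 0 2 \<eta>))"

lemma smooth_cutoff: "smooth_on UNIV (cutoff :: real ^ 'n::finite \<Rightarrow> complex)"
proof -
  have f: "diff_on k UNIV (\<lambda>\<eta>::real^'n. complex_of_real (flat 0 ((norm \<eta>)\<^sup>2 - 1)))" for k
    using diff_on_compose_real[OF open_UNIV diff_on_norm_sq[of _ 1 0 "-1"] subset_UNIV diff_on_flat[of _ 0]] by simp
  have nz: "complex_of_real (flat 0 ((norm \<eta>)\<^sup>2 - 1)) + complex_of_real (bump 0 2 \<eta>) \<noteq> 0" for \<eta> :: "real^'n"
  proof -
    have "0 < flat 0 ((norm \<eta>)\<^sup>2 - 1) + bump 0 2 \<eta>"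
    proof (cases "norm \<eta> < 2")
      case True
      then show ?thesis using bump_pos[of \<eta> 0 2] by (simp add: flat_def add_nonneg_pos)
    next
      case False
      then have "1\<^sup>2 < (norm \<eta>)\<^sup>2" by (intro power_strict_mono) auto
      then show ?thesis using bump_nonneg[of 0 2 \<eta>] by (simp add: flat_def add_pos_nonneg)
    qed
    then show ?thesis by (metis of_real_add of_real_eq_0_iff less_irrefl)
  qed
  have "diff_on k UNIV (\<lambda>\<eta>::real^'n. complex_of_real (bump 0 2 \<eta>))" for k
    using smooth_on_bump unfolding smooth_on_diff_on by blast
  then show ?thesis
    unfolding smooth_on_diff_on cutoff_def[abs_def]
    using nz by (intro allI diff_on_mult diff_on_inverse diff_on_add f open_UNIV) auto
qed

lemma cutoff_0: "norm \<eta> \<le> 1 \<Longrightarrow> cutoff \<eta> = 0"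
  using power_mono[of "norm \<eta>" 1 2] by (simp add: cutoff_def flat_def)

lemma cutoff_1: assumes "2 \<le> norm \<eta>" shows "cutoff \<eta> = 1"
proof -
  have "2\<^sup>2 \<le> (norm \<eta>)\<^sup>2" using assms by (rule power_mono) simp
  then show ?thesis by (simp add: cutoff_def bump_def flat_def)
qed

definition cutoff_at :: "real \<Rightarrow> 'n::finite phase \<Rightarrow> complex" where
  "cutoff_at t p = cutoff ((1 / t) *\<^sub>R snd p)"

lemma cutoff_at_0: "0 < t \<Longrightarrow> norm (snd p) \<le> t \<Longrightarrow> cutoff_at t p = 0"
  unfolding cutoff_at_def by (rule cutoff_0) (simp add: field_simps)

lemma dbound_one_minus_cut:
  "\<exists>B\<ge>0. \<forall>t\<ge>1. dbound lam (UNIV :: 'n::finite phase set) k B (\<lambda>p. (t / jbracket (snd p)) ^ N) (\<lambda>p. 1 - cutoff_at t p)"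
proof -
  have "smooth_on UNIV (\<lambda>\<eta>::real^'n. 1 + (-1) * cutoff \<eta>)"
    using smooth_cutoff unfolding smooth_on_diff_on by (intro allI diff_on_add diff_on_cmult) auto
  then have sm: "smooth_on UNIV (\<lambda>\<eta>::real^'n. 1 - cutoff \<eta>)" by simp
  have z: "1 - cutoff \<eta> = 0" if "\<eta> \<notin> cball 0 2" for \<eta> :: "real^'n" using cutoff_1[of \<eta>] that by simp
  have "\<exists>B\<ge>0. (\<forall>t\<ge>1. \<forall>V c. 0 < c \<longrightarrow> (\<forall>\<xi>. 0 \<le> V \<xi>) \<longrightarrow> (\<forall>\<xi>. (1 / t) *\<^sub>R \<xi> \<in> cball 0 2 \<longrightarrow> c \<le> V \<xi>) \<longrightarrow>
    dbound (\<lambda>_ \<xi>::real^'n. 1 / jbracket \<xi>) UNIV k (B / c) V (\<lambda>\<xi>. 1 - cutoff ((1 / t) *\<^sub>R \<xi>)))"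
    by (rule dbound_dilate[OF sm compact_cball order_refl z])
  then obtain B where B: "B \<ge> 0" "\<forall>t\<ge>1. \<forall>V c. 0 < c \<longrightarrow> (\<forall>\<xi>. 0 \<le> V \<xi>) \<longrightarrow> (\<forall>\<xi>. (1 / t) *\<^sub>R \<xi> \<in> cball 0 2 \<longrightarrow> c \<le> V \<xi>) \<longrightarrow>
    dbound (\<lambda>_ \<xi>::real^'n. 1 / jbracket \<xi>) UNIV k (B / c) V (\<lambda>\<xi>. 1 - cutoff ((1 / t) *\<^sub>R \<xi>))"
    by (elim exE conjE)
  \<comment> \<open>On the support \<open>norm \<xi> \<le> 2 * t\<close> with
    \<open>1 \<le> t\<close>, so \<open>jbracket \<xi>\<close> is at most
    \<open>sqrt 5 * t\<close>.\<close>
  define c where "c = (1 / sqrt 5) ^ N"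
  have "dbound (\<lambda>_ \<xi>. 1 / jbracket \<xi>) UNIV k (B / c) (\<lambda>\<xi>::real^'n. (t / jbracket \<xi>) ^ N) (\<lambda>\<xi>. 1 - cutoff ((1 / t) *\<^sub>R \<xi>))" if t: "1 \<le> t" for t
  proof (rule B(2)[rule_format, OF t])
    show "c \<le> (t / jbracket \<xi>) ^ N" if "(1 / t) *\<^sub>R \<xi> \<in> cball 0 2" for \<xi> :: "real^'n"
    proof -
      from that have "norm \<xi> \<le> 2 * t" using t by (simp add: divide_le_eq)
      then have "(norm \<xi>)\<^sup>2 \<le> (2 * t)\<^sup>2" by (rule power_mono) simp
      moreover have "1 \<le> t\<^sup>2" using t by simp
      ultimately have "1 + (norm \<xi>)\<^sup>2 \<le> 5 * t\<^sup>2" by (simp add: power_mult_distrib)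
      then have "sqrt (1 + (norm \<xi>)\<^sup>2) \<le> sqrt (5 * t\<^sup>2)" by (rule real_sqrt_le_mono)
      also have "\<dots> = sqrt 5 * t" using t by (simp add: real_sqrt_mult)
      finally have "jbracket \<xi> \<le> sqrt 5 * t" by (simp add: jbracket_def)
      then have "1 / sqrt 5 \<le> t / jbracket \<xi>" using jbracket_pos[of \<xi>] by (simp add: field_simps)
      then show "c \<le> (t / jbracket \<xi>) ^ N" unfolding c_def by (rule power_mono) simp
    qed
  qed (use t jbracket_nonneg in \<open>auto simp: c_def\<close>)
  from dbound_snd[where 'a = "real ^ 'n", OF this] show ?thesis
    unfolding cutoff_at_def using B(1) by (intro exI[of _ "B / c"]) (auto simp add: c_def)
qed

lemma dbound_cut: "\<exists>B\<ge>0. \<forall>t\<ge>1. dbound lam (UNIV :: 'n::finite phase set) k B (\<lambda>p. 1) (cutoff_at t)"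
proof -
  obtain B where B: "B \<ge> 0" "\<forall>t\<ge>1. dbound lam (UNIV :: 'n::finite phase set) k B (\<lambda>p. (t / jbracket (snd p)) ^ 0) (\<lambda>p. 1 - cutoff_at t p)"
    using dbound_one_minus_cut[of k 0] by (elim exE conjE)
  have "dbound lam (UNIV :: 'n phase set) k (1 + norm (- 1 :: complex) * B) (\<lambda>p. 1) (\<lambda>p. 1 + (- 1) * (1 - cutoff_at t p))" if "1 \<le> t" for t
    by (intro dbound_add dbound_const_mult dbound_const open_UNIV lam_nonneg)
      (use B(2)[rule_format, OF that] in simp_all)
  then show ?thesis using B(1) by (intro exI[of _ "1 + B"]) simp
qed

text \<open>The cutoff vanishes where \<open>norm \<xi> \<le> t\<close>, and elsewhere
  \<open>jbracket \<xi> / t\<close> is bounded below. Giving up one order thus makes the cutoff as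
  small as desired, which drives the Borel summation.\<close>

lemma dbound_cut_small:
  "\<exists>B\<ge>0. \<forall>t\<ge>1. dbound lam (UNIV :: 'n::finite phase set) k B (\<lambda>p. jbracket (snd p) / t) (cutoff_at t)"
proof -
  obtain B where B: "B \<ge> 0" "\<forall>t\<ge>1. dbound lam (UNIV :: 'n phase set) k B (\<lambda>p. 1) (cutoff_at t)"
    using dbound_cut[of k] by (elim exE conjE)
  have "dbound lam (UNIV :: 'n phase set) k (2 * B) (\<lambda>p. jbracket (snd p) / t) (cutoff_at t)" if t: "1 \<le> t" for t
  proof -
    let ?U = "{p::'n phase. t / 2 < norm (snd p)}" and ?V = "{p::'n phase. norm (snd p) < t}"
    have oV: "open ?V" by (intro open_Collect_less continuous_intros)
    have "dbound lam ?U k (2 * B) (\<lambda>p. jbracket (snd p) / t) (cutoff_at t)"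
    proof (rule dbound_mono[OF dbound_subset[OF B(2)[rule_format, OF t] subset_UNIV]])
      fix p :: "'n phase" assume "p \<in> ?U"
      then have "1 \<le> 2 * (jbracket (snd p) / t)" using norm_le_jbracket[of "snd p"] t by (simp add: field_simps)
      from mult_left_mono[OF this B(1)] show "B * 1 \<le> 2 * B * (jbracket (snd p) / t)" by (simp add: mult_ac)
    qed simp
    moreover have "dbound lam ?V k (2 * B) (\<lambda>p. jbracket (snd p) / t) (cutoff_at t)"
      by (rule dbound_cong[OF oV dbound_const[of _ 0]]) (use t B(1) in \<open>auto intro!: cutoff_at_0\<close>)
    ultimately have "dbound lam (\<Union>{?U, ?V}) k (2 * B) (\<lambda>p. jbracket (snd p) / t) (cutoff_at t)"
      by (intro dbound_Union) auto
    moreover have "\<Union>{?U, ?V} = UNIV" using t by auto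
    ultimately show ?thesis by simp
  qed
  then show ?thesis using B(1) by (intro exI[of _ "2 * B"]) simp
qed

lemma est_mono_dir:
  assumes "est l U w f" "\<And>b z. 0 \<le> l b z" "\<And>b z. l b z \<le> l' b z" "\<And>\<epsilon> z. 0 \<le> w \<epsilon> z"
  shows "est l' U w f"
  unfolding est_def estk_def
proof
  fix k
  obtain C where C: "O1 C" "\<forall>\<epsilon>\<in>{0<..1}. dbound l U k (C \<epsilon>) (w \<epsilon>) (f \<epsilon>)"
    using estD[OF assms(1), of k] unfolding estk_def by (elim exE conjE)
  have "dbound l' U k (C \<epsilon>) (w \<epsilon>) (f \<epsilon>)" if "\<epsilon> \<in> {0<..1}" for \<epsilon>
    by (rule dbound_mono_dir[OF C(2)[rule_format, OF that] assms(2,3)])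
      (use O1_nonneg[OF C(1)] assms(4) in simp)
  with C(1) show "\<exists>C. O1 C \<and> (\<forall>\<epsilon>\<in>{0<..1}. dbound l' U k (C \<epsilon>) (w \<epsilon>) (f \<epsilon>))" by blast
qed

lemma est_Dp:
  assumes "open U" "est l U w f" "\<And>b z. 0 \<le> l b z" "\<And>b z. l b z \<le> 1" "\<And>\<epsilon> z. 0 \<le> w \<epsilon> z" "b \<in> Basis"
  shows "est l U w (\<lambda>\<epsilon>. Dp b (f \<epsilon>))"
  unfolding Dp_def[abs_def]
proof (rule est_cmult[OF assms(1) est_mono[OF est_deriv[OF assms(2) Basis_0_pair(2)[OF assms(6)]] assms(3)]])
  fix \<epsilon> :: real and z
  show "w \<epsilon> z * l (b, 0) z \<le> 1 * w \<epsilon> z"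
    using mult_left_mono[OF assms(4)[of "(b, 0)" z] assms(5)[of \<epsilon> z]] by simp
qed simp

text \<open>The \<open>k\<close> powers of decay come from the covariable derivatives of
  \<open>p\<close> alone, while those of \<open>f\<close> are taken in the position and need only
  not lose. Hence any gain \<open>l\<close> between \<open>lam\<close> and 1 is allowed for
  \<open>f\<close>.\<close>

lemma est_Phi:
  assumes "open U" and l: "\<And>b z. 0 \<le> l b z" "\<And>b z. lam b z \<le> l b z" "\<And>b z. l b z \<le> 1"
    and v: "\<And>\<epsilon> z. 0 \<le> v \<epsilon> z"
  shows "est lam U w p \<Longrightarrow> est l U v f \<Longrightarrow> (\<And>\<epsilon> z. 0 \<le> w \<epsilon> z) \<Longrightarrow>
    est l U (\<lambda>\<epsilon> z. w \<epsilon> z * v \<epsilon> z * jbracket (snd z) powr (- real k)) (\<lambda>\<epsilon>. Phi k (p \<epsilon>) (f \<epsilon>))"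
proof (induction k arbitrary: w p f)
  case (0 w p f)
  have "est l U (\<lambda>\<epsilon> z. w \<epsilon> z * v \<epsilon> z) (\<lambda>\<epsilon> z. p \<epsilon> z * f \<epsilon> z)"
    by (rule est_mult[OF assms(1) est_mono_dir[OF 0(1) lam_nonneg l(2) 0(3)] 0(2)])
  then show ?case by simp
next
  case (Suc k w p f)
  have "est l U (\<lambda>\<epsilon> z. w \<epsilon> z * v \<epsilon> z * jbracket (snd z) powr (- real (Suc k)))
      (\<lambda>\<epsilon>. Phi k (dir_deriv (0, b) (p \<epsilon>)) (Dp b (f \<epsilon>)))" if b: "b \<in> Basis" for b
  proof (rule est_cong[OF Suc.IH[of "\<lambda>\<epsilon> z. w \<epsilon> z * lam (0, b) z"] assms(1) refl])
    show "est lam U (\<lambda>\<epsilon> z. w \<epsilon> z * lam (0, b) z) (\<lambda>\<epsilon>. dir_deriv (0, b) (p \<epsilon>))"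
      by (rule est_deriv[OF Suc.prems(1) Basis_0_pair(1)[OF b]])
    show "est l U v (\<lambda>\<epsilon>. Dp b (f \<epsilon>))" by (rule est_Dp[OF assms(1) Suc.prems(2) l(1,3) v b])
    show "0 \<le> w \<epsilon> z * lam (0, b) z" for \<epsilon> z by (intro mult_nonneg_nonneg Suc.prems(3) lam_nonneg)
    show "w \<epsilon> z * lam (0, b) z * v \<epsilon> z * jbracket (snd z) powr (- real k) =
        w \<epsilon> z * v \<epsilon> z * jbracket (snd z) powr (- real (Suc k))" for \<epsilon> z
      using powr_add[of "jbracket (snd z)" "- 1" "- real k"] by (simp add: lam_def powr_minus divide_inverse mult_ac)
  qed
  then show ?case
    unfolding Phi.simps by (intro est_cmult est_sum assms(1) l(1)) (auto intro!: mult_nonneg_nonneg v Suc.prems(3))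
qed

lemma dbound_glue:
  assumes "dbound l U k C w f" "open V" "U \<union> V = UNIV" "\<And>z. z \<in> V \<Longrightarrow> f z = 0"
    "\<And>z. 0 \<le> C * w z" "\<And>b z. 0 \<le> l b z"
  shows "dbound l UNIV k C w f"
proof -
  have "dbound l V k C w f"
    by (rule dbound_cong[OF assms(2) dbound_const[of V 0 C w l k]]) (use assms(4,5,6) in auto)
  then have "dbound l (\<Union>{U, V}) k C w f" using assms(1) by (intro dbound_Union) auto
  then show ?thesis using assms(3) by simp
qed

lemma est_glue:
  assumes "est l U w f" "open V" "U \<union> V = UNIV" "\<And>\<epsilon> z. \<epsilon> \<in> {0<..1} \<Longrightarrow> z \<in> V \<Longrightarrow> f \<epsilon> z = 0"
    "\<And>\<epsilon> z. 0 \<le> w \<epsilon> z" "\<And>b z. 0 \<le> l b z"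
  shows "est l UNIV w f"
  unfolding est_def estk_def
proof
  fix k
  obtain C where C: "O1 C" "\<forall>\<epsilon>\<in>{0<..1}. dbound l U k (C \<epsilon>) (w \<epsilon>) (f \<epsilon>)"
    using estD[OF assms(1), of k] unfolding estk_def by (elim exE conjE)
  have "dbound l UNIV k (C \<epsilon>) (w \<epsilon>) (f \<epsilon>)" if "\<epsilon> \<in> {0<..1}" for \<epsilon>
    by (rule dbound_glue[OF C(2)[rule_format, OF that] assms(2,3) assms(4)[OF that]])
      (use O1_nonneg[OF C(1)] assms(5,6) in simp_all)
  with C(1) show "\<exists>C. O1 C \<and> (\<forall>\<epsilon>\<in>{0<..1}. dbound l UNIV k (C \<epsilon>) (w \<epsilon>) (f \<epsilon>))" by blast
qed

lemma est_cut:
  assumes "\<And>\<epsilon>. 1 \<le> t \<epsilon>"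
  shows "est lam (UNIV :: 'n::finite phase set) (\<lambda>_ _. 1) (\<lambda>\<epsilon>. cutoff_at (t \<epsilon>))"
  unfolding est_def estk_def
proof
  fix k
  obtain B where "B \<ge> 0" "\<forall>t\<ge>1. dbound lam (UNIV :: 'n phase set) k B (\<lambda>p. 1) (cutoff_at t)"
    using dbound_cut[of k] by (elim exE conjE)
  then show "\<exists>C. O1 C \<and> (\<forall>\<epsilon>\<in>{0<..1}. dbound lam (UNIV :: 'n phase set) k (C \<epsilon>) (\<lambda>_. 1) (cutoff_at (t \<epsilon>)))"
    using assms by (intro exI[of _ "\<lambda>_. B"]) (simp add: O1_const)
qed

lemma est_one_minus_cut:
  assumes "\<And>\<epsilon>. 1 \<le> t \<epsilon>" "O1 t"
  shows "est lam (UNIV :: 'n::finite phase set) (\<lambda>_ p. jbracket (snd p) powr (- real N)) (\<lambda>\<epsilon> p. 1 - cutoff_at (t \<epsilon>) p)"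
  unfolding est_def estk_def
proof
  fix k
  obtain B where B: "B \<ge> 0" "\<forall>t\<ge>1. dbound lam (UNIV :: 'n phase set) k B (\<lambda>p. (t / jbracket (snd p)) ^ N) (\<lambda>p. 1 - cutoff_at t p)"
    using dbound_one_minus_cut[of k N] by (elim exE conjE)
  have "dbound lam (UNIV :: 'n phase set) k (B * t \<epsilon> ^ N) (\<lambda>p. jbracket (snd p) powr (- real N)) (\<lambda>p. 1 - cutoff_at (t \<epsilon>) p)" for \<epsilon>
    by (rule dbound_mono[OF B(2)[rule_format, OF assms(1)[of \<epsilon>]]])
      (simp_all add: powr_minus powr_realpow power_mult_distrib power_inverse divide_inverse)
  then show "\<exists>C. O1 C \<and> (\<forall>\<epsilon>\<in>{0<..1}. dbound lam (UNIV :: 'n phase set) k (C \<epsilon>) (\<lambda>p. jbracket (snd p) powr (- real N)) (\<lambda>p. 1 - cutoff_at (t \<epsilon>) p))"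
    using O1_mult[OF O1_const[OF B(1)] O1_power[OF assms(2), of N]] by (intro exI[of _ "\<lambda>\<epsilon>. B * t \<epsilon> ^ N"]) simp
qed

section \<open>Borel summation\<close>

lemma sum_half_le: "(\<Sum>j\<in>{m..<n}. (1 / 2 :: real) ^ j) \<le> 2"
proof -
  have "(\<Sum>j\<in>{m..<n}. (1 / 2 :: real) ^ j) \<le> (\<Sum>j<n. (1 / 2) ^ j)"
    by (rule sum_mono2) auto
  also have "\<dots> \<le> 2" by (simp add: sum_gp_strict)
  finally show ?thesis .
qed

text \<open>The classical construction with dilations depending on \<epsilon>. As the constants of
  the \<open>q j\<close> are bounded near 0, the dilations can be chosen bounded as well, so
  replacing \<open>q j\<close> by its cut version costs no power of \<epsilon>.\<close>

theorem borel_sum: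
  fixes q :: "nat \<Rightarrow> ('n::finite phase \<Rightarrow> complex) net"
  assumes q: "\<And>j. est lam UNIV (\<lambda>\<epsilon> z. \<omega> \<epsilon> z * jbracket (snd z) powr (- real j)) (q j)"
    and \<omega>: "\<And>\<epsilon> z. 0 \<le> \<omega> \<epsilon> z"
  shows "\<exists>Q. \<forall>J. est lam UNIV (\<lambda>\<epsilon> z. \<omega> \<epsilon> z * jbracket (snd z) powr (- real J)) (\<lambda>\<epsilon> z. Q \<epsilon> z - (\<Sum>j<J. q j \<epsilon> z))"
proof -
  let ?W = "\<lambda>J \<epsilon> z::'n phase. \<omega> \<epsilon> z * jbracket (snd z) powr (- real J)"
  define A where "A j k C \<longleftrightarrow> O1 C \<and> (\<forall>\<epsilon>\<in>{0<..1}. dbound lam UNIV k (C \<epsilon>) (?W j \<epsilon>) (q j \<epsilon>))" for j k C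
  have "\<forall>j k. \<exists>C. A j k C" using estD[OF q] unfolding A_def estk_def by blast
  then obtain C where C': "\<And>j k. A j k (C j k)" by metis
  have C: "O1 (C j k)" "\<And>\<epsilon>. \<epsilon> \<in> {0<..1} \<Longrightarrow> dbound lam UNIV k (C j k \<epsilon>) (?W j \<epsilon>) (q j \<epsilon>)" for j k
    using C'[of j k] unfolding A_def by simp_all
  define A' where "A' k B \<longleftrightarrow> 0 \<le> B \<and> (\<forall>t\<ge>1. dbound lam (UNIV :: 'n::finite phase set) k B (\<lambda>p. jbracket (snd p) / t) (cutoff_at t))" for k B
  have "\<exists>B. A' k B" for k unfolding A'_def by (rule dbound_cut_small)
  then obtain B where B': "\<And>k. A' k (B k)" by metis
  have B: "0 \<le> B k" "\<And>t. 1 \<le> t \<Longrightarrow> dbound lam (UNIV :: 'n::finite phase set) k (B k) (\<lambda>p. jbracket (snd p) / t) (cutoff_at t)" for k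
    using B'[of k] unfolding A'_def by simp_all
  \<comment> \<open>The 1 keeps the dilation at least 1, \<open>real j\<close> makes the sum locally
    finite, and the last summand makes the \<open>j\<close>-th term at most
    \<open>(1 / 2) ^ j\<close> for all derivative orders \<open>k \<le> j\<close>. Only finitely
    many constants enter, so \<open>t j\<close> remains \<open>O1\<close>.\<close>
  define t where "t j \<epsilon> = 1 + real j + 2 ^ j * (\<Sum>k\<le>j. 2 ^ k * (B k * C j k \<epsilon>))" for j \<epsilon>
  have O1t: "O1 (t j)" for j
    unfolding t_def[abs_def]
    by (rule O1_add[OF O1_const O1_mult[OF O1_const O1_sum[OF O1_mult[OF O1_const O1_mult[OF O1_const[OF B(1)] C(1)]]]]]) auto
  have BC: "0 \<le> 2 ^ k * (B k * C j k \<epsilon>)" for j k \<epsilon> using B(1) O1_nonneg[OF C(1)] by simp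
  have t: "1 \<le> t j \<epsilon>" "real j \<le> t j \<epsilon>" for j \<epsilon>
    unfolding t_def using sum_nonneg[of "{..j}" "\<lambda>k. 2 ^ k * (B k * C j k \<epsilon>)"] BC by (simp_all add: add_increasing2)
  have tC: "2 ^ j * (2 ^ k * (B k * C j k \<epsilon>)) \<le> t j \<epsilon>" if "k \<le> j" for j k \<epsilon>
  proof -
    have "2 ^ k * (B k * C j k \<epsilon>) \<le> (\<Sum>k\<le>j. 2 ^ k * (B k * C j k \<epsilon>))"
      using that by (intro member_le_sum) (use BC in auto)
    then show ?thesis by (simp add: t_def add_increasing)
  qed
  define h where "h j \<epsilon> z = cutoff_at (t j \<epsilon>) z * q j \<epsilon> z" for j \<epsilon> z
  have h0: "h j \<epsilon> z = 0" if "norm (snd z) \<le> real j" for j \<epsilon> z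
    using cutoff_at_0[of "t j \<epsilon>" z] t[of j \<epsilon>] that by (simp add: h_def)
  \<comment> \<open>Terms with \<open>norm (snd z) \<le> real j\<close> vanish, so any sufficiently
    long partial sum gives the same value.\<close>
  define Q where "Q \<epsilon> z = (\<Sum>j<nat \<lceil>norm (snd z)\<rceil>. h j \<epsilon> z)" for \<epsilon> z
  have Q: "Q \<epsilon> z = (\<Sum>j<M. h j \<epsilon> z)" if "norm (snd z) \<le> real M" for M \<epsilon> z
    unfolding Q_def by (rule sum.mono_neutral_left) (use that in \<open>auto simp: ceiling_le_iff intro!: h0, linarith?\<close>)
  \<comment> \<open>Because \<open>J < j\<close> one order is to spare;
    \<open>dbound_cut_small\<close> spends it on the factor
    \<open>1 / t j \<epsilon>\<close>.\<close>
  have hb: "dbound lam UNIV k ((1 / 2) ^ j) (?W J \<epsilon>) (h j \<epsilon>)" if "\<epsilon> \<in> {0<..1}" "k \<le> j" "J < j" for j k J \<epsilon>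
    unfolding h_def[abs_def]
  proof (rule dbound_mono[OF dbound_mult[OF open_UNIV B(2)[OF t(1)] C(2)[OF that(1)]] _ lam_nonneg])
    fix z :: "'n phase"
    let ?j = "jbracket (snd z)"
    have "?j * ?j powr (- real j) = ?j powr (1 - real j)"
      using powr_add[of ?j 1 "- real j"] by simp
    also have "\<dots> \<le> ?j powr (- real J)" using that(3) by (intro jbracket_powr_mono) auto
    finally have 1: "\<omega> \<epsilon> z * (?j * ?j powr (- real j)) \<le> \<omega> \<epsilon> z * ?j powr (- real J)" by (intro mult_left_mono \<omega>)
    have 2: "2 ^ k * (B k * C j k \<epsilon>) / t j \<epsilon> \<le> (1 / 2) ^ j"
      using tC[OF that(2), of \<epsilon>] t(1)[of j \<epsilon>] by (simp add: field_simps)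
    have "2 ^ k * (B k * C j k \<epsilon>) / t j \<epsilon> * (\<omega> \<epsilon> z * (?j * ?j powr (- real j))) \<le> (1 / 2) ^ j * (\<omega> \<epsilon> z * ?j powr (- real J))"
      by (rule mult_mono[OF 2 1]) (use \<omega> in auto)
    then show "2 ^ k * (B k * C j k \<epsilon>) * (?j / t j \<epsilon> * (\<omega> \<epsilon> z * ?j powr (- real j))) \<le> (1 / 2) ^ j * (\<omega> \<epsilon> z * ?j powr (- real J))"
      by (simp add: mult_ac)
  qed
  \<comment> \<open>On each set \<open>V T\<close> the tail is a finite sum, and the geometric
    constants add up to at most 2, independently of \<open>T\<close> and \<epsilon>.\<close>
  have tail: "dbound lam UNIV k 2 (?W J \<epsilon>) (\<lambda>z. Q \<epsilon> z - (\<Sum>j<K. h j \<epsilon> z))"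
    if \<epsilon>: "\<epsilon> \<in> {0<..1}" and K: "k \<le> K" "J < K" for k J K \<epsilon>
  proof -
    define V where "V T = {z::'n phase. norm (snd z) < real T}" for T
    have oV: "open (V T)" for T unfolding V_def by (intro open_Collect_less continuous_intros)
    have "dbound lam (V T) k 2 (?W J \<epsilon>) (\<lambda>z. Q \<epsilon> z - (\<Sum>j<K. h j \<epsilon> z))" for T
    proof (rule dbound_cong[OF oV _ _ refl])
      have "dbound lam UNIV k (\<Sum>j\<in>{K..<K + T}. (1 / 2) ^ j) (?W J \<epsilon>) (\<lambda>z. \<Sum>j\<in>{K..<K + T}. h j \<epsilon> z)"
        by (rule dbound_sum[OF open_UNIV _ hb[OF \<epsilon>]]) (use K in auto)
      from dbound_subset[OF this subset_UNIV]
      show "dbound lam (V T) k 2 (?W J \<epsilon>) (\<lambda>z. \<Sum>j\<in>{K..<K + T}. h j \<epsilon> z)"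
        by (rule dbound_mono[OF _ mult_right_mono[OF sum_half_le]]) (use \<omega> in auto)
      fix z assume "z \<in> V T"
      then have "Q \<epsilon> z = (\<Sum>j<K + T. h j \<epsilon> z)" by (intro Q) (simp add: V_def)
      also have "\<dots> = (\<Sum>j<K. h j \<epsilon> z) + (\<Sum>j\<in>{K..<K + T}. h j \<epsilon> z)"
        using sum.atLeastLessThan_concat[of 0 K "K + T" "\<lambda>j. h j \<epsilon> z"] by (simp add: lessThan_atLeast0)
      finally show "(\<Sum>j\<in>{K..<K + T}. h j \<epsilon> z) = Q \<epsilon> z - (\<Sum>j<K. h j \<epsilon> z)" by simp
    qed
    then have "dbound lam (\<Union>(range V)) k 2 (?W J \<epsilon>) (\<lambda>z. Q \<epsilon> z - (\<Sum>j<K. h j \<epsilon> z))"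
      by (intro dbound_Union) auto
    moreover have "\<Union>(range V) = UNIV"
      unfolding V_def using reals_Archimedean2 by auto
    ultimately show ?thesis by simp
  qed
  have "estk k lam UNIV (?W J) (\<lambda>\<epsilon> z. Q \<epsilon> z - (\<Sum>j<J. q j \<epsilon> z))" for k J
  proof -
    \<comment> \<open>From \<open>K\<close> on the tail bound applies. Terms between
      \<open>J\<close> and \<open>K\<close> have sufficient order by themselves, and terms below
      \<open>J\<close> are altered only by the rapidly decaying factor
      \<open>1 - cutoff_at\<close>.\<close>
    define K where "K = Suc (max J k)"
    have JK: "J < K" "k \<le> K" by (auto simp: K_def)
    have 1: "estk k lam UNIV (?W J) (\<lambda>\<epsilon> z. Q \<epsilon> z - (\<Sum>j<K. h j \<epsilon> z))"
      unfolding estk_def using tail[OF _ JK(2,1)] by (intro exI[of _ "\<lambda>_. 2"]) (simp add: O1_const)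
    have 2: "est lam UNIV (?W J) (h j)" if "J \<le> j" for j
      unfolding h_def[abs_def]
    proof (rule est_mono[OF est_mult[OF open_UNIV est_cut[OF t(1)] q] lam_nonneg, where c = 1])
      fix \<epsilon> :: real and z :: "'n phase"
      have "jbracket (snd z) powr (- real j) \<le> jbracket (snd z) powr (- real J)" using that by (intro jbracket_powr_mono) auto
      from mult_left_mono[OF this \<omega>] show "1 * ?W j \<epsilon> z \<le> 1 * ?W J \<epsilon> z" by simp
    qed simp
    have 3: "est lam UNIV (?W J) (\<lambda>\<epsilon> z. (1 - cutoff_at (t j \<epsilon>) z) * q j \<epsilon> z)" for j
    proof (rule est_mono[OF est_mult[OF open_UNIV est_one_minus_cut[OF t(1) O1t, where N = J] q] lam_nonneg, where c = 1])
      fix \<epsilon> :: real and z :: "'n phase"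
      have "jbracket (snd z) powr (- real j) \<le> jbracket (snd z) powr 0" by (intro jbracket_powr_mono) auto
      then have "?W J \<epsilon> z * jbracket (snd z) powr (- real j) \<le> ?W J \<epsilon> z * 1" by (intro mult_left_mono) (auto simp: \<omega>)
      then show "jbracket (snd z) powr (- real J) * ?W j \<epsilon> z \<le> 1 * ?W J \<epsilon> z" by (simp add: mult_ac)
    qed simp
    have W: "0 \<le> ?W J \<epsilon> z" for \<epsilon> z using \<omega> by simp
    have "est lam UNIV (?W J) (\<lambda>\<epsilon> z. (\<Sum>j\<in>{J..<K}. h j \<epsilon> z) + (- 1) * (\<Sum>j<J. (1 - cutoff_at (t j \<epsilon>) z) * q j \<epsilon> z))"
      by (intro est_add est_cmult est_sum open_UNIV 2 3 lam_nonneg W) auto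
    from estk_add[OF open_UNIV 1 estD[OF this]] show ?thesis
    proof (rule estk_cong[OF _ open_UNIV _ refl])
      fix \<epsilon> :: real and z :: "'n phase"
      have "(\<Sum>j<K. h j \<epsilon> z) = (\<Sum>j<J. h j \<epsilon> z) + (\<Sum>j\<in>{J..<K}. h j \<epsilon> z)"
        using sum.atLeastLessThan_concat[of 0 J K "\<lambda>j. h j \<epsilon> z"] JK by (simp add: lessThan_atLeast0)
      then show "Q \<epsilon> z - (\<Sum>j<K. h j \<epsilon> z) + ((\<Sum>j\<in>{J..<K}. h j \<epsilon> z) + (- 1) * (\<Sum>j<J. (1 - cutoff_at (t j \<epsilon>) z) * q j \<epsilon> z)) = Q \<epsilon> z - (\<Sum>j<J. q j \<epsilon> z)"
        by (simp add: h_def algebra_simps sum_subtractf)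
    qed
  qed
  then show ?thesis unfolding est_def by blast
qed

section \<open>The parametrix\<close>

text \<open>The symbol of the composition of \<open>p\<close> with \<open>f\<close> when
  \<open>p\<close> has degree at most \<open>m\<close> in the covariable; \<open>crem\<close> is the
  part beyond the leading product.\<close>

definition csum :: "nat \<Rightarrow> ('n::finite phase \<Rightarrow> complex) \<Rightarrow> ('n phase \<Rightarrow> complex) \<Rightarrow> 'n phase \<Rightarrow> complex" where
  "csum m p f z = (\<Sum>k\<le>m. Phi k p f z)"

definition crem :: "nat \<Rightarrow> ('n::finite phase \<Rightarrow> complex) \<Rightarrow> ('n phase \<Rightarrow> complex) \<Rightarrow> 'n phase \<Rightarrow> complex" where
  "crem m p f z = (\<Sum>k\<in>{1..m}. Phi k p f z)"

lemma csum_crem: "csum m p f z = p z * f z + crem m p f z"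
proof -
  have "{..m} = insert 0 {1..m}" by auto
  then show ?thesis by (simp add: csum_def crem_def)
qed

lemma csum_add:
  "smooth_on UNIV f \<Longrightarrow> smooth_on UNIV g \<Longrightarrow> csum m p (\<lambda>z. f z + g z) z = csum m p f z + csum m p g z"
  by (simp add: csum_def Phi_add2 sum.distrib)

lemma csum_sum:
  "(\<And>i. i \<in> I \<Longrightarrow> smooth_on UNIV (f i)) \<Longrightarrow> csum m p (\<lambda>z. \<Sum>i\<in>I. f i z) z = (\<Sum>i\<in>I. csum m p (f i) z)"
  unfolding csum_def by (subst sum.swap) (simp add: Phi_sum2)

text \<open>The hypotheses in the form in which they are used: \<open>P\<close> carries (i),
  \<open>lower\<close> carries (ii) and \<open>PP\<close> carries (iii), with the modulus of
  \<open>P\<close> as its own weight. The differential structure enters only through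
  \<open>compose\<close>.\<close>

locale hypoelliptic_net =
  fixes P :: "('n::finite phase \<Rightarrow> complex) net" and m :: nat and m' a a' R :: real
  assumes P: "est lam UNIV (\<lambda>\<epsilon> z. \<epsilon> powr a * jbracket (snd z) powr real m) P"
    and aa': "a \<le> a'" and m': "0 \<le> m'" and R: "0 < R"
    and lower: "\<exists>C>0. \<forall>\<epsilon>\<in>{0<..1}. \<forall>z. R \<le> norm (snd z) \<longrightarrow>
      C * \<epsilon> powr a' * jbracket (snd z) powr m' \<le> norm (P \<epsilon> z)"
    and PP: "est lam {z. R < norm (snd z)} (\<lambda>\<epsilon> z. norm (P \<epsilon> z)) P"
    and compose: "\<And>\<epsilon> s f u. \<epsilon> \<in> {0<..1} \<Longrightarrow> psym s f \<Longrightarrow> rapid1 u \<Longrightarrow>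
      psdo (P \<epsilon>) (psdo f u) = psdo (csum m (P \<epsilon>) f) u"
begin

text \<open>An open cover: (iii) is available on \<open>U\<close> and the cutoff
  \<open>\<theta>\<close> vanishes on \<open>V\<close>. The radius \<open>R + 1\<close> makes the
  two overlap and is at least 1, as the cutoff estimates require.\<close>

abbreviation U :: "'n phase set" where "U \<equiv> {z. R < norm (snd z)}"
abbreviation V :: "'n phase set" where "V \<equiv> {z. norm (snd z) < R + 1}"
abbreviation \<theta> :: "'n phase \<Rightarrow> complex" where "\<theta> \<equiv> cutoff_at (R + 1)"

lemma UV: "open U" "open V" "U \<union> V = UNIV"
  by (auto intro!: open_Collect_less continuous_intros)

lemma P_nz: assumes "\<epsilon> \<in> {0<..1}" "R \<le> norm (snd z)" shows "P \<epsilon> z \<noteq> 0"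
proof -
  obtain C where C: "C > 0" "\<forall>\<epsilon>\<in>{0<..1}. \<forall>z. R \<le> norm (snd z) \<longrightarrow>
      C * \<epsilon> powr a' * jbracket (snd z) powr m' \<le> norm (P \<epsilon> z)" using lower by blast
  have "0 < C * \<epsilon> powr a' * jbracket (snd z) powr m'" using C(1) assms(1) jbracket_pos[of "snd z"] by simp
  also have "\<dots> \<le> norm (P \<epsilon> z)" using C(2) assms by blast
  finally show ?thesis by auto
qed

lemma \<theta>_V: "z \<in> V \<Longrightarrow> \<theta> z = 0"
  using R by (intro cutoff_at_0) auto

lemma est_\<theta>: "est lam UNIV (\<lambda>_ _. 1) (\<lambda>_. \<theta>)"
  using R by (intro est_cut) simp

lemma est_1_\<theta>: "est lam UNIV (\<lambda>_ p. jbracket (snd p) powr (- real N)) (\<lambda>_ p. 1 - \<theta> p)"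
  by (rule est_one_minus_cut) (use R in \<open>auto intro: O1_const\<close>)

definition q0 :: "('n phase \<Rightarrow> complex) net" where
  "q0 \<epsilon> z = \<theta> z * inverse (P \<epsilon> z)"

text \<open>Where \<open>P\<close> may vanish \<open>\<theta>\<close> is 0, so the default value of
  \<open>inverse\<close> at 0 does no harm.\<close>

lemma P_q0: "\<epsilon> \<in> {0<..1} \<Longrightarrow> P \<epsilon> z * q0 \<epsilon> z = \<theta> z"
  using P_nz[of \<epsilon> z] \<theta>_V[of z] by (cases "R \<le> norm (snd z)") (auto simp: q0_def)

text \<open>The gain \<open>l\<close> is left open for two uses: \<open>lam\<close> for the terms of
  the right parametrix, and the constant 1 for the remainder \<open>s\<close>, of which only bounds
  without gain are known.\<close>

context
  fixes l :: "'n phase \<Rightarrow> 'n phase \<Rightarrow> real"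
  assumes l: "\<And>b z. 0 \<le> l b z" "\<And>b z. lam b z \<le> l b z" "\<And>b z. l b z \<le> 1"
begin

text \<open>The modulus of \<open>P\<close> in the weight of \<open>g\<close> cancels against that
  of \<open>1 / P\<close>; no power of \<epsilon> is spent.\<close>

lemma est_q0_mult:
  assumes "est l U (\<lambda>\<epsilon> z. norm (P \<epsilon> z) * v \<epsilon> z) g" and v: "\<And>\<epsilon> z. 0 \<le> v \<epsilon> z"
  shows "est l UNIV v (\<lambda>\<epsilon> z. q0 \<epsilon> z * g \<epsilon> z)"
proof (rule est_glue[OF _ UV(2,3) _ v l(1)])
  have "est lam U (\<lambda>\<epsilon> z. inverse (norm (P \<epsilon> z))) (\<lambda>\<epsilon> z. inverse (P \<epsilon> z))"
    by (rule est_inverse[OF UV(1) PP lam_nonneg]) (use P_nz in auto)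
  from est_mult[OF UV(1) est_subset[OF est_\<theta> subset_UNIV] this]
  have "est lam U (\<lambda>\<epsilon> z. 1 * inverse (norm (P \<epsilon> z))) q0"
    by (rule est_cong[OF _ UV(1) _ refl]) (simp add: q0_def)
  then have "est l U (\<lambda>\<epsilon> z. 1 * inverse (norm (P \<epsilon> z))) q0"
    by (rule est_mono_dir) (use l in auto)
  from est_mult[OF UV(1) this assms(1)]
  show "est l U v (\<lambda>\<epsilon> z. q0 \<epsilon> z * g \<epsilon> z)"
    by (rule est_cong[OF _ UV(1) refl]) (use P_nz in auto)
  show "q0 \<epsilon> z * g \<epsilon> z = 0" if "z \<in> V" for \<epsilon> z using \<theta>_V[OF that] by (simp add: q0_def)
qed

text \<open>The estimate that drives both recursions. Every term of \<open>crem\<close> involves at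
  least one covariable derivative of \<open>P\<close>, which gains one order.\<close>

lemma est_q0_crem:
  assumes f: "est l UNIV v f" and v: "\<And>\<epsilon> z. 0 \<le> v \<epsilon> z"
  shows "est l UNIV (\<lambda>\<epsilon> z. v \<epsilon> z * jbracket (snd z) powr (- 1)) (\<lambda>\<epsilon> z. q0 \<epsilon> z * crem m (P \<epsilon>) (f \<epsilon>) z)"
proof (rule est_q0_mult)
  show "est l U (\<lambda>\<epsilon> z. norm (P \<epsilon> z) * (v \<epsilon> z * jbracket (snd z) powr (- 1))) (\<lambda>\<epsilon> z. crem m (P \<epsilon>) (f \<epsilon>) z)"
    unfolding crem_def
  proof (rule est_sum[OF UV(1) _ l(1)])
    fix k assume k: "k \<in> {1..m}"
    have "est l U (\<lambda>\<epsilon> z. norm (P \<epsilon> z) * v \<epsilon> z * jbracket (snd z) powr (- real k)) (\<lambda>\<epsilon>. Phi k (P \<epsilon>) (f \<epsilon>))"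
      by (rule est_Phi[OF UV(1) l v PP est_subset[OF f subset_UNIV] norm_ge_zero])
    then show "est l U (\<lambda>\<epsilon> z. norm (P \<epsilon> z) * (v \<epsilon> z * jbracket (snd z) powr (- 1))) (\<lambda>\<epsilon>. Phi k (P \<epsilon>) (f \<epsilon>))"
    proof (rule est_mono[OF _ l(1), where c = 1])
      fix \<epsilon> and z :: "'n phase"
      have "jbracket (snd z) powr (- real k) \<le> jbracket (snd z) powr (- 1)" using k by (intro jbracket_powr_mono) auto
      from mult_left_mono[OF this, of "norm (P \<epsilon> z) * v \<epsilon> z"]
      show "norm (P \<epsilon> z) * v \<epsilon> z * jbracket (snd z) powr (- real k) \<le> 1 * (norm (P \<epsilon> z) * (v \<epsilon> z * jbracket (snd z) powr (- 1)))"
        using v by (simp only: mult.assoc mult_1_left norm_ge_zero mult_nonneg_nonneg)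
    qed simp
  qed (use v in simp)
qed (use v in simp)

text \<open>Here \<open>P\<close> is measured by (i), at the price \<open>\<epsilon> powr a\<close>.
  This is reserved for remainders and crude finite-order bounds, where the price is paid only
  once.\<close>

lemma est_Phi_P:
  assumes f: "est l UNIV v f" and v: "\<And>\<epsilon> z. 0 \<le> v \<epsilon> z" and k: "j \<le> k"
  shows "est l UNIV (\<lambda>\<epsilon> z. \<epsilon> powr a * jbracket (snd z) powr real m * v \<epsilon> z * jbracket (snd z) powr (- real j)) (\<lambda>\<epsilon>. Phi k (P \<epsilon>) (f \<epsilon>))"
proof (rule est_mono[OF est_Phi[OF open_UNIV l v P f, of k] l(1), where c = 1])
  fix \<epsilon> and z :: "'n phase"
  have "jbracket (snd z) powr (- real k) \<le> jbracket (snd z) powr (- real j)" using k by (intro jbracket_powr_mono) auto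
  then show "\<epsilon> powr a * jbracket (snd z) powr real m * v \<epsilon> z * jbracket (snd z) powr (- real k) \<le> 1 * (\<epsilon> powr a * jbracket (snd z) powr real m * v \<epsilon> z * jbracket (snd z) powr (- real j))"
    using v by (simp add: mult_left_mono)
qed auto

lemma est_crem:
  assumes f: "est l UNIV v f" and v: "\<And>\<epsilon> z. 0 \<le> v \<epsilon> z"
  shows "est l UNIV (\<lambda>\<epsilon> z. \<epsilon> powr a * jbracket (snd z) powr real m * v \<epsilon> z * jbracket (snd z) powr (- real 1)) (\<lambda>\<epsilon>. crem m (P \<epsilon>) (f \<epsilon>))"
  unfolding crem_def[abs_def]
  by (rule est_sum[OF open_UNIV est_Phi_P[OF f v] l(1)]) (use v in auto)

lemma est_csum:
  assumes f: "est l UNIV v f" and v: "\<And>\<epsilon> z. 0 \<le> v \<epsilon> z"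
  shows "est l UNIV (\<lambda>\<epsilon> z. \<epsilon> powr a * jbracket (snd z) powr real m * v \<epsilon> z * jbracket (snd z) powr (- real 0)) (\<lambda>\<epsilon>. csum m (P \<epsilon>) (f \<epsilon>))"
  unfolding csum_def[abs_def]
  by (rule est_sum[OF open_UNIV est_Phi_P[OF f v] l(1)]) (use v in auto)

end

lemmas lam_bounds = lam_nonneg order_refl lam_le_1

abbreviation \<omega> :: "real \<Rightarrow> 'n phase \<Rightarrow> real" where
  "\<omega> \<equiv> \<lambda>\<epsilon> z. \<epsilon> powr (- a') * jbracket (snd z) powr (- m')"

section \<open>The right parametrix\<close>

text \<open>Hypothesis (ii) says that 1 is dominated by \<open>norm (P \<epsilon> z)\<close> times
  the weight \<open>\<omega>\<close>. The factor \<open>\<epsilon> powr (- a')\<close> is paid at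
  this point and merely carried along by the recursion.\<close>

lemma est_q0: "est lam UNIV \<omega> q0"
proof -
  obtain C where C: "C > 0" "\<forall>\<epsilon>\<in>{0<..1}. \<forall>z. R \<le> norm (snd z) \<longrightarrow>
      C * \<epsilon> powr a' * jbracket (snd z) powr m' \<le> norm (P \<epsilon> z)" using lower by blast
  have "est lam U (\<lambda>_ _. 1) (\<lambda>_ _. 1)" by (rule est_const) auto
  then have "est lam U (\<lambda>\<epsilon> z. norm (P \<epsilon> z) * \<omega> \<epsilon> z) (\<lambda>_ _. 1)"
  proof (rule est_mono[OF _ lam_nonneg, where c = "1 / C"])
    fix \<epsilon> :: real and z :: "'n phase" assume \<epsilon>: "\<epsilon> \<in> {0<..1}" and z: "z \<in> U"
    have "C = C * \<epsilon> powr a' * jbracket (snd z) powr m' * \<omega> \<epsilon> z"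
      using \<epsilon> jbracket_pos[of "snd z"] by (simp add: powr_minus field_simps)
    also have "\<dots> \<le> norm (P \<epsilon> z) * \<omega> \<epsilon> z" using C(2)[rule_format, OF \<epsilon>, of z] z by (intro mult_right_mono) auto
    finally show "1 \<le> 1 / C * (norm (P \<epsilon> z) * \<omega> \<epsilon> z)" using C(1) by (simp add: field_simps)
  qed (use C(1) in auto)
  from est_q0_mult[OF lam_bounds this] show ?thesis by simp
qed

primrec qs :: "nat \<Rightarrow> ('n phase \<Rightarrow> complex) net" where
  "qs 0 = q0"
| "qs (Suc j) = (\<lambda>\<epsilon> z. (- 1) * (q0 \<epsilon> z * crem m (P \<epsilon>) (qs j \<epsilon>) z))"

lemma est_qs: "est lam UNIV (\<lambda>\<epsilon> z. \<omega> \<epsilon> z * jbracket (snd z) powr (- real j)) (qs j)"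
proof (induction j)
  case 0
  then show ?case using est_q0 by simp
next
  case (Suc j)
  have "est lam UNIV (\<lambda>\<epsilon> z. \<omega> \<epsilon> z * jbracket (snd z) powr (- real j) * jbracket (snd z) powr (- 1)) (qs (Suc j))"
    unfolding qs.simps by (rule est_cmult[OF open_UNIV est_q0_crem[OF lam_bounds Suc.IH]]) simp
  then show ?case
  proof (rule est_cong[OF _ open_UNIV refl])
    fix \<epsilon> :: real and z :: "'n phase"
    have "jbracket (snd z) powr (- real (Suc j)) = jbracket (snd z) powr (- real j) * jbracket (snd z) powr (- 1)"
      by (simp only: powr_add[symmetric]) (simp add: algebra_simps)
    then show "\<omega> \<epsilon> z * jbracket (snd z) powr (- real j) * jbracket (snd z) powr (- 1) = \<omega> \<epsilon> z * jbracket (snd z) powr (- real (Suc j))"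
      by (simp only: mult.assoc)
  qed
qed

text \<open>The sum telescopes: the leading part of each new term is \<open>- \<theta>\<close> times
  the remainder of the preceding one, so each remainder is cancelled up to the factor
  \<open>1 - \<theta>\<close>.\<close>

lemma csum_qs:
  assumes \<epsilon>: "\<epsilon> \<in> {0<..1}"
  shows "(\<Sum>j<Suc J. csum m (P \<epsilon>) (qs j \<epsilon>) z) =
    \<theta> z + (1 - \<theta> z) * (\<Sum>j<J. crem m (P \<epsilon>) (qs j \<epsilon>) z) + crem m (P \<epsilon>) (qs J \<epsilon>) z"
proof (induction J)
  case 0
  show ?case by (simp add: csum_crem P_q0[OF \<epsilon>])
next
  case (Suc J)
  have "P \<epsilon> z * qs (Suc J) \<epsilon> z = - (P \<epsilon> z * q0 \<epsilon> z * crem m (P \<epsilon>) (qs J \<epsilon>) z)" by simp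
  then have "csum m (P \<epsilon>) (qs (Suc J) \<epsilon>) z = - (\<theta> z * crem m (P \<epsilon>) (qs J \<epsilon>) z) + crem m (P \<epsilon>) (qs (Suc J) \<epsilon>) z"
    unfolding csum_crem P_q0[OF \<epsilon>] by (simp only:)
  then show ?case
    unfolding sum.lessThan_Suc[of _ "Suc J"] Suc.IH by (simp add: algebra_simps del: qs.simps)
qed

definition Q :: "('n phase \<Rightarrow> complex) net" where
  "Q = (SOME Q. \<forall>J. est lam UNIV (\<lambda>\<epsilon> z. \<omega> \<epsilon> z * jbracket (snd z) powr (- real J)) (\<lambda>\<epsilon> z. Q \<epsilon> z - (\<Sum>j<J. qs j \<epsilon> z)))"

lemma est_Q_diff: "est lam UNIV (\<lambda>\<epsilon> z. \<omega> \<epsilon> z * jbracket (snd z) powr (- real J)) (\<lambda>\<epsilon> z. Q \<epsilon> z - (\<Sum>j<J. qs j \<epsilon> z))"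
proof -
  have "\<exists>Q. \<forall>J. est lam UNIV (\<lambda>\<epsilon> z. \<omega> \<epsilon> z * jbracket (snd z) powr (- real J)) (\<lambda>\<epsilon> z. Q \<epsilon> z - (\<Sum>j<J. qs j \<epsilon> z))"
    by (rule borel_sum[OF est_qs]) simp
  from someI_ex[OF this] show ?thesis unfolding Q_def by (rule spec)
qed

lemma est_Q: "est lam UNIV \<omega> Q"
  using est_Q_diff[of 0] by simp

lemma esym_Q: "esym (- a') (- m') Q"
  by (rule est_one[OF est_Q]) simp

definition r :: "('n phase \<Rightarrow> complex) net" where
  "r \<epsilon> z = csum m (P \<epsilon>) (Q \<epsilon>) z - 1"

text \<open>The left side does not involve \<open>J\<close>; letting \<open>J\<close> grow shows
  that \<open>r\<close> has arbitrarily low order.\<close>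

lemma r_eq:
  assumes \<epsilon>: "\<epsilon> \<in> {0<..1}"
  shows "r \<epsilon> z = csum m (P \<epsilon>) (\<lambda>z. Q \<epsilon> z - (\<Sum>j<Suc J. qs j \<epsilon> z)) z + ((- 1) * (1 - \<theta> z) +
    ((1 - \<theta> z) * (\<Sum>j<J. crem m (P \<epsilon>) (qs j \<epsilon>) z) + crem m (P \<epsilon>) (qs J \<epsilon>) z))"
proof -
  have sq: "smooth_on UNIV (qs j \<epsilon>)" for j by (rule est_smooth[OF est_qs \<epsilon>])
  have "csum m (P \<epsilon>) (Q \<epsilon>) z = csum m (P \<epsilon>) (\<lambda>z. (Q \<epsilon> z - (\<Sum>j<Suc J. qs j \<epsilon> z)) + (\<Sum>j<Suc J. qs j \<epsilon> z)) z"
    by simp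
  also have "\<dots> = csum m (P \<epsilon>) (\<lambda>z. Q \<epsilon> z - (\<Sum>j<Suc J. qs j \<epsilon> z)) z + csum m (P \<epsilon>) (\<lambda>z. \<Sum>j<Suc J. qs j \<epsilon> z) z"
    by (rule csum_add[OF est_smooth[OF est_Q_diff \<epsilon>] smooth_on_sum[OF sq]])
  also have "csum m (P \<epsilon>) (\<lambda>z. \<Sum>j<Suc J. qs j \<epsilon> z) z = (\<Sum>j<Suc J. csum m (P \<epsilon>) (qs j \<epsilon>) z)"
    by (rule csum_sum[OF sq])
  finally show ?thesis unfolding r_def csum_qs[OF \<epsilon>] by (simp add: algebra_simps)
qed

lemma est_r: "est lam UNIV (\<lambda>\<epsilon> z. \<epsilon> powr (a - a') * jbracket (snd z) powr (- real N)) r"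
proof -
  let ?W = "\<lambda>\<epsilon> z::'n phase. \<epsilon> powr (a - a') * jbracket (snd z) powr (- real N)"
  \<comment> \<open>Composition with \<open>P\<close> raises the order by \<open>m\<close>, so
    \<open>N + m\<close> terms leave order at most - N.\<close>
  define J where "J = N + m"
  have W: "\<epsilon> powr a * jbracket (snd z) powr real m * (\<omega> \<epsilon> z * jbracket (snd z) powr (- real i)) * jbracket (snd z) powr (- real k) =
      \<epsilon> powr (a - a') * jbracket (snd z) powr (real m - m' - real i - real k)" for \<epsilon> i k and z :: "'n phase"
    by (simp only: diff_conv_add_uminus powr_add mult_ac)
  have mono: "est lam UNIV ?W f"
    if "est lam UNIV (\<lambda>\<epsilon> z. \<epsilon> powr a * jbracket (snd z) powr real m * (\<omega> \<epsilon> z * jbracket (snd z) powr (- real i)) * jbracket (snd z) powr (- real k)) f"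
      "N + m \<le> i" for f i k
  proof (rule est_mono[OF that(1) lam_nonneg, where c = 1])
    fix \<epsilon> :: real and z :: "'n phase"
    have "jbracket (snd z) powr (real m - m' - real i - real k) \<le> jbracket (snd z) powr (- real N)"
      using that(2) m' by (intro jbracket_powr_mono) linarith
    then show "\<epsilon> powr a * jbracket (snd z) powr real m * (\<omega> \<epsilon> z * jbracket (snd z) powr (- real i)) * jbracket (snd z) powr (- real k) \<le> 1 * ?W \<epsilon> z"
      unfolding W by (simp add: mult_left_mono)
  qed simp
  have 1: "est lam UNIV ?W (\<lambda>\<epsilon>. csum m (P \<epsilon>) (\<lambda>z. Q \<epsilon> z - (\<Sum>j<Suc J. qs j \<epsilon> z)))"
    by (rule mono[OF est_csum[OF lam_bounds est_Q_diff]]) (simp_all add: J_def)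
  have 2: "est lam UNIV ?W (\<lambda>\<epsilon>. crem m (P \<epsilon>) (qs J \<epsilon>))"
    by (rule mono[OF est_crem[OF lam_bounds est_qs]]) (simp_all add: J_def)
  \<comment> \<open>The cutoff error carries no power of \<epsilon>, and \<open>a \<le> a'\<close>
    makes \<open>\<epsilon> powr (a - a')\<close> at least 1.\<close>
  have 3: "est lam UNIV ?W (\<lambda>\<epsilon> z. (- 1) * (1 - \<theta> z))"
  proof (rule est_cmult[OF open_UNIV est_mono[OF est_1_\<theta> lam_nonneg, where c = 1]])
    fix \<epsilon> :: real and z :: "'n phase" assume "\<epsilon> \<in> {0<..1}"
    then have "1 \<le> \<epsilon> powr (a - a')" using powr_mono'[of "a - a'" 0 \<epsilon>] aa' by auto
    from mult_right_mono[OF this, of "jbracket (snd z) powr (- real N)"]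
    show "jbracket (snd z) powr (- real N) \<le> 1 * ?W \<epsilon> z" by simp
  qed simp
  have 4: "est lam UNIV ?W (\<lambda>\<epsilon> z. (1 - \<theta> z) * (\<Sum>j<J. crem m (P \<epsilon>) (qs j \<epsilon>) z))"
    unfolding sum_distrib_left
  proof (rule est_sum[OF open_UNIV _ lam_nonneg])
    fix j
    have "est lam UNIV (\<lambda>\<epsilon> z. \<epsilon> powr a * jbracket (snd z) powr real m * (\<omega> \<epsilon> z * jbracket (snd z) powr (- real j)) * jbracket (snd z) powr (- real 1)) (\<lambda>\<epsilon>. crem m (P \<epsilon>) (qs j \<epsilon>))"
      by (rule est_crem[OF lam_bounds est_qs]) simp
    from est_mult[OF open_UNIV est_1_\<theta>[of "N + m"] this]
    show "est lam UNIV ?W (\<lambda>\<epsilon> z. (1 - \<theta> z) * crem m (P \<epsilon>) (qs j \<epsilon>) z)"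
    proof (rule est_mono[OF _ lam_nonneg, where c = 1])
      fix \<epsilon> :: real and z :: "'n phase"
      have "jbracket (snd z) powr (- real (N + m)) * (\<epsilon> powr a * jbracket (snd z) powr real m * (\<omega> \<epsilon> z * jbracket (snd z) powr (- real j)) * jbracket (snd z) powr (- real 1))
          = \<epsilon> powr (a - a') * (jbracket (snd z) powr (- real (N + m)) * jbracket (snd z) powr (real m - m' - real j - real 1))"
        unfolding W by (simp only: mult_ac)
      also have "\<dots> = \<epsilon> powr (a - a') * jbracket (snd z) powr (- real N - m' - real j - 1)"
        by (simp add: powr_add[symmetric] algebra_simps)
      also have "\<dots> \<le> \<epsilon> powr (a - a') * jbracket (snd z) powr (- real N)"
        using m' by (intro mult_left_mono jbracket_powr_mono) auto
      finally show "jbracket (snd z) powr (- real (N + m)) * (\<epsilon> powr a * jbracket (snd z) powr real m * (\<omega> \<epsilon> z * jbracket (snd z) powr (- real j)) * jbracket (snd z) powr (- real 1)) \<le> 1 * ?W \<epsilon> z"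
        by simp
    qed simp
  qed simp
  have "est lam UNIV ?W (\<lambda>\<epsilon> z. csum m (P \<epsilon>) (\<lambda>z. Q \<epsilon> z - (\<Sum>j<Suc J. qs j \<epsilon> z)) z + ((- 1) * (1 - \<theta> z) +
      ((1 - \<theta> z) * (\<Sum>j<J. crem m (P \<epsilon>) (qs j \<epsilon>) z) + crem m (P \<epsilon>) (qs J \<epsilon>) z)))"
    by (intro est_add open_UNIV 1 2 3 4)
  then show ?thesis by (rule est_cong[OF _ open_UNIV _ refl]) (rule r_eq[symmetric])
qed

lemma esym_r: "esym (a - a') (- real N) r"
  by (rule est_one[OF est_r]) simp

lemma right_parametrix:
  assumes \<epsilon>: "\<epsilon> \<in> {0<..1}" and u: "rapid1 u"
  shows "psdo (P \<epsilon>) (psdo (Q \<epsilon>) u) = (\<lambda>x. u x + psdo (r \<epsilon>) u x)"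
proof
  fix x
  have "csum m (P \<epsilon>) (Q \<epsilon>) = (\<lambda>z. 1 + r \<epsilon> z)" by (auto simp: r_def)
  then have "psdo (P \<epsilon>) (psdo (Q \<epsilon>) u) = psdo (\<lambda>z. 1 + r \<epsilon> z) u"
    using compose[OF \<epsilon> esym_psym[OF esym_Q \<epsilon>] u] by simp
  then show "psdo (P \<epsilon>) (psdo (Q \<epsilon>) u) x = u x + psdo (r \<epsilon>) u x"
    using psdo_add_symbol[OF psym_const[of 1] esym_psym[OF esym_r[of 0] \<epsilon>] u, of x] psdo_1[OF u] by simp
qed

section \<open>The left inverse\<close>

lemma esym_\<theta>_mult:
  assumes "esym \<alpha> s f" shows "esym \<alpha> (s - real N) (\<lambda>\<epsilon> z. (1 - \<theta> z) * f \<epsilon> z)"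
proof (rule est_cong[OF est_mult[OF open_UNIV est_one[OF est_1_\<theta>] assms] open_UNIV refl])
  show "jbracket (snd z) powr (- real N) * (\<epsilon> powr \<alpha> * jbracket (snd z) powr s) = \<epsilon> powr \<alpha> * jbracket (snd z) powr (s - real N)"
    for \<epsilon> and z :: "'n phase"
    by (simp only: diff_conv_add_uminus powr_add mult_ac)
qed simp

text \<open>Applying \<open>q0\<close> to the equation \<open>csum m P s = \<rho>\<close> expresses \<open>s\<close> through terms of lower order
  without loss in \<open>\<epsilon>\<close>.\<close>

lemma bootstrap:
  assumes s: "esym \<alpha> t s" and \<rho>: "\<And>N. esym \<alpha> (- real N) (\<lambda>\<epsilon> z. q0 \<epsilon> z * \<rho> \<epsilon> z)"
    and eq: "\<And>\<epsilon> z. \<epsilon> \<in> {0<..1} \<Longrightarrow> csum m (P \<epsilon>) (s \<epsilon>) z = \<rho> \<epsilon> z"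
  shows "esym \<alpha> (- real N) s"
proof -
  have step: "esym \<alpha> (x - 1) s" if x: "esym \<alpha> x s" for x
  proof -
    obtain N :: nat where N: "- x + 1 \<le> real N" using real_arch_simple by blast
    have 1: "esym \<alpha> (x - 1) (\<lambda>\<epsilon> z. (1 - \<theta> z) * s \<epsilon> z)" using esym_\<theta>_mult[OF x, of 1] by simp
    have 2: "esym \<alpha> (x - 1) (\<lambda>\<epsilon> z. q0 \<epsilon> z * \<rho> \<epsilon> z)" by (rule esym_mono[OF \<rho>[of N]]) (use N in auto)
    have "est (\<lambda>_ _. 1) UNIV (\<lambda>\<epsilon> z. \<epsilon> powr \<alpha> * jbracket (snd z) powr x * jbracket (snd z) powr (- 1)) (\<lambda>\<epsilon> z. q0 \<epsilon> z * crem m (P \<epsilon>) (s \<epsilon>) z)"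
      by (rule est_q0_crem[OF _ _ _ x]) (auto intro: lam_le_1)
    then have 3: "esym \<alpha> (x - 1) (\<lambda>\<epsilon> z. q0 \<epsilon> z * crem m (P \<epsilon>) (s \<epsilon>) z)"
      by (rule est_cong[OF _ open_UNIV refl]) (simp only: diff_conv_add_uminus powr_add mult.assoc)
    \<comment> \<open>Splitting \<open>s\<close> into \<open>(1 - \<theta>) * s\<close> and
      \<open>\<theta> * s\<close>, with \<open>\<theta> = P * q0\<close> and \<open>P * s\<close>
      replaced by \<open>\<rho>\<close> minus the remainder \<open>crem\<close>.\<close>
    have "esym \<alpha> (x - 1) (\<lambda>\<epsilon> z. (1 - \<theta> z) * s \<epsilon> z + (q0 \<epsilon> z * \<rho> \<epsilon> z + (- 1) * (q0 \<epsilon> z * crem m (P \<epsilon>) (s \<epsilon>) z)))"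
      by (intro est_add est_cmult open_UNIV 1 2 3)
    then show ?thesis
    proof (rule est_cong[OF _ open_UNIV _ refl])
      fix \<epsilon> :: real and z :: "'n phase" assume \<epsilon>: "\<epsilon> \<in> {0<..1}"
      have "q0 \<epsilon> z * \<rho> \<epsilon> z = P \<epsilon> z * q0 \<epsilon> z * s \<epsilon> z + q0 \<epsilon> z * crem m (P \<epsilon>) (s \<epsilon>) z"
        unfolding eq[OF \<epsilon>, symmetric] csum_crem by (simp add: algebra_simps)
      then show "(1 - \<theta> z) * s \<epsilon> z + (q0 \<epsilon> z * \<rho> \<epsilon> z + (- 1) * (q0 \<epsilon> z * crem m (P \<epsilon>) (s \<epsilon>) z)) = s \<epsilon> z"
        unfolding P_q0[OF \<epsilon>] by (simp add: algebra_simps)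
    qed
  qed
  have "esym \<alpha> (t - real k) s" for k
  proof (induction k)
    case (Suc k)
    from step[OF this] show ?case by (simp add: algebra_simps)
  qed (use s in simp)
  moreover obtain k :: nat where "t + real N \<le> real k" using real_arch_simple by blast
  ultimately show ?thesis using esym_mono[of \<alpha> "t - real k" s \<alpha> "- real N"] by simp
qed

definition s :: "('n phase \<Rightarrow> complex) net" where
  "s \<epsilon> z = qcomp (Q \<epsilon>) (P \<epsilon>) z - 1"

lemma esym_P: "esym a (real m) P"
  by (rule est_one[OF P]) simp

text \<open>The composition itself has exponent a - a'; this and the constant 1 are weakened to 2a -
  2a', the exponent of the final estimate. The order comes from \<open>P\<close> and from the
  Laplacians inside \<open>qcomp\<close>.\<close>

lemma esym_s0: "esym (2 * a - 2 * a') (real m + 2 * real (CARD('n) + 1)) s"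
proof -
  have "esym (- a' + a) (real m + 2 * real (CARD('n) + 1)) (\<lambda>\<epsilon>. qcomp (Q \<epsilon>) (P \<epsilon>))"
    by (rule esym_qcomp(1)[OF esym_Q _ esym_P]) (use m' in simp)
  then have 1: "esym (2 * a - 2 * a') (real m + 2 * real (CARD('n) + 1)) (\<lambda>\<epsilon>. qcomp (Q \<epsilon>) (P \<epsilon>))"
    by (rule esym_mono) (use aa' in auto)
  have 2: "esym (2 * a - 2 * a') (real m + 2 * real (CARD('n) + 1)) (\<lambda>_ _. - 1)"
    by (rule esym_mono[OF psym_esym[OF psym_const]]) (use aa' in auto)
  from est_add[OF open_UNIV 1 2] show ?thesis by (simp add: s_def[abs_def])
qed

lemma left_parametrix:
  assumes \<epsilon>: "\<epsilon> \<in> {0<..1}" and u: "rapid1 u"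
  shows "psdo (Q \<epsilon>) (psdo (P \<epsilon>) u) = (\<lambda>x. u x + psdo (s \<epsilon>) u x)"
proof
  fix x
  have "qcomp (Q \<epsilon>) (P \<epsilon>) = (\<lambda>z. 1 + s \<epsilon> z)" by (auto simp: s_def)
  moreover have "psdo (Q \<epsilon>) (psdo (P \<epsilon>) u) = psdo (qcomp (Q \<epsilon>) (P \<epsilon>)) u"
    by (rule esym_qcomp(2)[OF esym_Q _ esym_P \<epsilon> u]) (use m' in simp)
  ultimately show "psdo (Q \<epsilon>) (psdo (P \<epsilon>) u) x = u x + psdo (s \<epsilon>) u x"
    using psdo_add_symbol[OF psym_const[of 1] esym_psym[OF esym_s0 \<epsilon>] u, of x] psdo_1[OF u] by simp
qed

lemma csum_s:
  assumes \<epsilon>: "\<epsilon> \<in> {0<..1}"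
  shows "csum m (P \<epsilon>) (s \<epsilon>) = kcomp (r \<epsilon>) (P \<epsilon>)"
proof (rule psdo_symbol_unique)
  note ps = esym_psym[OF esym_s0 \<epsilon>] and pP = esym_psym[OF esym_P \<epsilon>] and pr = esym_psym[OF esym_r[of 0] \<epsilon>]
  have "esym (a + (2 * a - 2 * a')) (real m + (real m + 2 * real (CARD('n) + 1)) + 0) (\<lambda>\<epsilon>. csum m (P \<epsilon>) (s \<epsilon>))"
  proof (rule est_cong[OF est_csum[OF _ _ _ esym_s0] open_UNIV refl])
    show "\<epsilon> powr a * jbracket (snd z) powr real m * (\<epsilon> powr (2 * a - 2 * a') * jbracket (snd z) powr (real m + 2 * real (CARD('n) + 1))) * jbracket (snd z) powr (- real 0)
      = \<epsilon> powr (a + (2 * a - 2 * a')) * jbracket (snd z) powr (real m + (real m + 2 * real (CARD('n) + 1)) + 0)" for \<epsilon> and z :: "'n phase"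
      by (simp only: powr_add mult_ac of_nat_0 minus_zero)
  qed (auto intro: lam_le_1)
  from esym_psym[OF this \<epsilon>]
  show "psym (real m + (real m + 2 * real (CARD('n) + 1)) + 0) (csum m (P \<epsilon>) (s \<epsilon>))" .
  show "psym (- real 0) (kcomp (r \<epsilon>) (P \<epsilon>))"
    by (rule esym_psym[OF esym_kcomp_rapid[OF esym_r esym_P] \<epsilon>])
  fix u :: "real ^ 'n \<Rightarrow> complex" assume u: "rapid1 u"
  interpret K: kernel_symbol "r \<epsilon>" "2 * real CARD('n) + 1" by (rule kernel_symbol_rapid[OF esym_r \<epsilon>])
  let ?v = "psdo (P \<epsilon>) u"
  have v: "rapid1 ?v" by (rule rapid1_psdo[OF pP u])
  show "psdo (csum m (P \<epsilon>) (s \<epsilon>)) u = psdo (kcomp (r \<epsilon>) (P \<epsilon>)) u"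
  proof
    fix x
    \<comment> \<open>Both ends compute \<open>P Q P u\<close>, once through the left and once
      through the right identity; the common term \<open>?v x\<close> then cancels.\<close>
    have "?v x + psdo (P \<epsilon>) (psdo (s \<epsilon>) u) x = psdo (P \<epsilon>) (\<lambda>x. u x + psdo (s \<epsilon>) u x) x"
      by (rule psdo_add[OF pP u rapid1_psdo[OF ps u], symmetric])
    also have "\<dots> = psdo (P \<epsilon>) (psdo (Q \<epsilon>) ?v) x" by (simp only: left_parametrix[OF \<epsilon> u])
    also have "\<dots> = ?v x + psdo (r \<epsilon>) ?v x" by (simp only: right_parametrix[OF \<epsilon> v])
    also have "psdo (r \<epsilon>) ?v = psdo (kcomp (r \<epsilon>) (P \<epsilon>)) u" by (rule K.psdo_comp[OF pP u])
    finally show "psdo (csum m (P \<epsilon>) (s \<epsilon>)) u x = psdo (kcomp (r \<epsilon>) (P \<epsilon>)) u x"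
      by (simp add: compose[OF \<epsilon> ps u])
  qed
qed

text \<open>In the term to which the bootstrap is applied, \<open>q0\<close> contributes the
  exponent - a', \<open>r\<close> contributes a - a' and \<open>P\<close> contributes a.\<close>

lemma esym_s: "esym (2 * a - 2 * a') (- real N) s"
proof (rule bootstrap[OF esym_s0, of "\<lambda>\<epsilon>. kcomp (r \<epsilon>) (P \<epsilon>)"])
  fix N :: nat
  have q: "esym (- a') (- m') q0" by (rule est_one[OF est_q0]) simp
  have "esym (- a' + (a - a' + a)) (- m' + - real N) (\<lambda>\<epsilon> z. q0 \<epsilon> z * kcomp (r \<epsilon>) (P \<epsilon>) z)"
    by (rule esym_mult[OF q esym_kcomp_rapid[OF esym_r esym_P]])
  then show "esym (2 * a - 2 * a') (- real N) (\<lambda>\<epsilon> z. q0 \<epsilon> z * kcomp (r \<epsilon>) (P \<epsilon>) z)"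
    by (rule esym_mono) (use m' in auto)
qed (simp only: csum_s)

end

section \<open>The given operator fits the framework\<close>

lemma psym_E_space:
  assumes "u \<in> E_space" shows "psym 0 (\<lambda>p::'n::finite phase. u (fst p))"
proof -
  have "est lam UNIV (\<lambda>_ _. 1) (\<lambda>_ p::'n phase. u (fst p))"
    unfolding est_def estk_def
  proof
    fix k
    obtain C where "dbound (\<lambda>_ _. 1) UNIV k C (\<lambda>_. 1) u" using E_space_bounded[OF assms] by blast
    from dbound_fst[OF this, where 'n = 'n]
    have "dbound lam UNIV k \<bar>C\<bar> (\<lambda>_. 1) (\<lambda>p::'n phase. u (fst p))" by (rule dbound_mono) auto
    then show "\<exists>C. O1 C \<and> (\<forall>\<epsilon>\<in>{0<..1}. dbound lam UNIV k (C \<epsilon>) (\<lambda>_. 1) (\<lambda>p::'n phase. u (fst p)))"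
      by (intro exI[of _ "\<lambda>_. \<bar>C\<bar>"]) (simp add: O1_const)
  qed
  then have "est (\<lambda>_ _. 1) UNIV (\<lambda>_ _. 1) (\<lambda>_ p::'n phase. u (fst p))" by (rule est_one) simp
  then have "esym 0 0 (\<lambda>_ p::'n phase. u (fst p))"
    by (rule est_cong) auto
  from esym_psym[OF this, of 1] show ?thesis by simp
qed

text \<open>Hypothesis (i) bounds a real supremum, which is informative only if the set is bounded
  above. Membership in the symbol class therefore has to come from the bounded coefficients.\<close>

lemma differential_symbol:
  fixes c :: "'n::finite mindex \<Rightarrow> real ^ 'n \<Rightarrow> complex"
  assumes c: "\<And>\<alpha>. mlen \<alpha> \<le> m \<Longrightarrow> c \<alpha> \<in> E_space"
  shows "(\<lambda>p. \<Sum>\<alpha> | mlen \<alpha> \<le> m. c \<alpha> (fst p) * mpow (snd p) \<alpha>) \<in> S_symb (real m)"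
proof -
  let ?P = "\<lambda>p::'n phase. \<Sum>\<alpha> | mlen \<alpha> \<le> m. c \<alpha> (fst p) * mpow (snd p) \<alpha>"
  have summand: "est lam UNIV (\<lambda>\<epsilon> z. \<epsilon> powr 0 * jbracket (snd z) powr real m) (\<lambda>_ p::'n phase. c \<alpha> (fst p) * mpow (snd p) \<alpha>)"
    if \<alpha>: "mlen \<alpha> \<le> m" for \<alpha>
    unfolding est_def estk_def
  proof
    fix k
    obtain C where C: "dbound (\<lambda>_ _. 1) UNIV k C (\<lambda>_. 1) (c \<alpha>)" using E_space_bounded[OF c[OF \<alpha>]] by blast
    let ?is = "mlist (\<lambda>i::'n. i) \<alpha>"
    have jn: "0 \<le> 1 / jbracket \<xi>" for \<xi> :: "real ^ 'n" by simp
    have "\<exists>D. dbound (\<lambda>_ \<xi>. 1 / jbracket \<xi>) UNIV k D (\<lambda>\<xi>::real^'n. prod_list (map (\<lambda>i. jbracket \<xi>) ?is))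
        (\<lambda>\<xi>. prod_list (map (\<lambda>i. complex_of_real (\<xi> $ i)) ?is))"
      by (rule dbound_prod_list[OF dbound_coordinate open_UNIV jn])
    then obtain D where D: "dbound (\<lambda>_ \<xi>. 1 / jbracket \<xi>) UNIV k D (\<lambda>\<xi>::real^'n. prod_list (map (\<lambda>i. jbracket \<xi>) ?is))
        (\<lambda>\<xi>. prod_list (map (\<lambda>i. complex_of_real (\<xi> $ i)) ?is))" ..
    have e: "prod_list (map (\<lambda>i. jbracket \<xi>) ?is) = jbracket \<xi> ^ mlen \<alpha>" for \<xi> :: "real ^ 'n"
      by (simp add: map_replicate_const)
    have e': "prod_list (map (\<lambda>i. complex_of_real (\<xi> $ i)) ?is) = mpow \<xi> \<alpha>" for \<xi> :: "real ^ 'n"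
      by (simp add: mpow_mlist map_mlist)
    have "dbound lam UNIV k \<bar>2 ^ k * (C * D)\<bar> (\<lambda>z. \<epsilon> powr 0 * jbracket (snd z) powr real m) (\<lambda>p::'n phase. c \<alpha> (fst p) * mpow (snd p) \<alpha>)"
      if "\<epsilon> \<in> {0<..1}" for \<epsilon> :: real
    proof (rule dbound_mono[OF dbound_mult[OF open_UNIV dbound_fst[OF C, where 'n = 'n] dbound_snd[OF D[unfolded e e']]] _ lam_nonneg])
      fix z :: "'n phase"
      have "jbracket (snd z) ^ mlen \<alpha> \<le> jbracket (snd z) ^ m" by (rule power_increasing[OF \<alpha> jbracket_ge1])
      then have "2 ^ k * (C * D) * (1 * jbracket (snd z) ^ mlen \<alpha>) \<le> \<bar>2 ^ k * (C * D)\<bar> * jbracket (snd z) ^ m"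
        by (intro mult_mono) auto
      then show "2 ^ k * (C * D) * (1 * jbracket (snd z) ^ mlen \<alpha>) \<le> \<bar>2 ^ k * (C * D)\<bar> * (\<epsilon> powr 0 * jbracket (snd z) powr real m)"
        using that by (simp add: powr_realpow)
    qed
    then show "\<exists>C. O1 C \<and> (\<forall>\<epsilon>\<in>{0<..1}. dbound lam UNIV k (C \<epsilon>) (\<lambda>z. \<epsilon> powr 0 * jbracket (snd z) powr real m) (\<lambda>p::'n phase. c \<alpha> (fst p) * mpow (snd p) \<alpha>))"
      by (intro exI[of _ "\<lambda>_. \<bar>2 ^ k * (C * D)\<bar>"] conjI O1_const ballI) auto
  qed
  have "est lam UNIV (\<lambda>\<epsilon> z. \<epsilon> powr 0 * jbracket (snd z) powr real m) (\<lambda>_. ?P)"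
    by (rule est_sum[OF open_UNIV summand lam_nonneg]) auto
  from M_symb_est[OF this] have "(\<lambda>_. ?P) \<in> {0<..1::real} \<rightarrow> S_symb (real m)" by (simp add: M_symb_def)
  from funcset_mem[OF this, of 1] show ?thesis by simp
qed

lemma G_inf_E_space:
  assumes "X \<in> G_inf" "d \<in> X" "\<epsilon> \<in> {0<..1}" shows "d \<epsilon> \<in> E_space"
proof -
  have "d \<in> M_E" using assms(1,2) by (auto simp: G_inf_def quotient_def)
  then show ?thesis using assms(3) by (auto simp: M_E_def Pi_def)
qed

theorem proposition2p6:
  fixes c :: "'n::finite mindex \<Rightarrow> (real ^ 'n \<Rightarrow> complex) net set"
    and P :: "((real ^ 'n) \<times> (real ^ 'n) \<Rightarrow> complex) net"
    and m :: nat and m' a a' R :: real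
  assumes op: "gen_diff_op m c"
    and aa': "a \<le> a'"
    and m': "0 \<le> m'" "m' \<le> real m"
    and R: "R > 0"
    and rep: "representative m c P"
    and i: "\<And>\<alpha> \<beta>. (\<lambda>\<epsilon>. symb_seminorm (real m) \<alpha> \<beta> (P \<epsilon>)) \<in> O[at_right 0](\<lambda>\<epsilon>. \<epsilon> powr a)"
    and ii: "\<exists>C>0. \<forall>x \<xi>. \<forall>\<epsilon>\<in>{0<..1}. norm \<xi> \<ge> R \<longrightarrow>
               norm (P \<epsilon> (x, \<xi>)) \<ge> C * \<epsilon> powr a' * jbracket \<xi> powr m'"
    and iii: "\<And>\<alpha> \<beta>. \<exists>C :: real net. C \<in> O[at_right 0](\<lambda>_. 1) \<and>
               (\<forall>x \<xi>. \<forall>\<epsilon>\<in>{0<..1}. norm \<xi> \<ge> R \<longrightarrow>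
                  norm (pd_xi \<alpha> (pd_x \<beta> (P \<epsilon>)) (x, \<xi>))
                    \<le> C \<epsilon> * norm (P \<epsilon> (x, \<xi>)) * jbracket \<xi> powr (- real (mlen \<alpha>)))"
  shows "\<exists>q r. q \<in> M_symb (- m') (- a') \<and> r \<in> M_symb_minf (a - a') \<and>
           (\<forall>\<epsilon>\<in>{0<..1}. \<forall>u\<in>schwartz.
              psdo (P \<epsilon>) (psdo (q \<epsilon>) u) = (\<lambda>x. u x + psdo (r \<epsilon>) u x)) \<and>
           (\<exists>s\<in>M_symb_minf (2 * a - 2 * a'). \<forall>\<epsilon>\<in>{0<..1}. \<forall>u\<in>schwartz.
              psdo (q \<epsilon>) (psdo (P \<epsilon>) u) = (\<lambda>x. u x + psdo (s \<epsilon>) u x))"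
proof -
  obtain d where d: "\<And>\<alpha>. mlen \<alpha> \<le> m \<Longrightarrow> d \<alpha> \<in> c \<alpha>"
    "\<And>\<epsilon> x \<xi>. \<epsilon> \<in> {0<..1} \<Longrightarrow> P \<epsilon> (x, \<xi>) = (\<Sum>\<alpha> | mlen \<alpha> \<le> m. d \<alpha> \<epsilon> x * mpow \<xi> \<alpha>)"
    using rep unfolding representative_def by blast
  have dE: "d \<alpha> \<epsilon> \<in> E_space" if "mlen \<alpha> \<le> m" "\<epsilon> \<in> {0<..1}" for \<alpha> \<epsilon>
    using op d(1) that by (auto simp: gen_diff_op_def intro: G_inf_E_space)
  have Pe: "P \<epsilon> p = (\<Sum>\<alpha> | mlen \<alpha> \<le> m. d \<alpha> \<epsilon> (fst p) * mpow (snd p) \<alpha>)" if "\<epsilon> \<in> {0<..1}" for \<epsilon> p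
    using d(2)[OF that, of "fst p" "snd p"] by simp
  have PS: "P \<epsilon> \<in> S_symb (real m)" if "\<epsilon> \<in> {0<..1}" for \<epsilon>
  proof -
    have "P \<epsilon> = (\<lambda>p. \<Sum>\<alpha> | mlen \<alpha> \<le> m. d \<alpha> \<epsilon> (fst p) * mpow (snd p) \<alpha>)" using Pe[OF that] by auto
    then show ?thesis using differential_symbol[of m "\<lambda>\<alpha>. d \<alpha> \<epsilon>", OF dE[OF _ that]] by simp
  qed
  have oU: "open {z::'n phase. R < norm (snd z)}" by (intro open_Collect_less continuous_intros)
  interpret hypoelliptic_net P m m' a a' R
  proof
    show est_P: "est lam UNIV (\<lambda>\<epsilon> z. \<epsilon> powr a * jbracket (snd z) powr real m) P"
      by (rule est_of_seminorm[OF PS i])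
    show "\<exists>C>0. \<forall>\<epsilon>\<in>{0<..1}. \<forall>z. R \<le> norm (snd z) \<longrightarrow> C * \<epsilon> powr a' * jbracket (snd z) powr m' \<le> norm (P \<epsilon> z)"
      using ii by fastforce
    \<comment> \<open>Hypothesis (iii) is restricted to the open set of covariables beyond
      \<open>R\<close>, on which derivatives may be reordered.\<close>
    show "est lam {z. R < norm (snd z)} (\<lambda>\<epsilon> z. norm (P \<epsilon> z)) P"
    proof (rule est_of_mderiv[OF oU])
      show "smooth_on {z. R < norm (snd z)} (P \<epsilon>)" if "\<epsilon> \<in> {0<..1}" for \<epsilon>
        by (rule est_smooth[OF est_subset[OF est_P subset_UNIV] that])
      fix \<alpha> \<beta> :: "'n mindex"
      obtain C where C: "C \<in> O[at_right 0](\<lambda>_. 1)" "\<forall>x \<xi>. \<forall>\<epsilon>\<in>{0<..1}. norm \<xi> \<ge> R \<longrightarrow>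
          norm (pd_xi \<alpha> (pd_x \<beta> (P \<epsilon>)) (x, \<xi>)) \<le> C \<epsilon> * norm (P \<epsilon> (x, \<xi>)) * jbracket \<xi> powr (- real (mlen \<alpha>))"
        using iii[of \<alpha> \<beta>] by blast
      \<comment> \<open>The given net of constants is only asymptotically bounded; its absolute
        value supplies the nonnegativity demanded by \<open>O1\<close>.\<close>
      have "norm (pd_xi \<alpha> (pd_x \<beta> (P \<epsilon>)) z) \<le> \<bar>C \<epsilon>\<bar> * (norm (P \<epsilon> z) * jbracket (snd z) powr (- real (mlen \<alpha>)))"
        if "\<epsilon> \<in> {0<..1}" "R < norm (snd z)" for \<epsilon> and z :: "'n phase"
      proof -
        have "norm (pd_xi \<alpha> (pd_x \<beta> (P \<epsilon>)) z) \<le> C \<epsilon> * (norm (P \<epsilon> z) * jbracket (snd z) powr (- real (mlen \<alpha>)))"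
          using C(2)[rule_format, OF that(1), of "snd z" "fst z"] that(2) by (simp add: mult.assoc)
        also have "\<dots> \<le> \<bar>C \<epsilon>\<bar> * (norm (P \<epsilon> z) * jbracket (snd z) powr (- real (mlen \<alpha>)))"
          by (intro mult_right_mono) auto
        finally show ?thesis .
      qed
      then show "\<exists>C. O1 C \<and> (\<forall>\<epsilon>\<in>{0<..1}. \<forall>z\<in>{z. R < norm (snd z)}. norm (pd_xi \<alpha> (pd_x \<beta> (P \<epsilon>)) z)
          \<le> C \<epsilon> * (norm (P \<epsilon> z) * jbracket (snd z) powr (- real (mlen \<alpha>))))"
        using O1_abs[OF C(1)] by (intro exI[of _ "\<lambda>\<epsilon>. \<bar>C \<epsilon>\<bar>"]) simp
    qed simp
    show "psdo (P \<epsilon>) (psdo f u) = psdo (csum m (P \<epsilon>) f) u"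
      if "\<epsilon> \<in> {0<..1}" "psym s f" "rapid1 u" for \<epsilon> s f u
      unfolding csum_def[abs_def]
      by (rule psdo_differential_psdo[OF Pe[OF that(1)] psym_E_space[OF dE[OF _ that(1)]] _ that(2,3)]) auto
  qed (use aa' m' R in auto)
  have "Q \<in> M_symb (- m') (- a')" by (rule M_symb_est[OF est_Q])
  moreover have "r \<in> M_symb_minf (a - a')" by (rule M_symb_minf_est[OF esym_r])
  moreover have "s \<in> M_symb_minf (2 * a - 2 * a')" by (rule M_symb_minf_est[OF esym_s])
  ultimately show ?thesis
    unfolding schwartz_iff Ball_def[of schwartz]
    using right_parametrix left_parametrix by blast
qed

end
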